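(* Let $\ell\ge1$, let $a_1,\dots,a_\ell>0$ and $n_1,\dots,n_\ell\ge 0$ be integers, and let $A=[D\,|\,\boldsymbol{n}]\in\mathbb{Z}^{\ell\times(\ell+1)}$ with $D=\operatorname{diag}(-a_1,\dots,-a_\ell)$ and $\boldsymbol{n}=(n_1,\dots,n_\ell)^T$, such that the associated $\mathbb{T}^\ell$-action on $\mathbb{C}^{\ell+1}$ is effective (so that $\gcd(a_i,n_i)=1$ for all $i$). Put $\mathcal{A}=\operatorname{lcm}(a_1,\dots,a_\ell)$, $m_i=n_i\mathcal{A}/a_i$, $\mathcal{M}=\sum_{i=1}^\ell m_i$, and let $M_0=J_A^{-1}(0)/\mathbb{T}^\ell$ be the symplectic quotient with $\mathbb{Z}$-graded global chart $\psi\colon\mathbb{R}[y_1,\dots,y_{\ell+3}]\to\mathcal{C}^\infty(M_0)$. For $N\ge2$ let $X_N=\mathbb{C}/\mathbb{Z}_N$ with $\mathbb{Z}$-graded global chart $\varphi\colon\mathbb{R}[x_1,x_2,x_3]\to\mathcal{C}^\infty(X_N)$ (both charts are described in the context). If $N=\mathcal{A}+\mathcal{M}$, then the algebra homomorphism $\lambda\colon\mathbb{R}[y_1,\dots,y_{\ell+3}]\to\mathbb{R}[x_1,x_2,x_3]$ given by $$y_i\mapsto\sqrt{\frac{\mathcal{A}^{\mathcal{A}}\prod_{j=1}^\ell m_j^{m_j}}{N^N}}\;x_i\quad (i=1,2),\qquad y_3\mapsto\frac{\mathcal{A}}{N}x_3,\qquad y_{3+i}\mapsto\frac{m_i}{N}x_3\quad(i=1,\dots,\ell)$$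 is a $\mathbb{Z}$-graded arrow which lifts to a $\mathbb{Z}$-graded regular symplectomorphism $X_N\to M_0$.
   Context: Convention: $0^0=1$. Torus actions: a matrix $A=(a_{ij})\in\mathbb{Z}^{\ell\times n}$ encodes the action of $\mathbb{T}^\ell=(\mathbb{S}^1)^\ell$ on $\mathbb{C}^n$ by $(t_1,\dots,t_\ell).(z_1,\dots,z_n)=(\prod_i t_i^{a_{i1}}z_1,\dots,\prod_i t_i^{a_{in}}z_n)$, with moment map $J_A=(J_1,\dots,J_\ell)$, $J_i=\frac12\sum_j a_{ij}z_j\overline{z_j}$. The Poisson bracket on $\mathcal{C}^\infty(\mathbb{C}^n)$ is determined by $\{z_i,\overline{z_j}\}=\frac{2}{\sqrt{-1}}\delta_{ij}$, all other brackets of coordinates being zero. With $Z=J_A^{-1}(0)$ and $I_Z$ the ideal of smooth functions vanishing on $Z$, the quotient $M_0=Z/\mathbb{T}^\ell$ carries the Poisson algebra of continuous functions $\mathcal{C}^\infty(M_0)=\mathcal{C}^\infty(\mathbb{C}^n)^{\mathbb{T}^\ell}/(\mathcal{C}^\infty(\mathbb{C}^n)^{\mathbb{T}^\ell}\cap I_Z)$. Poisson differential spaces: a differential space is a topological space $X$ with an algebra $\mathcal{C}^\infty(X)$ of continuous real functions such that the topology is generated by $\mathcal{C}^\infty(X)$, $\mathcal{C}^\infty(X)$ is closed under composition with smooth functions $F\in\mathcal{C}^\infty(\mathbb{R}^k)$, and any function locally agreeing with elements of $\mathcal{C}^\infty(X)$ belongs to $\mathcal{C}^\infty(X)$. A Poisson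 differential space has in addition a Poisson bracket on $\mathcal{C}^\infty(X)$. A Poisson map is a continuous map whose pullback sends smooth functions to smooth functions and preserves the Poisson brackets. A global chart on $X$ is an algebra homomorphism $\varphi\colon\mathbb{R}[x_1,\dots,x_k]\to\mathcal{C}^\infty(X)$, $x_i\mapsto\varphi_i$, such that (1) its image $\mathbb{R}[X]$ is a Poisson subalgebra; (2) every $f\in\mathcal{C}^\infty(X)$ equals $F(\varphi_1,\dots,\varphi_k)$ for some $F\in\mathcal{C}^\infty(\mathbb{R}^k)$; (3) $\mathbb{R}[X]$ separates points. Then $\mathbb{R}[\boldsymbol{x}]/\ker\varphi$ inherits a Poisson bracket. The symbol $\varphi$ also denotes the map $X\to\mathbb{R}^k$, $\xi\mapsto(\varphi_1(\xi),\dots,\varphi_k(\xi))$. The chart is $\mathbb{Z}$-graded if $\mathbb{R}[\boldsymbol{x}]$ carries a $\mathbb{Z}$-grading for which $\ker\varphi$ is homogeneous. An arrow from $X$ with global chart $\varphi\colon\mathbb{R}[x_1,\dots,x_k]\to\mathcal{C}^\infty(X)$ to $Y$ with global chart $\psi\colon\mathbb{R}[y_1,\dots,y_m]\to\mathcal{C}^\infty(Y)$ is an algebra morphism $\lambda\colon\mathbb{R}[\boldsymbol{y}]\to\mathbb{R}[\boldsymbol{x}]$ such that (i) $\lambda(\ker\psi)\subset\ker\varphi$ and the induced map $\overline{\lambda}\colon\mathbb{R}[\boldsymbol{y}]/\ker\psi\to\mathbb{R}[\boldsymbol{x}]/\ker\varphi$ is compatible with Poisson brackets; (ii) with $\vartheta\colon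 X\to\mathbb{R}^m$, $\vartheta(\xi)=\big(\varphi(\lambda(y_1))(\xi),\dots,\varphi(\lambda(y_m))(\xi)\big)$, one has $\operatorname{im}(\vartheta)\subset\operatorname{im}(\psi\colon Y\to\mathbb{R}^m)$. It is $\mathbb{Z}$-graded if both charts are $\mathbb{Z}$-graded and $\lambda$ is compatible with the gradings. The arrow lifts to the Poisson map $\chi\colon X\to Y$, $\chi(\xi)=\psi^{-1}(\vartheta(\xi))$, whose pullback $\widetilde\lambda=\chi^*$ satisfies $\varphi\circ\lambda=\widetilde\lambda\circ\psi$. If moreover $\overline\lambda$ is an isomorphism and $\operatorname{im}(\vartheta)=\operatorname{im}(\psi)$, then $\chi$ is called a regular symplectomorphism (regular Poisson diffeomorphism); it is $\mathbb{Z}$-graded if the arrow is. The chart of $M_0$: $\psi_i=\psi(y_i)$ is the class in $\mathcal{C}^\infty(M_0)$ of the invariant $\rho_i$, where $\rho_1=\operatorname{Re}\big(z_{\ell+1}^{\mathcal{A}}\prod_{i=1}^\ell z_i^{m_i}\big)$, $\rho_2=\operatorname{Im}\big(z_{\ell+1}^{\mathcal{A}}\prod_{i=1}^\ell z_i^{m_i}\big)$, $\rho_3=z_{\ell+1}\overline{z_{\ell+1}}$, $\rho_{3+i}=z_i\overline{z_i}$ for $i=1,\dots,\ell$; $y_1,y_2$ have degree $\mathcal{A}+\mathcal{M}$ and $y_3,\dots,y_{\ell+3}$ have degree $2$. The chart of $X_N$: $\mathbb{Z}_N\subset\mathbb{S}^1$ acts on $\mathbb{C}$ by multiplication, $\mathcal{C}^\infty(X_N)=\mathcal{C}^\infty(\mathbb{C})^{\mathbb{Z}_N}$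 with bracket induced by $\{z,\overline z\}=\frac{2}{\sqrt{-1}}$, and $\varphi(x_1)=\operatorname{Re}(z^N)$, $\varphi(x_2)=\operatorname{Im}(z^N)$, $\varphi(x_3)=z\overline z$; $x_1,x_2$ have degree $N$ and $x_3$ has degree $2$. *)

theory Defs
  imports "HOL-Analysis.Analysis" "HOL-Library.Poly_Mapping"
begin

section \<open>Smooth functions\<close>

definition partial_deriv :: "'i \<Rightarrow> (('i \<Rightarrow> real) \<Rightarrow> real) \<Rightarrow> ('i \<Rightarrow> real) \<Rightarrow> real" where
  "partial_deriv i F x = deriv (\<lambda>t. F (x(i := t))) (x i)"

text \<open>
  For a finite index set \<open>I\<close>, \<open>smooth_fun I\<close> is the algebra of smooth functions on the Euclidean
  space with coordinates indexed by \<open>I\<close>: all iterated partial derivatives exist and are continuous.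
  A point is given by a function on the whole index type, of which only the coordinates in \<open>I\<close>
  matter; this makes it possible to quantify over the dimension inside a formula.
\<close>

definition smooth_fun :: "'i set \<Rightarrow> (('i \<Rightarrow> real) \<Rightarrow> real) set" where
  "smooth_fun I = {F.
     (\<forall>x y. (\<forall>i\<in>I. x i = y i) \<longrightarrow> F x = F y) \<and>
     (\<forall>js\<in>lists I. continuous_on UNIV (foldr partial_deriv js F) \<and>
        (\<forall>i\<in>I. \<forall>x. (\<lambda>t. foldr partial_deriv js F (x(i := t))) differentiable (at (x i))))}"

definition smooth :: "('a::euclidean_space \<Rightarrow> real) \<Rightarrow> bool" where
  "smooth f \<longleftrightarrow> (\<lambda>x. f (\<Sum>b\<in>Basis. x b *\<^sub>R b)) \<in> smooth_fun Basis"


section \<open>Poisson differential spaces\<close>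

text \<open>
  Functions on the space are extensional: they are \<open>undefined\<close> outside the underlying set of points.
\<close>

record 'p poisson_space =
  space_top :: "'p topology"
  Cinf :: "('p \<Rightarrow> real) set"
  brk :: "('p \<Rightarrow> real) \<Rightarrow> ('p \<Rightarrow> real) \<Rightarrow> 'p \<Rightarrow> real"

definition pts :: "('p, 'b) poisson_space_scheme \<Rightarrow> 'p set" where
  "pts X = topspace (space_top X)"

definition fadd :: "('p, 'b) poisson_space_scheme \<Rightarrow> ('p \<Rightarrow> real) \<Rightarrow> ('p \<Rightarrow> real) \<Rightarrow> 'p \<Rightarrow> real" where
  "fadd X f g = (\<lambda>\<xi>\<in>pts X. f \<xi> + g \<xi>)"

definition fmult :: "('p, 'b) poisson_space_scheme \<Rightarrow> ('p \<Rightarrow> real) \<Rightarrow> ('p \<Rightarrow> real) \<Rightarrow> 'p \<Rightarrow> real" where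
  "fmult X f g = (\<lambda>\<xi>\<in>pts X. f \<xi> * g \<xi>)"

definition fconst :: "('p, 'b) poisson_space_scheme \<Rightarrow> real \<Rightarrow> 'p \<Rightarrow> real" where
  "fconst X c = (\<lambda>\<xi>\<in>pts X. c)"

definition differential_space :: "('p, 'b) poisson_space_scheme \<Rightarrow> bool" where
  "differential_space X \<longleftrightarrow>
     Cinf X \<subseteq> extensional (pts X) \<and>
     (\<forall>f\<in>Cinf X. continuous_map (space_top X) euclideanreal f) \<and>
     (\<forall>c. fconst X c \<in> Cinf X) \<and>
     (\<forall>f\<in>Cinf X. \<forall>g\<in>Cinf X. fadd X f g \<in> Cinf X \<and> fmult X f g \<in> Cinf X) \<and>
     space_top X = topology_generated_by {f -` U \<inter> pts X | f U. f \<in> Cinf X \<and> open U} \<and>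
     (\<forall>k. \<forall>F\<in>smooth_fun {..<k::nat}. \<forall>f\<in>{..<k} \<rightarrow> Cinf X.
        (\<lambda>\<xi>\<in>pts X. F (\<lambda>i. f i \<xi>)) \<in> Cinf X) \<and>
     (\<forall>f\<in>extensional (pts X).
        (\<forall>\<xi>\<in>pts X. \<exists>U g. openin (space_top X) U \<and> \<xi> \<in> U \<and> g \<in> Cinf X \<and> (\<forall>\<eta>\<in>U. f \<eta> = g \<eta>))
        \<longrightarrow> f \<in> Cinf X)"

definition poisson_bracket_on :: "('p, 'b) poisson_space_scheme \<Rightarrow> bool" where
  "poisson_bracket_on X \<longleftrightarrow>
     (\<forall>f\<in>Cinf X. \<forall>g\<in>Cinf X. brk X f g \<in> Cinf X) \<and>
     (\<forall>f\<in>Cinf X. \<forall>g\<in>Cinf X. \<forall>h\<in>Cinf X. brk X (fadd X f g) h = fadd X (brk X f h) (brk X g h)) \<and>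
     (\<forall>c. \<forall>f\<in>Cinf X. \<forall>g\<in>Cinf X.
        brk X (fmult X (fconst X c) f) g = fmult X (fconst X c) (brk X f g)) \<and>
     (\<forall>f\<in>Cinf X. \<forall>g\<in>Cinf X. brk X f g = fmult X (fconst X (-1)) (brk X g f)) \<and>
     (\<forall>f\<in>Cinf X. \<forall>g\<in>Cinf X. \<forall>h\<in>Cinf X.
        fadd X (brk X f (brk X g h)) (fadd X (brk X g (brk X h f)) (brk X h (brk X f g)))
          = fconst X 0) \<and>
     (\<forall>f\<in>Cinf X. \<forall>g\<in>Cinf X. \<forall>h\<in>Cinf X.
        brk X f (fmult X g h) = fadd X (fmult X (brk X f g) h) (fmult X g (brk X f h)))"

definition poisson_differential_space :: "('p, 'b) poisson_space_scheme \<Rightarrow> bool" where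
  "poisson_differential_space X \<longleftrightarrow> differential_space X \<and> poisson_bracket_on X"

definition pullback ::
  "('p, 'b) poisson_space_scheme \<Rightarrow> ('p \<Rightarrow> 'q) \<Rightarrow> ('q \<Rightarrow> real) \<Rightarrow> 'p \<Rightarrow> real" where
  "pullback X \<kappa> f = (\<lambda>\<xi>\<in>pts X. f (\<kappa> \<xi>))"

definition poisson_map ::
  "('p, 'b) poisson_space_scheme \<Rightarrow> ('q, 'c) poisson_space_scheme \<Rightarrow> ('p \<Rightarrow> 'q) \<Rightarrow> bool" where
  "poisson_map X Y \<kappa> \<longleftrightarrow>
     continuous_map (space_top X) (space_top Y) \<kappa> \<and>
     (\<forall>f\<in>Cinf Y. pullback X \<kappa> f \<in> Cinf X) \<and>
     (\<forall>f\<in>Cinf Y. \<forall>g\<in>Cinf Y. pullback X \<kappa> (brk Y f g) = brk X (pullback X \<kappa> f) (pullback X \<kappa> g))"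


section \<open>Polynomial algebras\<close>

text \<open>Real polynomials in variables indexed by the finite type \<open>'k\<close>.\<close>

type_synonym 'k rpoly = "('k \<Rightarrow>\<^sub>0 nat) \<Rightarrow>\<^sub>0 real"

definition Const :: "real \<Rightarrow> 'k rpoly" where
  "Const c = Poly_Mapping.single 0 c"

definition Var :: "'k \<Rightarrow> 'k rpoly" where
  "Var i = Poly_Mapping.single (Poly_Mapping.single i 1) 1"

text \<open>The homomorphism sending a constant \<open>r\<close> to \<open>c r\<close> and the variable \<open>i\<close> to \<open>g i\<close>.\<close>

definition poly_hom ::
  "(real \<Rightarrow> 'b) \<Rightarrow> ('k::finite \<Rightarrow> 'b) \<Rightarrow> 'k rpoly \<Rightarrow> 'b::comm_semiring_1" where
  "poly_hom c g p = (\<Sum>m\<in>Poly_Mapping.keys p.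
     c (Poly_Mapping.lookup p m) * (\<Prod>i\<in>UNIV. g i ^ Poly_Mapping.lookup m i))"

abbreviation poly_eval :: "('k::finite \<Rightarrow> real) \<Rightarrow> 'k rpoly \<Rightarrow> real" where
  "poly_eval \<equiv> poly_hom (\<lambda>r. r)"

abbreviation poly_subst :: "('k::finite \<Rightarrow> 'j rpoly) \<Rightarrow> 'k rpoly \<Rightarrow> 'j rpoly" where
  "poly_subst \<equiv> poly_hom Const"

definition poly_alg_hom :: "('k rpoly \<Rightarrow> 'j rpoly) \<Rightarrow> bool" where
  "poly_alg_hom lam \<longleftrightarrow>
     (\<forall>c. lam (Const c) = Const c) \<and>
     (\<forall>p q. lam (p + q) = lam p + lam q) \<and>
     (\<forall>p q. lam (p * q) = lam p * lam q)"

definition homog_components ::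
  "(int \<Rightarrow> 'k rpoly set) \<Rightarrow> 'k rpoly \<Rightarrow> (int \<Rightarrow> 'k rpoly) \<Rightarrow> bool" where
  "homog_components G p c \<longleftrightarrow>
     (\<forall>d. c d \<in> G d) \<and> finite {d. c d \<noteq> 0} \<and> p = (\<Sum>d | c d \<noteq> 0. c d)"

definition z_grading :: "(int \<Rightarrow> 'k rpoly set) \<Rightarrow> bool" where
  "z_grading G \<longleftrightarrow>
     (\<forall>d. 0 \<in> G d \<and> (\<forall>p\<in>G d. \<forall>q\<in>G d. p + q \<in> G d) \<and> (\<forall>r. \<forall>p\<in>G d. Const r * p \<in> G d)) \<and>
     (\<forall>d e. \<forall>p\<in>G d. \<forall>q\<in>G e. p * q \<in> G (d + e)) \<and>
     (\<forall>p. \<exists>!c. homog_components G p c)"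

definition homogeneous_ideal :: "(int \<Rightarrow> 'k rpoly set) \<Rightarrow> 'k rpoly set \<Rightarrow> bool" where
  "homogeneous_ideal G J \<longleftrightarrow> (\<forall>p\<in>J. \<forall>c. homog_components G p c \<longrightarrow> (\<forall>d. c d \<in> J))"

text \<open>The grading determined by the degrees \<open>w i\<close> of the variables.\<close>

definition weight_grading :: "('k::finite \<Rightarrow> int) \<Rightarrow> int \<Rightarrow> 'k rpoly set" where
  "weight_grading w d =
     {p. \<forall>m\<in>Poly_Mapping.keys p. (\<Sum>i\<in>UNIV. int (Poly_Mapping.lookup m i) * w i) = d}"


section \<open>Global charts\<close>

definition chart_hom ::
  "('p, 'b) poisson_space_scheme \<Rightarrow> ('k rpoly \<Rightarrow> 'p \<Rightarrow> real) \<Rightarrow> bool" where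
  "chart_hom X \<phi> \<longleftrightarrow>
     (\<forall>p. \<phi> p \<in> Cinf X) \<and>
     (\<forall>c. \<phi> (Const c) = fconst X c) \<and>
     (\<forall>p q. \<phi> (p + q) = fadd X (\<phi> p) (\<phi> q)) \<and>
     (\<forall>p q. \<phi> (p * q) = fmult X (\<phi> p) (\<phi> q))"

definition chart_map :: "('k rpoly \<Rightarrow> 'p \<Rightarrow> real) \<Rightarrow> 'p \<Rightarrow> 'k \<Rightarrow> real" where
  "chart_map \<phi> \<xi> = (\<lambda>i. \<phi> (Var i) \<xi>)"

definition global_chart ::
  "('p, 'b) poisson_space_scheme \<Rightarrow> ('k::finite rpoly \<Rightarrow> 'p \<Rightarrow> real) \<Rightarrow> bool" where
  "global_chart X \<phi> \<longleftrightarrow>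
     poisson_differential_space X \<and>
     chart_hom X \<phi> \<and>
     (\<forall>p q. brk X (\<phi> p) (\<phi> q) \<in> range \<phi>) \<and>
     (\<forall>f\<in>Cinf X. \<exists>F\<in>smooth_fun (UNIV :: 'k set). \<forall>\<xi>\<in>pts X. f \<xi> = F (chart_map \<phi> \<xi>)) \<and>
     (\<forall>\<xi>\<in>pts X. \<forall>\<eta>\<in>pts X. \<xi> \<noteq> \<eta> \<longrightarrow> (\<exists>p. \<phi> p \<xi> \<noteq> \<phi> p \<eta>))"

definition chart_ker ::
  "('p, 'b) poisson_space_scheme \<Rightarrow> ('k rpoly \<Rightarrow> 'p \<Rightarrow> real) \<Rightarrow> 'k rpoly set" where
  "chart_ker X \<phi> = {p. \<phi> p = fconst X 0}"

definition z_graded_chart ::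
  "('p, 'b) poisson_space_scheme \<Rightarrow> ('k::finite rpoly \<Rightarrow> 'p \<Rightarrow> real) \<Rightarrow> (int \<Rightarrow> 'k rpoly set) \<Rightarrow> bool"
  where
  "z_graded_chart X \<phi> G \<longleftrightarrow>
     global_chart X \<phi> \<and> z_grading G \<and> homogeneous_ideal G (chart_ker X \<phi>)"

text \<open>The quotient algebra by the kernel of the chart, as a set of cosets, with its bracket.\<close>

definition quot_alg ::
  "('p, 'b) poisson_space_scheme \<Rightarrow> ('k rpoly \<Rightarrow> 'p \<Rightarrow> real) \<Rightarrow> 'k rpoly set set" where
  "quot_alg X \<phi> = UNIV // {(p, q). q - p \<in> chart_ker X \<phi>}"

definition quot_brk ::
  "('p, 'b) poisson_space_scheme \<Rightarrow> ('k rpoly \<Rightarrow> 'p \<Rightarrow> real) \<Rightarrow>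
   'k rpoly set \<Rightarrow> 'k rpoly set \<Rightarrow> 'k rpoly set" where
  "quot_brk X \<phi> P Q = {r. \<exists>p\<in>P. \<exists>q\<in>Q. \<phi> r = brk X (\<phi> p) (\<phi> q)}"

definition induced_hom ::
  "('p, 'b) poisson_space_scheme \<Rightarrow> ('k rpoly \<Rightarrow> 'p \<Rightarrow> real) \<Rightarrow> ('j rpoly \<Rightarrow> 'k rpoly) \<Rightarrow>
   'j rpoly set \<Rightarrow> 'k rpoly set" where
  "induced_hom X \<phi> lam P = {q. \<exists>p\<in>P. q - lam p \<in> chart_ker X \<phi>}"


section \<open>Arrows and regular symplectomorphisms\<close>

text \<open>
  The spaces and charts are listed as \<open>X\<close>, \<open>\<phi>\<close>, \<open>Y\<close>, \<open>\<psi>\<close>; an arrow goes from \<open>X\<close> to \<open>Y\<close>, whereas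
  the algebra homomorphism \<open>lam\<close> goes from the polynomial algebra of \<open>\<psi>\<close> to that of \<open>\<phi>\<close>.
\<close>

definition arrow_theta ::
  "('k rpoly \<Rightarrow> 'p \<Rightarrow> real) \<Rightarrow> ('j rpoly \<Rightarrow> 'k rpoly) \<Rightarrow> 'p \<Rightarrow> 'j \<Rightarrow> real" where
  "arrow_theta \<phi> lam \<xi> = (\<lambda>j. \<phi> (lam (Var j)) \<xi>)"

definition arrow ::
  "('p, 'b) poisson_space_scheme \<Rightarrow> ('k::finite rpoly \<Rightarrow> 'p \<Rightarrow> real) \<Rightarrow>
   ('q, 'c) poisson_space_scheme \<Rightarrow> ('j::finite rpoly \<Rightarrow> 'q \<Rightarrow> real) \<Rightarrow>
   ('j rpoly \<Rightarrow> 'k rpoly) \<Rightarrow> bool" where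
  "arrow X \<phi> Y \<psi> lam \<longleftrightarrow>
     global_chart X \<phi> \<and> global_chart Y \<psi> \<and> poly_alg_hom lam \<and>
     lam ` chart_ker Y \<psi> \<subseteq> chart_ker X \<phi> \<and>
     (\<forall>P\<in>quot_alg Y \<psi>. \<forall>Q\<in>quot_alg Y \<psi>.
        induced_hom X \<phi> lam (quot_brk Y \<psi> P Q)
          = quot_brk X \<phi> (induced_hom X \<phi> lam P) (induced_hom X \<phi> lam Q)) \<and>
     arrow_theta \<phi> lam ` pts X \<subseteq> chart_map \<psi> ` pts Y"

definition z_graded_arrow ::
  "('p, 'b) poisson_space_scheme \<Rightarrow> ('k::finite rpoly \<Rightarrow> 'p \<Rightarrow> real) \<Rightarrow> (int \<Rightarrow> 'k rpoly set) \<Rightarrow>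
   ('q, 'c) poisson_space_scheme \<Rightarrow> ('j::finite rpoly \<Rightarrow> 'q \<Rightarrow> real) \<Rightarrow> (int \<Rightarrow> 'j rpoly set) \<Rightarrow>
   ('j rpoly \<Rightarrow> 'k rpoly) \<Rightarrow> bool" where
  "z_graded_arrow X \<phi> G Y \<psi> H lam \<longleftrightarrow>
     arrow X \<phi> Y \<psi> lam \<and> z_graded_chart X \<phi> G \<and> z_graded_chart Y \<psi> H \<and> (\<forall>d. lam ` H d \<subseteq> G d)"

definition arrow_lift ::
  "('p, 'b) poisson_space_scheme \<Rightarrow> ('k rpoly \<Rightarrow> 'p \<Rightarrow> real) \<Rightarrow>
   ('q, 'c) poisson_space_scheme \<Rightarrow> ('j rpoly \<Rightarrow> 'q \<Rightarrow> real) \<Rightarrow>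
   ('j rpoly \<Rightarrow> 'k rpoly) \<Rightarrow> 'p \<Rightarrow> 'q" where
  "arrow_lift X \<phi> Y \<psi> lam = (\<lambda>\<xi>\<in>pts X. the_inv_into (pts Y) (chart_map \<psi>) (arrow_theta \<phi> lam \<xi>))"

definition lifts_to ::
  "('p, 'b) poisson_space_scheme \<Rightarrow> ('k rpoly \<Rightarrow> 'p \<Rightarrow> real) \<Rightarrow>
   ('q, 'c) poisson_space_scheme \<Rightarrow> ('j rpoly \<Rightarrow> 'q \<Rightarrow> real) \<Rightarrow>
   ('j rpoly \<Rightarrow> 'k rpoly) \<Rightarrow> ('p \<Rightarrow> 'q) \<Rightarrow> bool" where
  "lifts_to X \<phi> Y \<psi> lam \<kappa> \<longleftrightarrow>
     \<kappa> = arrow_lift X \<phi> Y \<psi> lam \<and> poisson_map X Y \<kappa> \<and>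
     (\<forall>p. \<phi> (lam p) = pullback X \<kappa> (\<psi> p))"

definition regular_symplectomorphism ::
  "('p, 'b) poisson_space_scheme \<Rightarrow> ('k::finite rpoly \<Rightarrow> 'p \<Rightarrow> real) \<Rightarrow>
   ('q, 'c) poisson_space_scheme \<Rightarrow> ('j::finite rpoly \<Rightarrow> 'q \<Rightarrow> real) \<Rightarrow>
   ('j rpoly \<Rightarrow> 'k rpoly) \<Rightarrow> ('p \<Rightarrow> 'q) \<Rightarrow> bool" where
  "regular_symplectomorphism X \<phi> Y \<psi> lam \<kappa> \<longleftrightarrow>
     arrow X \<phi> Y \<psi> lam \<and> lifts_to X \<phi> Y \<psi> lam \<kappa> \<and>
     bij_betw (induced_hom X \<phi> lam) (quot_alg Y \<psi>) (quot_alg X \<phi>) \<and>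
     arrow_theta \<phi> lam ` pts X = chart_map \<psi> ` pts Y"

definition z_graded_regular_symplectomorphism ::
  "('p, 'b) poisson_space_scheme \<Rightarrow> ('k::finite rpoly \<Rightarrow> 'p \<Rightarrow> real) \<Rightarrow> (int \<Rightarrow> 'k rpoly set) \<Rightarrow>
   ('q, 'c) poisson_space_scheme \<Rightarrow> ('j::finite rpoly \<Rightarrow> 'q \<Rightarrow> real) \<Rightarrow> (int \<Rightarrow> 'j rpoly set) \<Rightarrow>
   ('j rpoly \<Rightarrow> 'k rpoly) \<Rightarrow> ('p \<Rightarrow> 'q) \<Rightarrow> bool" where
  "z_graded_regular_symplectomorphism X \<phi> G Y \<psi> H lam \<kappa> \<longleftrightarrow>
     regular_symplectomorphism X \<phi> Y \<psi> lam \<kappa> \<and> z_graded_arrow X \<phi> G Y \<psi> H lam"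


section \<open>Quotients of subsets of complex Euclidean space\<close>

definition dir_deriv :: "'a::real_vector \<Rightarrow> ('a \<Rightarrow> real) \<Rightarrow> 'a \<Rightarrow> real" where
  "dir_deriv v f z = deriv (\<lambda>t. f (z + t *\<^sub>R v)) 0"

text \<open>
  With \<open>z\<^sub>j = x\<^sub>j + \<i> y\<^sub>j\<close>, the relations \<open>{z\<^sub>j, cnj z\<^sub>k} = (2 / \<i>) \<delta>\<^sub>j\<^sub>k\<close>, \<open>{z\<^sub>j, z\<^sub>k} = 0\<close> and
  \<open>{cnj z\<^sub>j, cnj z\<^sub>k} = 0\<close> say that \<open>{x\<^sub>j, y\<^sub>k} = \<delta>\<^sub>j\<^sub>k\<close>, \<open>{x\<^sub>j, x\<^sub>k} = 0\<close> and \<open>{y\<^sub>j, y\<^sub>k} = 0\<close>.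
\<close>

definition std_brk ::
  "((complex ^ 'n) \<Rightarrow> real) \<Rightarrow> ((complex ^ 'n) \<Rightarrow> real) \<Rightarrow> (complex ^ 'n) \<Rightarrow> real" where
  "std_brk f g z = (\<Sum>j\<in>UNIV.
     dir_deriv (axis j 1) f z * dir_deriv (axis j \<i>) g z -
     dir_deriv (axis j \<i>) f z * dir_deriv (axis j 1) g z)"

definition orbit :: "('a \<Rightarrow> 'a) set \<Rightarrow> 'a \<Rightarrow> 'a set" where
  "orbit \<Gamma> z = (\<lambda>g. g z) ` \<Gamma>"

definition quotient_topology :: "'a topology \<Rightarrow> ('a \<Rightarrow> 'b) \<Rightarrow> 'b topology" where
  "quotient_topology T q =
     topology (\<lambda>V. V \<subseteq> q ` topspace T \<and> openin T {x \<in> topspace T. q x \<in> V})"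

lemma openin_quotient_topology:
  "openin (quotient_topology T q) V \<longleftrightarrow> V \<subseteq> q ` topspace T \<and> openin T {x \<in> topspace T. q x \<in> V}"
proof -
  have "istopology (\<lambda>V. V \<subseteq> q ` topspace T \<and> openin T {x \<in> topspace T. q x \<in> V})"
    unfolding istopology_def
  proof (intro conjI allI impI)
    fix S U
    assume "S \<subseteq> q ` topspace T \<and> openin T {x \<in> topspace T. q x \<in> S}"
      and "U \<subseteq> q ` topspace T \<and> openin T {x \<in> topspace T. q x \<in> U}"
    moreover have "{x \<in> topspace T. q x \<in> S \<inter> U}
        = {x \<in> topspace T. q x \<in> S} \<inter> {x \<in> topspace T. q x \<in> U}"
      by blast
    ultimately show "S \<inter> U \<subseteq> q ` topspace T" "openin T {x \<in> topspace T. q x \<in> S \<inter> U}"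
      by auto
  next
    fix K
    assume K: "\<forall>S\<in>K. S \<subseteq> q ` topspace T \<and> openin T {x \<in> topspace T. q x \<in> S}"
    then show "\<Union> K \<subseteq> q ` topspace T" by blast
    have "{x \<in> topspace T. q x \<in> \<Union> K} = (\<Union>S\<in>K. {x \<in> topspace T. q x \<in> S})"
      by blast
    with K show "openin T {x \<in> topspace T. q x \<in> \<Union> K}"
      by auto
  qed
  then show ?thesis
    unfolding quotient_topology_def by (simp add: topology_inverse')
qed

text \<open>
  For a group \<open>\<Gamma>\<close> of transformations and an invariant subset \<open>Z\<close>: \<open>smooth_ext \<Gamma> Z F f\<close> says that the
  function \<open>f\<close> on the orbit space of \<open>Z\<close> is the class of the smooth invariant function \<open>F\<close> modulo the
  ideal of functions vanishing on \<open>Z\<close>. The bracket of classes is the class of the bracket.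
\<close>

definition smooth_ext ::
  "((complex ^ 'n) \<Rightarrow> complex ^ 'n) set \<Rightarrow> (complex ^ 'n) set \<Rightarrow>
   ((complex ^ 'n) \<Rightarrow> real) \<Rightarrow> ((complex ^ 'n) set \<Rightarrow> real) \<Rightarrow> bool" where
  "smooth_ext \<Gamma> Z F f \<longleftrightarrow>
     smooth F \<and> (\<forall>g\<in>\<Gamma>. \<forall>z. F (g z) = F z) \<and> (\<forall>z\<in>Z. f (orbit \<Gamma> z) = F z)"

definition orbit_quotient ::
  "((complex ^ 'n) \<Rightarrow> complex ^ 'n) set \<Rightarrow> (complex ^ 'n) set \<Rightarrow> (complex ^ 'n) set poisson_space"
  where
  "orbit_quotient \<Gamma> Z =
     \<lparr>space_top = quotient_topology (top_of_set Z) (orbit \<Gamma>),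
      Cinf = {f \<in> extensional (orbit \<Gamma> ` Z). \<exists>F. smooth_ext \<Gamma> Z F f},
      brk = (\<lambda>f g. THE h. h \<in> extensional (orbit \<Gamma> ` Z) \<and>
               (\<forall>F G. smooth_ext \<Gamma> Z F f \<longrightarrow> smooth_ext \<Gamma> Z G g \<longrightarrow>
                  (\<forall>z\<in>Z. h (orbit \<Gamma> z) = std_brk F G z)))\<rparr>"

definition orbit_class ::
  "('a \<Rightarrow> 'a) set \<Rightarrow> 'a set \<Rightarrow> ('a \<Rightarrow> real) \<Rightarrow> 'a set \<Rightarrow> real" where
  "orbit_class \<Gamma> Z F = (\<lambda>\<xi>\<in>orbit \<Gamma> ` Z. THE c. \<forall>z\<in>Z. orbit \<Gamma> z = \<xi> \<longrightarrow> F z = c)"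

text \<open>The algebra homomorphism sending the variable \<open>i\<close> to the class of the invariant \<open>\<rho> i\<close>.\<close>

definition invariant_chart ::
  "('a \<Rightarrow> 'a) set \<Rightarrow> 'a set \<Rightarrow> ('k::finite \<Rightarrow> 'a \<Rightarrow> real) \<Rightarrow> 'k rpoly \<Rightarrow> 'a set \<Rightarrow> real" where
  "invariant_chart \<Gamma> Z \<rho> p = orbit_class \<Gamma> Z (\<lambda>z. poly_eval (\<lambda>i. \<rho> i z) p)"


section \<open>Torus actions and symplectic quotients\<close>

definition torus :: "(complex ^ 'l) set" where
  "torus = {t. \<forall>i. norm (t $ i) = 1}"

definition torus_act :: "int ^ 'n ^ 'l \<Rightarrow> complex ^ 'l \<Rightarrow> complex ^ 'n \<Rightarrow> complex ^ 'n" where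
  "torus_act A t z = (\<chi> j. (\<Prod>i\<in>UNIV. (t $ i) powi (A $ i $ j)) * z $ j)"

definition torus_maps :: "int ^ 'n ^ 'l \<Rightarrow> ((complex ^ 'n) \<Rightarrow> complex ^ 'n) set" where
  "torus_maps A = torus_act A ` torus"

definition effective_torus_action :: "int ^ 'n ^ 'l \<Rightarrow> bool" where
  "effective_torus_action A \<longleftrightarrow> (\<forall>t\<in>torus. (\<forall>z. torus_act A t z = z) \<longrightarrow> t = (\<chi> i. 1))"

definition moment_map :: "int ^ 'n ^ 'l \<Rightarrow> complex ^ 'n \<Rightarrow> real ^ 'l" where
  "moment_map A z = (\<chi> i. 1 / 2 * (\<Sum>j\<in>UNIV. of_int (A $ i $ j) * (cmod (z $ j))\<^sup>2))"

definition zero_fibre :: "int ^ 'n ^ 'l \<Rightarrow> (complex ^ 'n) set" where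
  "zero_fibre A = {z. moment_map A z = 0}"

definition symplectic_quotient :: "int ^ 'n ^ 'l \<Rightarrow> (complex ^ 'n) set poisson_space" where
  "symplectic_quotient A = orbit_quotient (torus_maps A) (zero_fibre A)"

text \<open>
  With \<open>\<ell> = CARD('l)\<close>, the coordinate \<open>z\<^sub>i\<close> for \<open>i \<le> \<ell>\<close> is \<open>z $ Some i\<close> and \<open>z\<^bsub>\<ell>+1\<^esub>\<close> is \<open>z $ None\<close>.
\<close>

definition weight_matrix :: "('l \<Rightarrow> nat) \<Rightarrow> ('l \<Rightarrow> nat) \<Rightarrow> int ^ ('l option) ^ 'l" where
  "weight_matrix a n = (\<chi> i j. case j of None \<Rightarrow> int (n i) | Some k \<Rightarrow> if k = i then - int (a i) else 0)"

definition lcm_all :: "('l::finite \<Rightarrow> nat) \<Rightarrow> nat" where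
  "lcm_all a = Lcm (range a)"

definition mult_exp :: "('l::finite \<Rightarrow> nat) \<Rightarrow> ('l \<Rightarrow> nat) \<Rightarrow> 'l \<Rightarrow> nat" where
  "mult_exp a n i = n i * lcm_all a div a i"

text \<open>
  The variables \<open>y\<^sub>1, y\<^sub>2, y\<^sub>3\<close> are indexed by \<open>Inl 1, Inl 2, Inl 3\<close> and \<open>y\<^bsub>3+i\<^esub>\<close> by \<open>Inr i\<close>.
\<close>

definition quotient_invariants ::
  "('l::finite \<Rightarrow> nat) \<Rightarrow> ('l \<Rightarrow> nat) \<Rightarrow> 3 + 'l \<Rightarrow> complex ^ ('l option) \<Rightarrow> real" where
  "quotient_invariants a n v z =
     (let w = (z $ None) ^ lcm_all a * (\<Prod>i\<in>UNIV. (z $ Some i) ^ mult_exp a n i) in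
      case v of
        Inl k \<Rightarrow> if k = 1 then Re w else if k = 2 then Im w else (cmod (z $ None))\<^sup>2
      | Inr i \<Rightarrow> (cmod (z $ Some i))\<^sup>2)"

definition quotient_chart ::
  "('l::finite \<Rightarrow> nat) \<Rightarrow> ('l \<Rightarrow> nat) \<Rightarrow> (3 + 'l) rpoly \<Rightarrow> (complex ^ ('l option)) set \<Rightarrow> real" where
  "quotient_chart a n =
     invariant_chart (torus_maps (weight_matrix a n)) (zero_fibre (weight_matrix a n))
       (quotient_invariants a n)"

definition quotient_grading ::
  "('l::finite \<Rightarrow> nat) \<Rightarrow> ('l \<Rightarrow> nat) \<Rightarrow> int \<Rightarrow> (3 + 'l) rpoly set" where
  "quotient_grading a n = weight_grading (\<lambda>v.
     if v = Inl 1 \<or> v = Inl 2 then int (lcm_all a + (\<Sum>i\<in>UNIV. mult_exp a n i)) else 2)"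


section \<open>Cyclic quotients of the complex plane\<close>

text \<open>The complex plane is rendered as \<open>complex ^ 1\<close>.\<close>

definition cyclic_maps :: "nat \<Rightarrow> ((complex ^ 1) \<Rightarrow> complex ^ 1) set" where
  "cyclic_maps N = {(\<lambda>z. u *s z) | u. u ^ N = 1}"

definition cyclic_quotient :: "nat \<Rightarrow> (complex ^ 1) set poisson_space" where
  "cyclic_quotient N = orbit_quotient (cyclic_maps N) UNIV"

definition cyclic_invariants :: "nat \<Rightarrow> 3 \<Rightarrow> complex ^ 1 \<Rightarrow> real" where
  "cyclic_invariants N k z =
     (if k = 1 then Re ((z $ 1) ^ N) else if k = 2 then Im ((z $ 1) ^ N) else (cmod (z $ 1))\<^sup>2)"

definition cyclic_chart :: "nat \<Rightarrow> 3 rpoly \<Rightarrow> (complex ^ 1) set \<Rightarrow> real" where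
  "cyclic_chart N = invariant_chart (cyclic_maps N) UNIV (cyclic_invariants N)"

definition cyclic_grading :: "nat \<Rightarrow> int \<Rightarrow> 3 rpoly set" where
  "cyclic_grading N = weight_grading (\<lambda>k. if k = 1 \<or> k = 2 then int N else 2)"


section \<open>The comparison homomorphism\<close>

definition comparison_hom ::
  "('l::finite \<Rightarrow> nat) \<Rightarrow> ('l \<Rightarrow> nat) \<Rightarrow> nat \<Rightarrow> (3 + 'l) rpoly \<Rightarrow> 3 rpoly" where
  "comparison_hom a n N = poly_subst (\<lambda>v. case v of
       Inl k \<Rightarrow>
         if k = 1 \<or> k = 2
         then Const (sqrt (real (lcm_all a ^ lcm_all a * (\<Prod>j\<in>UNIV. mult_exp a n j ^ mult_exp a n j))
                           / real (N ^ N))) * Var k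
         else Const (real (lcm_all a) / real N) * Var 3
     | Inr i \<Rightarrow> Const (real (mult_exp a n i) / real N) * Var 3)"

end

theory Submission
  imports Defs "HOL-Complex_Analysis.Conformal_Mappings"
begin

text \<open>
  The isomorphism comes from a linear map. Label the coordinates of \<open>complex ^ 'l option\<close> so that
  \<open>None\<close> is the coordinate on which the torus acts with the weights \<open>n i\<close> and \<open>Some i\<close> the one on
  which it acts with the weight \<open>- a i\<close>; write \<open>A\<close> for \<open>lcm_all a\<close> and \<open>m i\<close> for \<open>mult_exp a n i\<close>.
  The zero fibre \<open>Z\<close> of the moment map consists of the points with
  \<open>a i * |z (Some i)|^2 = n i * |z None|^2\<close> for all \<open>i\<close>. It contains the complex line parametrised
  by the map \<open>slice\<close> that multiplies \<open>w\<close> by \<open>sqrt (A / N)\<close> in the coordinate \<open>None\<close> and by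
  \<open>sqrt (m i / N)\<close> in the coordinate \<open>Some i\<close>. As \<open>N = A + (\<Sum>i. m i)\<close>, this map is isometric.

  Every torus orbit in \<open>Z\<close> meets this line: the moduli of the coordinates of a point of \<open>Z\<close> are
  proportional to the coefficients of \<open>slice\<close>, and the arguments can be adjusted by solving linear
  equations (\<open>zero_fibre_reaches_slice\<close>). The orbit meets the line in exactly one orbit of the
  \<open>N\<close>-th roots of unity (\<open>orbit_slice_eq_iff\<close>): it does not meet it in more because the invariant
  monomial \<open>z None ^ A * (\<Prod>i. z (Some i) ^ m i)\<close> restricts to a positive multiple of \<open>w ^ N\<close>; and
  multiplication of \<open>w\<close> by an \<open>N\<close>-th root of unity is induced by a torus element
  (\<open>root_of_unity_lift\<close>), because effectiveness makes \<open>a i\<close> and \<open>n i\<close> coprime, whence \<open>A\<close> and all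
  the \<open>m i\<close> together have no common prime factor. So \<open>slice\<close> induces a bijection from
  \<open>X = \<complex> / \<int>\<^sub>N\<close> to \<open>Y = Z / T\<close>, and in fact a homeomorphism.

  It identifies the smooth functions. The restriction to the line of a smooth invariant function
  is smooth and invariant under roots of unity. Conversely, by Schwarz's theorem for the cyclic
  group (\<open>smooth_cyclic_invariant_factors\<close>), every smooth function of \<open>w\<close> that is invariant under
  roots of unity is a smooth function of \<open>Re (w ^ N)\<close>, \<open>Im (w ^ N)\<close> and \<open>|w|^2\<close>, and these three
  are restrictions of torus invariants. Schwarz's theorem is proved here for this group: the
  Taylor expansion at the origin of an invariant function consists of polynomials in the three
  invariants, which Borel's construction sums to a smooth function; the remainder is flat at the
  origin and invariant, so that it descends through \<open>w \<mapsto> w ^ N\<close> to a smooth function of \<open>w ^ N\<close>.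

  It also preserves brackets (\<open>std_brk_slice\<close>). In each coordinate plane use the radial and the
  angular derivative. Along the slice, invariance under the torus makes the angular derivatives of
  a function in the various planes proportional to the coefficients of \<open>slice\<close>; since the squares
  of these coefficients add up to one, the brackets in the various planes add up to the bracket on
  the line.

  Hence \<open>slice\<close> induces an isomorphism \<open>poisson_iso_slice_quotient\<close> from \<open>X\<close> to \<open>Y\<close> of all the
  data of a Poisson differential space. Evaluating the invariants of \<open>Y\<close> on the slice gives
  precisely the images of the variables under the homomorphism of the theorem, which is
  surjective. It therefore suffices to check on \<open>X\<close> that there is a global chart; all properties
  of \<open>Y\<close>, its chart and the arrow are transported from there
  (\<open>regular_symplectomorphism_transport\<close>). The kernels of both charts are homogeneous because they
  consist of the polynomials that vanish on a set stable under the weighted dilations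
  (\<open>homogeneous_ideal_of_cone\<close>).
\<close>

section \<open>Smooth functions of finitely many coordinates\<close>

lemma mean_value_abs:
  fixes f :: "real \<Rightarrow> real"
  assumes "\<And>x. (f has_real_derivative f' x) (at x)"
  shows "\<exists>\<xi>. \<bar>\<xi> - a\<bar> \<le> \<bar>b - a\<bar> \<and> f b - f a = f' \<xi> * (b - a)"
proof (cases a b rule: linorder_cases)
  case less
  from MVT2[OF this assms] show ?thesis by (force simp: mult.commute)
next
  case greater
  from MVT2[OF this assms] obtain z where z: "z > b" "z < a" "f a - f b = (a - b) * f' z" by blast
  then show ?thesis by (intro exI[of _ z]) (auto simp: algebra_simps)
qed auto

text \<open>
  Smoothness is a greatest fixed point: it suffices to exhibit some class of continuous functions
  that contains the given one and is closed under partial derivatives. Choosing the class takes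
  the place of formulas for iterated derivatives in all the smoothness proofs below.
\<close>

lemma smooth_fun_coinduct:
  assumes "F \<in> C"
    and local: "\<And>F x y. F \<in> C \<Longrightarrow> (\<And>i. i \<in> I \<Longrightarrow> x i = y i) \<Longrightarrow> F x = F y"
    and cont: "\<And>F. F \<in> C \<Longrightarrow> continuous_on UNIV F"
    and deriv: "\<And>F i. F \<in> C \<Longrightarrow> i \<in> I \<Longrightarrow>
      \<exists>F'\<in>C. \<forall>x. ((\<lambda>t. F (x(i := t))) has_real_derivative F' x) (at (x i))"
  shows "F \<in> smooth_fun I"
proof -
  have step: "partial_deriv i F \<in> C \<and> (\<forall>x. (\<lambda>t. F (x(i := t))) differentiable at (x i))"
    if "F \<in> C" "i \<in> I" for F i
  proof -
    obtain F' where F': "F' \<in> C" "\<And>x. ((\<lambda>t. F (x(i := t))) has_real_derivative F' x) (at (x i))"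
      using deriv[OF \<open>F \<in> C\<close> \<open>i \<in> I\<close>] by blast
    have "partial_deriv i F = F'"
      unfolding partial_deriv_def using F'(2) by (auto intro!: ext DERIV_imp_deriv)
    with F' show ?thesis by (auto simp: real_differentiable_def)
  qed
  have iter: "foldr partial_deriv js F \<in> C" if "js \<in> lists I" for js
    using that by (induction js) (auto simp: assms(1) step)
  show ?thesis unfolding smooth_fun_def
    using local[OF assms(1)] cont[OF iter] step[OF iter] by blast
qed

lemma smooth_fun_local:
  assumes "F \<in> smooth_fun I" "\<And>i. i \<in> I \<Longrightarrow> x i = y i"
  shows "F x = F y"
  using assms unfolding smooth_fun_def by blast

lemma smooth_fun_iter:
  assumes "F \<in> smooth_fun I" "js \<in> lists I"
  shows "continuous_on UNIV (foldr partial_deriv js F)"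
    and "i \<in> I \<Longrightarrow> (\<lambda>t. foldr partial_deriv js F (x(i := t))) differentiable (at (x i))"
  using assms unfolding smooth_fun_def by auto

lemma smooth_fun_continuous: "F \<in> smooth_fun I \<Longrightarrow> continuous_on UNIV F"
  using smooth_fun_iter(1)[of F I "[]"] by simp

lemma smooth_fun_has_derivative:
  assumes "F \<in> smooth_fun I" "i \<in> I"
  shows "((\<lambda>t. F (x(i := t))) has_real_derivative partial_deriv i F (x(i := s))) (at s)"
proof -
  have "(\<lambda>t. F ((x(i := s))(i := t))) differentiable (at ((x(i := s)) i))"
    using smooth_fun_iter(2)[OF assms(1), of "[]" i "x(i := s)"] assms(2) by simp
  then show ?thesis
    by (simp add: partial_deriv_def flip: DERIV_deriv_iff_real_differentiable)
qed

lemma smooth_fun_partial_deriv: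
  assumes F: "F \<in> smooth_fun I" and i: "i \<in> I"
  shows "partial_deriv i F \<in> smooth_fun I"
proof -
  have "partial_deriv i F x = partial_deriv i F y" if "\<forall>j\<in>I. x j = y j" for x y
  proof -
    have "F (x(i := t)) = F (y(i := t))" for t
      by (rule smooth_fun_local[OF F]) (use that in auto)
    then show ?thesis using that i by (simp add: partial_deriv_def)
  qed
  moreover have "continuous_on UNIV (foldr partial_deriv js (partial_deriv i F)) \<and>
      (\<forall>k\<in>I. \<forall>x. (\<lambda>t. foldr partial_deriv js (partial_deriv i F) (x(k := t))) differentiable (at (x k)))"
    if "js \<in> lists I" for js
    using smooth_fun_iter[OF F, of "js @ [i]"] that i by simp
  ultimately show ?thesis unfolding smooth_fun_def by blast
qed

text \<open>
  Partial derivatives alone give no total derivative; their continuity is what makes the chain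
  rule true. The coordinates are moved from \<open>h t0\<close> to \<open>h t\<close> one after the other, and the mean
  value theorem applies to each move.
\<close>

lemma smooth_fun_chain:
  assumes F: "F \<in> smooth_fun J" and fin: "finite J"
    and h: "\<And>j. j \<in> J \<Longrightarrow> ((\<lambda>t. h t j) has_real_derivative h' j) (at t0)"
  shows "((\<lambda>t. F (h t)) has_real_derivative (\<Sum>j\<in>J. partial_deriv j F (h t0) * h' j)) (at t0)"
proof -
  \<comment> \<open>The point in which only the coordinates in \<open>S\<close> have been moved.\<close>
  define hS where "hS S t = (\<lambda>j. if j \<in> S then h t j else h t0 j)" for S t
  have hS0: "hS S t0 = h t0" for S by (auto simp: hS_def)
  have "((\<lambda>t. F (hS S t)) has_real_derivative (\<Sum>j\<in>S. partial_deriv j F (h t0) * h' j)) (at t0)"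
    if "S \<subseteq> J" for S
    using finite_subset[OF that fin] that
  proof (induction S rule: finite_induct)
    case empty
    then show ?case by (simp add: hS_def)
  next
    case (insert i S)
    then have i: "i \<in> J" and S: "S \<subseteq> J" by auto
    define G where "G t = F ((hS S t)(i := h t i)) - F ((hS S t)(i := h t0 i))" for t
    have "\<exists>\<xi>. \<bar>\<xi> - h t0 i\<bar> \<le> \<bar>h t i - h t0 i\<bar> \<and>
        G t = partial_deriv i F ((hS S t)(i := \<xi>)) * (h t i - h t0 i)" for t
      unfolding G_def by (rule mean_value_abs) (rule smooth_fun_has_derivative[OF F i])
    then obtain \<xi> where \<xi>: "\<And>t. \<bar>\<xi> t - h t0 i\<bar> \<le> \<bar>h t i - h t0 i\<bar>"
      and G: "\<And>t. G t = partial_deriv i F ((hS S t)(i := \<xi> t)) * (h t i - h t0 i)"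
      by metis
    have lim_h: "((\<lambda>t. h t j) \<longlongrightarrow> h t0 j) (at t0)" if "j \<in> J" for j
      using DERIV_isCont[OF h[OF that]] by (simp add: isCont_def)
    have "((\<lambda>t. \<xi> t - h t0 i) \<longlongrightarrow> 0) (at t0)"
    proof (rule Lim_null_comparison)
      show "\<forall>\<^sub>F t in at t0. norm (\<xi> t - h t0 i) \<le> \<bar>h t i - h t0 i\<bar>" using \<xi> by simp
      show "((\<lambda>t. \<bar>h t i - h t0 i\<bar>) \<longlongrightarrow> 0) (at t0)"
        using lim_h[OF i] by (simp add: LIM_zero tendsto_rabs_zero)
    qed
    then have lim_xi: "(\<xi> \<longlongrightarrow> h t0 i) (at t0)" by (simp add: LIM_zero_cancel)
    have lim_pt: "((\<lambda>t. (hS S t)(i := \<xi> t)) \<longlongrightarrow> h t0) (at t0)"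
    proof -
      have "((\<lambda>t. ((hS S t)(i := \<xi> t)) j) \<longlongrightarrow> h t0 j) (at t0)" for j
        using lim_xi lim_h[of j] S by (cases "j = i"; cases "j \<in> S") (auto simp: hS_def)
      then have "limitin (product_topology (\<lambda>_. euclidean) UNIV) (\<lambda>t. (hS S t)(i := \<xi> t)) (h t0) (at t0)"
        by (simp add: limitin_componentwise)
      then show ?thesis by (simp add: euclidean_product_topology)
    qed
    have "continuous_on UNIV (partial_deriv i F)"
      by (rule smooth_fun_continuous[OF smooth_fun_partial_deriv[OF F i]])
    then have lim_d: "((\<lambda>t. partial_deriv i F ((hS S t)(i := \<xi> t))) \<longlongrightarrow> partial_deriv i F (h t0)) (at t0)"
      by (rule continuous_on_tendsto_compose[OF _ lim_pt]) auto
    have G0: "G t0 = 0" by (simp add: G_def)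
    have "(G has_real_derivative partial_deriv i F (h t0) * h' i) (at t0)"
      unfolding has_field_derivative_iff
      using tendsto_mult[OF lim_d h[OF i, unfolded has_field_derivative_iff]] G0
      by (simp add: G)
    moreover have "F (hS (insert i S) t) = F (hS S t) + G t" for t
    proof -
      have "hS (insert i S) t = (hS S t)(i := h t i)" by (auto simp: hS_def)
      moreover have "hS S t = (hS S t)(i := h t0 i)" using insert.hyps by (auto simp: hS_def)
      ultimately show ?thesis unfolding G_def by (metis add.commute diff_add_cancel)
    qed
    ultimately show ?case
      using DERIV_add[OF insert.IH[OF S]] insert.hyps by (simp add: add.commute)
  qed
  from this[of J] have "((\<lambda>t. F (hS J t)) has_real_derivative (\<Sum>j\<in>J. partial_deriv j F (h t0) * h' j)) (at t0)"
    by simp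
  moreover have "F (hS J t) = F (h t)" for t
    by (rule smooth_fun_local[OF F]) (simp add: hS_def)
  ultimately show ?thesis by simp
qed

lemma smooth_fun_const [simp]: "(\<lambda>x. c) \<in> smooth_fun I"
  by (rule smooth_fun_coinduct[where C = "range (\<lambda>c x. c)"]) (auto intro!: derivative_intros)

lemma smooth_fun_coord:
  assumes "i \<in> I"
  shows "(\<lambda>x. x i) \<in> smooth_fun I"
proof (rule smooth_fun_coinduct)
  define C :: "(('a \<Rightarrow> real) \<Rightarrow> real) set" where "C = insert (\<lambda>x. x i) (range (\<lambda>c x. c))"
  show "(\<lambda>x. x i) \<in> C" by (simp add: C_def)
  show "F x = F y" if "F \<in> C" "\<And>j. j \<in> I \<Longrightarrow> x j = y j" for F x y
    using that assms unfolding C_def by auto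
  show "continuous_on UNIV F" if "F \<in> C" for F
    using that continuous_on_product_then_coordinatewise[OF continuous_on_id, of UNIV i]
    unfolding C_def by auto
  show "\<exists>F'\<in>C. \<forall>x. ((\<lambda>t. F (x(j := t))) has_real_derivative F' x) (at (x j))"
    if F: "F \<in> C" for F j
  proof -
    have const: "(\<lambda>x. c) \<in> C" for c unfolding C_def by blast
    consider "F = (\<lambda>x. x i)" "i = j" | "F = (\<lambda>x. x i)" "i \<noteq> j" | c where "F = (\<lambda>x. c)"
      using F unfolding C_def by blast
    then show ?thesis
    proof cases
      case 1
      then show ?thesis by (intro bexI[OF _ const[of 1]]) simp
    next
      case 2
      then show ?thesis by (intro bexI[OF _ const[of 0]]) simp
    next
      case 3
      then show ?thesis by (intro bexI[OF _ const[of 0]]) simp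
    qed
  qed
qed

text \<open>
  The partial derivatives of a composite, a product or a quotient are sums of products of
  functions of these same kinds, so none of the closure properties of smooth functions can be
  obtained by coinduction in isolation. This class collects them all and is closed under partial
  derivatives.
\<close>

inductive_set smooth_closure :: "'i set \<Rightarrow> 'j set \<Rightarrow> (('i \<Rightarrow> real) \<Rightarrow> real) set" for I J where
  base: "F \<in> smooth_fun I \<Longrightarrow> F \<in> smooth_closure I J"
| comp: "F \<in> smooth_fun J \<Longrightarrow> (\<And>j. j \<in> J \<Longrightarrow> g j \<in> smooth_fun I) \<Longrightarrow> (\<lambda>x. F (\<lambda>j. g j x)) \<in> smooth_closure I J"
| add: "F \<in> smooth_closure I J \<Longrightarrow> G \<in> smooth_closure I J \<Longrightarrow> (\<lambda>x. F x + G x) \<in> smooth_closure I J"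
| mult: "F \<in> smooth_closure I J \<Longrightarrow> G \<in> smooth_closure I J \<Longrightarrow> (\<lambda>x. F x * G x) \<in> smooth_closure I J"
| inverse: "F \<in> smooth_fun I \<Longrightarrow> (\<And>x. F x \<noteq> 0) \<Longrightarrow> (\<lambda>x. inverse (F x)) \<in> smooth_closure I J"

lemma smooth_closure_sum:
  assumes "finite S" "\<And>j. j \<in> S \<Longrightarrow> F j \<in> smooth_closure I J"
  shows "(\<lambda>x. \<Sum>j\<in>S. F j x) \<in> smooth_closure I J"
  using assms by (induction S rule: finite_induct) (auto intro: smooth_closure.intros)

lemma smooth_closure_eq:
  assumes fin: "finite J"
  shows "smooth_closure (I :: 'a set) J = smooth_fun I"
proof
  show "smooth_fun I \<subseteq> smooth_closure I J" by (auto intro: base)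
  show "smooth_closure I J \<subseteq> smooth_fun I"
  proof
    fix F assume F: "F \<in> smooth_closure I J"
    show "F \<in> smooth_fun I"
    proof (rule smooth_fun_coinduct[OF F])
      fix F :: "('a \<Rightarrow> real) \<Rightarrow> real" and x y :: "'a \<Rightarrow> real"
      assume "F \<in> smooth_closure I J" and eq: "\<And>i. i \<in> I \<Longrightarrow> x i = y i"
      then show "F x = F y"
      proof induction
        case (comp F g)
        have "g j x = g j y" if "j \<in> J" for j 
          using smooth_fun_local[of "g j" I x y] comp eq that by auto
        then show ?case using smooth_fun_local[OF comp(1), of "\<lambda>j. g j x" "\<lambda>j. g j y"] by auto
      next
        case (base F)
        then show ?case using smooth_fun_local[of F I x y] by simp
      next
        case (inverse F)
        then show ?case using smooth_fun_local[of F I x y] by simp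
      qed auto
    next
      fix F assume "F \<in> smooth_closure I J"
      then show "continuous_on UNIV F"
      proof induction
        case (comp F g)
        have cont: "continuous_on UNIV (\<lambda>x j. if j \<in> J then g j x else 0)"
        proof (rule continuous_on_coordinatewise_then_product)
          show "continuous_on UNIV (\<lambda>x. if j \<in> J then g j x else 0)" for j
            using smooth_fun_continuous[OF comp(2)] by (cases "j \<in> J") auto
        qed
        have "F (\<lambda>j. if j \<in> J then g j x else 0) = F (\<lambda>j. g j x)" for x
          using smooth_fun_local[OF comp(1), of "\<lambda>j. if j \<in> J then g j x else 0" "\<lambda>j. g j x"] by auto
        moreover have "continuous_on UNIV (\<lambda>x. F (\<lambda>j. if j \<in> J then g j x else 0))"
          by (rule continuous_on_compose2[OF smooth_fun_continuous[OF comp(1)] cont]) auto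
        ultimately show ?case by simp
      next
        case (base F)
        then show ?case by (rule smooth_fun_continuous)
      next
        case (inverse F)
        then show ?case using smooth_fun_continuous[of F I] by (intro continuous_intros) auto
      qed (auto intro!: continuous_intros)
    next
      fix F i assume F: "F \<in> smooth_closure I J" and i: "i \<in> I"
      from F show "\<exists>F'\<in>smooth_closure I J. \<forall>x. ((\<lambda>t. F (x(i := t))) has_real_derivative F' x) (at (x i))"
      proof induction
        case (base F)
        then show ?case using smooth_fun_has_derivative[OF base i] smooth_fun_partial_deriv[OF base i]
          by (intro bexI[of _ "partial_deriv i F"])
             (metis fun_upd_triv, auto intro: smooth_closure.base)
      next
        case (comp F g)
        show ?case
        proof (intro bexI allI)
          fix x
          show "((\<lambda>t. F (\<lambda>j. g j (x(i := t)))) has_real_derivative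
            (\<Sum>j\<in>J. partial_deriv j F (\<lambda>j. g j x) * partial_deriv i (g j) x)) (at (x i))"
            using smooth_fun_chain[OF comp(1) fin, of "\<lambda>t j. g j (x(i := t))" "\<lambda>j. partial_deriv i (g j) x" "x i"]
              smooth_fun_has_derivative[OF comp(2) i, of _ x "x i"] by simp
        next
          show "(\<lambda>x. \<Sum>j\<in>J. partial_deriv j F (\<lambda>j. g j x) * partial_deriv i (g j) x) \<in> smooth_closure I J"
          proof (rule smooth_closure_sum[OF fin])
            fix j assume j: "j \<in> J"
            have "(\<lambda>x. partial_deriv j F (\<lambda>j. g j x)) \<in> smooth_closure I J"
              by (rule smooth_closure.comp[OF smooth_fun_partial_deriv[OF comp(1) j] comp(2)])
            moreover have "partial_deriv i (g j) \<in> smooth_closure I J"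
              by (rule smooth_closure.base[OF smooth_fun_partial_deriv[OF comp(2)[OF j] i]])
            ultimately show "(\<lambda>x. partial_deriv j F (\<lambda>j. g j x) * partial_deriv i (g j) x) \<in> smooth_closure I J"
              by (rule smooth_closure.mult)
          qed
        qed
      next
        case (add F G)
        then obtain F' G' where "F' \<in> smooth_closure I J" "G' \<in> smooth_closure I J"
          "\<And>x. ((\<lambda>t. F (x(i := t))) has_real_derivative F' x) (at (x i))"
          "\<And>x. ((\<lambda>t. G (x(i := t))) has_real_derivative G' x) (at (x i))" by blast
        then show ?case
          by (intro bexI[of _ "\<lambda>x. F' x + G' x"] allI DERIV_add smooth_closure.add)
      next
        case (mult F G)
        then obtain F' G' where "F' \<in> smooth_closure I J" "G' \<in> smooth_closure I J"
          "\<And>x. ((\<lambda>t. F (x(i := t))) has_real_derivative F' x) (at (x i))"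
          "\<And>x. ((\<lambda>t. G (x(i := t))) has_real_derivative G' x) (at (x i))" by blast
        note FG = this
        have "((\<lambda>t. F (x(i := t)) * G (x(i := t))) has_real_derivative F' x * G x + G' x * F x) (at (x i))" for x
          using DERIV_mult[OF FG(3,4)[of x]] by simp
        then show ?case
          by (intro bexI[of _ "\<lambda>x. F' x * G x + G' x * F x"] allI smooth_closure.add
              smooth_closure.mult FG mult.hyps)
      next
        case (inverse F)
        show ?case
        proof (intro bexI allI)
          fix x
          have "((\<lambda>t. F (x(i := t))) has_real_derivative partial_deriv i F x) (at (x i))"
            using smooth_fun_has_derivative[OF inverse(1) i, of x "x i"] by simp
          from DERIV_inverse'[OF this]
          show "((\<lambda>t. inverse (F (x(i := t)))) has_real_derivative
             (-1) * ((inverse (F x) * partial_deriv i F x) * inverse (F x))) (at (x i))"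
            using inverse(2) by simp
        next
          show "(\<lambda>x. (-1) * ((inverse (F x) * partial_deriv i F x) * inverse (F x))) \<in> smooth_closure I J"
            by (intro smooth_closure.mult smooth_closure.inverse[OF inverse]
                smooth_closure.base[OF smooth_fun_const]
                smooth_closure.base[OF smooth_fun_partial_deriv[OF inverse(1) i]])
        qed
      qed
    qed
  qed
qed

lemma smooth_fun_compose:
  assumes "finite J" "F \<in> smooth_fun J" "\<And>j. j \<in> J \<Longrightarrow> g j \<in> smooth_fun I"
  shows "(\<lambda>x. F (\<lambda>j. g j x)) \<in> smooth_fun I"
  using smooth_closure.comp[of F J g I] assms by (simp add: smooth_closure_eq)

lemma smooth_fun_add:
  assumes "F \<in> smooth_fun I" "G \<in> smooth_fun I"
  shows "(\<lambda>x. F x + G x) \<in> smooth_fun I"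
  using smooth_closure.add[of F I "{}" G] assms by (simp add: smooth_closure_eq)

lemma smooth_fun_mult:
  assumes "F \<in> smooth_fun I" "G \<in> smooth_fun I"
  shows "(\<lambda>x. F x * G x) \<in> smooth_fun I"
  using smooth_closure.mult[of F I "{}" G] assms by (simp add: smooth_closure_eq)

lemma smooth_fun_inverse:
  assumes "F \<in> smooth_fun I" "\<And>x. F x \<noteq> 0"
  shows "(\<lambda>x. inverse (F x)) \<in> smooth_fun I"
  using smooth_closure.inverse[OF assms, of "{}"] by (simp add: smooth_closure_eq)


section \<open>Smooth functions on Euclidean spaces\<close>

text \<open>
  In the coordinates of a Euclidean space, changing one coordinate is translation along a basis
  vector. This turns partial derivatives into directional ones.
\<close>

lemma sum_fun_upd_Basis:
  fixes x :: "'a::euclidean_space \<Rightarrow> real"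
  assumes "b \<in> Basis"
  shows "(\<Sum>c\<in>Basis. (x(b := t)) c *\<^sub>R c) = (\<Sum>c\<in>Basis. x c *\<^sub>R c) + (t - x b) *\<^sub>R b"
proof -
  have "(\<Sum>c\<in>Basis. (x(b := t)) c *\<^sub>R c) - (\<Sum>c\<in>Basis. x c *\<^sub>R c)
      = (\<Sum>c\<in>Basis. if c = b then (t - x b) *\<^sub>R b else 0)"
    by (subst sum_subtractf[symmetric], rule sum.cong) (auto simp: scaleR_diff_left)
  also have "\<dots> = (t - x b) *\<^sub>R b" using assms by simp
  finally show ?thesis by (simp add: algebra_simps)
qed

lemma has_derivative_shift:
  "((\<lambda>t. f (z + (t - s) *\<^sub>R b)) has_real_derivative D) (at s) \<longleftrightarrow>
   ((\<lambda>t. f (z + t *\<^sub>R b)) has_real_derivative D) (at 0)"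
  using DERIV_shift[of "\<lambda>t. f (z + (t - s) *\<^sub>R b)" D 0 s] by simp

lemma smooth_coinduct:
  fixes f :: "'a::euclidean_space \<Rightarrow> real"
  assumes "f \<in> C"
    and cont: "\<And>f. f \<in> C \<Longrightarrow> continuous_on UNIV f"
    and deriv: "\<And>f b. f \<in> C \<Longrightarrow> b \<in> Basis \<Longrightarrow>
      \<exists>f'\<in>C. \<forall>z. ((\<lambda>t. f (z + t *\<^sub>R b)) has_real_derivative f' z) (at 0)"
  shows "smooth f"
  unfolding smooth_def
proof (rule smooth_fun_coinduct)
  let ?E = "\<lambda>x. \<Sum>b\<in>Basis. x b *\<^sub>R (b::'a)"
  let ?C = "(\<lambda>f x. f (?E x)) ` C"
  show "(\<lambda>x. f (?E x)) \<in> ?C" using assms(1) by simp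
  show "F x = F y" if "F \<in> ?C" "\<And>i. i \<in> Basis \<Longrightarrow> x i = y i" for F x y
  proof -
    have "?E x = ?E y" using that(2) by simp
    with that(1) show ?thesis by auto
  qed
  have contE: "continuous_on UNIV ?E"
    by (intro continuous_on_sum continuous_on_scaleR continuous_on_const
        continuous_on_product_then_coordinatewise[OF continuous_on_id])
  show "continuous_on UNIV F" if "F \<in> ?C" for F
  proof -
    from that obtain f where f: "f \<in> C" "F = (\<lambda>x. f (?E x))" by blast
    show ?thesis unfolding f(2) by (rule continuous_on_compose2[OF cont[OF f(1)] contE]) simp
  qed
  show "\<exists>F'\<in>?C. \<forall>x. ((\<lambda>t. F (x(i := t))) has_real_derivative F' x) (at (x i))"
    if F: "F \<in> ?C" and i: "i \<in> Basis" for F i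
  proof -
    from F obtain f where f: "f \<in> C" "F = (\<lambda>x. f (?E x))" by blast
    with deriv i obtain f' where f': "f' \<in> C"
      "\<And>z. ((\<lambda>t. f (z + t *\<^sub>R i)) has_real_derivative f' z) (at 0)" by blast
    show ?thesis
      by (rule bexI[of _ "\<lambda>x. f' (?E x)"])
         (use f f' i in \<open>auto simp: sum_fun_upd_Basis has_derivative_shift simp del: fun_upd_apply\<close>)
  qed
qed

lemma smooth_continuous:
  fixes f :: "'a::euclidean_space \<Rightarrow> real"
  assumes "smooth f"
  shows "continuous_on UNIV f"
proof -
  have "continuous_on UNIV (\<lambda>z. (\<lambda>x. f (\<Sum>b\<in>Basis. x b *\<^sub>R b)) (\<lambda>b. z \<bullet> b))"
    by (rule continuous_on_compose2[OF smooth_fun_continuous[OF assms[unfolded smooth_def]]])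
       (auto intro!: continuous_on_coordinatewise_then_product continuous_intros)
  then show ?thesis by (simp add: euclidean_representation)
qed

lemma partial_deriv_dir_deriv:
  fixes f :: "'a::euclidean_space \<Rightarrow> real"
  assumes "b \<in> Basis"
  shows "partial_deriv b (\<lambda>x. f (\<Sum>b\<in>Basis. x b *\<^sub>R b)) x = dir_deriv b f (\<Sum>b\<in>Basis. x b *\<^sub>R b)"
  unfolding partial_deriv_def dir_deriv_def deriv_def
  using assms by (simp add: sum_fun_upd_Basis has_derivative_shift del: fun_upd_apply)

lemma smooth_dir_deriv:
  fixes f :: "'a::euclidean_space \<Rightarrow> real"
  assumes "smooth f" "b \<in> Basis"
  shows "smooth (dir_deriv b f)"
proof -
  have "partial_deriv b (\<lambda>x. f (\<Sum>b\<in>Basis. x b *\<^sub>R b)) \<in> smooth_fun Basis"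
    using assms unfolding smooth_def by (rule smooth_fun_partial_deriv)
  moreover have "partial_deriv b (\<lambda>x. f (\<Sum>b\<in>Basis. x b *\<^sub>R b)) =
      (\<lambda>x. dir_deriv b f (\<Sum>b\<in>Basis. x b *\<^sub>R b))"
    using partial_deriv_dir_deriv[OF assms(2)] by blast
  ultimately show ?thesis unfolding smooth_def by simp
qed

text \<open>
  The velocity may be any vector, whereas \<open>smooth\<close> speaks of derivatives along basis vectors only.
\<close>

lemma smooth_chain:
  fixes f :: "'a::euclidean_space \<Rightarrow> real"
  assumes f: "smooth f" and c: "(c has_vector_derivative v) (at t0)"
  shows "((\<lambda>t. f (c t)) has_real_derivative (\<Sum>b\<in>Basis. dir_deriv b f (c t0) * (v \<bullet> b))) (at t0)"
proof -
  let ?F = "\<lambda>x. f (\<Sum>b\<in>Basis. x b *\<^sub>R b)"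
  have "((\<lambda>t. c t \<bullet> b) has_real_derivative v \<bullet> b) (at t0)" for b
    using c unfolding has_vector_derivative_def has_field_derivative_def
    by (auto intro!: derivative_eq_intros simp: inner_commute mult.commute)
  from smooth_fun_chain[of ?F Basis "\<lambda>t b. c t \<bullet> b", OF f[unfolded smooth_def] _ this]
  have "((\<lambda>t. ?F (\<lambda>b. c t \<bullet> b)) has_real_derivative
     (\<Sum>b\<in>Basis. partial_deriv b ?F (\<lambda>b. c t0 \<bullet> b) * (v \<bullet> b))) (at t0)" by simp
  then show ?thesis by (simp add: partial_deriv_dir_deriv euclidean_representation)
qed

lemma smooth_dir_deriv_eq:
  fixes f :: "'a::euclidean_space \<Rightarrow> real"
  assumes "smooth f"
  shows "dir_deriv v f z = (\<Sum>b\<in>Basis. dir_deriv b f z * (v \<bullet> b))"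
    and "((\<lambda>t. f (z + t *\<^sub>R v)) has_real_derivative dir_deriv v f (z + s *\<^sub>R v)) (at s)"
proof -
  have "((\<lambda>t. z + t *\<^sub>R v) has_vector_derivative v) (at s)" for s z
    by (auto intro!: derivative_eq_intros)
  from smooth_chain[OF assms this]
  have *: "((\<lambda>t. f (z + t *\<^sub>R v)) has_real_derivative (\<Sum>b\<in>Basis. dir_deriv b f (z + s *\<^sub>R v) * (v \<bullet> b))) (at s)"
    for s z by simp
  show 1: "dir_deriv v f z = (\<Sum>b\<in>Basis. dir_deriv b f z * (v \<bullet> b))" for z
    unfolding dir_deriv_def[of v] using *[of z 0] by (intro DERIV_imp_deriv) simp
  show "((\<lambda>t. f (z + t *\<^sub>R v)) has_real_derivative dir_deriv v f (z + s *\<^sub>R v)) (at s)"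
    using *[of z s] by (simp add: 1)
qed

lemma dir_deriv_unique:
  assumes "((\<lambda>t. f (z + t *\<^sub>R v)) has_real_derivative D) (at 0)"
  shows "dir_deriv v f z = D"
  unfolding dir_deriv_def using assms by (rule DERIV_imp_deriv)

lemma smooth_has_dir_deriv:
  fixes f :: "'a::euclidean_space \<Rightarrow> real"
  assumes "smooth f"
  shows "((\<lambda>t. f (z + t *\<^sub>R v)) has_real_derivative dir_deriv v f z) (at 0)"
  using smooth_dir_deriv_eq(2)[OF assms, of z v 0] by simp

lemma smooth_chain_dir:
  fixes f :: "'a::euclidean_space \<Rightarrow> real"
  assumes f: "smooth f" and c: "(c has_vector_derivative v) (at t0)"
  shows "((\<lambda>t. f (c t)) has_real_derivative dir_deriv v f (c t0)) (at t0)"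
  using smooth_chain[OF assms] by (simp add: smooth_dir_deriv_eq(1)[OF f, of v])

subsection \<open>Closure properties\<close>

lemma smooth_const [simp]: "smooth (\<lambda>z. c)"
  unfolding smooth_def by simp

lemma smooth_add: "smooth f \<Longrightarrow> smooth g \<Longrightarrow> smooth (\<lambda>z. f z + g z)"
  unfolding smooth_def by (rule smooth_fun_add)

lemma smooth_mult: "smooth f \<Longrightarrow> smooth g \<Longrightarrow> smooth (\<lambda>z. f z * g z)"
  unfolding smooth_def by (rule smooth_fun_mult)

lemma smooth_inverse: "smooth f \<Longrightarrow> (\<And>z. f z \<noteq> 0) \<Longrightarrow> smooth (\<lambda>z. inverse (f z))"
  unfolding smooth_def by (rule smooth_fun_inverse)

lemma smooth_diff: "smooth f \<Longrightarrow> smooth g \<Longrightarrow> smooth (\<lambda>z. f z - g z)"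
  using smooth_add[of f "\<lambda>z. (-1) * g z"] smooth_mult[of "\<lambda>z. -1" g] by simp

lemma smooth_sum:
  "(\<And>i. i \<in> S \<Longrightarrow> smooth (f i)) \<Longrightarrow> smooth (\<lambda>z. \<Sum>i\<in>S. f i z)"
  by (induction S rule: infinite_finite_induct) (auto intro: smooth_add)

lemma smooth_power: "smooth f \<Longrightarrow> smooth (\<lambda>z. f z ^ k)"
  by (induction k) (auto intro: smooth_mult)

lemma smooth_fun_sum:
  assumes "\<And>j. j \<in> S \<Longrightarrow> F j \<in> smooth_fun I"
  shows "(\<lambda>x. \<Sum>j\<in>S. F j x) \<in> smooth_fun I"
  using assms by (induction S rule: infinite_finite_induct) (simp_all add: smooth_fun_add)

lemma smooth_inner: "smooth (\<lambda>z::'a::euclidean_space. z \<bullet> v)"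
proof -
  have "(\<lambda>x. \<Sum>b\<in>Basis. x b * (b \<bullet> v)) \<in> smooth_fun (Basis :: 'a set)"
    by (intro smooth_fun_sum smooth_fun_mult smooth_fun_coord smooth_fun_const)
  moreover have "(\<lambda>x. (\<Sum>b\<in>Basis. x b *\<^sub>R b) \<bullet> v) = (\<lambda>x. \<Sum>b\<in>Basis. x b * (b \<bullet> v))"
    by (simp only: inner_sum_left inner_scaleR_left)
  ultimately show ?thesis unfolding smooth_def by simp
qed

lemma smooth_compose_fun:
  assumes "finite J" "F \<in> smooth_fun J" "\<And>j. j \<in> J \<Longrightarrow> smooth (g j)"
  shows "smooth (\<lambda>z. F (\<lambda>j. g j z))"
  unfolding smooth_def
proof (rule smooth_fun_compose[where g = "\<lambda>j x. g j (\<Sum>b\<in>Basis. x b *\<^sub>R b)", OF assms(1,2)])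
  show "(\<lambda>x. g j (\<Sum>b\<in>Basis. x b *\<^sub>R b)) \<in> smooth_fun Basis" if "j \<in> J" for j
    using assms(3)[OF that] unfolding smooth_def .
qed

lemma smooth_compose:
  fixes f :: "'b::euclidean_space \<Rightarrow> real" and g :: "'a::euclidean_space \<Rightarrow> 'b"
  assumes "smooth f" "\<And>b. b \<in> Basis \<Longrightarrow> smooth (\<lambda>z. g z \<bullet> b)"
  shows "smooth (\<lambda>z. f (g z))"
proof -
  have "smooth (\<lambda>z. (\<lambda>x. f (\<Sum>b\<in>Basis. x b *\<^sub>R b)) (\<lambda>b. g z \<bullet> b))"
    by (rule smooth_compose_fun[OF finite_Basis assms(1)[unfolded smooth_def] assms(2)])
  then show ?thesis by (simp add: euclidean_representation)
qed

lemma smooth_imp_smooth_fun: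
  fixes f :: "'b::euclidean_space \<Rightarrow> real"
  assumes "smooth f" "\<And>b. b \<in> Basis \<Longrightarrow> (\<lambda>x. g x \<bullet> b) \<in> smooth_fun I"
  shows "(\<lambda>x. f (g x)) \<in> smooth_fun I"
proof -
  have "(\<lambda>x. (\<lambda>x. f (\<Sum>b\<in>Basis. x b *\<^sub>R b)) (\<lambda>b. g x \<bullet> b)) \<in> smooth_fun I"
    by (rule smooth_fun_compose[OF finite_Basis assms(1)[unfolded smooth_def] assms(2)])
  then show ?thesis by (simp add: euclidean_representation)
qed

lemma smooth_linear:
  fixes f :: "'b::euclidean_space \<Rightarrow> real" and g :: "'a::euclidean_space \<Rightarrow> 'b"
  assumes f: "smooth f" and g: "linear g"
  shows "smooth (\<lambda>z. f (g z))"
proof (rule smooth_compose[OF f])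
  fix b :: 'b
  have "g z \<bullet> b = z \<bullet> adjoint g b" for z using adjoint_works[OF g, of z b] by simp
  then show "smooth (\<lambda>z. g z \<bullet> b)" by (simp add: smooth_inner)
qed

lemma smooth_local:
  fixes f :: "'a::euclidean_space \<Rightarrow> real"
  assumes "\<And>z. \<exists>U g. open U \<and> z \<in> U \<and> smooth g \<and> (\<forall>w\<in>U. f w = g w)"
  shows "smooth f"
proof (rule smooth_coinduct)
  define C :: "('a \<Rightarrow> real) set"
    where "C = {f. \<forall>z. \<exists>U g. open U \<and> z \<in> U \<and> smooth g \<and> (\<forall>w\<in>U. f w = g w)}"
  show "f \<in> C" using assms by (simp add: C_def)
  show "continuous_on UNIV f" if "f \<in> C" for f
  proof -
    have "isCont f z" for z
    proof -
      obtain U g where U: "open U" "z \<in> U" "smooth g" "\<forall>w\<in>U. f w = g w"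
        using \<open>f \<in> C\<close> unfolding C_def by blast
      then have "continuous_on U f"
        by (metis continuous_on_cong continuous_on_subset smooth_continuous subset_UNIV)
      then show ?thesis using U(1,2) continuous_on_eq_continuous_at[OF U(1)] by blast
    qed
    then show ?thesis by (simp add: continuous_at_imp_continuous_on)
  qed
  show "\<exists>f'\<in>C. \<forall>z. ((\<lambda>t. f (z + t *\<^sub>R b)) has_real_derivative f' z) (at 0)"
    if "f \<in> C" and b: "b \<in> Basis" for f b
  proof -
    have *: "((\<lambda>t. f (w + t *\<^sub>R b)) has_real_derivative dir_deriv b g w) (at 0)"
      if "open U" "w \<in> U" "smooth g" "\<forall>w\<in>U. f w = g w" for U w g
    proof -
      have "((\<lambda>t. w + t *\<^sub>R b) \<longlongrightarrow> w + 0 *\<^sub>R b) (nhds 0)"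
        by (intro tendsto_intros filterlim_ident)
      then have "\<forall>\<^sub>F t in nhds 0. w + t *\<^sub>R b \<in> U"
        using that by (auto dest: topological_tendstoD)
      then have "\<forall>\<^sub>F t in nhds 0. f (w + t *\<^sub>R b) = g (w + t *\<^sub>R b)"
        by eventually_elim (use that in auto)
      from DERIV_cong_ev[OF refl this refl] show ?thesis
        using smooth_has_dir_deriv[OF that(3)] by simp
    qed
    have "dir_deriv b f \<in> C"
      unfolding C_def
    proof (safe)
      fix z
      obtain U g where U: "open U" "z \<in> U" "smooth g" "\<forall>w\<in>U. f w = g w"
        using \<open>f \<in> C\<close> unfolding C_def by blast
      have "dir_deriv b f w = dir_deriv b g w" if "w \<in> U" for w
        using *[OF U(1) that U(3,4)] by (rule dir_deriv_unique)
      with U b smooth_dir_deriv show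
        "\<exists>U g. open U \<and> z \<in> U \<and> smooth g \<and> (\<forall>w\<in>U. dir_deriv b f w = g w)" by blast
    qed
    moreover have "((\<lambda>t. f (z + t *\<^sub>R b)) has_real_derivative dir_deriv b f z) (at 0)" for z
    proof -
      obtain U g where U: "open U" "z \<in> U" "smooth g" "\<forall>w\<in>U. f w = g w"
        using \<open>f \<in> C\<close> unfolding C_def by blast
      show ?thesis using *[OF U] dir_deriv_unique[OF *[OF U]] by simp
    qed
    ultimately show ?thesis by blast
  qed
qed

section \<open>Bump functions\<close>

text \<open>
  Extended by zero, the functions \<open>p (1 / t) * exp (- 1 / t)\<close> for polynomials \<open>p\<close> form a class
  closed under derivatives, which contains the standard smooth function that vanishes exactly for
  \<open>t \<le> 0\<close>.
\<close>

definition exp_recip :: "real poly \<Rightarrow> real \<Rightarrow> real" where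
  "exp_recip p t = (if t > 0 then poly p (1 / t) * exp (- (1 / t)) else 0)"

lemma poly_times_exp_neg_tendsto_0:
  "((\<lambda>x::real. poly p x * exp (- x)) \<longlongrightarrow> 0) at_top"
proof -
  have "((\<lambda>x. \<Sum>i\<le>degree p. coeff p i * (x ^ i / exp x)) \<longlongrightarrow> (\<Sum>i\<le>degree p. coeff p i * 0)) at_top"
    by (intro tendsto_sum tendsto_mult tendsto_const tendsto_power_div_exp_0)
  then show ?thesis
    by (simp add: poly_altdef exp_minus field_simps sum_divide_distrib)
qed

lemma exp_recip_has_derivative:
  "(exp_recip p has_real_derivative exp_recip (monom 1 2 * (p - pderiv p)) t) (at t)"
proof -
  consider "t > 0" | "t < 0" | "t = 0" by linarith
  then show ?thesis
  proof cases
    case 1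
    have "((\<lambda>t. poly p (1 / t) * exp (- (1 / t))) has_real_derivative
        exp_recip (monom 1 2 * (p - pderiv p)) t) (at t)"
      using 1 by (auto intro!: derivative_eq_intros poly_DERIV[THEN DERIV_chain2]
          simp: exp_recip_def poly_monom field_simps power2_eq_square)
    moreover have "\<forall>\<^sub>F s in nhds t. exp_recip p s = poly p (1 / s) * exp (- (1 / s))"
      using eventually_nhds_in_open[of "{0<..}" t] 1
      by (auto elim!: eventually_mono simp: exp_recip_def)
    ultimately show ?thesis by (subst DERIV_cong_ev[OF refl _ refl]) auto
  next
    case 2
    have "\<forall>\<^sub>F s in nhds t. exp_recip p s = 0"
      using eventually_nhds_in_open[of "{..<0}" t] 2
      by (auto elim!: eventually_mono simp: exp_recip_def)
    moreover have "exp_recip q t = 0" for q using 2 by (simp add: exp_recip_def)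
    ultimately show ?thesis by (subst DERIV_cong_ev[OF refl _ refl]) auto
  next
    case 3
    \<comment> \<open>The difference quotient at \<open>0\<close> is of the same form with the polynomial multiplied by its
      variable.\<close>
    have "((\<lambda>y. poly (pCons 0 p) (inverse y) * exp (- inverse y)) \<longlongrightarrow> 0) (at_right (0::real))"
      by (rule filterlim_compose[OF poly_times_exp_neg_tendsto_0 filterlim_inverse_at_top_right])
    moreover have "\<forall>\<^sub>F y in at_right 0. exp_recip p y / y = poly (pCons 0 p) (inverse y) * exp (- inverse y)"
      using eventually_at_right_less[of 0]
      by eventually_elim (auto simp: exp_recip_def field_simps)
    ultimately have "((\<lambda>y. exp_recip p y / y) \<longlongrightarrow> 0) (at_right 0)"
      by (simp add: filterlim_cong)
    moreover have "((\<lambda>y. exp_recip p y / y) \<longlongrightarrow> 0) (at_left 0)"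
    proof -
      have "\<forall>\<^sub>F y in at_left (0::real). y < 0" by (simp add: eventually_at_filter)
      then have "\<forall>\<^sub>F y in at_left 0. exp_recip p y / y = 0"
        by eventually_elim (auto simp: exp_recip_def)
      then show ?thesis by (simp add: tendsto_eventually)
    qed
    ultimately have "((\<lambda>y. exp_recip p y / y) \<longlongrightarrow> 0) (at 0)"
      by (simp add: filterlim_split_at)
    then show ?thesis using 3 by (simp add: has_field_derivative_iff exp_recip_def)
  qed
qed

lemma smooth_exp_recip: "smooth (exp_recip p)"
proof (rule smooth_coinduct[where C = "range exp_recip"])
  show "continuous_on UNIV f" if "f \<in> range exp_recip" for f
    using that exp_recip_has_derivative
    by (auto intro!: continuous_at_imp_continuous_on DERIV_isCont)
  show "\<exists>f'\<in>range exp_recip. \<forall>z. ((\<lambda>t. f (z + t *\<^sub>R b)) has_real_derivative f' z) (at 0)"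
    if "f \<in> range exp_recip" "b \<in> Basis" for f and b :: real
  proof -
    from that obtain p where "f = exp_recip p" "b = 1" by auto
    moreover have "((\<lambda>t. exp_recip p (z + t)) has_real_derivative
        exp_recip (monom 1 2 * (p - pderiv p)) z) (at 0)" for z
      using DERIV_shift[of "exp_recip p" _ 0 z] exp_recip_has_derivative[of p z]
      by (simp add: add.commute)
    ultimately show ?thesis by auto
  qed
qed auto

lemma smooth_real_compose:
  assumes "smooth (f :: real \<Rightarrow> real)" "smooth g"
  shows "smooth (\<lambda>z. f (g z))"
  by (rule smooth_compose[OF assms(1)]) (use assms(2) in auto)

lemma smooth_norm_square: "smooth (\<lambda>z::'a::euclidean_space. (norm z)\<^sup>2)"
proof -
  have "smooth (\<lambda>z::'a. \<Sum>b\<in>Basis. (z \<bullet> b) * (z \<bullet> b))"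
    by (intro smooth_sum smooth_mult smooth_inner)
  then show ?thesis by (simp add: euclidean_inner[symmetric] power2_norm_eq_inner)
qed

lemma smooth_bump_exists:
  obtains \<beta> :: "'a::euclidean_space \<Rightarrow> real"
  where "smooth \<beta>" "\<And>x. norm x \<le> 1 \<Longrightarrow> \<beta> x = 1" "\<And>x. norm x \<ge> 2 \<Longrightarrow> \<beta> x = 0"
proof
  let ?e = "exp_recip [:1:]"
  \<comment> \<open>Normalise \<open>?u\<close>, positive for \<open>norm x < 2\<close>, by the nowhere vanishing sum with \<open>?v\<close>, positive
    for \<open>norm x > 1\<close>.\<close>
  let ?u = "\<lambda>x::'a. ?e (4 - (norm x)\<^sup>2)" and ?v = "\<lambda>x::'a. ?e ((norm x)\<^sup>2 - 1)"
  have nonneg: "?e t \<ge> 0" for t by (simp add: exp_recip_def)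
  have pos: "?e t > 0" if "t > 0" for t using that by (simp add: exp_recip_def)
  have "?u x + ?v x > 0" for x
    using nonneg[of "4 - (norm x)\<^sup>2"] nonneg[of "(norm x)\<^sup>2 - 1"] pos[of "4 - (norm x)\<^sup>2"] pos[of "(norm x)\<^sup>2 - 1"]
    by (cases "(norm x)\<^sup>2 < 4") linarith+
  then have nz: "?u x + ?v x \<noteq> 0" for x by (metis less_irrefl)
  show "smooth (\<lambda>x. ?u x * inverse (?u x + ?v x))"
    by (intro smooth_mult smooth_inverse smooth_add smooth_real_compose[OF smooth_exp_recip]
        smooth_diff smooth_norm_square smooth_const nz)
  show "?u x * inverse (?u x + ?v x) = 1" if "norm x \<le> 1" for x
  proof -
    have "?v x = 0" using power_le_one[OF norm_ge_zero that, of 2] by (simp add: exp_recip_def)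
    with nz[of x] show ?thesis by simp
  qed
  show "?u x * inverse (?u x + ?v x) = 0" if "norm x \<ge> 2" for x
  proof -
    have "4 \<le> (norm x)\<^sup>2" using power_mono[OF that, of 2] by simp
    then show ?thesis by (simp add: exp_recip_def)
  qed
qed

section \<open>Iterated derivatives and series of smooth functions\<close>

abbreviation iter_deriv :: "'a::euclidean_space list \<Rightarrow> ('a \<Rightarrow> real) \<Rightarrow> 'a \<Rightarrow> real" where
  "iter_deriv js f \<equiv> foldr dir_deriv js f"

lemma smooth_iter_deriv: "smooth f \<Longrightarrow> js \<in> lists Basis \<Longrightarrow> smooth (iter_deriv js f)"
  by (induction js) (auto intro: smooth_dir_deriv)

lemma dir_deriv_add:
  fixes f g :: "'a::euclidean_space \<Rightarrow> real"
  assumes "smooth f" "smooth g"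
  shows "dir_deriv v (\<lambda>z. f z + g z) = (\<lambda>z. dir_deriv v f z + dir_deriv v g z)"
  by (intro ext dir_deriv_unique DERIV_add smooth_has_dir_deriv assms)

lemma dir_deriv_mult:
  fixes f g :: "'a::euclidean_space \<Rightarrow> real"
  assumes "smooth f" "smooth g"
  shows "dir_deriv v (\<lambda>z. f z * g z) = (\<lambda>z. dir_deriv v f z * g z + dir_deriv v g z * f z)"
proof
  fix z
  show "dir_deriv v (\<lambda>z. f z * g z) z = dir_deriv v f z * g z + dir_deriv v g z * f z"
    using DERIV_mult[OF smooth_has_dir_deriv[OF assms(1)] smooth_has_dir_deriv[OF assms(2)], of z v z v]
    by (intro dir_deriv_unique) simp
qed

lemma dir_deriv_rescale:
  fixes f :: "'a::euclidean_space \<Rightarrow> real"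
  assumes "smooth f"
  shows "dir_deriv v (\<lambda>x. c * f (r *\<^sub>R x)) = (\<lambda>x. c * r * dir_deriv v f (r *\<^sub>R x))"
proof
  fix x
  have "((\<lambda>t. f (r *\<^sub>R x + t *\<^sub>R v)) has_real_derivative dir_deriv v f (r *\<^sub>R x)) (at (r * 0))"
    using smooth_has_dir_deriv[OF assms] by simp
  from DERIV_chain2[where f = "\<lambda>s. f (r *\<^sub>R x + s *\<^sub>R v)" and g = "\<lambda>t. r * t" and x = 0 and s = UNIV
      and Db = r, OF this]
  have "((\<lambda>t. f (r *\<^sub>R (x + t *\<^sub>R v))) has_real_derivative dir_deriv v f (r *\<^sub>R x) * r) (at 0)"
    by (auto simp: scaleR_add_right intro!: derivative_eq_intros)
  from DERIV_cmult[OF this, of c]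
  show "dir_deriv v (\<lambda>x. c * f (r *\<^sub>R x)) x = c * r * dir_deriv v f (r *\<^sub>R x)"
    by (intro dir_deriv_unique) (simp add: mult_ac)
qed

lemma iter_deriv_add:
  assumes "smooth f" "smooth g" "js \<in> lists Basis"
  shows "iter_deriv js (\<lambda>z. f z + g z) = (\<lambda>z. iter_deriv js f z + iter_deriv js g z)"
  using assms(3) by (induction js) (simp_all add: dir_deriv_add smooth_iter_deriv assms)

text \<open>
  Each derivative of a rescaled function costs a factor \<open>r\<close>. With \<open>r = 1 / \<epsilon>\<close> this is what the
  powers of \<open>\<epsilon>\<close> in Borel's construction have to outweigh.
\<close>

lemma iter_deriv_rescale:
  assumes "smooth f" "js \<in> lists Basis"
  shows "iter_deriv js (\<lambda>x. c * f (r *\<^sub>R x)) = (\<lambda>x. c * r ^ length js * iter_deriv js f (r *\<^sub>R x))"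
  using assms(2)
proof (induction js)
  case (Cons b js)
  then have "iter_deriv (b # js) (\<lambda>x. c * f (r *\<^sub>R x))
      = dir_deriv b (\<lambda>x. (c * r ^ length js) * iter_deriv js f (r *\<^sub>R x))"
    by simp
  also have "\<dots> = (\<lambda>x. (c * r ^ length js) * r * dir_deriv b (iter_deriv js f) (r *\<^sub>R x))"
    by (rule dir_deriv_rescale) (use Cons assms in \<open>auto intro: smooth_iter_deriv\<close>)
  finally show ?case by (simp add: mult_ac)
qed simp

lemma iter_deriv_bounded:
  fixes f :: "'a::euclidean_space \<Rightarrow> real"
  assumes "smooth f" and supp: "\<And>x. norm x > r \<Longrightarrow> f x = 0" and js: "js \<in> lists Basis"
  shows "\<exists>C. \<forall>x. \<bar>iter_deriv js f x\<bar> \<le> C"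
proof -
  have zero: "iter_deriv js f x = 0" if "norm x > r" for x
    using js that
  proof (induction js arbitrary: x)
    case (Cons b js)
    have "((\<lambda>t. norm (x + t *\<^sub>R b)) \<longlongrightarrow> norm (x + 0 *\<^sub>R b)) (nhds 0)"
      by (intro tendsto_intros filterlim_ident)
    then have "\<forall>\<^sub>F t in nhds 0. norm (x + t *\<^sub>R b) > r"
      using Cons.prems order_tendstoD(1) by fastforce
    then have "\<forall>\<^sub>F t in nhds 0. iter_deriv js f (x + t *\<^sub>R b) = 0"
      by eventually_elim (use Cons in auto)
    then have "((\<lambda>t. iter_deriv js f (x + t *\<^sub>R b)) has_real_derivative 0) (at 0)"
      by (subst DERIV_cong_ev[OF refl _ refl]) auto
    then show ?case by (simp add: dir_deriv_unique)
  qed (use supp in auto)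
  have "compact ((\<lambda>x. iter_deriv js f x) ` cball 0 r)"
    by (intro compact_continuous_image continuous_on_subset[OF smooth_continuous[OF smooth_iter_deriv]])
       (use assms in auto)
  then obtain C where "\<forall>x\<in>cball 0 r. \<bar>iter_deriv js f x\<bar> \<le> C"
    by (auto dest!: compact_imp_bounded simp: bounded_iff)
  then have C: "\<bar>iter_deriv js f x\<bar> \<le> C" if "norm x \<le> r" for x using that by simp
  have "\<bar>iter_deriv js f x\<bar> \<le> \<bar>C\<bar>" for x
  proof (cases "norm x \<le> r")
    case True
    then show ?thesis using C[of x] by linarith
  qed (use zero in auto)
  then show ?thesis by blast
qed

text \<open>
  Derivatives may be taken term by term, since the differentiated series converge uniformly. The
  bound has to hold only from an index on that depends on the derivative, as in Borel's
  construction, where the first terms are beyond control.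
\<close>

lemma smooth_suminf:
  fixes F :: "nat \<Rightarrow> 'a::euclidean_space \<Rightarrow> real"
  assumes "\<And>k. smooth (F k)"
    and "\<And>js. js \<in> lists Basis \<Longrightarrow> \<exists>K. \<forall>k\<ge>K. \<forall>z. \<bar>iter_deriv js (F k) z\<bar> \<le> (1/2) ^ k"
  shows "smooth (\<lambda>z. suminf (\<lambda>k. F k z))"
proof (rule smooth_coinduct)
  \<comment> \<open>The property of the sequence of terms, rather than of the sum, is stable under derivatives.\<close>
  define P where "P F \<longleftrightarrow> (\<forall>k. smooth (F k)) \<and>
    (\<forall>js\<in>lists Basis. \<exists>K. \<forall>k\<ge>K. \<forall>z. \<bar>iter_deriv js (F k) z\<bar> \<le> (1/2) ^ k)"
    for F :: "nat \<Rightarrow> 'a \<Rightarrow> real"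
  define C where "C = {(\<lambda>z. suminf (\<lambda>k. F k z)) | F. P F}"
  show "(\<lambda>z. suminf (\<lambda>k. F k z)) \<in> C" unfolding C_def P_def using assms by blast
  have ev: "\<forall>\<^sub>F k in sequentially. \<forall>z. \<bar>F k z\<bar> \<le> (1/2) ^ k" if "P F" for F
  proof -
    have "\<exists>K. \<forall>k\<ge>K. \<forall>z. \<bar>iter_deriv [] (F k) z\<bar> \<le> (1/2) ^ k"
      using that unfolding P_def by blast
    then show ?thesis unfolding eventually_sequentially by simp
  qed
  have summ: "summable (\<lambda>k. (1/2::real) ^ k)" by (simp add: summable_geometric)
  show "continuous_on UNIV f" if "f \<in> C" for f
  proof -
    from that obtain F where F: "P F" "f = (\<lambda>z. suminf (\<lambda>k. F k z))" by (auto simp: C_def)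
    have "uniform_limit UNIV (\<lambda>n z. \<Sum>k<n. F k z) f sequentially"
      unfolding F(2) by (rule Weierstrass_m_test_ev[OF _ summ]) (use ev[OF F(1)] in auto)
    moreover have "continuous_on UNIV (\<lambda>z. \<Sum>k<n. F k z)" for n
      using F(1) by (intro continuous_on_sum smooth_continuous) (auto simp: P_def)
    ultimately show ?thesis by (intro uniform_limit_theorem) auto
  qed
  show "\<exists>f'\<in>C. \<forall>z. ((\<lambda>t. f (z + t *\<^sub>R b)) has_real_derivative f' z) (at 0)"
    if "f \<in> C" and b: "b \<in> Basis" for f b
  proof -
    from that obtain F where F: "P F" "f = (\<lambda>z. suminf (\<lambda>k. F k z))" by (auto simp: C_def)
    have P': "P (\<lambda>k. dir_deriv b (F k))"
      unfolding P_def
    proof (intro conjI allI ballI)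
      show "smooth (dir_deriv b (F k))" for k using F(1) b by (auto simp: P_def smooth_dir_deriv)
      fix js assume "js \<in> lists (Basis :: 'a set)"
      then have "js @ [b] \<in> lists Basis" using b by simp
      then obtain K where "\<forall>k\<ge>K. \<forall>z. \<bar>iter_deriv (js @ [b]) (F k) z\<bar> \<le> (1/2) ^ k"
        using F(1) unfolding P_def by blast
      then show "\<exists>K. \<forall>k\<ge>K. \<forall>z. \<bar>iter_deriv js (dir_deriv b (F k)) z\<bar> \<le> (1/2) ^ k" by auto
    qed
    have "((\<lambda>t. f (z + t *\<^sub>R b)) has_real_derivative (suminf (\<lambda>k. dir_deriv b (F k) z))) (at 0)" for z
    proof -
      have "((\<lambda>t. suminf (\<lambda>k. F k (z + t *\<^sub>R b))) has_real_derivative (suminf (\<lambda>k. dir_deriv b (F k) (z + 0 *\<^sub>R b)))) (at 0)"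
      proof (rule has_field_derivative_series'(2)[of UNIV])
        show "((\<lambda>t. F k (z + t *\<^sub>R b)) has_real_derivative dir_deriv b (F k) (z + s *\<^sub>R b)) (at s within UNIV)"
          for k s using F(1) by (simp add: P_def smooth_dir_deriv_eq(2))
        show "uniformly_convergent_on UNIV (\<lambda>n t. \<Sum>k<n. dir_deriv b (F k) (z + t *\<^sub>R b))"
          by (rule Weierstrass_m_test'_ev[OF _ summ]) (use ev[OF P'] in \<open>auto elim: eventually_mono\<close>)
        show "summable (\<lambda>k. F k (z + 0 *\<^sub>R b))"
          by (rule summable_comparison_test_ev[OF _ summ]) (use ev[OF F(1)] in \<open>auto elim: eventually_mono\<close>)
      qed auto
      then show ?thesis by (simp add: F(2))
    qed
    then show ?thesis using P' by (intro bexI[of _ "\<lambda>z. suminf (\<lambda>k. dir_deriv b (F k) z)"]) (auto simp: C_def)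
  qed
qed

section \<open>Flat functions\<close>

definition flat :: "('a::real_normed_vector \<Rightarrow> real) \<Rightarrow> bool" where
  "flat f \<longleftrightarrow> (\<forall>K. \<exists>C. \<forall>\<^sub>F z in nhds 0. \<bar>f z\<bar> \<le> C * norm z ^ K)"

lemma flat_zero: "flat f \<Longrightarrow> f 0 = 0"
  unfolding flat_def by (auto dest!: spec[of _ 1] eventually_nhds_x_imp_x)

lemma flat_add:
  assumes "flat f" "flat g"
  shows "flat (\<lambda>z. f z + g z)"
  unfolding flat_def
proof
  fix K
  obtain C D where "\<forall>\<^sub>F z in nhds 0. \<bar>f z\<bar> \<le> C * norm z ^ K" "\<forall>\<^sub>F z in nhds 0. \<bar>g z\<bar> \<le> D * norm z ^ K"
    using assms unfolding flat_def by blast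
  then have "\<forall>\<^sub>F z in nhds 0. \<bar>f z + g z\<bar> \<le> (C + D) * norm z ^ K"
    by eventually_elim (simp add: algebra_simps)
  then show "\<exists>C. \<forall>\<^sub>F z in nhds 0. \<bar>f z + g z\<bar> \<le> C * norm z ^ K" by blast
qed

lemma flat_mult:
  assumes f: "flat f" and g: "continuous_on UNIV g"
  shows "flat (\<lambda>z. g z * f z)"
  unfolding flat_def
proof
  fix K
  obtain C where C: "\<forall>\<^sub>F z in nhds 0. \<bar>f z\<bar> \<le> C * norm z ^ K"
    using f unfolding flat_def by blast
  have "isCont (\<lambda>z. \<bar>g z\<bar>) 0"
    using g by (intro continuous_intros) (simp add: continuous_on_eq_continuous_at)
  then have "((\<lambda>z. \<bar>g z\<bar>) \<longlongrightarrow> \<bar>g 0\<bar>) (nhds 0)"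
    using tendsto_at_iff_tendsto_nhds[of "\<lambda>z. \<bar>g z\<bar>" 0] by (simp add: isCont_def)
  then have "\<forall>\<^sub>F z in nhds 0. \<bar>g z\<bar> < \<bar>g 0\<bar> + 1"
    by (rule order_tendstoD(2)) simp
  with C have "\<forall>\<^sub>F z in nhds 0. \<bar>g z * f z\<bar> \<le> ((\<bar>g 0\<bar> + 1) * C) * norm z ^ K"
  proof eventually_elim
    case (elim z)
    then have "\<bar>g z\<bar> * \<bar>f z\<bar> \<le> (\<bar>g 0\<bar> + 1) * (C * norm z ^ K)"
      by (intro mult_mono) auto
    then show ?case by (simp add: abs_mult mult_ac)
  qed
  then show "\<exists>C. \<forall>\<^sub>F z in nhds 0. \<bar>g z * f z\<bar> \<le> C * norm z ^ K" by blast
qed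

lemma flat_isCont:
  assumes "flat f"
  shows "isCont f 0"
proof -
  obtain C where "\<forall>\<^sub>F z in nhds 0. \<bar>f z\<bar> \<le> C * norm z ^ 1"
    using assms unfolding flat_def by blast
  then have "\<forall>\<^sub>F z in at 0. norm (f z) \<le> C * norm z"
    by (auto simp: eventually_at_filter elim: eventually_mono)
  moreover have "((\<lambda>z. C * norm z) \<longlongrightarrow> 0) (at (0::'a))"
    by (auto intro!: tendsto_eq_intros)
  ultimately show ?thesis
    using Lim_null_comparison flat_zero[OF assms] unfolding isCont_def by metis
qed

lemma has_derivative_0_if_quadratic:
  fixes g :: "real \<Rightarrow> real"
  assumes "\<forall>\<^sub>F t in nhds 0. \<bar>g t\<bar> \<le> C * t\<^sup>2"
  shows "(g has_real_derivative 0) (at 0)"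
proof -
  have g0: "g 0 = 0" using eventually_nhds_x_imp_x[OF assms] by simp
  have "\<forall>\<^sub>F t in at 0. norm ((g t - g 0) / (t - 0)) \<le> C * \<bar>t\<bar>"
    using assms unfolding eventually_at_filter
    by eventually_elim (auto simp: g0 field_simps power2_eq_square abs_mult)
  moreover have "((\<lambda>t. C * \<bar>t\<bar>) \<longlongrightarrow> 0) (at (0::real))"
    by (auto intro!: tendsto_eq_intros)
  ultimately show ?thesis unfolding has_field_derivative_iff by (rule Lim_null_comparison)
qed

lemma flat_has_derivative_0:
  fixes f :: "'a::real_normed_vector \<Rightarrow> real"
  assumes "flat f"
  shows "((\<lambda>t. f (t *\<^sub>R v)) has_real_derivative 0) (at 0)"
proof -
  obtain C where C: "\<forall>\<^sub>F z in nhds 0. \<bar>f z\<bar> \<le> C * norm z ^ 2"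
    using assms unfolding flat_def by blast
  have "((\<lambda>t. t *\<^sub>R v) \<longlongrightarrow> 0 *\<^sub>R v) (nhds 0)" by (intro tendsto_intros filterlim_ident)
  then have "filterlim (\<lambda>t. t *\<^sub>R v) (nhds 0) (nhds 0)" by simp
  from filterlim_iff[THEN iffD1, OF this, rule_format, OF C]
  have "\<forall>\<^sub>F t in nhds 0. \<bar>f (t *\<^sub>R v)\<bar> \<le> (C * (norm v)\<^sup>2) * t\<^sup>2"
    by (simp add: power_mult_distrib mult_ac)
  then show ?thesis by (rule has_derivative_0_if_quadratic)
qed

text \<open>
  A Landau type interpolation: the derivative is bounded by the difference quotient for a step
  \<open>t\<close>, up to an error \<open>O(t)\<close> coming from the bounded second derivative. The step \<open>t = |z|^(K + 1)\<close>
  is so large compared with the values of \<open>f\<close>, which are \<open>O(t^2)\<close>, that the quotient is \<open>O(t)\<close> as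
  well.
\<close>

lemma flat_dir_deriv:
  fixes f :: "'a::euclidean_space \<Rightarrow> real"
  assumes f: "smooth f" and flat: "flat f" and b: "b \<in> Basis"
  shows "flat (dir_deriv b f)"
  unfolding flat_def
proof
  fix K
  let ?f' = "dir_deriv b f" and ?f'' = "dir_deriv b (dir_deriv b f)"
  have sm: "smooth ?f'" "smooth ?f''" using f b by (auto intro: smooth_dir_deriv)
  have "compact (?f'' ` cball 0 2)"
    by (intro compact_continuous_image continuous_on_subset[OF smooth_continuous[OF sm(2)]]) auto
  then obtain M where "\<forall>x\<in>cball 0 2. \<bar>?f'' x\<bar> \<le> M"
    by (auto dest!: compact_imp_bounded simp: bounded_iff)
  then have M: "\<bar>?f'' x\<bar> \<le> M" if "norm x \<le> 2" for x using that by simp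
  obtain C0 where "\<forall>\<^sub>F z in nhds 0. \<bar>f z\<bar> \<le> C0 * norm z ^ (2 * (K + 1))"
    using flat unfolding flat_def by blast
  then obtain \<delta> where "\<delta> > 0" and \<delta>': "\<forall>z. dist z 0 < \<delta> \<longrightarrow> \<bar>f z\<bar> \<le> C0 * norm z ^ (2 * (K + 1))"
    unfolding eventually_nhds_metric by blast
  have \<delta>: "\<bar>f z\<bar> \<le> C0 * norm z ^ (2 * (K + 1))" if "norm z < \<delta>" for z
    using \<delta>'[rule_format, of z] that by (simp only: dist_0_norm dist_commute)
  define C where "C = \<bar>C0\<bar>"
  have C: "\<bar>f z\<bar> \<le> C * norm z ^ (2 * (K + 1))" if "norm z < \<delta>" for z
    unfolding C_def by (rule order_trans[OF \<delta>[OF that]]) (intro mult_right_mono, auto)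
  have "C \<ge> 0" by (simp add: C_def)
  have zero: "?f' 0 = 0"
    using flat_has_derivative_0[OF flat] by (intro dir_deriv_unique) simp
  define D where "D = C * (2 ^ (2 * (K + 1)) + 1) + M"
  have "\<bar>?f' z\<bar> \<le> D * norm z ^ (K + 1)" if z: "norm z < min (1/2) (\<delta>/2)" for z
  proof (cases "z = 0")
    case True
    then show ?thesis using zero by simp
  next
    case False
    let ?r = "norm z"
    define t where "t = ?r ^ (K + 1)"
    have r: "0 < ?r" "?r \<le> 1" using False z by auto
    then have t: "0 < t" "t \<le> ?r" "t \<le> 1"
      using power_le_one[of ?r K] power_le_one[of ?r "K + 1"]
      unfolding t_def by (auto simp: mult_left_le)
    obtain \<xi> where \<xi>: "\<bar>\<xi>\<bar> \<le> \<bar>t\<bar>" "f (z + t *\<^sub>R b) - f z = ?f' (z + \<xi> *\<^sub>R b) * t"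
      using mean_value_abs[of "\<lambda>t. f (z + t *\<^sub>R b)" "\<lambda>t. ?f' (z + t *\<^sub>R b)" 0 t]
        smooth_dir_deriv_eq(2)[OF f] by auto
    obtain \<eta> where \<eta>: "\<bar>\<eta>\<bar> \<le> \<bar>\<xi>\<bar>" "?f' (z + \<xi> *\<^sub>R b) - ?f' z = ?f'' (z + \<eta> *\<^sub>R b) * \<xi>"
      using mean_value_abs[of "\<lambda>t. ?f' (z + t *\<^sub>R b)" "\<lambda>t. ?f'' (z + t *\<^sub>R b)" 0 \<xi>]
        smooth_dir_deriv_eq(2)[OF sm(1)] by auto
    have nb: "norm (z + s *\<^sub>R b) \<le> ?r + \<bar>s\<bar>" for s
      using norm_triangle_ineq[of z "s *\<^sub>R b"] b by simp
    have "norm (z + \<eta> *\<^sub>R b) \<le> 2" using nb[of \<eta>] \<eta>(1) \<xi>(1) t r by linarith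
    then have 1: "\<bar>?f'' (z + \<eta> *\<^sub>R b) * \<xi>\<bar> \<le> M * t"
      unfolding abs_mult using M \<xi>(1) t by (intro mult_mono) (auto intro: order_trans[OF abs_ge_zero])
    have le: "norm (z + t *\<^sub>R b) \<le> 2 * ?r" using nb[of t] t by linarith
    moreover have "2 * ?r < \<delta>" using z by simp
    ultimately have "norm (z + t *\<^sub>R b) < \<delta>" by linarith
    from order_trans[OF C[OF this] mult_left_mono[OF power_mono[OF le norm_ge_zero] \<open>C \<ge> 0\<close>]]
    have "\<bar>f (z + t *\<^sub>R b)\<bar> \<le> C * (2 * ?r) ^ (2 * (K + 1))" .
    moreover have "\<bar>f z\<bar> \<le> C * ?r ^ (2 * (K + 1))" 
    proof (rule C)
      have "?r < \<delta> / 2" using z by simp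
      then show "?r < \<delta>" using r by linarith
    qed
    ultimately have "\<bar>f (z + t *\<^sub>R b) - f z\<bar> \<le> C * (2 * ?r) ^ (2 * (K + 1)) + C * ?r ^ (2 * (K + 1))"
      by linarith
    also have "\<dots> = (C * (2 ^ (2 * (K + 1)) + 1) * t) * t"
    proof -
      have "?r ^ (2 * (K + 1)) = t * t"
        by (simp only: t_def mult_2 power_add[of ?r "K + 1" "K + 1"])
      then show ?thesis unfolding power_mult_distrib by (simp only: ring_distribs mult_1_right mult_1_left mult.assoc)
    qed
    finally have "\<bar>?f' (z + \<xi> *\<^sub>R b)\<bar> \<le> C * (2 ^ (2 * (K + 1)) + 1) * t"
      using t(1) unfolding \<xi>(2) abs_mult by (simp add: mult_le_cancel_right)
    with 1 \<eta>(2) have "\<bar>?f' z\<bar> \<le> C * (2 ^ (2 * (K + 1)) + 1) * t + M * t" by linarith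
    then show ?thesis by (simp add: D_def t_def algebra_simps)
  qed
  then have "\<forall>\<^sub>F z in nhds 0. \<bar>?f' z\<bar> \<le> D * norm z ^ (K + 1)"
    unfolding eventually_nhds_metric using \<open>\<delta> > 0\<close>
    by (intro exI[of _ "min (1/2) (\<delta>/2)"] conjI allI impI) (simp_all only: dist_0_norm dist_commute, simp)
  moreover have "\<forall>\<^sub>F z in nhds (0::'a). norm z < 1"
    unfolding eventually_nhds_metric by (intro exI[of _ 1]) simp
  ultimately have "\<forall>\<^sub>F z in nhds 0. \<bar>?f' z\<bar> \<le> \<bar>D\<bar> * norm z ^ K"
  proof eventually_elim
    case (elim z)
    have "D * norm z ^ (K + 1) \<le> \<bar>D\<bar> * norm z ^ K"
      using elim(2) by (intro mult_mono) (auto intro: mult_left_le_one_le)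
    with elim(1) show ?case by linarith
  qed
  then show "\<exists>C. \<forall>\<^sub>F z in nhds 0. \<bar>?f' z\<bar> \<le> C * norm z ^ K" by blast
qed

text \<open>
  At the origin the quotient takes the value \<open>0\<close>, either by the convention on division by zero or,
  for \<open>M = 0\<close>, because flat functions vanish there.
\<close>

lemma flat_divide_norm_power:
  fixes h :: "'a::real_inner \<Rightarrow> real"
  assumes "flat h"
  shows "flat (\<lambda>z. h z / (z \<bullet> z) ^ M)"
  unfolding flat_def
proof
  fix K
  obtain C where "\<forall>\<^sub>F z in nhds 0. \<bar>h z\<bar> \<le> C * norm z ^ (K + 2 * M)"
    using assms unfolding flat_def by blast
  then have "\<forall>\<^sub>F z in nhds 0. \<bar>h z / (z \<bullet> z) ^ M\<bar> \<le> \<bar>C\<bar> * norm z ^ K"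
  proof eventually_elim
    case (elim z)
    show ?case
    proof (cases "z = 0")
      case True
      then show ?thesis using flat_zero[OF assms] by simp
    next
      case False
      have zz: "(z \<bullet> z) ^ M = norm z ^ (2 * M)" by (simp add: power_mult flip: power2_norm_eq_inner)
      have "\<bar>h z / (z \<bullet> z) ^ M\<bar> \<le> C * norm z ^ (K + 2 * M) / norm z ^ (2 * M)"
        unfolding zz using elim by (simp add: abs_divide divide_right_mono)
      also have "\<dots> = C * norm z ^ K" using False by (simp add: power_add)
      also have "\<dots> \<le> \<bar>C\<bar> * norm z ^ K" by (intro mult_right_mono) auto
      finally show ?thesis .
    qed
  qed
  then show "\<exists>C. \<forall>\<^sub>F z in nhds 0. \<bar>h z / (z \<bullet> z) ^ M\<bar> \<le> C * norm z ^ K" by blast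
qed

text \<open>
  The derivatives of such a quotient are quotients of the same form, with a larger \<open>M\<close> and another
  flat numerator.
\<close>

lemma smooth_flat_divide_norm_power:
  fixes h :: "'a::euclidean_space \<Rightarrow> real"
  assumes "smooth h" "flat h"
  shows "smooth (\<lambda>z. h z / (z \<bullet> z) ^ M)"
proof (rule smooth_coinduct)
  define C where "C = {(\<lambda>z. h z / (z \<bullet> z) ^ M) | h M. smooth h \<and> flat (h :: 'a \<Rightarrow> real)}"
  show "(\<lambda>z. h z / (z \<bullet> z) ^ M) \<in> C" using assms by (auto simp: C_def)
  show "continuous_on UNIV f" if "f \<in> C" for f
  proof -
    from that obtain h M where f: "f = (\<lambda>z. h z / (z \<bullet> z) ^ M)" "smooth h" "flat h"
      by (auto simp: C_def)
    have "isCont f z" for z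
    proof (cases "z = 0")
      case True
      then show ?thesis using flat_isCont[OF flat_divide_norm_power[OF f(3)]] f(1) by simp
    next
      case False
      have "isCont h z" using smooth_continuous[OF f(2)] by (simp add: continuous_on_eq_continuous_at)
      then show ?thesis using False unfolding f(1) by (intro continuous_intros) auto
    qed
    then show ?thesis by (simp add: continuous_at_imp_continuous_on)
  qed
  show "\<exists>f'\<in>C. \<forall>z. ((\<lambda>t. f (z + t *\<^sub>R b)) has_real_derivative f' z) (at 0)"
    if "f \<in> C" and b: "b \<in> Basis" for f b
  proof -
    from that obtain h M where f: "f = (\<lambda>z. h z / (z \<bullet> z) ^ M)" and h: "smooth h" "flat h"
      by (auto simp: C_def)
    define h' where "h' z = (z \<bullet> z) * dir_deriv b h z + (- 2 * real M * (z \<bullet> b)) * h z" for z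
    have sq: "smooth (\<lambda>z::'a. z \<bullet> z)" using smooth_norm_square by (simp add: power2_norm_eq_inner)
    have "smooth h'" unfolding h'_def
      by (intro smooth_add smooth_mult sq smooth_const smooth_inner h smooth_dir_deriv b)
    moreover have "flat h'" unfolding h'_def
      by (intro flat_add flat_mult flat_dir_deriv h b continuous_intros)
    ultimately have in_C: "(\<lambda>z. h' z / (z \<bullet> z) ^ Suc M) \<in> C" unfolding C_def by blast
    have "((\<lambda>t. f (z + t *\<^sub>R b)) has_real_derivative h' z / (z \<bullet> z) ^ Suc M) (at 0)" for z
    proof (cases "z = 0")
      case True
      then show ?thesis
        using flat_has_derivative_0[OF flat_divide_norm_power[OF h(2), of M], of b] by (simp add: f)
    next
      case False
      have d: "((\<lambda>t. (z + t *\<^sub>R b) \<bullet> (z + t *\<^sub>R b)) has_real_derivative 2 * (z \<bullet> b)) (at 0)"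
        unfolding inner_add_left inner_add_right
        by (auto intro!: derivative_eq_intros simp: inner_commute)
      have d2: "((\<lambda>t. ((z + t *\<^sub>R b) \<bullet> (z + t *\<^sub>R b)) ^ M) has_real_derivative
          real M * (2 * (z \<bullet> b) * (z \<bullet> z) ^ (M - 1))) (at 0)"
        using DERIV_power[OF d, of M] by (simp add: mult_ac)
      have "((\<lambda>t. h (z + t *\<^sub>R b) / ((z + t *\<^sub>R b) \<bullet> (z + t *\<^sub>R b)) ^ M) has_real_derivative
         (dir_deriv b h z * (z \<bullet> z) ^ M - h z * (real M * (2 * (z \<bullet> b) * (z \<bullet> z) ^ (M - 1)))) /
         ((z \<bullet> z) ^ M * (z \<bullet> z) ^ M)) (at 0)"
        using DERIV_divide[OF smooth_has_dir_deriv[OF h(1), of z b] d2] False by simp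
      also have "(dir_deriv b h z * (z \<bullet> z) ^ M - h z * (real M * (2 * (z \<bullet> b) * (z \<bullet> z) ^ (M - 1)))) /
         ((z \<bullet> z) ^ M * (z \<bullet> z) ^ M) = h' z / (z \<bullet> z) ^ Suc M"
        using False by (cases M) (simp_all add: h'_def field_simps)
      finally show ?thesis by (simp add: f)
    qed
    then show ?thesis by (intro bexI[OF _ in_C] allI)
  qed
qed


section \<open>Invariant flat functions and the power map\<close>

lemma open_power_image:
  assumes "N > 0" "open U"
  shows "open ((\<lambda>z::complex. z ^ N) ` U)"
proof (rule open_mapping_thm[of _ UNIV])
  show "\<not> (\<lambda>z::complex. z ^ N) constant_on UNIV"
  proof
    assume "(\<lambda>z::complex. z ^ N) constant_on UNIV"
    then obtain c where "\<And>z::complex. z ^ N = c" unfolding constant_on_def by blast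
    from this[of 0] this[of 1] show False using assms(1) by (simp add: zero_power)
  qed
qed (use assms in \<open>auto intro!: holomorphic_intros\<close>)

text \<open>The power map is open and surjective, hence a quotient map.\<close>

lemma continuous_on_power_quotient:
  fixes H :: "complex \<Rightarrow> 'a::topological_space"
  assumes "N > 0" "continuous_on UNIV h" "\<And>z. H (z ^ N) = h z"
  shows "continuous_on UNIV H"
  unfolding continuous_on_open_vimage[OF open_UNIV]
proof (intro allI impI)
  fix B :: "'a set" assume "open B"
  then have "open (h -` B)" using assms(2) by (simp add: continuous_on_open_vimage)
  moreover have "H -` B \<inter> UNIV = (\<lambda>z. z ^ N) ` (h -` B)"
  proof -
    have "u \<in> (\<lambda>z. z ^ N) ` (h -` B)" if "H u \<in> B" for u
    proof -
      obtain z where "u = z ^ N" using exists_complex_root assms(1) by (metis not_gr_zero)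
      then show ?thesis using that assms(3) by auto
    qed
    then show ?thesis using assms(3) by auto
  qed
  ultimately show "open (H -` B \<inter> UNIV)" using open_power_image[OF assms(1)] by simp
qed

lemma inner_complex_Basis_sum:
  "(\<Sum>b\<in>Basis. f b * ((v::complex) \<bullet> b)) = f 1 * Re v + f \<i> * Im v"
  by (simp add: Basis_complex_def inner_complex_def)

text \<open>
  A branch of the \<open>N\<close>-th root along the line through \<open>u0\<close> with direction \<open>b\<close>, with its velocity:
  the implicit function theorem for \<open>z ^ N = u\<close> in explicit form.
\<close>

lemma local_root_curve:
  fixes u0 z0 b :: complex
  assumes "N > 0" "z0 ^ N = u0" "u0 \<noteq> 0"
  obtains c where "\<forall>\<^sub>F t in nhds (0::real). c t ^ N = u0 + t *\<^sub>R b" "c 0 = z0"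
    "(c has_vector_derivative (b * z0 / (of_nat N * u0))) (at 0)"
proof
  define w where "w t = 1 + of_real t * b / u0" for t :: real
  define c where "c t = z0 * exp (Ln (w t) / of_nat N)" for t
  have w: "(w has_vector_derivative (b / u0)) (at t)" for t
    unfolding w_def using assms(3)
    by (auto intro!: derivative_eq_intros simp: has_vector_derivative_def scaleR_conv_of_real)
  have "isCont w 0" using w[of 0] by (rule has_vector_derivative_continuous)
  then have "(w \<longlongrightarrow> w 0) (nhds 0)" using tendsto_at_iff_tendsto_nhds[of w 0] by (simp add: isCont_def)
  then have "\<forall>\<^sub>F t in nhds 0. w t \<in> - {0}" by (rule topological_tendstoD) (auto simp: w_def)
  then show "\<forall>\<^sub>F t in nhds 0. c t ^ N = u0 + t *\<^sub>R b"
  proof eventually_elim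
    case (elim t)
    have "exp (Ln (w t) / of_nat N) ^ N = w t"
      using elim assms(1) by (simp flip: exp_of_nat_mult)
    then show ?case using assms
      by (simp add: c_def power_mult_distrib w_def field_simps scaleR_conv_of_real)
  qed
  show "c 0 = z0" by (simp add: c_def w_def)
  have "((\<lambda>x. z0 * exp (Ln x / of_nat N)) has_field_derivative (z0 / of_nat N)) (at (w 0))"
    using assms(1) by (auto intro!: derivative_eq_intros simp: w_def)
  from field_vector_diff_chain_at[OF w this]
  show "(c has_vector_derivative (b * z0 / (of_nat N * u0))) (at 0)"
    by (simp add: c_def[abs_def] o_def mult_ac)
qed

lemma smooth_Re_Im: "smooth Re" "smooth Im"
  using smooth_inner[of "1::complex"] smooth_inner[of \<i>] by (simp_all add: inner_complex_def)

lemma smooth_complex_monomial: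
  "smooth (\<lambda>z. Re (a * z ^ m * cnj z ^ n))" "smooth (\<lambda>z. Im (a * z ^ m * cnj z ^ n))"
proof -
  have mono: "smooth (\<lambda>z. Re (a * z ^ m)) \<and> smooth (\<lambda>z. Im (a * z ^ m))" for a m
  proof (induction m arbitrary: a)
    case (Suc m)
    have "smooth (\<lambda>z. Re z * Re (a * z ^ m) - Im z * Im (a * z ^ m))"
      "smooth (\<lambda>z. Re z * Im (a * z ^ m) + Im z * Re (a * z ^ m))"
      using Suc[of a] smooth_Re_Im by (auto intro!: smooth_diff smooth_add smooth_mult)
    moreover have "Re (a * z ^ Suc m) = Re z * Re (a * z ^ m) - Im z * Im (a * z ^ m)"
      "Im (a * z ^ Suc m) = Re z * Im (a * z ^ m) + Im z * Re (a * z ^ m)" for z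
      by (simp_all add: algebra_simps)
    ultimately show ?case by simp
  qed simp
  have "smooth (\<lambda>z. Re (a * z ^ m) * Re (1 * z ^ n) + Im (a * z ^ m) * Im (1 * z ^ n))"
    "smooth (\<lambda>z. Im (a * z ^ m) * Re (1 * z ^ n) - Re (a * z ^ m) * Im (1 * z ^ n))"
    using mono[of a m] mono[of 1 n] by (intro smooth_diff smooth_add smooth_mult; blast)+
  moreover have "cnj z ^ n = cnj (1 * z ^ n)" for z by simp
  ultimately show "smooth (\<lambda>z. Re (a * z ^ m * cnj z ^ n))" "smooth (\<lambda>z. Im (a * z ^ m * cnj z ^ n))"
    by (simp_all only: times_complex.simps complex_cnj cnj.simps) (simp_all add: algebra_simps)
qed

text \<open>
  Away from the origin, \<open>H\<close> is locally \<open>h\<close> composed with a branch of the root, and its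
  derivatives, pulled back by the power map, are derivatives of \<open>h\<close> divided by powers of \<open>|z|\<close>.
  Flatness absorbs these denominators, so the pulled back derivative is again smooth and flat, and
  the class of all such \<open>H\<close> is closed under partial derivatives.
\<close>

lemma smooth_power_quotient_of_flat:
  fixes h H :: "complex \<Rightarrow> real"
  assumes N: "N > 0" and "smooth h" "flat h" "\<And>z. H (z ^ N) = h z"
  shows "smooth H"
proof (rule smooth_coinduct)
  define C where "C = {H. \<exists>h. smooth h \<and> flat h \<and> (\<forall>z::complex. H (z ^ N) = h z)}"
  show "H \<in> C" using assms by (auto simp: C_def)
  show "continuous_on UNIV H" if "H \<in> C" for H
    using that continuous_on_power_quotient[OF N] smooth_continuous unfolding C_def by blast
  show "\<exists>H'\<in>C. \<forall>z. ((\<lambda>t. H (z + t *\<^sub>R b)) has_real_derivative H' z) (at 0)"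
    if "H \<in> C" and b: "b \<in> Basis" for H b
  proof -
    from that obtain h where h: "smooth h" "flat h" "\<And>z. H (z ^ N) = h z" by (auto simp: C_def)
    \<comment> \<open>The velocity \<open>b / (N * z ^ (N - 1))\<close> of the root is \<open>v z / |z|^(2 * N)\<close> with a polynomial
      \<open>v\<close>.\<close>
    define v where "v z = b * z * cnj (z ^ N) / of_nat N" for z
    define k where "k z = Re (v z) * dir_deriv 1 h z + Im (v z) * dir_deriv \<i> h z" for z
    define h' where "h' z = k z / (z \<bullet> z) ^ N" for z
    have B: "(1::complex) \<in> Basis" "\<i> \<in> Basis" by (auto simp: Basis_complex_def)
    have "v = (\<lambda>z. (b / of_nat N) * z ^ 1 * cnj z ^ N)"
      unfolding v_def by (auto simp: field_simps)
    then have sv: "smooth (\<lambda>z. Re (v z))" "smooth (\<lambda>z. Im (v z))"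
      using smooth_complex_monomial by metis+
    have "smooth k" unfolding k_def
      by (intro smooth_add smooth_mult sv smooth_dir_deriv h B)
    moreover have "flat k" unfolding k_def
      by (intro flat_add flat_mult flat_dir_deriv h B smooth_continuous sv)
    ultimately have h': "smooth h'" "flat h'"
      unfolding h'_def using smooth_flat_divide_norm_power flat_divide_norm_power by blast+
    have deriv: "((\<lambda>t. H (z ^ N + t *\<^sub>R b)) has_real_derivative h' z) (at 0)" for z
    proof (cases "z = 0")
      case True
      \<comment> \<open>The root of \<open>t *\<^sub>R b\<close> has modulus \<open>|t|^(1 / N)\<close>, so flatness to order \<open>2 * N\<close> gives a
        quadratic bound in \<open>t\<close>.\<close>
      obtain D where D: "\<forall>\<^sub>F z in nhds 0. \<bar>h z\<bar> \<le> D * norm z ^ (2 * N)"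
        using h(2) unfolding flat_def by blast
      then obtain \<delta> where "\<delta> > 0" and \<delta>': "\<forall>z. dist z 0 < \<delta> \<longrightarrow> \<bar>h z\<bar> \<le> D * norm z ^ (2 * N)"
        unfolding eventually_nhds_metric by blast
      have \<delta>: "\<bar>h z\<bar> \<le> D * norm z ^ (2 * N)" if "norm z < \<delta>" for z
        using \<delta>'[rule_format, of z] that by (simp only: dist_0_norm dist_commute)
      have "\<bar>H (t *\<^sub>R b)\<bar> \<le> D * t\<^sup>2" if "\<bar>t\<bar> < \<delta> ^ N" for t
      proof -
        obtain w where w: "t *\<^sub>R b = w ^ N" using exists_complex_root N by (metis not_gr_zero)
        have "norm w ^ N = \<bar>t\<bar>" using arg_cong[OF w, of norm] b by (simp add: norm_power)
        moreover from this have "norm w < \<delta>" using that \<open>\<delta> > 0\<close>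
          by (metis power_less_imp_less_base less_eq_real_def)
        ultimately show ?thesis using \<delta>[of w] h(3)[of w] w
          by (simp add: mult.commute[of 2] power_mult)
      qed
      then have "\<forall>\<^sub>F t in nhds 0. \<bar>H (t *\<^sub>R b)\<bar> \<le> D * t\<^sup>2"
        using \<open>\<delta> > 0\<close> unfolding eventually_nhds_metric
        by (intro exI[of _ "\<delta> ^ N"]) (auto simp: dist_real_def)
      from has_derivative_0_if_quadratic[OF this] show ?thesis
        using True N flat_zero[OF h'(2)] by (simp add: zero_power)
    next
      case False
      then have nz: "z ^ N \<noteq> 0" by simp
      obtain c where c: "\<forall>\<^sub>F t in nhds (0::real). c t ^ N = z ^ N + t *\<^sub>R b" "c 0 = z"
        "(c has_vector_derivative (b * z / (of_nat N * z ^ N))) (at 0)"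
        using local_root_curve[OF N refl nz] by blast
      have zz: "complex_of_real ((z \<bullet> z) ^ N) = z ^ N * cnj (z ^ N)"
      proof -
        have "complex_of_real (z \<bullet> z) = z * cnj z"
          by (simp add: complex_eq_iff inner_complex_def)
        then show ?thesis by (simp add: power_mult_distrib)
      qed
      have "b * z / (of_nat N * z ^ N) = v z / complex_of_real ((z \<bullet> z) ^ N)"
        unfolding zz v_def using False by (simp add: field_simps)
      then have "dir_deriv (b * z / (of_nat N * z ^ N)) h z = h' z"
        unfolding smooth_dir_deriv_eq(1)[OF h(1), of "b * z / (of_nat N * z ^ N)"] inner_complex_Basis_sum
        by (simp add: h'_def k_def add_divide_distrib mult_ac)
      then have "((\<lambda>t. h (c t)) has_real_derivative h' z) (at 0)"
        using smooth_chain_dir[OF h(1) c(3)] c(2) by simp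
      moreover have "\<forall>\<^sub>F t in nhds 0. H (z ^ N + t *\<^sub>R b) = h (c t)"
        using c(1) by eventually_elim (metis h(3))
      ultimately show ?thesis by (subst DERIV_cong_ev[OF refl _ refl]) auto
    qed
    define H' where "H' u = h' (SOME z. z ^ N = u)" for u
    have root: "(SOME z. z ^ N = u) ^ N = u" for u :: complex
      by (rule someI_ex) (metis exists_complex_root N not_gr_zero)
    have H': "((\<lambda>t. H (u + t *\<^sub>R b)) has_real_derivative H' u) (at 0)" for u
      using deriv[of "SOME z. z ^ N = u"] unfolding H'_def root .
    have "H' (z ^ N) = h' z" for z
      using DERIV_unique[OF H' deriv] .
    then have "H' \<in> C" using h' unfolding C_def by blast
    with H' show ?thesis by blast
  qed
qed

lemma flat_descends_to_power_quotient:
  fixes h :: "complex \<Rightarrow> real"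
  assumes N: "N > 0" and "smooth h" "flat h" and inv: "\<And>u z. u ^ N = 1 \<Longrightarrow> h (u * z) = h z"
  obtains H where "smooth H" "\<And>z. H (z ^ N) = h z"
proof
  define H where "H u = h (SOME z. z ^ N = u)" for u
  show eq: "H (z ^ N) = h z" for z
  proof -
    define w where "w = (SOME w. w ^ N = z ^ N)"
    have w: "w ^ N = z ^ N" unfolding w_def by (rule someI[of _ z]) simp
    have "h w = h z"
    proof (cases "z = 0")
      case True
      then show ?thesis using w N by (simp add: zero_power)
    next
      case False
      then have "(w / z) ^ N = 1" using w by (simp add: power_divide)
      from inv[OF this, of z] False show ?thesis by simp
    qed
    then show ?thesis by (simp add: H_def w_def)
  qed
  show "smooth H" by (rule smooth_power_quotient_of_flat[OF N assms(2,3) eq])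
qed

section \<open>Taylor expansion\<close>

text \<open>
  The \<open>k\<close>-th derivative at \<open>w\<close> in the direction \<open>z\<close>, written out in coordinates so that it is
  visibly a homogeneous polynomial in \<open>z\<close>.
\<close>

primrec taylor_term :: "nat \<Rightarrow> ('a::euclidean_space \<Rightarrow> real) \<Rightarrow> 'a \<Rightarrow> 'a \<Rightarrow> real" where
  "taylor_term 0 f z w = f w"
| "taylor_term (Suc k) f z w = (\<Sum>b\<in>Basis. (z \<bullet> b) * taylor_term k (dir_deriv b f) z w)"

lemma taylor_term_has_derivative:
  assumes "smooth f"
  shows "((\<lambda>t. taylor_term k f z (t *\<^sub>R z)) has_real_derivative taylor_term (Suc k) f z (s *\<^sub>R z)) (at s)"
  using assms
proof (induction k arbitrary: f)
  case 0
  have "dir_deriv z f (s *\<^sub>R z) = (\<Sum>b\<in>Basis. (z \<bullet> b) * dir_deriv b f (s *\<^sub>R z))"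
    using smooth_dir_deriv_eq(1)[OF 0, of z "s *\<^sub>R z"] by (simp add: mult.commute)
  then show ?case using smooth_dir_deriv_eq(2)[OF 0, of 0 z s] by simp
next
  case (Suc k)
  have "((\<lambda>t. \<Sum>b\<in>Basis. (z \<bullet> b) * taylor_term k (dir_deriv b f) z (t *\<^sub>R z)) has_real_derivative
     (\<Sum>b\<in>Basis. (z \<bullet> b) * taylor_term (Suc k) (dir_deriv b f) z (s *\<^sub>R z))) (at s)"
    by (intro DERIV_sum DERIV_cmult Suc.IH smooth_dir_deriv Suc.prems)
  then show ?case by simp
qed

lemma taylor_term_bounded:
  fixes f :: "'a::euclidean_space \<Rightarrow> real"
  assumes "smooth f"
  shows "\<exists>C. \<forall>z w. norm w \<le> 1 \<longrightarrow> \<bar>taylor_term k f z w\<bar> \<le> C * norm z ^ k"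
  using assms
proof (induction k arbitrary: f)
  case 0
  have "compact (f ` cball 0 1)"
    by (intro compact_continuous_image continuous_on_subset[OF smooth_continuous[OF 0]]) auto
  then obtain C where "\<forall>x\<in>cball 0 1. \<bar>f x\<bar> \<le> C"
    by (auto dest!: compact_imp_bounded simp: bounded_iff)
  then show ?case by (intro exI[of _ C]) simp
next
  case (Suc k)
  have "\<exists>C. \<forall>z w. norm w \<le> 1 \<longrightarrow> \<bar>taylor_term k (dir_deriv b f) z w\<bar> \<le> C * norm z ^ k"
    if "b \<in> Basis" for b
    using Suc.IH smooth_dir_deriv[OF Suc.prems that] by blast
  then obtain C where C: "\<And>b z w. b \<in> Basis \<Longrightarrow> norm w \<le> 1 \<Longrightarrow>
      \<bar>taylor_term k (dir_deriv b f) z w\<bar> \<le> C b * norm z ^ k" by metis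
  show ?case
  proof (intro exI allI impI)
    fix z w :: 'a assume w: "norm w \<le> 1"
    have "\<bar>(z \<bullet> b) * taylor_term k (dir_deriv b f) z w\<bar> \<le> norm z * (C b * norm z ^ k)" if "b \<in> Basis" for b
      unfolding abs_mult using C[OF that w] Basis_le_norm[OF that] by (intro mult_mono) auto
    then have "\<bar>taylor_term (Suc k) f z w\<bar> \<le> (\<Sum>b\<in>Basis. norm z * (C b * norm z ^ k))"
      by (auto intro!: order_trans[OF sum_abs] sum_mono)
    then show "\<bar>taylor_term (Suc k) f z w\<bar> \<le> (\<Sum>b\<in>Basis. C b) * norm z ^ Suc k"
      by (simp add: sum_distrib_right sum_distrib_left mult_ac)
  qed
qed

lemma taylor_approximation:
  fixes f :: "'a::euclidean_space \<Rightarrow> real"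
  assumes "smooth f"
  shows "\<exists>C. \<forall>z. norm z \<le> 1 \<longrightarrow> \<bar>f z - (\<Sum>k<K. taylor_term k f z 0 / fact k)\<bar> \<le> C * norm z ^ K"
proof -
  obtain C where C: "\<And>z w. norm w \<le> 1 \<Longrightarrow> \<bar>taylor_term K f z w\<bar> \<le> C * norm z ^ K"
    using taylor_term_bounded[OF assms] by blast
  show ?thesis
  proof (intro exI allI impI)
    fix z :: 'a assume z: "norm z \<le> 1"
    have "\<exists>t. \<bar>t\<bar> \<le> \<bar>1\<bar> \<and> f (1 *\<^sub>R z) =
        (\<Sum>m<K. (taylor_term m f z (0 *\<^sub>R z) / fact m) * 1 ^ m) + (taylor_term K f z (t *\<^sub>R z) / fact K) * 1 ^ K"
      by (rule Maclaurin_all_le) (use taylor_term_has_derivative[OF assms] in auto)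
    then obtain t where t: "\<bar>t\<bar> \<le> 1" and
      eq: "f z = (\<Sum>m<K. taylor_term m f z 0 / fact m) + taylor_term K f z (t *\<^sub>R z) / fact K" by auto
    have "norm (t *\<^sub>R z) \<le> 1" using t z by (simp add: mult_le_one)
    from C[OF this, of z] have "\<bar>taylor_term K f z (t *\<^sub>R z)\<bar> / fact K \<le> (C * norm z ^ K) / fact K"
      by (intro divide_right_mono) auto
    then show "\<bar>f z - (\<Sum>k<K. taylor_term k f z 0 / fact k)\<bar> \<le> (C / fact K) * norm z ^ K"
      by (simp add: eq abs_divide)
  qed
qed

text \<open>
  The Taylor terms in a direction only see the function on the ray in that direction; hence they
  inherit the invariance under linear maps from the function.
\<close>

lemma taylor_term_cong_ray:
  assumes f: "smooth f" and "\<And>s. f (s *\<^sub>R z) = f (s *\<^sub>R z')"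
  shows "taylor_term k f z (s *\<^sub>R z) = taylor_term k f z' (s *\<^sub>R z')"
proof (induction k arbitrary: s)
  case (Suc k)
  have "(\<lambda>t. taylor_term k f z (t *\<^sub>R z)) = (\<lambda>t. taylor_term k f z' (t *\<^sub>R z'))"
    using Suc.IH by blast
  from DERIV_unique[OF taylor_term_has_derivative[OF f, of k z s, unfolded this] taylor_term_has_derivative[OF f]]
  show ?case .
qed (use assms in simp)

inductive_set homogeneous_z_cnj :: "nat \<Rightarrow> (complex \<Rightarrow> complex) set" for k where
  monom: "a + b = k \<Longrightarrow> (\<lambda>z. \<alpha> * z ^ a * cnj z ^ b) \<in> homogeneous_z_cnj k"
| add: "g \<in> homogeneous_z_cnj k \<Longrightarrow> h \<in> homogeneous_z_cnj k \<Longrightarrow> (\<lambda>z. g z + h z) \<in> homogeneous_z_cnj k"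

lemma homogeneous_z_cnj_mult_linear:
  assumes "g \<in> homogeneous_z_cnj k"
  shows "(\<lambda>z. (c * z + d * cnj z) * g z) \<in> homogeneous_z_cnj (Suc k)"
  using assms
proof induction
  case (monom a b \<alpha>)
  have "(\<lambda>z. (c * \<alpha>) * z ^ Suc a * cnj z ^ b + (d * \<alpha>) * z ^ a * cnj z ^ Suc b) \<in> homogeneous_z_cnj (Suc k)"
    using monom by (intro homogeneous_z_cnj.add homogeneous_z_cnj.monom) auto
  then show ?case by (simp add: algebra_simps)
next
  case (add g h)
  from homogeneous_z_cnj.add[OF add.IH] show ?case by (simp add: algebra_simps)
qed

lemma taylor_term_homogeneous_z_cnj:
  fixes f :: "complex \<Rightarrow> real"
  shows "(\<lambda>z. complex_of_real (taylor_term k f z w)) \<in> homogeneous_z_cnj k"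
proof (induction k arbitrary: f)
  case 0
  have "(\<lambda>z. complex_of_real (f w) * z ^ 0 * cnj z ^ 0) \<in> homogeneous_z_cnj 0"
    by (rule homogeneous_z_cnj.monom) simp
  then show ?case by simp
next
  case (Suc k)
  have "(\<lambda>z. (1/2 * z + 1/2 * cnj z) * of_real (taylor_term k (dir_deriv 1 f) z w)
      + ((- \<i>/2) * z + (\<i>/2) * cnj z) * of_real (taylor_term k (dir_deriv \<i> f) z w)) \<in> homogeneous_z_cnj (Suc k)"
    by (intro homogeneous_z_cnj.add homogeneous_z_cnj_mult_linear Suc.IH)
  moreover have "complex_of_real (Re z) = 1/2 * z + 1/2 * cnj z"
    "complex_of_real (Im z) = (- \<i>/2) * z + (\<i>/2) * cnj z" for z
    by (simp_all add: complex_eq_iff)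
  ultimately show ?case
    by (simp add: Basis_complex_def inner_complex_def)
qed

section \<open>Invariant polynomials\<close>

abbreviation cyclic_coords :: "nat \<Rightarrow> complex \<Rightarrow> real ^ 3" where
  "cyclic_coords N z \<equiv> vector [Re (z ^ N), Im (z ^ N), (cmod z)\<^sup>2]"

text \<open>
  The weights \<open>N\<close>, \<open>N\<close>, \<open>2\<close> of the variables are the degrees in \<open>z\<close> and \<open>cnj z\<close> of the invariants
  in \<open>cyclic_coords\<close>, so that substituting these preserves degrees.
\<close>

inductive_set weighted_homogeneous :: "nat \<Rightarrow> nat \<Rightarrow> (real ^ 3 \<Rightarrow> real) set" for N k where
  zero: "(\<lambda>x. 0) \<in> weighted_homogeneous N k"
| monom: "N * (a + b) + 2 * c = k \<Longrightarrow>
    (\<lambda>x. r * (x $ 1) ^ a * (x $ 2) ^ b * (x $ 3) ^ c) \<in> weighted_homogeneous N k"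
| add: "P \<in> weighted_homogeneous N k \<Longrightarrow> Q \<in> weighted_homogeneous N k \<Longrightarrow>
    (\<lambda>x. P x + Q x) \<in> weighted_homogeneous N k"

lemma weighted_homogeneous_mult_monom:
  assumes "P \<in> weighted_homogeneous N k"
  shows "(\<lambda>x. (r * (x $ 1) ^ a * (x $ 2) ^ b * (x $ 3) ^ c) * P x)
     \<in> weighted_homogeneous N (k + N * (a + b) + 2 * c)"
  using assms
proof induction
  case zero
  then show ?case by (simp add: weighted_homogeneous.zero)
next
  case (monom a' b' c' r')
  have "(\<lambda>x. (r * r') * (x $ 1) ^ (a + a') * (x $ 2) ^ (b + b') * (x $ 3) ^ (c + c'))
     \<in> weighted_homogeneous N (k + N * (a + b) + 2 * c)"
    by (rule weighted_homogeneous.monom) (use monom in \<open>auto simp: algebra_simps\<close>)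
  then show ?case by (simp add: power_add mult_ac)
next
  case (add P Q)
  from weighted_homogeneous.add[OF add.IH] show ?case by (simp add: algebra_simps)
qed

lemma Re_power_weighted_homogeneous:
  "(\<lambda>x. Re (\<beta> * Complex (x $ 1) (x $ 2) ^ q)) \<in> weighted_homogeneous N (N * q)"
proof (induction q arbitrary: \<beta>)
  case 0
  have "(\<lambda>x. Re \<beta> * (x $ 1) ^ 0 * (x $ 2) ^ 0 * (x $ 3) ^ 0) \<in> weighted_homogeneous N (N * 0)"
    by (rule weighted_homogeneous.monom) simp
  then show ?case by simp
next
  case (Suc q)
  have "(\<lambda>x. (1 * (x $ 1) ^ 1 * (x $ 2) ^ 0 * (x $ 3) ^ 0) * Re (\<beta> * Complex (x $ 1) (x $ 2) ^ q)
      + (1 * (x $ 1) ^ 0 * (x $ 2) ^ 1 * (x $ 3) ^ 0) * Re ((\<i> * \<beta>) * Complex (x $ 1) (x $ 2) ^ q))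
      \<in> weighted_homogeneous N (N * Suc q)"
    using weighted_homogeneous_mult_monom[OF Suc[of \<beta>], of 1 1 0 0]
      weighted_homogeneous_mult_monom[OF Suc[of "\<i> * \<beta>"], of 1 0 1 0]
    by (intro weighted_homogeneous.add) (simp_all add: algebra_simps)
  moreover have "Re (\<beta> * Complex u v ^ Suc q) = u * Re (\<beta> * Complex u v ^ q) + v * Re ((\<i> * \<beta>) * Complex u v ^ q)"
    for u v by (simp add: algebra_simps)
  ultimately show ?case by simp
qed

lemma sum_roots_unity_powers:
  fixes \<eta> :: complex
  assumes "\<eta> ^ N = 1"
  shows "(\<Sum>j<N. \<eta> ^ j) = (if \<eta> = 1 then of_nat N else 0)"
  using assms by (simp add: geometric_sum)

text \<open>
  The average over the roots of unity annihilates \<open>z ^ a * cnj z ^ b\<close> unless \<open>a\<close> and \<open>b\<close> are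
  congruent modulo \<open>N\<close>. In that case the monomial is a power of \<open>|z|^2\<close> times a power of \<open>z ^ N\<close>
  or of its conjugate.
\<close>

lemma average_homogeneous_z_cnj:
  assumes N: "N > 0" and g: "g \<in> homogeneous_z_cnj k"
  defines "\<omega> \<equiv> exp (2 * of_real pi * \<i> / of_nat N)"
  shows "\<exists>P\<in>weighted_homogeneous N k. \<forall>z.
    Re ((\<Sum>j<N. g (\<omega> ^ j * z)) / of_nat N) = P (cyclic_coords N z)"
  using g
proof induction
  case (monom a b \<alpha>)
  have \<omega>_pow: "\<omega> ^ m = exp (2 * of_real pi * \<i> * of_nat m / of_nat N)" for m
    by (simp add: \<omega>_def mult_ac flip: exp_of_nat_mult)
  have \<omega>N: "\<omega> ^ N = 1" unfolding \<omega>_pow using N by simp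
  have norm: "\<omega> * cnj \<omega> = 1" 
    by (simp add: \<omega>_def exp_cnj flip: exp_add)
  have "cnj \<omega> ^ N = 1" using \<omega>N by (metis complex_cnj_one complex_cnj_power)
  \<comment> \<open>The factor by which the rotation by \<open>\<omega>\<close> multiplies the monomial.\<close>
  define \<eta> where "\<eta> = \<omega> ^ a * cnj \<omega> ^ b"
  have "\<eta> ^ N = (\<omega> ^ N) ^ a * (cnj \<omega> ^ N) ^ b"
    by (simp add: \<eta>_def power_mult_distrib mult.commute flip: power_mult)
  then have \<eta>N: "\<eta> ^ N = 1" using \<omega>N \<open>cnj \<omega> ^ N = 1\<close> by simp
  have "(\<Sum>j<N. \<alpha> * (\<omega> ^ j * z) ^ a * cnj (\<omega> ^ j * z) ^ b) = (\<alpha> * z ^ a * cnj z ^ b) * (\<Sum>j<N. \<eta> ^ j)" for z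
    unfolding sum_distrib_left \<eta>_def
    by (intro sum.cong refl) (simp add: power_mult_distrib mult_ac flip: power_mult)
  then have avg: "(\<Sum>j<N. \<alpha> * (\<omega> ^ j * z) ^ a * cnj (\<omega> ^ j * z) ^ b) / of_nat N =
      (if \<eta> = 1 then \<alpha> * z ^ a * cnj z ^ b else 0)" for z
    unfolding sum_roots_unity_powers[OF \<eta>N] using N by simp
  show ?case
  proof (cases "\<eta> = 1")
    case False
    then show ?thesis using False 
      by (intro bexI[OF _ weighted_homogeneous.zero] allI, simp only: avg) simp
  next
    case True
    have "\<omega> ^ a = \<omega> ^ a * (cnj \<omega> * \<omega>) ^ b" using norm by (simp add: mult.commute)
    also have "\<dots> = \<eta> * \<omega> ^ b" by (simp add: \<eta>_def power_mult_distrib mult_ac)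
    finally have "a mod N = b mod N" using True N
      by (simp add: \<omega>_pow complex_root_unity_eq)
    have sq: "complex_of_real (((cmod z)\<^sup>2) ^ j) = (z * cnj z) ^ j" for z j
      by (metis complex_norm_square of_real_power)
    show ?thesis
    proof (cases "b \<le> a")
      case le: True
      with \<open>a mod N = b mod N\<close> obtain q where q: "a = b + N * q"
        by (metis mod_eq_nat1E mult.commute)
      have "(\<lambda>x. (1 * (x $ 1) ^ 0 * (x $ 2) ^ 0 * (x $ 3) ^ b) * Re (\<alpha> * Complex (x $ 1) (x $ 2) ^ q))
         \<in> weighted_homogeneous N (N * q + N * (0 + 0) + 2 * b)"
        by (intro weighted_homogeneous_mult_monom Re_power_weighted_homogeneous)
      moreover have "N * q + N * (0 + 0) + 2 * b = k" using monom q by simp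
      moreover have "Re (\<alpha> * z ^ a * cnj z ^ b) = ((cmod z)\<^sup>2) ^ b * Re (\<alpha> * (z ^ N) ^ q)" for z
      proof -
        have "\<alpha> * z ^ a * cnj z ^ b = complex_of_real (((cmod z)\<^sup>2) ^ b) * (\<alpha> * (z ^ N) ^ q)"
          unfolding q sq by (simp add: power_add power_mult power_mult_distrib mult_ac)
        moreover have "Re (complex_of_real r * w) = r * Re w" for r w by simp
        ultimately show ?thesis by metis
      qed
      ultimately have in_wh: "(\<lambda>x. (1 * (x $ 1) ^ 0 * (x $ 2) ^ 0 * (x $ 3) ^ b) * Re (\<alpha> * Complex (x $ 1) (x $ 2) ^ q))
          \<in> weighted_homogeneous N k"
        and re: "\<And>z. Re (\<alpha> * z ^ a * cnj z ^ b) = ((cmod z)\<^sup>2) ^ b * Re (\<alpha> * (z ^ N) ^ q)"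
        by (metis, metis)
      show ?thesis
        by (intro bexI[OF _ in_wh] allI) (simp only: avg vector_3 complex_surj \<open>\<eta> = 1\<close> if_P[OF refl] re power_0 mult_1_left)
    next
      case False
      with \<open>a mod N = b mod N\<close> obtain q where q: "b = a + N * q"
        by (metis mod_eq_nat1E mult.commute nat_le_linear)
      have "(\<lambda>x. (1 * (x $ 1) ^ 0 * (x $ 2) ^ 0 * (x $ 3) ^ a) * Re (cnj \<alpha> * Complex (x $ 1) (x $ 2) ^ q))
         \<in> weighted_homogeneous N (N * q + N * (0 + 0) + 2 * a)"
        by (intro weighted_homogeneous_mult_monom Re_power_weighted_homogeneous)
      moreover have "N * q + N * (0 + 0) + 2 * a = k" using monom q by simp
      moreover have "Re (\<alpha> * z ^ a * cnj z ^ b) = ((cmod z)\<^sup>2) ^ a * Re (cnj \<alpha> * (z ^ N) ^ q)" for z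
      proof -
        have "\<alpha> * z ^ a * cnj z ^ b = complex_of_real (((cmod z)\<^sup>2) ^ a) * cnj (cnj \<alpha> * (z ^ N) ^ q)"
          unfolding q sq by (simp add: power_add power_mult power_mult_distrib mult_ac)
        moreover have "Re (complex_of_real r * cnj w) = r * Re w" for r w by simp
        ultimately show ?thesis by metis
      qed
      ultimately have in_wh: "(\<lambda>x. (1 * (x $ 1) ^ 0 * (x $ 2) ^ 0 * (x $ 3) ^ a) * Re (cnj \<alpha> * Complex (x $ 1) (x $ 2) ^ q))
          \<in> weighted_homogeneous N k"
        and re: "\<And>z. Re (\<alpha> * z ^ a * cnj z ^ b) = ((cmod z)\<^sup>2) ^ a * Re (cnj \<alpha> * (z ^ N) ^ q)"
        by (metis, metis)
      show ?thesis
        by (intro bexI[OF _ in_wh] allI) (simp only: avg vector_3 complex_surj \<open>\<eta> = 1\<close> if_P[OF refl] re power_0 mult_1_left)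
    qed
  qed
next
  case (add g h)
  then obtain P Q where P: "P \<in> weighted_homogeneous N k" "Q \<in> weighted_homogeneous N k"
    "\<And>z. Re ((\<Sum>j<N. g (\<omega> ^ j * z)) / of_nat N) = P (cyclic_coords N z)"
    "\<And>z. Re ((\<Sum>j<N. h (\<omega> ^ j * z)) / of_nat N) = Q (cyclic_coords N z)" by blast
  show ?case
    by (intro bexI[OF _ weighted_homogeneous.add[OF P(1,2)]] allI)
       (simp only: sum.distrib add_divide_distrib plus_complex.simps P(3,4))
qed


section \<open>A Borel-type extension\<close>

lemma smooth_nth: "smooth (\<lambda>x::real^'n. x $ i)"
  using smooth_inner[of "axis i (1::real)"] by (simp add: inner_axis inner_real_def)

lemma weighted_homogeneous_smooth: "P \<in> weighted_homogeneous N k \<Longrightarrow> smooth P"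
  by (induction rule: weighted_homogeneous.induct)
     (auto intro!: smooth_add smooth_mult smooth_power smooth_nth)

lemma cutoff_smooth:
  fixes \<beta> P :: "real ^ 3 \<Rightarrow> real"
  assumes "smooth \<beta>" "smooth P"
  shows "smooth (\<lambda>x. \<beta> (r *\<^sub>R x) * P x)"
  by (intro smooth_mult assms(2) smooth_linear[OF assms(1)]) (rule linear_scaleR)

text \<open>
  For \<open>N \<ge> 2\<close> no variable has weight more than \<open>N\<close>, so the degree of a monomial is at least its
  weighted degree divided by \<open>N\<close>.
\<close>

lemma weighted_degree_bound:
  fixes N :: nat
  assumes "N \<ge> 2" "N * m < N * (a + b) + 2 * c"
  shows "m < a + b + c"
proof -
  have "2 * c \<le> N * c" using assms(1) by simp
  with assms(2) have "N * m < N * (a + b + c)" unfolding distrib_left by linarith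
  then show ?thesis using assms(1) by simp
qed

text \<open>
  For a monomial of degree \<open>d\<close>, cutting off at distance \<open>\<epsilon>\<close> yields \<open>\<epsilon> ^ d\<close> times a fixed compactly
  supported function of \<open>x / \<epsilon>\<close>; its derivatives of order less than \<open>d\<close> are therefore \<open>O(\<epsilon>)\<close>.
\<close>

lemma cutoff_iter_deriv_bound:
  fixes \<beta> :: "real ^ 3 \<Rightarrow> real"
  assumes N: "N \<ge> 2" and \<beta>: "smooth \<beta>" "\<And>x. norm x \<ge> 2 \<Longrightarrow> \<beta> x = 0"
    and P: "P \<in> weighted_homogeneous N k" and js: "js \<in> lists Basis" "N * length js < k"
  shows "\<exists>C. \<forall>\<epsilon>. 0 < \<epsilon> \<and> \<epsilon> \<le> 1 \<longrightarrow>
    (\<forall>x. \<bar>iter_deriv js (\<lambda>x. \<beta> ((1 / \<epsilon>) *\<^sub>R x) * P x) x\<bar> \<le> C * \<epsilon>)"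
  using P
proof induction
  case zero
  have "iter_deriv js (\<lambda>x::real^3. 0) = (\<lambda>x. 0)"
    using iter_deriv_rescale[OF smooth_const[of 0] js(1), of 0 1] by simp
  then show ?case by (intro exI[of _ 0]) simp
next
  case (monom a b c r)
  define G where "G x = r * (x $ 1) ^ a * (x $ 2) ^ b * (x $ 3) ^ c" for x :: "real ^ 3"
  define d where "d = a + b + c"
  have len: "length js < d"
    using weighted_degree_bound[OF N, of "length js"] js(2) monom by (simp add: d_def)
  have smG: "smooth G" unfolding G_def by (intro smooth_mult smooth_power smooth_nth smooth_const)
  have sm: "smooth (\<lambda>x. \<beta> x * G x)" by (intro smooth_mult \<beta> smG)
  have "\<exists>C. \<forall>x. \<bar>iter_deriv js (\<lambda>x. \<beta> x * G x) x\<bar> \<le> C"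
    by (rule iter_deriv_bounded[OF sm _ js(1), of 2]) (use \<beta>(2) in simp)
  then obtain C where C: "\<And>x. \<bar>iter_deriv js (\<lambda>x. \<beta> x * G x) x\<bar> \<le> C" by blast
  have "\<bar>iter_deriv js (\<lambda>x. \<beta> ((1 / \<epsilon>) *\<^sub>R x) * G x) x\<bar> \<le> \<bar>C\<bar> * \<epsilon>" if \<epsilon>: "0 < \<epsilon>" "\<epsilon> \<le> 1" for \<epsilon> x
  proof -
    have "G x = \<epsilon> ^ d * G ((1 / \<epsilon>) *\<^sub>R x)" for x
      using \<epsilon>(1) by (simp add: G_def d_def power_add power_divide)
    then have "(\<lambda>x. \<beta> ((1 / \<epsilon>) *\<^sub>R x) * G x) =
        (\<lambda>x. \<epsilon> ^ d * (\<beta> ((1 / \<epsilon>) *\<^sub>R x) * G ((1 / \<epsilon>) *\<^sub>R x)))"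
      by (metis mult.left_commute)
    then have "iter_deriv js (\<lambda>x. \<beta> ((1 / \<epsilon>) *\<^sub>R x) * G x) x =
        \<epsilon> ^ d * (1 / \<epsilon>) ^ length js * iter_deriv js (\<lambda>x. \<beta> x * G x) ((1 / \<epsilon>) *\<^sub>R x)"
      using iter_deriv_rescale[OF sm js(1), of "\<epsilon> ^ d" "1 / \<epsilon>"] by simp
    also have "\<epsilon> ^ d * (1 / \<epsilon>) ^ length js = \<epsilon> ^ (d - length js)"
      using \<epsilon>(1) len by (simp add: power_diff power_one_over divide_inverse power_inverse)
    finally have eq: "iter_deriv js (\<lambda>x. \<beta> ((1 / \<epsilon>) *\<^sub>R x) * G x) x =
        \<epsilon> ^ (d - length js) * iter_deriv js (\<lambda>x. \<beta> x * G x) ((1 / \<epsilon>) *\<^sub>R x)" .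
    have "\<epsilon> ^ (d - length js) \<le> \<epsilon> ^ 1" using \<epsilon> len by (intro power_decreasing) auto
    then show ?thesis unfolding eq abs_mult mult.commute[of "\<bar>C\<bar>"]
      using \<epsilon> C[of "(1 / \<epsilon>) *\<^sub>R x"] by (intro mult_mono) auto
  qed
  then show ?case unfolding G_def by blast
next
  case (add P Q)
  obtain C where C: "\<And>\<epsilon> x. 0 < \<epsilon> \<Longrightarrow> \<epsilon> \<le> 1 \<Longrightarrow> \<bar>iter_deriv js (\<lambda>x. \<beta> ((1 / \<epsilon>) *\<^sub>R x) * P x) x\<bar> \<le> C * \<epsilon>"
    using add.IH(1) by blast
  obtain D where D: "\<And>\<epsilon> x. 0 < \<epsilon> \<Longrightarrow> \<epsilon> \<le> 1 \<Longrightarrow> \<bar>iter_deriv js (\<lambda>x. \<beta> ((1 / \<epsilon>) *\<^sub>R x) * Q x) x\<bar> \<le> D * \<epsilon>"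
    using add.IH(2) by blast
  have "\<bar>iter_deriv js (\<lambda>x. \<beta> ((1 / \<epsilon>) *\<^sub>R x) * (P x + Q x)) x\<bar> \<le> (C + D) * \<epsilon>"
    if "0 < \<epsilon>" "\<epsilon> \<le> 1" for \<epsilon> x
  proof -
    have "iter_deriv js (\<lambda>x. \<beta> ((1 / \<epsilon>) *\<^sub>R x) * (P x + Q x)) x =
      iter_deriv js (\<lambda>x. \<beta> ((1 / \<epsilon>) *\<^sub>R x) * P x) x + iter_deriv js (\<lambda>x. \<beta> ((1 / \<epsilon>) *\<^sub>R x) * Q x) x"
      unfolding distrib_left
      by (subst iter_deriv_add)
         (intro cutoff_smooth \<beta> weighted_homogeneous_smooth[OF add.hyps(1)]
            weighted_homogeneous_smooth[OF add.hyps(2)] js refl)+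
    then show ?thesis using C[OF that, of x] D[OF that, of x] by (simp add: distrib_right)
  qed
  then show ?case by blast
qed

text \<open>
  On the support of the cutoff \<open>norm x \<le> 2 * \<epsilon>\<close>, and one of the more than \<open>m\<close> factors \<open>norm x\<close> of
  a monomial is traded for this bound.
\<close>

lemma cutoff_bound:
  fixes \<beta> :: "real ^ 3 \<Rightarrow> real"
  assumes N: "N \<ge> 2" and \<beta>: "smooth \<beta>" "\<And>x. norm x \<ge> 2 \<Longrightarrow> \<beta> x = 0"
    and P: "P \<in> weighted_homogeneous N k" and m: "N * m < k"
  shows "\<exists>C. \<forall>\<epsilon>. 0 < \<epsilon> \<and> \<epsilon> \<le> 1 \<longrightarrow>
    (\<forall>x. \<bar>\<beta> ((1 / \<epsilon>) *\<^sub>R x) * P x\<bar> \<le> C * \<epsilon> * norm x ^ m)"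
  using P
proof induction
  case zero
  then show ?case by (intro exI[of _ 0]) simp
next
  case (monom a b c r)
  define d where "d = a + b + c"
  have md: "m < d"
    using weighted_degree_bound[OF N, of m] m monom by (simp add: d_def)
  have "\<exists>B. \<forall>x. \<bar>iter_deriv [] \<beta> x\<bar> \<le> B"
    by (rule iter_deriv_bounded[OF \<beta>(1), of 2]) (use \<beta>(2) in auto)
  then obtain B where B: "\<And>x. \<bar>\<beta> x\<bar> \<le> B" by auto
  then have "B \<ge> 0" by (meson abs_ge_zero order_trans)
  have "\<bar>\<beta> ((1 / \<epsilon>) *\<^sub>R x) * (r * (x $ 1) ^ a * (x $ 2) ^ b * (x $ 3) ^ c)\<bar>
      \<le> (B * (\<bar>r\<bar> * 2 ^ (d - m))) * \<epsilon> * norm x ^ m" if \<epsilon>: "0 < \<epsilon>" "\<epsilon> \<le> 1" for \<epsilon> x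
  proof (cases "norm ((1 / \<epsilon>) *\<^sub>R x) \<ge> 2")
    case True
    then show ?thesis using \<beta>(2) \<epsilon> \<open>B \<ge> 0\<close> by simp
  next
    case False
    then have nx: "norm x \<le> 2 * \<epsilon>" using \<epsilon> by (simp add: field_simps)
    have "\<bar>x $ 1\<bar> ^ a * \<bar>x $ 2\<bar> ^ b * \<bar>x $ 3\<bar> ^ c \<le> norm x ^ a * norm x ^ b * norm x ^ c"
      by (intro mult_mono power_mono component_le_norm_cart) auto
    also have "\<dots> = norm x ^ d" by (simp add: d_def power_add)
    also have "\<dots> = norm x ^ m * (norm x ^ (d - m - 1) * norm x)"
    proof -
      have "norm x ^ m * (norm x ^ (d - m - 1) * norm x) = norm x ^ (m + (d - m - 1) + 1)"
        by (simp only: power_add power_one_right mult.assoc)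
      also have "m + (d - m - 1) + 1 = d" using md by simp
      finally show ?thesis by simp
    qed
    also have "\<dots> \<le> norm x ^ m * (2 ^ (d - m - 1) * (2 * \<epsilon>))"
      using nx \<epsilon> by (intro mult_left_mono mult_mono power_mono) auto
    also have "2 ^ (d - m - 1) * (2 * \<epsilon>) = 2 ^ (d - m) * \<epsilon>"
      using md by (cases "d - m") auto
    finally have 1: "\<bar>x $ 1\<bar> ^ a * \<bar>x $ 2\<bar> ^ b * \<bar>x $ 3\<bar> ^ c \<le> norm x ^ m * (2 ^ (d - m) * \<epsilon>)" .
    have "\<bar>\<beta> ((1 / \<epsilon>) *\<^sub>R x)\<bar> * (\<bar>r\<bar> * (\<bar>x $ 1\<bar> ^ a * \<bar>x $ 2\<bar> ^ b * \<bar>x $ 3\<bar> ^ c))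
        \<le> B * (\<bar>r\<bar> * (norm x ^ m * (2 ^ (d - m) * \<epsilon>)))"
      by (intro mult_mono[OF B] mult_left_mono[OF 1]) (use \<open>B \<ge> 0\<close> in auto)
    then show ?thesis by (simp add: abs_mult power_abs mult_ac)
  qed
  then show ?case by blast
next
  case (add P Q)
  obtain C where C: "\<And>\<epsilon> x. 0 < \<epsilon> \<Longrightarrow> \<epsilon> \<le> 1 \<Longrightarrow> \<bar>\<beta> ((1 / \<epsilon>) *\<^sub>R x) * P x\<bar> \<le> C * \<epsilon> * norm x ^ m"
    using add.IH(1) by blast
  obtain D where D: "\<And>\<epsilon> x. 0 < \<epsilon> \<Longrightarrow> \<epsilon> \<le> 1 \<Longrightarrow> \<bar>\<beta> ((1 / \<epsilon>) *\<^sub>R x) * Q x\<bar> \<le> D * \<epsilon> * norm x ^ m"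
    using add.IH(2) by blast
  have "\<bar>\<beta> ((1 / \<epsilon>) *\<^sub>R x) * (P x + Q x)\<bar> \<le> (C + D) * \<epsilon> * norm x ^ m"
    if "0 < \<epsilon>" "\<epsilon> \<le> 1" for \<epsilon> x
    using C[OF that, of x] D[OF that, of x] by (simp add: distrib_left distrib_right)
  then show ?case by blast
qed

text \<open>
  Only finitely many derivatives and powers are concerned for a given \<open>k\<close>, so one constant serves
  for them all.
\<close>

lemma cutoff_uniform_bound:
  fixes \<beta> :: "real ^ 3 \<Rightarrow> real"
  assumes N: "N \<ge> 2" and \<beta>: "smooth \<beta>" "\<And>x. norm x \<ge> 2 \<Longrightarrow> \<beta> x = 0"
    and P: "P \<in> weighted_homogeneous N k"
  shows "\<exists>B\<ge>0. \<forall>\<epsilon>. 0 < \<epsilon> \<and> \<epsilon> \<le> 1 \<longrightarrow>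
    (\<forall>js\<in>lists Basis. N * length js < k \<longrightarrow>
       (\<forall>x. \<bar>iter_deriv js (\<lambda>x. \<beta> ((1 / \<epsilon>) *\<^sub>R x) * P x) x\<bar> \<le> B * \<epsilon>)) \<and>
    (\<forall>m x. N * m < k \<longrightarrow> \<bar>\<beta> ((1 / \<epsilon>) *\<^sub>R x) * P x\<bar> \<le> B * \<epsilon> * norm x ^ m)"
proof -
  define S where "S = {js. set js \<subseteq> (Basis :: (real^3) set) \<and> length js \<le> k}"
  have finS: "finite S" unfolding S_def by (rule finite_lists_length_le) simp
  define boundC where "boundC js c \<longleftrightarrow> (\<forall>\<epsilon>. 0 < \<epsilon> \<and> \<epsilon> \<le> 1 \<longrightarrow>
    (\<forall>x. \<bar>iter_deriv js (\<lambda>x. \<beta> ((1 / \<epsilon>) *\<^sub>R x) * P x) x\<bar> \<le> c * \<epsilon>))" for js c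
  have "\<exists>c. boundC js c" if "js \<in> lists Basis" "N * length js < k" for js
    unfolding boundC_def by (rule cutoff_iter_deriv_bound[OF N \<beta> P that])
  then obtain C where C': "\<And>js. js \<in> lists Basis \<Longrightarrow> N * length js < k \<Longrightarrow> boundC js (C js)"
    by metis
  have C: "\<bar>iter_deriv js (\<lambda>x. \<beta> ((1 / \<epsilon>) *\<^sub>R x) * P x) x\<bar> \<le> C js * \<epsilon>"
    if "js \<in> lists Basis" "N * length js < k" "0 < \<epsilon>" "\<epsilon> \<le> 1" for js \<epsilon> x
    using C'[OF that(1,2)] that(3,4) unfolding boundC_def by blast
  define boundD where "boundD m c \<longleftrightarrow> (\<forall>\<epsilon>. 0 < \<epsilon> \<and> \<epsilon> \<le> 1 \<longrightarrow>
    (\<forall>x. \<bar>\<beta> ((1 / \<epsilon>) *\<^sub>R x) * P x\<bar> \<le> c * \<epsilon> * norm x ^ m))" for m c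
  have "\<exists>c. boundD m c" if "N * m < k" for m
    unfolding boundD_def by (rule cutoff_bound[OF N \<beta> P that])
  then obtain D where D': "\<And>m. N * m < k \<Longrightarrow> boundD m (D m)" by metis
  have D: "\<bar>\<beta> ((1 / \<epsilon>) *\<^sub>R x) * P x\<bar> \<le> D m * \<epsilon> * norm x ^ m"
    if "N * m < k" "0 < \<epsilon>" "\<epsilon> \<le> 1" for m \<epsilon> x
    using D'[OF that(1)] that(2,3) unfolding boundD_def by blast
  define B where "B = (\<Sum>js\<in>S. \<bar>C js\<bar>) + (\<Sum>m<k. \<bar>D m\<bar>)"
  have nn: "(\<Sum>js\<in>S. \<bar>C js\<bar>) \<ge> 0" "(\<Sum>m<k. \<bar>D m\<bar>) \<ge> 0" by (auto intro: sum_nonneg)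
  have len: "m < k" if "N * m < k" for m
    using that N le_less_trans[of m "N * m" k] by simp
  have CB: "C js \<le> B" if "js \<in> lists Basis" "N * length js < k" for js
  proof -
    have "js \<in> S" using that len[OF that(2)] by (auto simp: S_def)
    then have "\<bar>C js\<bar> \<le> (\<Sum>js\<in>S. \<bar>C js\<bar>)" using finS by (intro member_le_sum) auto
    then show ?thesis using nn unfolding B_def by linarith
  qed
  have DB: "D m \<le> B" if "N * m < k" for m
  proof -
    have "\<bar>D m\<bar> \<le> (\<Sum>m<k. \<bar>D m\<bar>)" using len[OF that] by (intro member_le_sum) auto
    then show ?thesis using nn unfolding B_def by linarith
  qed
  show ?thesis
  proof (intro exI[of _ B] conjI allI impI ballI)
    show "B \<ge> 0" using nn by (simp add: B_def)
    fix \<epsilon> :: real assume \<epsilon>: "0 < \<epsilon> \<and> \<epsilon> \<le> 1"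
    show "\<bar>iter_deriv js (\<lambda>x. \<beta> ((1 / \<epsilon>) *\<^sub>R x) * P x) x\<bar> \<le> B * \<epsilon>"
      if "js \<in> lists Basis" "N * length js < k" for js x
      by (rule order_trans[OF C[OF that] mult_right_mono[OF CB[OF that]]]) (use \<epsilon> in auto)
    show "\<bar>\<beta> ((1 / \<epsilon>) *\<^sub>R x) * P x\<bar> \<le> B * \<epsilon> * norm x ^ m" if "N * m < k" for m x
      by (rule order_trans[OF D[OF that] mult_right_mono[OF mult_right_mono[OF DB[OF that]]]]) (use \<epsilon> in auto)
  qed
qed

text \<open>
  Borel's theorem for the grading by weights: the series of the \<open>P k\<close>, cut off at distances \<open>\<epsilon> k\<close>
  that tend to zero fast enough, converges together with all its derivatives, and near the origin
  the cutoffs do not affect any given initial segment.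
\<close>

lemma borel_weighted_homogeneous:
  assumes N: "N \<ge> 2" and P: "\<And>k. P k \<in> weighted_homogeneous N k"
  obtains F where "smooth F"
    "\<And>M. \<exists>C. \<forall>\<^sub>F x in nhds 0. \<bar>F x - (\<Sum>k\<le>N * M. P k x)\<bar> \<le> C * norm x ^ M"
proof -
  obtain \<beta> :: "real ^ 3 \<Rightarrow> real" where \<beta>: "smooth \<beta>" "\<And>x. norm x \<le> 1 \<Longrightarrow> \<beta> x = 1"
    "\<And>x. norm x \<ge> 2 \<Longrightarrow> \<beta> x = 0" by (rule smooth_bump_exists[where 'a = "real ^ 3"]) (rule that)
  define admissible where "admissible k B \<longleftrightarrow> B \<ge> 0 \<and> (\<forall>\<epsilon>. 0 < \<epsilon> \<and> \<epsilon> \<le> 1 \<longrightarrow>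
    (\<forall>js\<in>lists Basis. N * length js < k \<longrightarrow>
       (\<forall>x. \<bar>iter_deriv js (\<lambda>x. \<beta> ((1 / \<epsilon>) *\<^sub>R x) * P k x) x\<bar> \<le> B * \<epsilon>)) \<and>
    (\<forall>m x. N * m < k \<longrightarrow> \<bar>\<beta> ((1 / \<epsilon>) *\<^sub>R x) * P k x\<bar> \<le> B * \<epsilon> * norm x ^ m))" for k B
  have "\<exists>B. admissible k B" for k
    unfolding admissible_def by (rule cutoff_uniform_bound[OF N \<beta>(1,3) P])
  then obtain B where B: "\<And>k. admissible k (B k)" by metis
  have B0: "B k \<ge> 0" for k using B unfolding admissible_def by blast
  have B1: "\<bar>iter_deriv js (\<lambda>x. \<beta> ((1 / \<epsilon>) *\<^sub>R x) * P k x) x\<bar> \<le> B k * \<epsilon>"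
    if "0 < \<epsilon>" "\<epsilon> \<le> 1" "js \<in> lists Basis" "N * length js < k" for k \<epsilon> js x
    using B[of k] that unfolding admissible_def by blast
  have B2: "\<bar>\<beta> ((1 / \<epsilon>) *\<^sub>R x) * P k x\<bar> \<le> B k * \<epsilon> * norm x ^ m"
    if "0 < \<epsilon>" "\<epsilon> \<le> 1" "N * m < k" for k \<epsilon> m x
    using B[of k] that unfolding admissible_def by blast
  \<comment> \<open>This choice turns the bounds \<open>B k * \<epsilon>\<close> into \<open>(1/2) ^ k\<close>.\<close>
  define \<epsilon> where "\<epsilon> k = 1 / ((B k + 1) * 2 ^ k)" for k
  have \<epsilon>: "0 < \<epsilon> k" "\<epsilon> k \<le> 1" "B k * \<epsilon> k \<le> (1/2) ^ k" for k
  proof -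
    have "(1::real) * 1 \<le> (B k + 1) * 2 ^ k" using B0[of k] by (intro mult_mono) auto
    then show "0 < \<epsilon> k" "\<epsilon> k \<le> 1" by (auto simp: \<epsilon>_def)
    have "B k / (B k + 1) \<le> 1" using B0[of k] by simp
    then have "B k / (B k + 1) * (1/2) ^ k \<le> 1 * (1/2) ^ k" by (intro mult_right_mono) auto
    then show "B k * \<epsilon> k \<le> (1/2) ^ k" by (simp add: \<epsilon>_def power_one_over)
  qed
  define T where "T k x = \<beta> ((1 / \<epsilon> k) *\<^sub>R x) * P k x" for k x
  define F where "F x = suminf (\<lambda>k. T k x)" for x
  have T_iter: "\<bar>iter_deriv js (T k) x\<bar> \<le> (1/2) ^ k" if "js \<in> lists Basis" "N * length js < k" for js k x
    using order_trans[OF B1[OF \<epsilon>(1,2) that] \<epsilon>(3)] unfolding T_def .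
  have T_bd: "\<bar>T k x\<bar> \<le> (1/2) ^ k * norm x ^ m" if "N * m < k" for k m x
    using order_trans[OF B2[OF \<epsilon>(1,2) that] mult_right_mono[OF \<epsilon>(3)]] unfolding T_def by simp
  have summ: "summable (\<lambda>k. (1/2::real) ^ k)" by (simp add: summable_geometric)
  have sumT: "summable (\<lambda>k. T k x)" for x
    by (rule summable_comparison_test_ev[OF _ summ])
       (use T_bd[of 0] in \<open>auto simp: eventually_sequentially intro!: exI[of _ 1]\<close>)
  have "smooth F" unfolding F_def
  proof (rule smooth_suminf)
    show "smooth (T k)" for k
      unfolding T_def by (rule cutoff_smooth[OF \<beta>(1) weighted_homogeneous_smooth[OF P]])
    \<comment> \<open>The \<open>k\<close>-th term is under control as soon as \<open>k\<close> exceeds \<open>N\<close> times the order of the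
      derivative.\<close>
    show "\<exists>K. \<forall>k\<ge>K. \<forall>z. \<bar>iter_deriv js (T k) z\<bar> \<le> (1/2) ^ k" if "js \<in> lists Basis" for js
      using T_iter[OF that] by (intro exI[of _ "Suc (N * length js)"]) auto
  qed
  moreover have "\<exists>C. \<forall>\<^sub>F x in nhds 0. \<bar>F x - (\<Sum>k\<le>N * M. P k x)\<bar> \<le> C * norm x ^ M" for M
  proof -
    have near: "\<forall>\<^sub>F x in nhds (0::real^3). norm x < \<epsilon> k" for k
      unfolding eventually_nhds_metric by (intro exI[of _ "\<epsilon> k"]) (use \<epsilon>(1) in auto)
    have "\<forall>\<^sub>F x in nhds (0::real^3). \<forall>k\<in>{..N * M}. norm x < \<epsilon> k"
      by (rule eventually_ball_finite) (use near in auto)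
    then have "\<forall>\<^sub>F x in nhds 0. \<bar>F x - (\<Sum>k\<le>N * M. P k x)\<bar> \<le> 2 * norm x ^ M"
    proof eventually_elim
      case (elim x)
      have "T k x = P k x" if "k \<le> N * M" for k
      proof -
        have "norm x < \<epsilon> k" using elim that by auto
        then have "norm ((1 / \<epsilon> k) *\<^sub>R x) \<le> 1" using \<epsilon>(1)[of k] by (simp add: field_simps)
        then show ?thesis by (simp add: T_def \<beta>(2))
      qed
      then have "(\<Sum>k\<le>N * M. P k x) = (\<Sum>k<Suc (N * M). T k x)"
        by (simp add: lessThan_Suc_atMost)
      then have "F x - (\<Sum>k\<le>N * M. P k x) = suminf (\<lambda>n. T (n + Suc (N * M)) x)"
        using suminf_split_initial_segment[OF sumT, of x "Suc (N * M)"] by (simp add: F_def)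
      also have "norm \<dots> \<le> suminf (\<lambda>n. (1/2) ^ n * norm x ^ M)"
      proof (rule norm_suminf_le)
        fix n
        have "\<bar>T (n + Suc (N * M)) x\<bar> \<le> (1/2) ^ (n + Suc (N * M)) * norm x ^ M"
          by (rule T_bd) simp
        also have "\<dots> \<le> (1/2) ^ n * norm x ^ M"
          by (intro mult_right_mono power_decreasing) auto
        finally show "norm (T (n + Suc (N * M)) x) \<le> (1/2) ^ n * norm x ^ M" by simp
      qed (intro summable_mult2 summ)
      also have "suminf (\<lambda>n. (1/2) ^ n * norm x ^ M) = 2 * norm x ^ M"
        using suminf_geometric[of "1/2::real"] by (simp add: suminf_mult2[OF summ, symmetric])
      finally show ?case by simp
    qed
    then show ?thesis by blast
  qed
  ultimately show ?thesis using that by blast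
qed

section \<open>Smooth invariants of the cyclic group\<close>

lemma norm_root_unity:
  fixes u :: complex
  assumes "u ^ N = 1" "N > 0"
  shows "cmod u = 1"
proof -
  have "cmod u ^ N = 1" using assms(1) by (metis norm_one norm_power)
  then show ?thesis using power_eq_imp_eq_base[of "cmod u" N 1] assms(2) by simp
qed

lemma cyclic_coords_invariant:
  assumes "u ^ N = 1" "N > 0"
  shows "cyclic_coords N (u * z) = cyclic_coords N z"
  using assms norm_root_unity[OF assms] by (simp add: power_mult_distrib norm_mult)

lemma smooth_cyclic_coords: "smooth (\<lambda>z. cyclic_coords N z $ i)"
proof -
  have "smooth (\<lambda>z. Re (1 * z ^ N * cnj z ^ 0))" "smooth (\<lambda>z. Im (1 * z ^ N * cnj z ^ 0))"
    by (rule smooth_complex_monomial)+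
  then show ?thesis using smooth_norm_square[where 'a = complex] exhaust_3[of i]
    by (auto simp: vector_3)
qed

lemma smooth_compose_vec:
  fixes g :: "'a::euclidean_space \<Rightarrow> real ^ 'n"
  assumes "smooth f" "\<And>i. smooth (\<lambda>z. g z $ i)"
  shows "smooth (\<lambda>z. f (g z))"
proof (rule smooth_compose[OF assms(1)])
  fix b :: "real ^ 'n" assume "b \<in> Basis"
  then obtain i where "b = axis i 1" by (auto simp: Basis_vec_def)
  then show "smooth (\<lambda>z. g z \<bullet> b)" using assms(2)[of i] by (simp add: inner_axis inner_real_def)
qed

text \<open>
  Schwarz's theorem for the cyclic group. The Taylor terms of \<open>f\<close> at the origin are invariant,
  hence equal to their averages, hence weighted homogeneous polynomials in the invariants. A
  smooth function \<open>F1\<close> with these polynomials as its expansion accounts for \<open>f\<close> up to a flat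
  invariant function, which is a smooth function of \<open>z ^ N\<close>.
\<close>

theorem smooth_cyclic_invariant_factors:
  fixes f :: "complex \<Rightarrow> real"
  assumes N: "N \<ge> 2" and f: "smooth f" and inv: "\<And>u z. u ^ N = 1 \<Longrightarrow> f (u * z) = f z"
  obtains F where "smooth (F :: real ^ 3 \<Rightarrow> real)" "\<And>z. f z = F (cyclic_coords N z)"
proof -
  have N0: "N > 0" using N by simp
  let ?\<tau> = "\<lambda>k z. taylor_term k f z 0"
  define \<omega> where "\<omega> = exp (2 * of_real pi * \<i> / of_nat N)"
  have \<omega>: "(\<omega> ^ j) ^ N = 1" for j
  proof -
    have "\<omega> ^ N = 1" using complex_root_unity[of N 1] N0 by (simp add: \<omega>_def)
    then show ?thesis by (metis mult.commute power_mult power_one)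
  qed
  have \<tau>_inv: "?\<tau> k (u * z) = ?\<tau> k z" if "u ^ N = 1" for k u z
  proof -
    have "f (s *\<^sub>R (u * z)) = f (s *\<^sub>R z)" for s
      using inv[OF that, of "s *\<^sub>R z"] by (simp only: mult_scaleR_right)
    from taylor_term_cong_ray[OF f this, of k 0] show ?thesis by simp
  qed
  have "\<exists>P\<in>weighted_homogeneous N k. \<forall>z. ?\<tau> k z / fact k = P (cyclic_coords N z)" for k
  proof -
    obtain P where P: "P \<in> weighted_homogeneous N k" "\<And>z. Re ((\<Sum>j<N. complex_of_real (?\<tau> k (\<omega> ^ j * z))) / of_nat N) = P (cyclic_coords N z)"
      using average_homogeneous_z_cnj[OF N0 taylor_term_homogeneous_z_cnj[of k f 0]] unfolding \<omega>_def by blast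
    have "?\<tau> k z = P (cyclic_coords N z)" for z
      using P(2)[of z] N0 by (simp add: \<tau>_inv[OF \<omega>])
    then show ?thesis
      using weighted_homogeneous_mult_monom[OF P(1), of "1 / fact k" 0 0 0]
      by (intro bexI[of _ "\<lambda>x. (1 / fact k * (x $ 1) ^ 0 * (x $ 2) ^ 0 * (x $ 3) ^ 0) * P x"]) auto
  qed
  then obtain P where P: "\<And>k. P k \<in> weighted_homogeneous N k"
    and \<tau>P: "\<And>k z. ?\<tau> k z / fact k = P k (cyclic_coords N z)" by metis
  obtain F1 where F1: "smooth F1"
    "\<And>M. \<exists>C. \<forall>\<^sub>F x in nhds 0. \<bar>F1 x - (\<Sum>k\<le>N * M. P k x)\<bar> \<le> C * norm x ^ M"
    using borel_weighted_homogeneous[OF N P] by blast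
  define h where "h z = f z - F1 (cyclic_coords N z)" for z
  have "smooth h" unfolding h_def
    by (intro smooth_diff f smooth_compose_vec[OF F1(1)] smooth_cyclic_coords)
  moreover have "flat h" unfolding flat_def
  proof
    fix K
    \<comment> \<open>Both expansions are taken up to degree \<open>N * K\<close> in \<open>z\<close>: this is what it takes for the
      remainder of \<open>F1\<close> to be of order \<open>K\<close>.\<close>
    obtain C where C: "\<And>z. norm z \<le> 1 \<Longrightarrow> \<bar>f z - (\<Sum>k<Suc (N * K). ?\<tau> k z / fact k)\<bar> \<le> C * norm z ^ Suc (N * K)"
      using taylor_approximation[OF f] by blast
    obtain D where D: "\<forall>\<^sub>F x in nhds 0. \<bar>F1 x - (\<Sum>k\<le>N * K. P k x)\<bar> \<le> D * norm x ^ K"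
      using F1(2) by blast
    have "continuous_on UNIV (\<lambda>z. cyclic_coords N z)"
      by (subst vec_lambda_eta[symmetric], rule continuous_on_vec_lambda)
         (rule smooth_continuous[OF smooth_cyclic_coords])
    then have "isCont (\<lambda>z. cyclic_coords N z) 0"
      using continuous_on_eq_continuous_at[OF open_UNIV] by blast
    then have "((\<lambda>z. cyclic_coords N z) \<longlongrightarrow> cyclic_coords N 0) (nhds 0)"
      unfolding isCont_def by (rule iffD1[OF tendsto_at_iff_tendsto_nhds])
    moreover have "cyclic_coords N 0 = 0"
      using N0 by (simp add: vec_eq_iff forall_3 vector_3 zero_power)
    ultimately have "filterlim (cyclic_coords N) (nhds 0) (nhds 0)" by simp
    from filterlim_iff[THEN iffD1, OF this, rule_format, OF D]
    have "\<forall>\<^sub>F z in nhds 0. \<bar>F1 (cyclic_coords N z) - (\<Sum>k\<le>N * K. P k (cyclic_coords N z))\<bar>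
        \<le> D * norm (cyclic_coords N z) ^ K" .
    moreover have "\<forall>\<^sub>F z in nhds (0::complex). norm z < 1"
      unfolding eventually_nhds_metric by (intro exI[of _ 1]) simp
    ultimately have "\<forall>\<^sub>F z in nhds 0. \<bar>h z\<bar> \<le> (\<bar>C\<bar> + \<bar>D\<bar> * 3 ^ K) * norm z ^ K"
    proof eventually_elim
      case (elim z)
      then have z: "norm z \<le> 1" by simp
      have pw: "norm z ^ j \<le> norm z" if "j \<ge> 1" for j
        using power_decreasing[OF that, of "norm z"] z by simp
      have "norm (cyclic_coords N z) \<le> (\<Sum>i\<in>UNIV. \<bar>cyclic_coords N z $ i\<bar>)"
        by (rule norm_le_l1_cart)
      also have "\<dots> = \<bar>Re (z ^ N)\<bar> + \<bar>Im (z ^ N)\<bar> + (cmod z)\<^sup>2"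
        by (simp add: sum_3 vector_3)
      also have "\<dots> \<le> 3 * norm z"
        using abs_Re_le_cmod[of "z ^ N"] abs_Im_le_cmod[of "z ^ N"] pw[of N] pw[of 2] N0
        by (simp add: norm_power)
      finally have "norm (cyclic_coords N z) ^ K \<le> (3 * norm z) ^ K" by (intro power_mono) auto
      then have "\<bar>D\<bar> * norm (cyclic_coords N z) ^ K \<le> \<bar>D\<bar> * 3 ^ K * norm z ^ K"
        unfolding power_mult_distrib mult.assoc by (intro mult_left_mono) auto
      moreover have "D * norm (cyclic_coords N z) ^ K \<le> \<bar>D\<bar> * norm (cyclic_coords N z) ^ K"
        by (intro mult_right_mono) auto
      moreover have "C * norm z ^ Suc (N * K) \<le> \<bar>C\<bar> * norm z ^ K"
      proof (intro mult_mono power_decreasing)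
        show "K \<le> Suc (N * K)" using N0 by (simp add: le_SucI)
      qed (use z in auto)
      moreover have "(\<Sum>k<Suc (N * K). ?\<tau> k z / fact k) = (\<Sum>k\<le>N * K. P k (cyclic_coords N z))"
        by (simp add: \<tau>P lessThan_Suc_atMost)
      ultimately show ?case using C[OF z] elim(1)
        unfolding h_def distrib_right by linarith
    qed
    then show "\<exists>C. \<forall>\<^sub>F z in nhds 0. \<bar>h z\<bar> \<le> C * norm z ^ K" by blast
  qed
  moreover have "h (u * z) = h z" if "u ^ N = 1" for u z
    unfolding h_def cyclic_coords_invariant[OF that N0] inv[OF that] ..
  ultimately obtain H where H: "smooth H" "\<And>z. H (z ^ N) = h z"
    using flat_descends_to_power_quotient[OF N0] by metis
  show ?thesis
  proof
    show "smooth (\<lambda>x. F1 x + H (Complex (x $ 1) (x $ 2)))"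
    proof (intro smooth_add F1(1) smooth_compose[OF H(1)])
      fix b :: complex
      have "smooth (\<lambda>x::real^3. (x $ 1) * Re b + (x $ 2) * Im b)"
        by (intro smooth_add smooth_mult smooth_nth smooth_const)
      then show "smooth (\<lambda>x::real^3. Complex (x $ 1) (x $ 2) \<bullet> b)" by (simp add: inner_complex_def)
    qed
    show "f z = F1 (cyclic_coords N z) + H (Complex (cyclic_coords N z $ 1) (cyclic_coords N z $ 2))" for z
      using H(2)[of z] by (simp add: vector_3 h_def)
  qed
qed

section \<open>Polynomial algebras\<close>

text \<open>
  The conditions on the map of coefficients under which \<open>poly_hom\<close> is a homomorphism. They cover
  evaluation, where it is the identity, and substitution, where it is \<open>Const\<close>.
\<close>

definition semiring_hom :: "('a::comm_semiring_1 \<Rightarrow> 'b::comm_semiring_1) \<Rightarrow> bool" where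
  "semiring_hom c \<longleftrightarrow> c 0 = 0 \<and> c 1 = 1 \<and> (\<forall>r s. c (r + s) = c r + c s) \<and> (\<forall>r s. c (r * s) = c r * c s)"

lemma semiring_hom_id [simp]: "semiring_hom (\<lambda>r. r)"
  by (simp add: semiring_hom_def)

lemma semiring_hom_Const [simp]: "semiring_hom (Const :: real \<Rightarrow> 'k rpoly)"
  by (simp add: semiring_hom_def Const_def single_add mult_single)

lemma rpoly_additive_induct [case_names zero add]:
  assumes "P (0 :: 'k rpoly)" "\<And>p m a. P p \<Longrightarrow> P (p + Poly_Mapping.single m a)"
  shows "P p"
proof (induction p rule: update_induct)
  case (update f a b)
  have "Poly_Mapping.update a b f = f + Poly_Mapping.single a b"
    using update(1) by (intro poly_mapping_eqI) (auto simp: lookup_update lookup_add lookup_single when_def in_keys_iff)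
  then show ?case using assms(2)[OF update(3)] by simp
qed (rule assms(1))

lemma poly_hom_superset:
  assumes "c 0 = 0" "finite S" "Poly_Mapping.keys p \<subseteq> S"
  shows "poly_hom c g p = (\<Sum>m\<in>S. c (Poly_Mapping.lookup p m) * (\<Prod>i\<in>UNIV. g i ^ Poly_Mapping.lookup m i))"
  unfolding poly_hom_def using assms
  by (intro sum.mono_neutral_left) (auto simp: in_keys_iff)

lemma poly_hom_single:
  assumes "c 0 = 0"
  shows "poly_hom c g (Poly_Mapping.single m a) = c a * (\<Prod>i\<in>UNIV. g i ^ Poly_Mapping.lookup m i)"
  using poly_hom_superset[of c "{m}" "Poly_Mapping.single m a" g] assms by (simp add: lookup_single)

lemma poly_hom_add:
  assumes "semiring_hom c"
  shows "poly_hom c g (p + q) = poly_hom c g p + poly_hom c g q"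
proof -
  let ?S = "Poly_Mapping.keys p \<union> Poly_Mapping.keys q"
  have c: "c 0 = 0" "c (r + s) = c r + c s" for r s
    using assms by (auto simp: semiring_hom_def)
  have "Poly_Mapping.keys (p + q) \<subseteq> ?S" by (rule Poly_Mapping.keys_add)
  then show ?thesis
    using poly_hom_superset[of c ?S _ g] c
    by (simp add: lookup_add distrib_right sum.distrib)
qed

lemma poly_hom_zero: "poly_hom c g 0 = 0"
  by (simp add: poly_hom_def)

lemma poly_hom_mult:
  assumes c: "semiring_hom c"
  shows "poly_hom c g (p * q) = poly_hom c g p * poly_hom c g q"
proof (induction p rule: rpoly_additive_induct)
  case (add p m a)
  have c0: "c 0 = 0" and cm: "c (r * s) = c r * c s" for r s
    using c by (auto simp: semiring_hom_def)
  have "poly_hom c g (Poly_Mapping.single m a * q) = poly_hom c g (Poly_Mapping.single m a) * poly_hom c g q" for q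
  proof (induction q rule: rpoly_additive_induct)
    case (add q n b)
    have "poly_hom c g (Poly_Mapping.single m a * Poly_Mapping.single n b) =
        poly_hom c g (Poly_Mapping.single m a) * poly_hom c g (Poly_Mapping.single n b)"
      by (simp add: mult_single poly_hom_single[of c, OF c0] cm lookup_add power_add prod.distrib mult_ac)
    then show ?case by (simp add: distrib_left poly_hom_add[OF c] add)
  qed (simp add: poly_hom_zero)
  then show ?case by (simp add: distrib_right poly_hom_add[OF c] add)
qed (simp add: poly_hom_zero)

lemma poly_hom_Const:
  assumes "semiring_hom c"
  shows "poly_hom c g (Const r) = c r"
  using assms unfolding Const_def by (subst poly_hom_single) (auto simp: semiring_hom_def)

lemma poly_hom_Var:
  assumes "semiring_hom c"
  shows "poly_hom c g (Var i) = g i"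
proof -
  have "(\<Prod>j\<in>UNIV. g j ^ Poly_Mapping.lookup (Poly_Mapping.single i 1) j) = (\<Prod>j\<in>UNIV. if j = i then g i else 1)"
    by (intro prod.cong) (auto simp: lookup_single when_def)
  then show ?thesis
    using assms unfolding Var_def by (subst poly_hom_single) (auto simp: semiring_hom_def)
qed

lemma poly_alg_hom_poly_subst: "poly_alg_hom (poly_subst g)"
  unfolding poly_alg_hom_def by (simp add: poly_hom_Const poly_hom_add poly_hom_mult)

lemma Var_power: "Var i ^ k = Poly_Mapping.single (Poly_Mapping.single i k) 1"
  by (induction k) (simp_all add: Var_def mult_single flip: single_add)

lemma prod_Var_power:
  "finite S \<Longrightarrow> (\<Prod>i\<in>S. Var i ^ k i) = Poly_Mapping.single (\<Sum>i\<in>S. Poly_Mapping.single i (k i)) 1"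
  by (induction S rule: finite_induct) (simp_all add: Var_power mult_single)

lemma single_eq_Const_times_prod_Var:
  "Poly_Mapping.single m a = Const a * (\<Prod>i\<in>UNIV. Var (i::'k::finite) ^ Poly_Mapping.lookup m i)"
proof -
  have "(\<Sum>i\<in>UNIV. Poly_Mapping.single i (Poly_Mapping.lookup m i)) = m"
    by (intro poly_mapping_eqI) (simp add: lookup_sum lookup_single when_def)
  then show ?thesis by (simp add: prod_Var_power Const_def mult_single)
qed

text \<open>Polynomials are generated as an algebra by the constants and the variables.\<close>

lemma rpoly_induct [case_names Const Var add mult]:
  fixes p :: "'k::finite rpoly"
  assumes Const: "\<And>c. P (Const c)" and Var: "\<And>i. P (Var i)"
    and add: "\<And>p q. P p \<Longrightarrow> P q \<Longrightarrow> P (p + q)" and mult: "\<And>p q. P p \<Longrightarrow> P q \<Longrightarrow> P (p * q)"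
  shows "P p"
proof (induction p rule: rpoly_additive_induct)
  case zero
  show ?case using Const[of 0] by (simp add: Const_def)
next
  case (add p m a)
  have one: "P 1" using Const[of 1] by (simp add: Const_def)
  have "P (Var i ^ k)" for i k by (induction k) (auto intro: one Var mult)
  then have "P (\<Prod>i\<in>S. Var i ^ k i)" for S k
    by (induction S rule: infinite_finite_induct) (auto intro: one mult)
  then show ?case unfolding single_eq_Const_times_prod_Var by (intro assms add Const)
qed

lemma poly_eval_poly_subst: "poly_eval x (poly_subst g p) = poly_eval (\<lambda>v. poly_eval x (g v)) p"
  by (induction p rule: rpoly_induct) (simp_all add: poly_hom_Const poly_hom_Var poly_hom_add poly_hom_mult)

lemma smooth_poly_eval:
  assumes "\<And>i. smooth (\<rho> i)"
  shows "smooth (\<lambda>z. poly_eval (\<lambda>i. \<rho> i z) p)"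
  by (induction p rule: rpoly_induct)
     (simp_all add: poly_hom_Const poly_hom_Var poly_hom_add poly_hom_mult assms smooth_add smooth_mult)

lemma smooth_fun_poly_eval: "(\<lambda>y. poly_eval y p) \<in> smooth_fun UNIV"
  by (induction p rule: rpoly_induct)
     (simp_all add: poly_hom_Const poly_hom_Var poly_hom_add poly_hom_mult smooth_fun_add smooth_fun_mult smooth_fun_coord)

section \<open>Weight gradings\<close>

definition weight :: "('k::finite \<Rightarrow> int) \<Rightarrow> ('k \<Rightarrow>\<^sub>0 nat) \<Rightarrow> int" where
  "weight w m = (\<Sum>i\<in>UNIV. int (Poly_Mapping.lookup m i) * w i)"

lemma weight_grading_iff: "p \<in> weight_grading w d \<longleftrightarrow> (\<forall>m\<in>Poly_Mapping.keys p. weight w m = d)"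
  by (simp add: weight_grading_def weight_def)

lemma weight_add: "weight w (m + n) = weight w m + weight w n"
  by (simp add: weight_def lookup_add distrib_right sum.distrib)

lemma weight_grading_zero: "0 \<in> weight_grading w d"
  by (simp add: weight_grading_iff)

lemma weight_grading_add:
  "p \<in> weight_grading w d \<Longrightarrow> q \<in> weight_grading w d \<Longrightarrow> p + q \<in> weight_grading w d"
  using Poly_Mapping.keys_add[of p q] unfolding weight_grading_iff by blast

lemma weight_grading_mult:
  "p \<in> weight_grading w d \<Longrightarrow> q \<in> weight_grading w e \<Longrightarrow> p * q \<in> weight_grading w (d + e)"
  using keys_mult[of p q] unfolding weight_grading_iff by (auto simp: weight_add)

lemma weight_grading_Const: "Const r \<in> weight_grading w 0"
  by (simp add: weight_grading_iff Const_def weight_def)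

lemma weight_grading_Var: "Var i \<in> weight_grading w (w i)"
proof -
  have "weight w (Poly_Mapping.single i 1) = (\<Sum>j\<in>UNIV. if j = i then w i else 0)"
    unfolding weight_def by (intro sum.cong) (auto simp: lookup_single when_def)
  then show ?thesis by (simp add: weight_grading_iff Var_def)
qed

lemma weight_grading_Const_mult:
  "p \<in> weight_grading w d \<Longrightarrow> Const r * p \<in> weight_grading w d"
  using weight_grading_mult[OF weight_grading_Const, of p w d r] by simp

lemma weight_grading_sum:
  "(\<And>i. i \<in> S \<Longrightarrow> p i \<in> weight_grading w d) \<Longrightarrow> (\<Sum>i\<in>S. p i) \<in> weight_grading w d"
  by (induction S rule: infinite_finite_induct) (auto intro: weight_grading_zero weight_grading_add)

lemma weight_grading_power: "p \<in> weight_grading w d \<Longrightarrow> p ^ k \<in> weight_grading w (int k * d)"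
proof (induction k)
  case 0
  then show ?case using weight_grading_Const[of 1 w] by (simp add: Const_def)
next
  case (Suc k)
  then show ?case using weight_grading_mult[of p w d "p ^ k" "int k * d"] by (simp add: algebra_simps)
qed

lemma weight_grading_prod_power:
  assumes "\<And>i. g i \<in> weight_grading w (e i)"
  shows "finite S \<Longrightarrow> (\<Prod>i\<in>S. g i ^ k i) \<in> weight_grading w (\<Sum>i\<in>S. int (k i) * e i)"
proof (induction S rule: finite_induct)
  case empty
  then show ?case using weight_grading_Const[of 1 w] by (simp add: Const_def)
qed (simp add: weight_grading_mult weight_grading_power assms)

lemma poly_subst_weight_grading:
  assumes "\<And>i. g i \<in> weight_grading w' (w i)" "p \<in> weight_grading w d"
  shows "poly_subst g p \<in> weight_grading w' d"
  unfolding poly_hom_def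
proof (intro weight_grading_sum weight_grading_Const_mult)
  fix m assume "m \<in> Poly_Mapping.keys p"
  then have "weight w m = d" using assms(2) by (simp add: weight_grading_iff)
  then show "(\<Prod>i\<in>UNIV. g i ^ Poly_Mapping.lookup m i) \<in> weight_grading w' d"
    using weight_grading_prod_power[of g w' w UNIV, OF assms(1)] by (auto simp: weight_def)
qed

definition weight_component :: "('k::finite \<Rightarrow> int) \<Rightarrow> 'k rpoly \<Rightarrow> int \<Rightarrow> 'k rpoly" where
  "weight_component w p d =
     (\<Sum>m | m \<in> Poly_Mapping.keys p \<and> weight w m = d. Poly_Mapping.single m (Poly_Mapping.lookup p m))"

lemma lookup_weight_component:
  "Poly_Mapping.lookup (weight_component w p d) m = (if weight w m = d then Poly_Mapping.lookup p m else 0)"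
proof -
  have "Poly_Mapping.lookup (weight_component w p d) m =
      (\<Sum>k | k \<in> Poly_Mapping.keys p \<and> weight w k = d. if k = m then Poly_Mapping.lookup p m else 0)"
    unfolding weight_component_def lookup_sum
    by (intro sum.cong) (auto simp: lookup_single when_def)
  then show ?thesis by (simp add: sum.delta in_keys_iff)
qed

text \<open>
  Existence and uniqueness of the decomposition into homogeneous components, in one statement.
\<close>

lemma homog_components_weight_grading_iff:
  "homog_components (weight_grading w) p c \<longleftrightarrow> c = weight_component w p"
proof
  assume c: "homog_components (weight_grading w) p c"
  then have fin: "finite {d. c d \<noteq> 0}" and p: "p = (\<Sum>d | c d \<noteq> 0. c d)"
    and deg: "c d \<in> weight_grading w d" for d
    by (auto simp: homog_components_def)
  have zero: "Poly_Mapping.lookup (c d) m = 0" if "weight w m \<noteq> d" for d m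
    using deg[of d] that by (auto simp: weight_grading_iff in_keys_iff)
  have "Poly_Mapping.lookup p m = Poly_Mapping.lookup (c (weight w m)) m" for m
  proof -
    have "Poly_Mapping.lookup p m = (\<Sum>d | c d \<noteq> 0. Poly_Mapping.lookup (c d) m)"
      by (subst p) (simp add: lookup_sum)
    also have "\<dots> = (\<Sum>d | c d \<noteq> 0. if d = weight w m then Poly_Mapping.lookup (c (weight w m)) m else 0)"
      by (intro sum.cong refl) (use zero in auto)
    also have "\<dots> = Poly_Mapping.lookup (c (weight w m)) m"
      using fin by (auto simp: sum.delta)
    finally show ?thesis .
  qed
  then have "Poly_Mapping.lookup (c d) m = Poly_Mapping.lookup (weight_component w p d) m" for d m
    using zero by (auto simp: lookup_weight_component)
  then show "c = weight_component w p" by (intro ext poly_mapping_eqI)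
next
  assume c: "c = weight_component w p"
  have sub: "{d. weight_component w p d \<noteq> 0} \<subseteq> weight w ` Poly_Mapping.keys p"
  proof
    fix d assume "d \<in> {d. weight_component w p d \<noteq> 0}"
    then obtain m where "Poly_Mapping.lookup (weight_component w p d) m \<noteq> 0"
      by (metis lookup_zero mem_Collect_eq poly_mapping_eqI)
    then show "d \<in> weight w ` Poly_Mapping.keys p"
      by (auto simp: lookup_weight_component in_keys_iff split: if_splits)
  qed
  then have fin: "finite {d. weight_component w p d \<noteq> 0}" by (rule finite_subset) simp
  have "p = (\<Sum>d | weight_component w p d \<noteq> 0. weight_component w p d)"
  proof (rule poly_mapping_eqI)
    fix m
    have "(\<Sum>d | weight_component w p d \<noteq> 0. Poly_Mapping.lookup (weight_component w p d) m) =
        (\<Sum>d | weight_component w p d \<noteq> 0. if d = weight w m then Poly_Mapping.lookup p m else 0)"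
      by (intro sum.cong refl) (auto simp: lookup_weight_component)
    also have "\<dots> = Poly_Mapping.lookup p m"
    proof (cases "Poly_Mapping.lookup p m = 0")
      case False
      then have "weight_component w p (weight w m) \<noteq> 0"
        using lookup_weight_component[of w p "weight w m" m] by auto
      then show ?thesis using fin by (simp add: sum.delta)
    next
      case True
      then show ?thesis by (auto intro!: sum.neutral)
    qed
    finally show "Poly_Mapping.lookup p m =
        Poly_Mapping.lookup (\<Sum>d | weight_component w p d \<noteq> 0. weight_component w p d) m"
      by (simp add: lookup_sum)
  qed
  moreover have "weight_component w p d \<in> weight_grading w d" for d
    by (auto simp: weight_grading_iff in_keys_iff lookup_weight_component split: if_splits)
  ultimately show "homog_components (weight_grading w) p c"
    using fin by (simp add: homog_components_def c)
qed

lemma z_grading_weight_grading: "z_grading (weight_grading w)"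
  unfolding z_grading_def homog_components_weight_grading_iff
  by (simp add: weight_grading_zero weight_grading_add weight_grading_Const_mult weight_grading_mult)

lemma poly_eval_rescale:
  assumes "p \<in> weight_grading (\<lambda>i. int (v i)) d"
  shows "poly_eval (\<lambda>i. t ^ v i * x i) p = t ^ nat d * poly_eval x p"
  unfolding poly_hom_def sum_distrib_left
proof (intro sum.cong refl)
  fix m assume "m \<in> Poly_Mapping.keys p"
  then have "d = (\<Sum>i\<in>UNIV. int (Poly_Mapping.lookup m i) * int (v i))"
    using assms by (simp add: weight_grading_iff weight_def)
  then have "nat d = (\<Sum>i\<in>UNIV. Poly_Mapping.lookup m i * v i)"
    by (simp flip: of_nat_mult of_nat_sum)
  then have "(\<Prod>i\<in>UNIV. (t ^ v i * x i) ^ Poly_Mapping.lookup m i) = t ^ nat d * (\<Prod>i\<in>UNIV. x i ^ Poly_Mapping.lookup m i)"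
    by (simp add: power_mult_distrib prod.distrib power_sum mult.commute flip: power_mult)
  then show "Poly_Mapping.lookup p m * (\<Prod>i\<in>UNIV. (t ^ v i * x i) ^ Poly_Mapping.lookup m i) =
      t ^ nat d * (Poly_Mapping.lookup p m * (\<Prod>i\<in>UNIV. x i ^ Poly_Mapping.lookup m i))"
    by simp
qed

text \<open>
  The weighted dilation by \<open>t\<close> multiplies the value of the component of degree \<open>d\<close> by \<open>t ^ d\<close>. On
  a set stable under dilations, the values of the components of \<open>p\<close> at a point are thus the
  coefficients of a polynomial in \<open>t\<close> that vanishes for all positive \<open>t\<close>.
\<close>

lemma homogeneous_ideal_of_cone:
  assumes J: "\<And>p. p \<in> J \<longleftrightarrow> (\<forall>x\<in>S. poly_eval x p = 0)"
    and S: "\<And>x t. x \<in> S \<Longrightarrow> t > 0 \<Longrightarrow> (\<lambda>i. t ^ v i * x i) \<in> S"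
  shows "homogeneous_ideal (weight_grading (\<lambda>i. int (v i))) J"
  unfolding homogeneous_ideal_def
proof (intro ballI allI impI)
  fix p c d assume "p \<in> J" and c: "homog_components (weight_grading (\<lambda>i. int (v i))) p c"
  then have fin: "finite {d. c d \<noteq> 0}" and p: "p = (\<Sum>d | c d \<noteq> 0. c d)"
    and deg: "c d \<in> weight_grading (\<lambda>i. int (v i)) d" for d
    by (auto simp: homog_components_def)
  have nonneg: "d \<ge> 0" if "c d \<noteq> 0" for d
  proof -
    have "Poly_Mapping.keys (c d) \<noteq> {}" using that by simp
    then obtain m where "m \<in> Poly_Mapping.keys (c d)" by blast
    then have "d = weight (\<lambda>i. int (v i)) m" using deg[of d] by (simp add: weight_grading_iff)
    then show ?thesis by (simp add: weight_def sum_nonneg)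
  qed
  have eval_sum: "poly_eval x (\<Sum>d\<in>D. c d) = (\<Sum>d\<in>D. poly_eval x (c d))" for x and D :: "int set"
    by (induction D rule: infinite_finite_induct) (simp_all add: poly_hom_zero poly_hom_add)
  show "c d \<in> J"
    unfolding J
  proof
    fix x assume x: "x \<in> S"
    define q where "q = (\<Sum>d | c d \<noteq> 0. monom (poly_eval x (c d)) (nat d))"
    have "poly q t = 0" if "t > 0" for t
    proof -
      have "poly q t = (\<Sum>d | c d \<noteq> 0. poly_eval (\<lambda>i. t ^ v i * x i) (c d))"
        unfolding q_def poly_sum poly_monom poly_eval_rescale[OF deg] by (intro sum.cong refl mult.commute)
      also have "\<dots> = poly_eval (\<lambda>i. t ^ v i * x i) p" by (subst p) (simp add: eval_sum)
      also have "\<dots> = 0" using \<open>p \<in> J\<close> S[OF x that] unfolding J by blast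
      finally show ?thesis .
    qed
    then have "{0<..} \<subseteq> {t. poly q t = 0}" by auto
    then have "infinite {t. poly q t = 0}" using infinite_Ioi infinite_super by blast
    then have "q = 0" using poly_roots_finite by blast
    show "poly_eval x (c d) = 0"
    proof (cases "c d = 0")
      case False
      have "coeff q (nat d) = (\<Sum>e | c e \<noteq> 0. if e = d then poly_eval x (c d) else 0)"
        unfolding q_def coeff_sum coeff_monom
        by (intro sum.cong refl) (use nonneg False in \<open>auto simp: nat_eq_iff2\<close>)
      also have "\<dots> = poly_eval x (c d)" using fin False by (simp add: sum.delta)
      finally show ?thesis using \<open>q = 0\<close> by simp
    qed (simp add: poly_hom_zero)
  qed
qed

section \<open>Charts\<close>

text \<open>
  A chart is determined by its coordinate functions: \<open>\<phi> p\<close> is the polynomial \<open>p\<close> in the functions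
  \<open>\<phi> (Var i)\<close>.
\<close>

lemma chart_hom_eval:
  fixes \<phi> :: "'k::finite rpoly \<Rightarrow> 'p \<Rightarrow> real"
  assumes \<phi>: "chart_hom X \<phi>" and \<xi>: "\<xi> \<in> pts X"
  shows "\<phi> p \<xi> = poly_eval (chart_map \<phi> \<xi>) p"
proof (induction p rule: rpoly_induct)
  case (Const c)
  then show ?case using \<phi> \<xi> by (simp add: chart_hom_def poly_hom_Const fconst_def)
next
  case (Var i)
  then show ?case by (simp add: poly_hom_Var chart_map_def)
next
  case (add p q)
  then show ?case using \<phi> \<xi> by (simp add: chart_hom_def poly_hom_add fadd_def)
next
  case (mult p q)
  then show ?case using \<phi> \<xi> by (simp add: chart_hom_def poly_hom_mult fmult_def)
qed

lemma differential_spaceD: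
  assumes "differential_space X"
  shows "Cinf X \<subseteq> extensional (pts X)"
    and "\<forall>f\<in>Cinf X. continuous_map (space_top X) euclideanreal f"
    and "\<forall>c. fconst X c \<in> Cinf X"
    and "\<forall>f\<in>Cinf X. \<forall>g\<in>Cinf X. fadd X f g \<in> Cinf X \<and> fmult X f g \<in> Cinf X"
    and "space_top X = topology_generated_by {f -` U \<inter> pts X | f U. f \<in> Cinf X \<and> open U}"
    and "\<forall>k. \<forall>F\<in>smooth_fun {..<k::nat}. \<forall>f\<in>{..<k} \<rightarrow> Cinf X. (\<lambda>\<xi>\<in>pts X. F (\<lambda>i. f i \<xi>)) \<in> Cinf X"
    and "\<forall>f\<in>extensional (pts X).
        (\<forall>\<xi>\<in>pts X. \<exists>U g. openin (space_top X) U \<and> \<xi> \<in> U \<and> g \<in> Cinf X \<and> (\<forall>\<eta>\<in>U. f \<eta> = g \<eta>))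
        \<longrightarrow> f \<in> Cinf X"
proof -
  note X = assms[unfolded differential_space_def]
  show "Cinf X \<subseteq> extensional (pts X)"
    using X by (elim conjE)
  show "\<forall>f\<in>Cinf X. continuous_map (space_top X) euclideanreal f"
    using X by (elim conjE)
  show "\<forall>c. fconst X c \<in> Cinf X"
    using X by (elim conjE)
  show "\<forall>f\<in>Cinf X. \<forall>g\<in>Cinf X. fadd X f g \<in> Cinf X \<and> fmult X f g \<in> Cinf X"
    using X by (elim conjE)
  show "space_top X = topology_generated_by {f -` U \<inter> pts X | f U. f \<in> Cinf X \<and> open U}"
    using X by (elim conjE)
  show "\<forall>k. \<forall>F\<in>smooth_fun {..<k::nat}. \<forall>f\<in>{..<k} \<rightarrow> Cinf X. (\<lambda>\<xi>\<in>pts X. F (\<lambda>i. f i \<xi>)) \<in> Cinf X"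
    using X by (elim conjE)
  show "\<forall>f\<in>extensional (pts X).
        (\<forall>\<xi>\<in>pts X. \<exists>U g. openin (space_top X) U \<and> \<xi> \<in> U \<and> g \<in> Cinf X \<and> (\<forall>\<eta>\<in>U. f \<eta> = g \<eta>))
        \<longrightarrow> f \<in> Cinf X"
    using X by (elim conjE)
qed

lemma Cinf_extensional: "differential_space X \<Longrightarrow> f \<in> Cinf X \<Longrightarrow> f \<in> extensional (pts X)"
  using differential_spaceD(1) by blast

lemma global_chartD:
  fixes \<phi> :: "'k::finite rpoly \<Rightarrow> 'p \<Rightarrow> real"
  assumes "global_chart X \<phi>"
  shows "differential_space X" "poisson_bracket_on X" "chart_hom X \<phi>"
    and "brk X (\<phi> p) (\<phi> q) \<in> range \<phi>"
    and "f \<in> Cinf X \<Longrightarrow> \<exists>F\<in>smooth_fun (UNIV :: 'k set). \<forall>\<xi>\<in>pts X. f \<xi> = F (chart_map \<phi> \<xi>)"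
    and "\<xi> \<in> pts X \<Longrightarrow> \<eta> \<in> pts X \<Longrightarrow> \<xi> \<noteq> \<eta> \<Longrightarrow> \<exists>p. \<phi> p \<xi> \<noteq> \<phi> p \<eta>"
  using assms by (simp_all add: global_chart_def poisson_differential_space_def)

lemma global_chart_extensional: "global_chart X \<phi> \<Longrightarrow> \<phi> p \<in> extensional (pts X)"
  using Cinf_extensional[of X "\<phi> p"] global_chartD(1,3)[of X \<phi>] by (simp add: chart_hom_def)

lemma global_chart_inj_on:
  fixes \<phi> :: "'k::finite rpoly \<Rightarrow> 'p \<Rightarrow> real"
  assumes "global_chart X \<phi>"
  shows "inj_on (chart_map \<phi>) (pts X)"
proof (rule inj_onI, rule ccontr)
  fix \<xi> \<eta> assume *: "\<xi> \<in> pts X" "\<eta> \<in> pts X" "chart_map \<phi> \<xi> = chart_map \<phi> \<eta>" "\<xi> \<noteq> \<eta>"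
  then obtain p where "\<phi> p \<xi> \<noteq> \<phi> p \<eta>" using global_chartD(6)[OF assms] by blast
  moreover have "chart_hom X \<phi>" by (rule global_chartD(3)[OF assms])
  ultimately show False using * chart_hom_eval[of X \<phi>] by metis
qed

lemma diff_in_chart_ker_iff:
  fixes \<phi> :: "'k::finite rpoly \<Rightarrow> 'p \<Rightarrow> real"
  assumes "global_chart X \<phi>"
  shows "q - p \<in> chart_ker X \<phi> \<longleftrightarrow> \<phi> q = \<phi> p"
proof -
  have \<phi>: "chart_hom X \<phi>" by (rule global_chartD(3)[OF assms])
  have "\<phi> (q - p) \<xi> = \<phi> q \<xi> - \<phi> p \<xi>" if "\<xi> \<in> pts X" for \<xi>
  proof -
    have "poly_eval (chart_map \<phi> \<xi>) q = poly_eval (chart_map \<phi> \<xi>) (q - p) + poly_eval (chart_map \<phi> \<xi>) p"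
      by (simp flip: poly_hom_add[OF semiring_hom_id])
    then show ?thesis using chart_hom_eval[OF \<phi> that] by simp
  qed
  then have "(\<forall>\<xi>\<in>pts X. \<phi> (q - p) \<xi> = 0) \<longleftrightarrow> (\<forall>\<xi>\<in>pts X. \<phi> q \<xi> = \<phi> p \<xi>)" by auto
  moreover have "\<phi> (q - p) = fconst X 0 \<longleftrightarrow> (\<forall>\<xi>\<in>pts X. \<phi> (q - p) \<xi> = 0)"
    using extensionalityI[OF global_chart_extensional[OF assms, of "q - p"], of "fconst X 0"]
    by (auto simp: fconst_def)
  moreover have "\<phi> q = \<phi> p \<longleftrightarrow> (\<forall>\<xi>\<in>pts X. \<phi> q \<xi> = \<phi> p \<xi>)"
    using extensionalityI[OF global_chart_extensional[OF assms] global_chart_extensional[OF assms], of q p]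
    by auto
  ultimately show ?thesis by (simp add: chart_ker_def)
qed

text \<open>
  Two polynomials are congruent modulo the kernel of a chart if and only if they define the same
  function, so the elements of the quotient algebra are the fibres of the chart. In this form the
  induced homomorphism and the bracket are easy to compute.
\<close>

definition fibre :: "('k rpoly \<Rightarrow> 'p \<Rightarrow> real) \<Rightarrow> ('p \<Rightarrow> real) \<Rightarrow> 'k rpoly set" where
  "fibre \<phi> f = {q. \<phi> q = f}"

lemma quot_alg_eq_fibres:
  fixes \<phi> :: "'k::finite rpoly \<Rightarrow> 'p \<Rightarrow> real"
  assumes "global_chart X \<phi>"
  shows "quot_alg X \<phi> = range (\<lambda>p. fibre \<phi> (\<phi> p))"
  unfolding quot_alg_def quotient_def fibre_def
  by (auto simp: diff_in_chart_ker_iff[OF assms] Image_def)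

section \<open>Transport of Poisson differential spaces\<close>

text \<open>
  An isomorphism of all the data of a Poisson differential space. The second condition says that
  the smooth functions on \<open>Y\<close> are exactly those whose pullback is smooth. The axioms are not part
  of the notion: they pass from \<open>X\<close> to \<open>Y\<close>.
\<close>

definition poisson_iso ::
  "('p, 'b) poisson_space_scheme \<Rightarrow> ('q, 'c) poisson_space_scheme \<Rightarrow> ('p \<Rightarrow> 'q) \<Rightarrow> bool" where
  "poisson_iso X Y \<kappa> \<longleftrightarrow>
     homeomorphic_map (space_top X) (space_top Y) \<kappa> \<and>
     Cinf Y = {f \<in> extensional (pts Y). pullback X \<kappa> f \<in> Cinf X} \<and>
     (\<forall>f\<in>Cinf Y. \<forall>g\<in>Cinf Y. brk Y f g \<in> extensional (pts Y) \<and>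
        pullback X \<kappa> (brk Y f g) = brk X (pullback X \<kappa> f) (pullback X \<kappa> g))"

lemma poisson_iso_pts: "poisson_iso X Y \<kappa> \<Longrightarrow> \<kappa> ` pts X = pts Y"
  unfolding poisson_iso_def pts_def by (auto dest: homeomorphic_imp_surjective_map)

lemma poisson_iso_inj_on: "poisson_iso X Y \<kappa> \<Longrightarrow> inj_on \<kappa> (pts X)"
  unfolding poisson_iso_def pts_def by (auto dest: homeomorphic_imp_injective_map)

lemma pullback_apply: "\<xi> \<in> pts X \<Longrightarrow> pullback X \<kappa> f \<xi> = f (\<kappa> \<xi>)"
  by (simp add: pullback_def)

text \<open>
  Functions on \<open>Y\<close> can be compared after pullback; every identity on \<open>Y\<close> below is reduced in this
  way to one on \<open>X\<close>.
\<close>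

lemma pullback_eq_iff:
  assumes "\<kappa> ` pts X = pts Y" "f \<in> extensional (pts Y)" "g \<in> extensional (pts Y)"
  shows "pullback X \<kappa> f = pullback X \<kappa> g \<longleftrightarrow> f = g"
proof
  assume eq: "pullback X \<kappa> f = pullback X \<kappa> g"
  have "f \<eta> = g \<eta>" if \<eta>: "\<eta> \<in> pts Y" for \<eta>
  proof -
    obtain \<xi> where "\<xi> \<in> pts X" "\<eta> = \<kappa> \<xi>" using \<eta> assms(1) by blast
    then show ?thesis using fun_cong[OF eq, of \<xi>] by (simp add: pullback_apply)
  qed
  then show "f = g" by (rule extensionalityI[OF assms(2,3)])
qed simp

lemma pullback_fconst: "\<kappa> ` pts X = pts Y \<Longrightarrow> pullback X \<kappa> (fconst Y c) = fconst X c"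
  by (auto simp: pullback_def fconst_def intro!: restrict_ext)

lemma pullback_fadd:
  "\<kappa> ` pts X = pts Y \<Longrightarrow> pullback X \<kappa> (fadd Y f g) = fadd X (pullback X \<kappa> f) (pullback X \<kappa> g)"
  by (auto simp: pullback_def fadd_def intro!: restrict_ext)

lemma pullback_fmult:
  "\<kappa> ` pts X = pts Y \<Longrightarrow> pullback X \<kappa> (fmult Y f g) = fmult X (pullback X \<kappa> f) (pullback X \<kappa> g)"
  by (auto simp: pullback_def fmult_def intro!: restrict_ext)

lemma fops_extensional [simp]:
  "fconst X c \<in> extensional (pts X)" "fadd X f g \<in> extensional (pts X)" "fmult X f g \<in> extensional (pts X)"
  by (simp_all add: fconst_def fadd_def fmult_def)

lemma pullback_surj:
  assumes "\<kappa> ` pts X = pts Y" "inj_on \<kappa> (pts X)" "f \<in> extensional (pts X)"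
  obtains g where "g \<in> extensional (pts Y)" "pullback X \<kappa> g = f"
proof
  let ?g = "\<lambda>\<eta>\<in>pts Y. f (the_inv_into (pts X) \<kappa> \<eta>)"
  show "?g \<in> extensional (pts Y)" by simp
  show "pullback X \<kappa> ?g = f"
    by (rule extensionalityI[OF _ assms(3)])
       (use assms(1) in \<open>auto simp: pullback_def the_inv_into_f_f[OF assms(2)]\<close>)
qed

lemma differential_space_transport:
  assumes X: "differential_space X" and iso: "poisson_iso X Y \<kappa>"
  shows "differential_space Y"
proof -
  note im = poisson_iso_pts[OF iso] and inj = poisson_iso_inj_on[OF iso]
  have hom: "homeomorphic_map (space_top X) (space_top Y) \<kappa>"
    and Cinf_iff: "f \<in> Cinf Y \<longleftrightarrow> f \<in> extensional (pts Y) \<and> pullback X \<kappa> f \<in> Cinf X" for f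
    using iso by (auto simp: poisson_iso_def)
  have \<kappa>: "\<kappa> \<xi> \<in> pts Y" if "\<xi> \<in> pts X" for \<xi> using im that by blast
  have cont: "continuous_map (space_top Y) euclideanreal f" if "f \<in> Cinf Y" for f
  proof (rule continuous_compose_quotient_map)
    show "quotient_map (space_top X) (space_top Y) \<kappa>"
      using hom by (simp add: homeomorphic_map_def)
    have "continuous_map (space_top X) euclideanreal (pullback X \<kappa> f)"
      using differential_spaceD(2)[OF X] that by (simp add: Cinf_iff)
    then show "continuous_map (space_top X) euclideanreal (f \<circ> \<kappa>)"
      by (rule continuous_map_eq) (simp add: pullback_def pts_def)
  qed
  define B where "B = {f -` U \<inter> pts X | f U. f \<in> Cinf X \<and> open (U::real set)}"
  define B' where "B' = {f -` U \<inter> pts Y | f U. f \<in> Cinf Y \<and> open (U::real set)}"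
  have top: "space_top Y = topology_generated_by B'"
    unfolding topology_eq
  proof (intro allI iffI)
    fix S assume S: "openin (space_top Y) S"
    have "generate_topology_on B' (\<kappa> ` T) \<and> T \<subseteq> pts X" if "generate_topology_on B T" for T
      using that
    proof induction
      case Empty
      then show ?case by (simp add: generate_topology_on.Empty)
    next
      case (Int a b)
      moreover have "\<kappa> ` (a \<inter> b) = \<kappa> ` a \<inter> \<kappa> ` b"
        using Int.IH by (intro inj_on_image_Int[OF inj]) auto
      ultimately show ?case by (auto intro: generate_topology_on.Int)
    next
      case (UN K)
      have "\<kappa> ` \<Union>K = \<Union>((`) \<kappa> ` K)" by blast
      moreover have "generate_topology_on B' (\<Union>((`) \<kappa> ` K))"
        by (rule generate_topology_on.UN) (use UN.IH in auto)
      ultimately show ?case using UN.IH by auto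
    next
      case (Basis s)
      then obtain f U where s: "s = f -` U \<inter> pts X" "f \<in> Cinf X" "open U" unfolding B_def by blast
      obtain g where g: "g \<in> extensional (pts Y)" "pullback X \<kappa> g = f"
        using pullback_surj[OF im inj Cinf_extensional[OF X s(2)]] by blast
      have "\<kappa> ` s = g -` U \<inter> pts Y"
      proof -
        have "f \<xi> = g (\<kappa> \<xi>)" if "\<xi> \<in> pts X" for \<xi>
          using pullback_apply[OF that, of \<kappa> g] g(2) by simp
        then show ?thesis unfolding s(1) im[symmetric] by auto
      qed
      moreover have "g \<in> Cinf Y" using g s(2) by (simp add: Cinf_iff)
      ultimately have "\<kappa> ` s \<in> B'" using s(3) unfolding B'_def by blast
      then show ?case using s(1) by (auto intro: generate_topology_on.Basis)
    qed
    moreover have "openin (space_top X) {x \<in> topspace (space_top X). \<kappa> x \<in> S}"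
      using S homeomorphic_imp_continuous_map[OF hom] by (simp add: continuous_map)
    moreover have "space_top X = topology_generated_by B" unfolding B_def by (rule differential_spaceD(5)[OF X])
    ultimately have "generate_topology_on B' (\<kappa> ` {x \<in> pts X. \<kappa> x \<in> S})"
      by (simp add: openin_topology_generated_by_iff pts_def)
    moreover have "\<kappa> ` {x \<in> pts X. \<kappa> x \<in> S} = S"
      using openin_subset[OF S] im by (auto simp: pts_def)
    ultimately show "openin (topology_generated_by B') S"
      by (simp add: openin_topology_generated_by_iff)
  next
    fix S assume "openin (topology_generated_by B') S"
    then have "generate_topology_on B' S" by (simp add: openin_topology_generated_by_iff)
    then show "openin (space_top Y) S"
    proof induction
      case (Basis s)
      then obtain f U where s: "s = f -` U \<inter> pts Y" "f \<in> Cinf Y" "open U" unfolding B'_def by blast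
      have "s = {x \<in> topspace (space_top Y). f x \<in> U}" using s(1) by (auto simp: pts_def)
      then show ?case using cont[OF s(2)] s(3) by (simp add: continuous_map)
    qed auto
  qed
  show ?thesis
    unfolding differential_space_def
  proof (intro conjI)
    show "Cinf Y \<subseteq> extensional (pts Y)" by (auto simp: Cinf_iff)
    show "\<forall>f\<in>Cinf Y. continuous_map (space_top Y) euclideanreal f" using cont by blast
    show "\<forall>c. fconst Y c \<in> Cinf Y"
      using differential_spaceD(3)[OF X] by (simp add: Cinf_iff pullback_fconst[OF im])
    show "\<forall>f\<in>Cinf Y. \<forall>g\<in>Cinf Y. fadd Y f g \<in> Cinf Y \<and> fmult Y f g \<in> Cinf Y"
      using differential_spaceD(4)[OF X] by (simp add: Cinf_iff pullback_fadd[OF im] pullback_fmult[OF im])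
    show "space_top Y = topology_generated_by {f -` U \<inter> pts Y | f U. f \<in> Cinf Y \<and> open U}"
      using top unfolding B'_def .
    show "\<forall>k. \<forall>F\<in>smooth_fun {..<k::nat}. \<forall>f\<in>{..<k} \<rightarrow> Cinf Y. (\<lambda>\<eta>\<in>pts Y. F (\<lambda>i. f i \<eta>)) \<in> Cinf Y"
    proof (intro allI ballI)
      fix k :: nat and F f assume F: "F \<in> smooth_fun {..<k}" and f: "f \<in> {..<k} \<rightarrow> Cinf Y"
      have "(\<lambda>i. pullback X \<kappa> (f i)) \<in> {..<k} \<rightarrow> Cinf X" using f by (auto simp: Cinf_iff)
      then have "(\<lambda>\<xi>\<in>pts X. F (\<lambda>i. pullback X \<kappa> (f i) \<xi>)) \<in> Cinf X"
        by (rule differential_spaceD(6)[OF X, THEN spec, THEN bspec, OF F, THEN bspec])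
      moreover have "(\<lambda>\<xi>\<in>pts X. F (\<lambda>i. pullback X \<kappa> (f i) \<xi>)) = pullback X \<kappa> (\<lambda>\<eta>\<in>pts Y. F (\<lambda>i. f i \<eta>))"
        by (auto simp: pullback_def \<kappa> intro!: restrict_ext)
      ultimately show "(\<lambda>\<eta>\<in>pts Y. F (\<lambda>i. f i \<eta>)) \<in> Cinf Y" by (simp add: Cinf_iff)
    qed
    show "\<forall>f\<in>extensional (pts Y).
        (\<forall>\<xi>\<in>pts Y. \<exists>U g. openin (space_top Y) U \<and> \<xi> \<in> U \<and> g \<in> Cinf Y \<and> (\<forall>\<eta>\<in>U. f \<eta> = g \<eta>))
        \<longrightarrow> f \<in> Cinf Y"
    proof (intro ballI impI)
      fix f assume f: "f \<in> extensional (pts Y)"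
        and loc: "\<forall>\<xi>\<in>pts Y. \<exists>U g. openin (space_top Y) U \<and> \<xi> \<in> U \<and> g \<in> Cinf Y \<and> (\<forall>\<eta>\<in>U. f \<eta> = g \<eta>)"
      have "\<exists>U g. openin (space_top X) U \<and> \<xi> \<in> U \<and> g \<in> Cinf X \<and> (\<forall>\<eta>\<in>U. pullback X \<kappa> f \<eta> = g \<eta>)"
        if \<xi>: "\<xi> \<in> pts X" for \<xi>
      proof -
        obtain U g where U: "openin (space_top Y) U" "\<kappa> \<xi> \<in> U" "g \<in> Cinf Y" "\<forall>\<eta>\<in>U. f \<eta> = g \<eta>"
          using loc \<kappa>[OF \<xi>] by blast
        have "openin (space_top X) {x \<in> topspace (space_top X). \<kappa> x \<in> U}"
          using U(1) homeomorphic_imp_continuous_map[OF hom] by (simp add: continuous_map)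
        moreover have "pullback X \<kappa> g \<in> Cinf X" using U(3) by (simp add: Cinf_iff)
        ultimately show ?thesis using U \<xi>
          by (intro exI[of _ "{x \<in> topspace (space_top X). \<kappa> x \<in> U}"] exI[of _ "pullback X \<kappa> g"])
             (auto simp: pullback_def pts_def)
      qed
      moreover have "pullback X \<kappa> f \<in> extensional (pts X)" by (simp add: pullback_def)
      ultimately have "pullback X \<kappa> f \<in> Cinf X" using differential_spaceD(7)[OF X] by blast
      then show "f \<in> Cinf Y" using f by (simp add: Cinf_iff)
    qed
  qed
qed

lemma poisson_bracket_onD:
  assumes "poisson_bracket_on X"
  shows "\<forall>f\<in>Cinf X. \<forall>g\<in>Cinf X. brk X f g \<in> Cinf X"
    and "\<forall>f\<in>Cinf X. \<forall>g\<in>Cinf X. \<forall>h\<in>Cinf X. brk X (fadd X f g) h = fadd X (brk X f h) (brk X g h)"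
    and "\<forall>c. \<forall>f\<in>Cinf X. \<forall>g\<in>Cinf X. brk X (fmult X (fconst X c) f) g = fmult X (fconst X c) (brk X f g)"
    and "\<forall>f\<in>Cinf X. \<forall>g\<in>Cinf X. brk X f g = fmult X (fconst X (-1)) (brk X g f)"
    and "\<forall>f\<in>Cinf X. \<forall>g\<in>Cinf X. \<forall>h\<in>Cinf X. fadd X (brk X f (brk X g h)) (fadd X (brk X g (brk X h f)) (brk X h (brk X f g))) = fconst X 0"
    and "\<forall>f\<in>Cinf X. \<forall>g\<in>Cinf X. \<forall>h\<in>Cinf X. brk X f (fmult X g h) = fadd X (fmult X (brk X f g) h) (fmult X g (brk X f h))"
proof -
  note X = assms[unfolded poisson_bracket_on_def]
  show "\<forall>f\<in>Cinf X. \<forall>g\<in>Cinf X. brk X f g \<in> Cinf X"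
    using X by (elim conjE)
  show "\<forall>f\<in>Cinf X. \<forall>g\<in>Cinf X. \<forall>h\<in>Cinf X. brk X (fadd X f g) h = fadd X (brk X f h) (brk X g h)"
    using X by (elim conjE)
  show "\<forall>c. \<forall>f\<in>Cinf X. \<forall>g\<in>Cinf X. brk X (fmult X (fconst X c) f) g = fmult X (fconst X c) (brk X f g)"
    using X by (elim conjE)
  show "\<forall>f\<in>Cinf X. \<forall>g\<in>Cinf X. brk X f g = fmult X (fconst X (-1)) (brk X g f)"
    using X by (elim conjE)
  show "\<forall>f\<in>Cinf X. \<forall>g\<in>Cinf X. \<forall>h\<in>Cinf X. fadd X (brk X f (brk X g h)) (fadd X (brk X g (brk X h f)) (brk X h (brk X f g))) = fconst X 0"
    using X by (elim conjE)
  show "\<forall>f\<in>Cinf X. \<forall>g\<in>Cinf X. \<forall>h\<in>Cinf X. brk X f (fmult X g h) = fadd X (fmult X (brk X f g) h) (fmult X g (brk X f h))"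
    using X by (elim conjE)
qed

lemma poisson_bracket_transport:
  assumes dX: "differential_space X" and X: "poisson_bracket_on X" and iso: "poisson_iso X Y \<kappa>"
  shows "poisson_bracket_on Y"
proof -
  note im = poisson_iso_pts[OF iso]
  have Cinf_iff: "f \<in> Cinf Y \<longleftrightarrow> f \<in> extensional (pts Y) \<and> pullback X \<kappa> f \<in> Cinf X" for f
    using iso by (auto simp: poisson_iso_def)
  have pb: "pullback X \<kappa> f \<in> Cinf X" if "f \<in> Cinf Y" for f using that by (simp add: Cinf_iff)
  have br: "brk Y f g \<in> extensional (pts Y)"
    "pullback X \<kappa> (brk Y f g) = brk X (pullback X \<kappa> f) (pullback X \<kappa> g)"
    if "f \<in> Cinf Y" "g \<in> Cinf Y" for f g using iso that by (auto simp: poisson_iso_def)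
  have dY: "differential_space Y" by (rule differential_space_transport[OF dX iso])
  have cl: "fconst Y c \<in> Cinf Y" "f \<in> Cinf Y \<Longrightarrow> g \<in> Cinf Y \<Longrightarrow> fadd Y f g \<in> Cinf Y"
    "f \<in> Cinf Y \<Longrightarrow> g \<in> Cinf Y \<Longrightarrow> fmult Y f g \<in> Cinf Y" for c f g
    using differential_spaceD(3,4)[OF dY] by auto
  have bC: "brk Y f g \<in> Cinf Y" if "f \<in> Cinf Y" "g \<in> Cinf Y" for f g
    using poisson_bracket_onD(1)[OF X] br[OF that] pb[OF that(1)] pb[OF that(2)] by (simp add: Cinf_iff)
  note eq = pullback_eq_iff[OF im, THEN iffD1]
  note ops = pullback_fadd[OF im] pullback_fmult[OF im] pullback_fconst[OF im]
  show ?thesis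
    unfolding poisson_bracket_on_def
  proof (intro conjI ballI allI)
    fix f g assume fg: "f \<in> Cinf Y" "g \<in> Cinf Y"
    show "brk Y f g \<in> Cinf Y" by (rule bC[OF fg])
    show "brk Y (fmult Y (fconst Y c) f) g = fmult Y (fconst Y c) (brk Y f g)" for c
      by (rule eq) (use poisson_bracket_onD(3)[OF X] fg pb in \<open>simp_all add: br ops cl bC\<close>)
    show "brk Y f g = fmult Y (fconst Y (-1)) (brk Y g f)"
    proof (rule eq)
      have "brk X (pullback X \<kappa> f) (pullback X \<kappa> g) = fmult X (fconst X (-1)) (brk X (pullback X \<kappa> g) (pullback X \<kappa> f))"
        using poisson_bracket_onD(4)[OF X] fg pb by blast
      then show "pullback X \<kappa> (brk Y f g) = pullback X \<kappa> (fmult Y (fconst Y (-1)) (brk Y g f))"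
        using fg by (simp add: br ops)
    qed (use fg in \<open>simp_all add: br\<close>)
    fix h assume h: "h \<in> Cinf Y"
    show "brk Y (fadd Y f g) h = fadd Y (brk Y f h) (brk Y g h)"
      by (rule eq) (use poisson_bracket_onD(2)[OF X] fg h pb in \<open>simp_all add: br ops cl bC\<close>)
    show "fadd Y (brk Y f (brk Y g h)) (fadd Y (brk Y g (brk Y h f)) (brk Y h (brk Y f g))) = fconst Y 0"
      by (rule eq) (use poisson_bracket_onD(5)[OF X] fg h pb in \<open>simp_all add: br ops cl bC\<close>)
    show "brk Y f (fmult Y g h) = fadd Y (fmult Y (brk Y f g) h) (fmult Y g (brk Y f h))"
      by (rule eq) (use poisson_bracket_onD(6)[OF X] fg h pb in \<open>simp_all add: br ops cl bC\<close>)
  qed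
qed

text \<open>
  Surjectivity of \<open>lam\<close> is essential: the functions on \<open>X\<close> given by polynomials have to come from
  polynomials on \<open>Y\<close>, and the coordinates of \<open>X\<close> have to be polynomials in the coordinates of \<open>Y\<close>.
\<close>

lemma global_chart_transport:
  fixes \<phi> :: "'k::finite rpoly \<Rightarrow> 'p \<Rightarrow> real" and \<psi> :: "'j::finite rpoly \<Rightarrow> 'q \<Rightarrow> real"
  assumes \<phi>: "global_chart X \<phi>" and iso: "poisson_iso X Y \<kappa>"
    and lam: "poly_alg_hom lam" "surj lam"
    and ext: "\<And>p. \<psi> p \<in> extensional (pts Y)" and comm: "\<And>p. \<phi> (lam p) = pullback X \<kappa> (\<psi> p)"
  shows "global_chart Y \<psi>"
proof -
  note im = poisson_iso_pts[OF iso] and inj = poisson_iso_inj_on[OF iso]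
  have dX: "differential_space X" and bX: "poisson_bracket_on X" and hX: "chart_hom X \<phi>"
    by (rule global_chartD[OF \<phi>])+
  have Cinf_iff: "f \<in> Cinf Y \<longleftrightarrow> f \<in> extensional (pts Y) \<and> pullback X \<kappa> f \<in> Cinf X" for f
    using iso by (auto simp: poisson_iso_def)
  note eq = pullback_eq_iff[OF im, THEN iffD1]
  note ops = pullback_fadd[OF im] pullback_fmult[OF im] pullback_fconst[OF im]
  have hY: "chart_hom Y \<psi>"
    unfolding chart_hom_def
  proof (intro conjI allI)
    show "\<psi> p \<in> Cinf Y" for p using hX by (simp add: Cinf_iff ext chart_hom_def flip: comm)
    show "\<psi> (Const c) = fconst Y c" for c
      by (rule eq) (use hX lam(1) in \<open>simp_all add: ext ops chart_hom_def poly_alg_hom_def flip: comm\<close>)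
    show "\<psi> (p + q) = fadd Y (\<psi> p) (\<psi> q)" for p q
      by (rule eq) (use hX lam(1) in \<open>simp_all add: ext ops chart_hom_def poly_alg_hom_def flip: comm\<close>)
    show "\<psi> (p * q) = fmult Y (\<psi> p) (\<psi> q)" for p q
      by (rule eq) (use hX lam(1) in \<open>simp_all add: ext ops chart_hom_def poly_alg_hom_def flip: comm\<close>)
  qed
  show ?thesis
    unfolding global_chart_def
  proof (intro conjI allI ballI impI)
    show "poisson_differential_space Y"
      unfolding poisson_differential_space_def
      using differential_space_transport[OF dX iso] poisson_bracket_transport[OF dX bX iso] by simp
    show "chart_hom Y \<psi>" by (rule hY)
    show "brk Y (\<psi> p) (\<psi> q) \<in> range \<psi>" for p q
    proof -
      have C: "\<psi> p \<in> Cinf Y" "\<psi> q \<in> Cinf Y" using hY by (auto simp: chart_hom_def)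
      have br: "brk Y (\<psi> p) (\<psi> q) \<in> extensional (pts Y)"
        "pullback X \<kappa> (brk Y (\<psi> p) (\<psi> q)) = brk X (\<phi> (lam p)) (\<phi> (lam q))"
        using iso C by (auto simp: poisson_iso_def comm)
      obtain r where "brk X (\<phi> (lam p)) (\<phi> (lam q)) = \<phi> r" using global_chartD(4)[OF \<phi>] by blast
      moreover obtain r' where "r = lam r'" using lam(2) by (metis surjD)
      ultimately have "pullback X \<kappa> (brk Y (\<psi> p) (\<psi> q)) = pullback X \<kappa> (\<psi> r')" using br(2) comm by simp
      then have "brk Y (\<psi> p) (\<psi> q) = \<psi> r'" by (rule eq[OF br(1) ext])
      then show ?thesis by blast
    qed
    show "\<exists>F\<in>smooth_fun UNIV. \<forall>\<xi>\<in>pts Y. f \<xi> = F (chart_map \<psi> \<xi>)" if "f \<in> Cinf Y" for f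
    proof -
      have "pullback X \<kappa> f \<in> Cinf X" using that by (simp add: Cinf_iff)
      then obtain F where F: "F \<in> smooth_fun (UNIV :: 'k set)"
        "\<And>\<xi>. \<xi> \<in> pts X \<Longrightarrow> pullback X \<kappa> f \<xi> = F (chart_map \<phi> \<xi>)"
        using global_chartD(5)[OF \<phi>] by blast
      have "\<forall>i. \<exists>q. lam q = Var i" using lam(2) by (metis surjD)
      \<comment> \<open>The coordinates of \<open>X\<close> as polynomials in those of \<open>Y\<close>.\<close>
      then obtain q where q: "\<And>i. lam (q i) = Var i" by metis
      have "(\<lambda>y. F (\<lambda>i. poly_eval y (q i))) \<in> smooth_fun UNIV"
        by (rule smooth_fun_compose[where g = "\<lambda>i y. poly_eval y (q i)", OF finite F(1) smooth_fun_poly_eval])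
      moreover have "f \<eta> = F (\<lambda>i. poly_eval (chart_map \<psi> \<eta>) (q i))" if \<eta>: "\<eta> \<in> pts Y" for \<eta>
      proof -
        obtain \<xi> where \<xi>: "\<xi> \<in> pts X" "\<eta> = \<kappa> \<xi>" using \<eta> im by blast
        have coord: "chart_map \<phi> \<xi> i = poly_eval (chart_map \<psi> \<eta>) (q i)" for i
        proof -
          have "chart_map \<phi> \<xi> i = \<phi> (lam (q i)) \<xi>" by (simp only: chart_map_def q)
          also have "\<dots> = \<psi> (q i) \<eta>" using \<xi> by (simp add: comm pullback_apply)
          also have "\<dots> = poly_eval (chart_map \<psi> \<eta>) (q i)" by (rule chart_hom_eval[OF hY \<eta>])
          finally show ?thesis .
        qed
        have "f \<eta> = F (chart_map \<phi> \<xi>)" using F(2)[OF \<xi>(1)] \<xi> by (simp only: pullback_apply)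
        also have "chart_map \<phi> \<xi> = (\<lambda>i. poly_eval (chart_map \<psi> \<eta>) (q i))" by (rule HOL.ext) (rule coord)
        finally show ?thesis .
      qed
      ultimately show ?thesis by (intro bexI[of _ "\<lambda>y. F (\<lambda>i. poly_eval y (q i))"]) auto
    qed
    show "\<exists>p. \<psi> p \<xi> \<noteq> \<psi> p \<eta>" if \<xi>\<eta>: "\<xi> \<in> pts Y" "\<eta> \<in> pts Y" "\<xi> \<noteq> \<eta>" for \<xi> \<eta>
    proof -
      obtain x y where xy: "x \<in> pts X" "y \<in> pts X" "\<xi> = \<kappa> x" "\<eta> = \<kappa> y" using \<xi>\<eta>(1,2) im by blast
      with \<xi>\<eta>(3) have "x \<noteq> y" by blast
      then obtain p where "\<phi> p x \<noteq> \<phi> p y" using global_chartD(6)[OF \<phi> xy(1,2)] by blast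
      moreover obtain p' where "p = lam p'" using lam(2) by (metis surjD)
      ultimately have "\<psi> p' (\<kappa> x) \<noteq> \<psi> p' (\<kappa> y)" using xy by (simp add: comm pullback_apply)
      then show ?thesis using xy by blast
    qed
  qed
qed

text \<open>
  The condition \<open>comm\<close> says that the map \<open>arrow_theta\<close> is \<open>\<kappa>\<close> followed by the coordinates of \<open>Y\<close>.
  So its image is that of \<open>Y\<close>, the lift is \<open>\<kappa>\<close> itself, and the induced homomorphism is the
  pullback by \<open>\<kappa>\<close>, which is injective and preserves brackets.
\<close>

theorem regular_symplectomorphism_transport:
  fixes \<phi> :: "'k::finite rpoly \<Rightarrow> 'p \<Rightarrow> real" and \<psi> :: "'j::finite rpoly \<Rightarrow> 'q \<Rightarrow> real"
  assumes \<phi>: "global_chart X \<phi>" and iso: "poisson_iso X Y \<kappa>"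
    and lam: "poly_alg_hom lam" "surj lam"
    and ext: "\<And>p. \<psi> p \<in> extensional (pts Y)" and comm: "\<And>p. \<phi> (lam p) = pullback X \<kappa> (\<psi> p)"
  shows "regular_symplectomorphism X \<phi> Y \<psi> lam (restrict \<kappa> (pts X))"
proof -
  note im = poisson_iso_pts[OF iso] and inj = poisson_iso_inj_on[OF iso]
  have \<psi>: "global_chart Y \<psi>" by (rule global_chart_transport[OF assms])
  have hX: "chart_hom X \<phi>" and hY: "chart_hom Y \<psi>"
    using global_chartD(3)[OF \<phi>] global_chartD(3)[OF \<psi>] .
  have hom: "homeomorphic_map (space_top X) (space_top Y) \<kappa>" using iso by (simp add: poisson_iso_def)
  have Cinf_iff: "f \<in> Cinf Y \<longleftrightarrow> f \<in> extensional (pts Y) \<and> pullback X \<kappa> f \<in> Cinf X" for f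
    using iso by (auto simp: poisson_iso_def)
  have \<psi>C: "\<psi> p \<in> Cinf Y" for p using hY by (simp add: chart_hom_def)
  have br: "pullback X \<kappa> (brk Y f g) = brk X (pullback X \<kappa> f) (pullback X \<kappa> g)" "brk Y f g \<in> extensional (pts Y)"
    if "f \<in> Cinf Y" "g \<in> Cinf Y" for f g using iso that by (auto simp: poisson_iso_def)
  note eq_iff = pullback_eq_iff[OF im]
  have lam_eq: "\<phi> (lam p) = \<phi> (lam q) \<longleftrightarrow> \<psi> p = \<psi> q" for p q
    unfolding comm by (rule eq_iff[OF ext ext])
  have ind: "induced_hom X \<phi> lam (fibre \<psi> f) = fibre \<phi> (pullback X \<kappa> f)" if f: "f \<in> range \<psi>" for f
  proof -
    obtain p0 where p0: "f = \<psi> p0" using f by blast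
    have "(\<exists>p. \<psi> p = \<psi> p0 \<and> \<phi> q = \<phi> (lam p)) \<longleftrightarrow> \<phi> q = pullback X \<kappa> (\<psi> p0)" for q
      unfolding comm by metis
    then show ?thesis
      unfolding p0 induced_hom_def fibre_def diff_in_chart_ker_iff[OF \<phi>] by simp
  qed
  have qbY: "quot_brk Y \<psi> (fibre \<psi> f) (fibre \<psi> g) = fibre \<psi> (brk Y f g)"
    if "f \<in> range \<psi>" "g \<in> range \<psi>" for f g
    using that unfolding quot_brk_def fibre_def by auto
  have qbX: "quot_brk X \<phi> (fibre \<phi> f) (fibre \<phi> g) = fibre \<phi> (brk X f g)"
    if "f \<in> range \<phi>" "g \<in> range \<phi>" for f g
    using that unfolding quot_brk_def fibre_def by auto
  have pb_range: "pullback X \<kappa> f \<in> range \<phi>" if "f \<in> range \<psi>" for f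
    using that by (auto simp flip: comm)
  have theta: "arrow_theta \<phi> lam \<xi> = chart_map \<psi> (\<kappa> \<xi>)" if "\<xi> \<in> pts X" for \<xi>
    using that by (auto simp: arrow_theta_def chart_map_def comm pullback_apply)
  have theta_im: "arrow_theta \<phi> lam ` pts X = chart_map \<psi> ` pts Y"
  proof -
    have "arrow_theta \<phi> lam ` pts X = chart_map \<psi> ` \<kappa> ` pts X"
      by (auto simp: theta image_image)
    then show ?thesis by (simp add: im)
  qed
  have arrow: "arrow X \<phi> Y \<psi> lam"
    unfolding arrow_def
  proof (intro conjI ballI)
    show "lam ` chart_ker Y \<psi> \<subseteq> chart_ker X \<phi>"
      by (auto simp: chart_ker_def comm pullback_fconst[OF im])
    fix P Q assume "P \<in> quot_alg Y \<psi>" "Q \<in> quot_alg Y \<psi>"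
    then obtain p q where P: "P = fibre \<psi> (\<psi> p)" "Q = fibre \<psi> (\<psi> q)"
      unfolding quot_alg_eq_fibres[OF \<psi>] by blast
    have "brk Y (\<psi> p) (\<psi> q) \<in> range \<psi>" by (rule global_chartD(4)[OF \<psi>])
    then show "induced_hom X \<phi> lam (quot_brk Y \<psi> P Q) =
        quot_brk X \<phi> (induced_hom X \<phi> lam P) (induced_hom X \<phi> lam Q)"
      unfolding P by (simp add: qbY ind qbX pb_range br \<psi>C)
  qed (use \<phi> \<psi> lam theta_im in auto)
  have lift: "restrict \<kappa> (pts X) = arrow_lift X \<phi> Y \<psi> lam"
    unfolding arrow_lift_def
  proof (rule restrict_ext)
    fix \<xi> assume \<xi>: "\<xi> \<in> pts X"
    then have "\<kappa> \<xi> \<in> pts Y" using im by blast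
    then show "\<kappa> \<xi> = the_inv_into (pts Y) (chart_map \<psi>) (arrow_theta \<phi> lam \<xi>)"
      by (simp add: theta[OF \<xi>] the_inv_into_f_f[OF global_chart_inj_on[OF \<psi>]])
  qed
  have pb_restrict: "pullback X (restrict \<kappa> (pts X)) f = pullback X \<kappa> f" for f
    by (auto simp: pullback_def)
  have "poisson_map X Y (restrict \<kappa> (pts X))"
    unfolding poisson_map_def pb_restrict
  proof (intro conjI ballI)
    show "continuous_map (space_top X) (space_top Y) (restrict \<kappa> (pts X))"
      by (rule continuous_map_eq[OF homeomorphic_imp_continuous_map[OF hom]]) (simp add: pts_def)
  qed (use br Cinf_iff in auto)
  with lift have lifts: "lifts_to X \<phi> Y \<psi> lam (restrict \<kappa> (pts X))"
    unfolding lifts_to_def pb_restrict by (simp add: comm)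
  have "bij_betw (induced_hom X \<phi> lam) (quot_alg Y \<psi>) (quot_alg X \<phi>)"
    unfolding bij_betw_def
  proof
    have ind': "induced_hom X \<phi> lam (fibre \<psi> (\<psi> p)) = fibre \<phi> (\<phi> (lam p))" for p
      by (simp add: ind comm)
    have fibre_eq: "fibre \<phi> (\<phi> p) = fibre \<phi> f \<longleftrightarrow> \<phi> p = f" for p f
      unfolding fibre_def set_eq_iff mem_Collect_eq by metis
    show "inj_on (induced_hom X \<phi> lam) (quot_alg Y \<psi>)"
      unfolding quot_alg_eq_fibres[OF \<psi>]
      by (rule inj_onI) (auto simp: ind' fibre_eq lam_eq)
    show "induced_hom X \<phi> lam ` quot_alg Y \<psi> = quot_alg X \<phi>"
    proof -
      have "induced_hom X \<phi> lam ` quot_alg Y \<psi> = (\<lambda>p. fibre \<phi> (\<phi> p)) ` range lam"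
        unfolding quot_alg_eq_fibres[OF \<psi>] image_image ind' ..
      then show ?thesis using lam(2) by (simp add: quot_alg_eq_fibres[OF \<phi>])
    qed
  qed
  with arrow lifts theta_im show ?thesis unfolding regular_symplectomorphism_def by blast
qed

section \<open>Second derivatives\<close>

text \<open>
  The second difference is symmetric in the two directions while the derivative on the right is
  not; comparing both orders for small \<open>h\<close> shows that second derivatives commute.
\<close>

lemma mixed_difference:
  fixes f :: "'a::euclidean_space \<Rightarrow> real"
  assumes f: "smooth f" and b: "b \<in> Basis"
  shows "\<exists>\<xi> \<eta>. \<bar>\<xi>\<bar> \<le> \<bar>h\<bar> \<and> \<bar>\<eta>\<bar> \<le> \<bar>h\<bar> \<and>
    f (z + h *\<^sub>R b + h *\<^sub>R c) - f (z + h *\<^sub>R b) - f (z + h *\<^sub>R c) + f z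
      = dir_deriv c (dir_deriv b f) (z + \<xi> *\<^sub>R b + \<eta> *\<^sub>R c) * h * h"
proof -
  let ?f' = "dir_deriv b f"
  have sm: "smooth ?f'" using f b by (rule smooth_dir_deriv)
  have "((\<lambda>s. f (z + h *\<^sub>R c + s *\<^sub>R b) - f (z + s *\<^sub>R b)) has_real_derivative
      ?f' (z + h *\<^sub>R c + s *\<^sub>R b) - ?f' (z + s *\<^sub>R b)) (at s)" for s
    by (intro DERIV_diff smooth_dir_deriv_eq(2)[OF f])
  from mean_value_abs[OF this, of 0 h]
  obtain \<xi> where \<xi>: "\<bar>\<xi>\<bar> \<le> \<bar>h\<bar>" "(f (z + h *\<^sub>R c + h *\<^sub>R b) - f (z + h *\<^sub>R b)) - (f (z + h *\<^sub>R c) - f z)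
      = (?f' (z + h *\<^sub>R c + \<xi> *\<^sub>R b) - ?f' (z + \<xi> *\<^sub>R b)) * h" by auto
  from mean_value_abs[OF smooth_dir_deriv_eq(2)[OF sm, of "z + \<xi> *\<^sub>R b" c], of 0 h]
  obtain \<eta> where \<eta>: "\<bar>\<eta>\<bar> \<le> \<bar>h\<bar>" "?f' (z + \<xi> *\<^sub>R b + h *\<^sub>R c) - ?f' (z + \<xi> *\<^sub>R b)
      = dir_deriv c ?f' (z + \<xi> *\<^sub>R b + \<eta> *\<^sub>R c) * h" by auto
  have "?f' (z + h *\<^sub>R c + \<xi> *\<^sub>R b) - ?f' (z + \<xi> *\<^sub>R b) = dir_deriv c ?f' (z + \<xi> *\<^sub>R b + \<eta> *\<^sub>R c) * h"
    using \<eta>(2) by (simp add: add_ac)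
  with \<xi>(2) have "f (z + h *\<^sub>R b + h *\<^sub>R c) - f (z + h *\<^sub>R b) - f (z + h *\<^sub>R c) + f z
      = dir_deriv c ?f' (z + \<xi> *\<^sub>R b + \<eta> *\<^sub>R c) * h * h" by (simp add: add_ac)
  with \<xi>(1) \<eta>(1) show ?thesis by blast
qed

lemma dir_deriv_commute:
  fixes f :: "'a::euclidean_space \<Rightarrow> real"
  assumes f: "smooth f" and b: "b \<in> Basis" "c \<in> Basis"
  shows "dir_deriv b (dir_deriv c f) z = dir_deriv c (dir_deriv b f) z"
proof (rule ccontr)
  let ?p = "dir_deriv b (dir_deriv c f)" and ?q = "dir_deriv c (dir_deriv b f)"
  define e where "e = \<bar>?p z - ?q z\<bar> / 2"
  assume "?p z \<noteq> ?q z"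
  then have e: "e > 0" by (simp add: e_def)
  have "smooth ?p" "smooth ?q" using f b by (auto intro: smooth_dir_deriv)
  then have "continuous_on UNIV ?p" "continuous_on UNIV ?q" by (auto intro: smooth_continuous)
  then have "isCont ?p z" "isCont ?q z" using continuous_on_eq_continuous_at[OF open_UNIV] by blast+
  then obtain d1 d2 where d: "d1 > 0" "d2 > 0"
    "\<And>x. dist x z < d1 \<Longrightarrow> dist (?p x) (?p z) < e" "\<And>x. dist x z < d2 \<Longrightarrow> dist (?q x) (?q z) < e"
    using e unfolding continuous_at_eps_delta by metis
  define h where "h = min d1 d2 / 3"
  have h: "h > 0" using d by (simp add: h_def)
  have near: "dist (z + s *\<^sub>R u + t *\<^sub>R v) z < min d1 d2"
    if "\<bar>s\<bar> \<le> \<bar>h\<bar>" "\<bar>t\<bar> \<le> \<bar>h\<bar>" "u \<in> Basis" "v \<in> Basis" for s t and u v :: 'a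
  proof -
    have "dist (z + s *\<^sub>R u + t *\<^sub>R v) z = norm (s *\<^sub>R u + t *\<^sub>R v)" by (simp add: dist_norm add.assoc)
    also have "\<dots> \<le> \<bar>s\<bar> + \<bar>t\<bar>" using norm_triangle_ineq[of "s *\<^sub>R u" "t *\<^sub>R v"] that(3,4) by simp
    also have "\<dots> < min d1 d2" using that(1,2) h d(1,2) by (simp add: h_def)
    finally show ?thesis .
  qed
  obtain \<xi> \<eta> where 1: "\<bar>\<xi>\<bar> \<le> \<bar>h\<bar>" "\<bar>\<eta>\<bar> \<le> \<bar>h\<bar>"
    "f (z + h *\<^sub>R b + h *\<^sub>R c) - f (z + h *\<^sub>R b) - f (z + h *\<^sub>R c) + f z = ?q (z + \<xi> *\<^sub>R b + \<eta> *\<^sub>R c) * h * h"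
    using mixed_difference[OF f b(1)] by blast
  obtain \<xi>' \<eta>' where 2: "\<bar>\<xi>'\<bar> \<le> \<bar>h\<bar>" "\<bar>\<eta>'\<bar> \<le> \<bar>h\<bar>"
    "f (z + h *\<^sub>R c + h *\<^sub>R b) - f (z + h *\<^sub>R c) - f (z + h *\<^sub>R b) + f z = ?p (z + \<xi>' *\<^sub>R c + \<eta>' *\<^sub>R b) * h * h"
    using mixed_difference[OF f b(2)] by blast
  have "?q (z + \<xi> *\<^sub>R b + \<eta> *\<^sub>R c) * h * h = ?p (z + \<xi>' *\<^sub>R c + \<eta>' *\<^sub>R b) * h * h"
  proof -
    have "z + h *\<^sub>R c + h *\<^sub>R b = z + h *\<^sub>R b + h *\<^sub>R c" by (simp add: add_ac)
    from 2(3)[unfolded this] 1(3) show ?thesis by linarith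
  qed
  then have eq: "?q (z + \<xi> *\<^sub>R b + \<eta> *\<^sub>R c) = ?p (z + \<xi>' *\<^sub>R c + \<eta>' *\<^sub>R b)" using h by simp
  have "dist (?q (z + \<xi> *\<^sub>R b + \<eta> *\<^sub>R c)) (?q z) < e" using d(4) near[OF 1(1,2) b] by simp
  moreover have "dist (?p (z + \<xi>' *\<^sub>R c + \<eta>' *\<^sub>R b)) (?p z) < e" using d(3) near[OF 2(1,2) b(2,1)] by simp
  ultimately show False unfolding eq dist_real_def e_def by (simp add: abs_if split: if_splits)
qed

section \<open>Quotients by groups of transformations\<close>

text \<open>
  A set of maps of this kind consists of bijections and is closed under inverses, whence the
  orbits form a partition.
\<close>

definition transformation_group :: "('a \<Rightarrow> 'a) set \<Rightarrow> bool" where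
  "transformation_group \<Gamma> \<longleftrightarrow> (\<lambda>z. z) \<in> \<Gamma> \<and> (\<forall>g\<in>\<Gamma>. \<forall>h\<in>\<Gamma>. (\<lambda>z. g (h z)) \<in> \<Gamma>) \<and>
     (\<forall>g\<in>\<Gamma>. \<exists>h\<in>\<Gamma>. \<forall>z. h (g z) = z)"

lemma orbit_eq_iff:
  assumes "transformation_group \<Gamma>"
  shows "orbit \<Gamma> z = orbit \<Gamma> w \<longleftrightarrow> (\<exists>g\<in>\<Gamma>. w = g z)"
proof
  assume "orbit \<Gamma> z = orbit \<Gamma> w"
  moreover have "w \<in> orbit \<Gamma> w"
    using assms unfolding transformation_group_def orbit_def by (auto intro!: image_eqI[of _ _ "\<lambda>z. z"])
  ultimately show "\<exists>g\<in>\<Gamma>. w = g z" unfolding orbit_def by blast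
next
  assume "\<exists>g\<in>\<Gamma>. w = g z"
  then obtain g where g: "g \<in> \<Gamma>" "w = g z" by blast
  then obtain h where h: "h \<in> \<Gamma>" "h w = z" using assms unfolding transformation_group_def by blast
  have sub: "orbit \<Gamma> y \<subseteq> orbit \<Gamma> x" if k: "k \<in> \<Gamma>" "y = k x" for k x y
  proof
    fix v assume "v \<in> orbit \<Gamma> y"
    then obtain l where "l \<in> \<Gamma>" "v = l (k x)" using k unfolding orbit_def by blast
    moreover have "(\<lambda>z. l (k z)) \<in> \<Gamma>" using assms \<open>l \<in> \<Gamma>\<close> k unfolding transformation_group_def by blast
    ultimately show "v \<in> orbit \<Gamma> x" unfolding orbit_def by (intro image_eqI[of _ _ "\<lambda>z. l (k z)"])
  qed
  show "orbit \<Gamma> z = orbit \<Gamma> w" using sub[OF g] sub[OF h(1) h(2)[symmetric]] by blast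
qed

lemma pts_orbit_quotient: "pts (orbit_quotient \<Gamma> Z) = orbit \<Gamma> ` Z"
proof -
  have "topspace (quotient_topology (top_of_set Z) (orbit \<Gamma>)) = orbit \<Gamma> ` Z"
  proof
    show "topspace (quotient_topology (top_of_set Z) (orbit \<Gamma>)) \<subseteq> orbit \<Gamma> ` Z"
      using openin_topspace[of "quotient_topology (top_of_set Z) (orbit \<Gamma>)"]
      by (simp only: openin_quotient_topology topspace_euclidean_subtopology)
    have "{x \<in> Z. orbit \<Gamma> x \<in> orbit \<Gamma> ` Z} = Z" by blast
    then have "openin (quotient_topology (top_of_set Z) (orbit \<Gamma>)) (orbit \<Gamma> ` Z)"
      by (simp add: openin_quotient_topology)
    then show "orbit \<Gamma> ` Z \<subseteq> topspace (quotient_topology (top_of_set Z) (orbit \<Gamma>))"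
      by (rule openin_subset)
  qed
  then show ?thesis by (simp add: pts_def orbit_quotient_def)
qed

lemma openin_orbit_quotient:
  "openin (space_top (orbit_quotient \<Gamma> Z)) V \<longleftrightarrow>
     V \<subseteq> orbit \<Gamma> ` Z \<and> openin (top_of_set Z) {z \<in> Z. orbit \<Gamma> z \<in> V}"
  by (simp add: orbit_quotient_def openin_quotient_topology)

lemma Cinf_orbit_quotient:
  "f \<in> Cinf (orbit_quotient \<Gamma> Z) \<longleftrightarrow> f \<in> extensional (orbit \<Gamma> ` Z) \<and> (\<exists>F. smooth_ext \<Gamma> Z F f)"
  by (simp add: orbit_quotient_def)

text \<open>
  The bracket on an orbit space is a definite description, meaningful only once the bracket of
  invariant functions is known to depend on their classes alone. The hypothesis \<open>wd\<close> expresses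
  this for the given \<open>f\<close> and \<open>g\<close>.
\<close>

lemma brk_orbit_quotient:
  assumes f: "smooth_ext \<Gamma> Z F0 f" and g: "smooth_ext \<Gamma> Z G0 g"
    and wd: "\<And>F G F' G' z z'. smooth_ext \<Gamma> Z F f \<Longrightarrow> smooth_ext \<Gamma> Z G g \<Longrightarrow>
      smooth_ext \<Gamma> Z F' f \<Longrightarrow> smooth_ext \<Gamma> Z G' g \<Longrightarrow> z \<in> Z \<Longrightarrow> z' \<in> Z \<Longrightarrow> orbit \<Gamma> z = orbit \<Gamma> z' \<Longrightarrow>
      std_brk F G z = std_brk F' G' z'"
  shows "brk (orbit_quotient \<Gamma> Z) f g \<in> extensional (orbit \<Gamma> ` Z)"
    and "\<And>F G z. smooth_ext \<Gamma> Z F f \<Longrightarrow> smooth_ext \<Gamma> Z G g \<Longrightarrow> z \<in> Z \<Longrightarrow>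
      brk (orbit_quotient \<Gamma> Z) f g (orbit \<Gamma> z) = std_brk F G z"
proof -
  define P where "P h \<longleftrightarrow> h \<in> extensional (orbit \<Gamma> ` Z) \<and>
    (\<forall>F G. smooth_ext \<Gamma> Z F f \<longrightarrow> smooth_ext \<Gamma> Z G g \<longrightarrow> (\<forall>z\<in>Z. h (orbit \<Gamma> z) = std_brk F G z))" for h
  define h where "h = (\<lambda>\<xi>\<in>orbit \<Gamma> ` Z. std_brk F0 G0 (SOME z. z \<in> Z \<and> orbit \<Gamma> z = \<xi>))"
  have "h (orbit \<Gamma> z) = std_brk F G z"
    if FG: "smooth_ext \<Gamma> Z F f" "smooth_ext \<Gamma> Z G g" and z: "z \<in> Z" for F G z
  proof -
    define z' where "z' = (SOME z'. z' \<in> Z \<and> orbit \<Gamma> z' = orbit \<Gamma> z)"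
    have z': "z' \<in> Z \<and> orbit \<Gamma> z' = orbit \<Gamma> z"
      unfolding z'_def by (rule someI[of _ z]) (simp add: z)
    have "h (orbit \<Gamma> z) = std_brk F0 G0 z'" using z by (simp add: h_def z'_def)
    also have "\<dots> = std_brk F G z" by (rule wd) (use f g FG z z' in auto)
    finally show ?thesis .
  qed
  moreover have "h \<in> extensional (orbit \<Gamma> ` Z)" by (simp add: h_def)
  ultimately have h: "P h" unfolding P_def by blast
  have uniq: "k = h" if k: "P k" for k
  proof (rule extensionalityI)
    show "k \<in> extensional (orbit \<Gamma> ` Z)" "h \<in> extensional (orbit \<Gamma> ` Z)"
      by (rule k[unfolded P_def, THEN conjunct1], rule h[unfolded P_def, THEN conjunct1])
    fix \<xi> assume "\<xi> \<in> orbit \<Gamma> ` Z"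
    then obtain z where "z \<in> Z" "\<xi> = orbit \<Gamma> z" by blast
    then show "k \<xi> = h \<xi>"
      using k[unfolded P_def, THEN conjunct2, rule_format, OF f g]
        h[unfolded P_def, THEN conjunct2, rule_format, OF f g] by simp
  qed
  have "(THE h. P h) = h" by (rule the_equality[of P, OF h uniq])
  moreover have "brk (orbit_quotient \<Gamma> Z) f g = (THE h. P h)"
    unfolding P_def by (simp add: orbit_quotient_def)
  ultimately have PB: "P (brk (orbit_quotient \<Gamma> Z) f g)" using h by simp
  show "brk (orbit_quotient \<Gamma> Z) f g \<in> extensional (orbit \<Gamma> ` Z)"
    by (rule PB[unfolded P_def, THEN conjunct1])
  show "brk (orbit_quotient \<Gamma> Z) f g (orbit \<Gamma> z) = std_brk F G z"
    if "smooth_ext \<Gamma> Z F f" "smooth_ext \<Gamma> Z G g" "z \<in> Z" for F G z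
    by (rule PB[unfolded P_def, THEN conjunct2, rule_format, OF that])
qed

lemma orbit_class_orbit:
  assumes "transformation_group \<Gamma>" "\<And>g z. g \<in> \<Gamma> \<Longrightarrow> F (g z) = F z" "z \<in> Z"
  shows "orbit_class \<Gamma> Z F (orbit \<Gamma> z) = F z"
proof -
  have inv: "F w = F z" if w: "orbit \<Gamma> w = orbit \<Gamma> z" for w
  proof -
    obtain g where "g \<in> \<Gamma>" "z = g w" using w unfolding orbit_eq_iff[OF assms(1)] by blast
    then show ?thesis using assms(2)[of g w] by simp
  qed
  have "(THE c. \<forall>w\<in>Z. orbit \<Gamma> w = orbit \<Gamma> z \<longrightarrow> F w = c) = F z"
  proof (rule the_equality)
    show "\<forall>w\<in>Z. orbit \<Gamma> w = orbit \<Gamma> z \<longrightarrow> F w = F z" using inv by blast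
    show "c = F z" if "\<forall>w\<in>Z. orbit \<Gamma> w = orbit \<Gamma> z \<longrightarrow> F w = c" for c
      using that assms(3) by simp
  qed
  then show ?thesis using assms(3) by (simp add: orbit_class_def)
qed

lemma invariant_chart_orbit:
  assumes "transformation_group \<Gamma>" "\<And>g z i. g \<in> \<Gamma> \<Longrightarrow> \<rho> i (g z) = \<rho> i z" "z \<in> Z"
  shows "invariant_chart \<Gamma> Z \<rho> p (orbit \<Gamma> z) = poly_eval (\<lambda>i. \<rho> i z) p"
  unfolding invariant_chart_def by (rule orbit_class_orbit) (simp_all add: assms)

lemma invariant_chart_extensional: "invariant_chart \<Gamma> Z \<rho> p \<in> extensional (orbit \<Gamma> ` Z)"
  by (simp add: invariant_chart_def orbit_class_def)

text \<open>
  The image of \<open>Z\<close> under homogeneous invariants is stable under the weighted dilations if \<open>Z\<close> is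
  stable under the ordinary ones.
\<close>

lemma homogeneous_ideal_invariant_chart:
  fixes Z :: "'a::real_vector set"
  assumes \<Gamma>: "transformation_group \<Gamma>" "\<And>g z i. g \<in> \<Gamma> \<Longrightarrow> \<rho> i (g z) = \<rho> i z"
    and pts: "pts X = orbit \<Gamma> ` Z"
    and cone: "\<And>t z. t > 0 \<Longrightarrow> z \<in> Z \<Longrightarrow> t *\<^sub>R z \<in> Z"
    and \<rho>: "\<And>t z i. \<rho> i (t *\<^sub>R z) = t ^ v i * \<rho> i z"
  shows "homogeneous_ideal (weight_grading (\<lambda>i. int (v i))) (chart_ker X (invariant_chart \<Gamma> Z \<rho>))"
proof (rule homogeneous_ideal_of_cone[where S = "(\<lambda>z i. \<rho> i z) ` Z"])
  fix p
  have "invariant_chart \<Gamma> Z \<rho> p = fconst X 0 \<longleftrightarrow> (\<forall>\<xi>\<in>orbit \<Gamma> ` Z. invariant_chart \<Gamma> Z \<rho> p \<xi> = 0)"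
    using extensionalityI[OF invariant_chart_extensional[of \<Gamma> Z \<rho> p], of "fconst X 0"]
    by (auto simp: fconst_def pts)
  then show "p \<in> chart_ker X (invariant_chart \<Gamma> Z \<rho>) \<longleftrightarrow> (\<forall>x\<in>(\<lambda>z i. \<rho> i z) ` Z. poly_eval x p = 0)"
    by (simp add: chart_ker_def invariant_chart_orbit[OF \<Gamma>])
next
  fix x and t :: real assume "x \<in> (\<lambda>z i. \<rho> i z) ` Z" "t > 0"
  then obtain z where "z \<in> Z" "x = (\<lambda>i. \<rho> i z)" by blast
  then have "(\<lambda>i. t ^ v i * x i) = (\<lambda>i. \<rho> i (t *\<^sub>R z))" "t *\<^sub>R z \<in> Z"
    using \<rho> cone[OF \<open>t > 0\<close>] by auto
  then show "(\<lambda>i. t ^ v i * x i) \<in> (\<lambda>z i. \<rho> i z) ` Z" by blast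
qed

section \<open>The Poisson bracket and diagonal unitary maps\<close>

definition diag :: "complex ^ 'n \<Rightarrow> complex ^ 'n \<Rightarrow> complex ^ 'n" where
  "diag c z = (\<chi> j. c $ j * z $ j)"

lemma axis_in_Basis: "axis j (1::complex) \<in> Basis" "axis j \<i> \<in> Basis"
  by (auto simp: axis_in_Basis_iff Basis_complex_def)

lemma axis_complex: "axis j p = Re p *\<^sub>R axis j 1 + Im p *\<^sub>R axis j \<i>"
  by (simp add: vec_eq_iff axis_def complex_eq_iff)

lemma dir_deriv_lincomb:
  assumes "smooth f"
  shows "dir_deriv (a *\<^sub>R u + b *\<^sub>R v) f z = a * dir_deriv u f z + b * dir_deriv v f z"
  unfolding smooth_dir_deriv_eq(1)[OF assms, of "a *\<^sub>R u + b *\<^sub>R v"]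
    smooth_dir_deriv_eq(1)[OF assms, of u] smooth_dir_deriv_eq(1)[OF assms, of v]
  by (simp add: inner_add_left distrib_left sum.distrib sum_distrib_left mult_ac)

lemma dir_deriv_axis:
  assumes "smooth (f :: complex ^ 'n \<Rightarrow> real)"
  shows "dir_deriv (axis j p) f z = Re p * dir_deriv (axis j 1) f z + Im p * dir_deriv (axis j \<i>) f z"
  by (subst axis_complex) (rule dir_deriv_lincomb[OF assms])

lemma dir_deriv_diag:
  assumes "\<And>j. cmod (c $ j) = 1" "\<And>z. f (diag c z) = f z"
  shows "dir_deriv (axis j p) f (diag c z) = dir_deriv (axis j (cnj (c $ j) * p)) f z"
proof -
  have "diag c z + t *\<^sub>R axis j p = diag c (z + t *\<^sub>R axis j (cnj (c $ j) * p))" for t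
  proof -
    have "c $ j * cnj (c $ j) = 1" using assms(1)[of j] by (simp add: complex_norm_square[symmetric])
    then have "c $ j * (cnj (c $ j) * p) = p" by (metis mult.assoc mult_1)
    then show ?thesis
      by (auto simp: vec_eq_iff diag_def axis_def algebra_simps)
  qed
  then show ?thesis by (simp add: dir_deriv_def assms(2))
qed

text \<open>
  Multiplication of the coordinates by complex numbers of modulus one is symplectic.
\<close>

lemma std_brk_diag:
  assumes c: "\<And>j. cmod (c $ j) = 1"
    and f: "smooth f" "\<And>z. f (diag c z) = f z" and g: "smooth g" "\<And>z. g (diag c z) = g z"
  shows "std_brk f g (diag c z) = std_brk f g z"
  unfolding std_brk_def
proof (rule sum.cong[OF refl])
  fix j
  define a b where "a = Re (c $ j)" and "b = Im (c $ j)"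
  have ab: "a * a + b * b = 1"
    using c[of j] by (simp add: a_def b_def cmod_def power2_eq_square)
  have 1: "dir_deriv (axis j 1) h (diag c z) = a * dir_deriv (axis j 1) h z - b * dir_deriv (axis j \<i>) h z"
    "dir_deriv (axis j \<i>) h (diag c z) = b * dir_deriv (axis j 1) h z + a * dir_deriv (axis j \<i>) h z"
    if "smooth h" "\<And>z. h (diag c z) = h z" for h
    unfolding dir_deriv_diag[where c = c and f = h, OF c that(2)]
    by (subst dir_deriv_axis[OF that(1)], simp add: a_def b_def)+
  have "(a * p - b * q) * (b * r + a * s) - (b * p + a * q) * (a * r - b * s) = (a * a + b * b) * (p * s - q * r)"
    for p q r s by (simp add: algebra_simps)
  then show "dir_deriv (axis j 1) f (diag c z) * dir_deriv (axis j \<i>) g (diag c z) -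
         dir_deriv (axis j \<i>) f (diag c z) * dir_deriv (axis j 1) g (diag c z) =
         dir_deriv (axis j 1) f z * dir_deriv (axis j \<i>) g z -
         dir_deriv (axis j \<i>) f z * dir_deriv (axis j 1) g z"
    unfolding 1[OF f] 1[OF g] ab by simp
qed

lemma smooth_std_brk:
  assumes "smooth f" "smooth g"
  shows "smooth (std_brk f g)"
  unfolding std_brk_def
  by (intro smooth_sum smooth_diff smooth_mult smooth_dir_deriv axis_in_Basis assms)

section \<open>Cyclic quotients\<close>

lemma std_brk_1:
  "std_brk f g (z :: complex ^ 1) =
     dir_deriv (axis 1 1) f z * dir_deriv (axis 1 \<i>) g z - dir_deriv (axis 1 \<i>) f z * dir_deriv (axis 1 1) g z"
  by (simp add: std_brk_def)

lemma cyclic_maps_group: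
  assumes "N > 0"
  shows "transformation_group (cyclic_maps N)"
  unfolding transformation_group_def
proof (intro conjI ballI)
  show "(\<lambda>z. z) \<in> cyclic_maps N" unfolding cyclic_maps_def by (auto intro!: exI[of _ 1])
  fix g assume "g \<in> cyclic_maps N"
  then obtain u where u: "g = (\<lambda>z. u *s z)" "u ^ N = 1" unfolding cyclic_maps_def by blast
  have "u \<noteq> 0" using u(2) assms by (metis power_eq_0_iff zero_neq_one)
  show "\<exists>h\<in>cyclic_maps N. \<forall>z. h (g z) = z"
    using u \<open>u \<noteq> 0\<close> unfolding cyclic_maps_def
    by (intro bexI[of _ "\<lambda>z. inverse u *s z"]) (auto simp: power_inverse vec_eq_iff intro!: exI[of _ "inverse u"])
  fix h assume "h \<in> cyclic_maps N"
  then obtain v where v: "h = (\<lambda>z. v *s z)" "v ^ N = 1" unfolding cyclic_maps_def by blast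
  show "(\<lambda>z. g (h z)) \<in> cyclic_maps N"
    unfolding cyclic_maps_def using u v
    by (auto simp: power_mult_distrib vec_eq_iff intro!: exI[of _ "u * v"])
qed

lemma cyclic_orbit_eq_iff:
  assumes "N > 0"
  shows "orbit (cyclic_maps N) z = orbit (cyclic_maps N) w \<longleftrightarrow> (z $ 1) ^ N = (w $ 1) ^ N"
proof -
  have "(\<exists>g\<in>cyclic_maps N. w = g z) \<longleftrightarrow> (\<exists>u. u ^ N = 1 \<and> w $ 1 = u * z $ 1)"
    unfolding cyclic_maps_def by (auto simp: vec_eq_iff)
  also have "\<dots> \<longleftrightarrow> (z $ 1) ^ N = (w $ 1) ^ N"
  proof
    assume eq: "(z $ 1) ^ N = (w $ 1) ^ N"
    show "\<exists>u. u ^ N = 1 \<and> w $ 1 = u * z $ 1"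
    proof (cases "z $ 1 = 0")
      case True
      then have "w $ 1 = 0" using eq assms by (metis power_eq_0_iff zero_power)
      then show ?thesis using True by (intro exI[of _ 1]) simp
    next
      case False
      then show ?thesis by (intro exI[of _ "w $ 1 / z $ 1"]) (simp add: power_divide eq[symmetric])
    qed
  qed (auto simp: power_mult_distrib)
  finally show ?thesis unfolding orbit_eq_iff[OF cyclic_maps_group[OF assms]] .
qed

lemma pts_cyclic_quotient: "pts (cyclic_quotient N) = range (orbit (cyclic_maps N))"
  unfolding cyclic_quotient_def by (rule pts_orbit_quotient)

text \<open>
  For the whole space there is nothing to extend: an invariant smooth function is determined by
  its class.
\<close>

lemma smooth_ext_cyclic_iff:
  assumes "N > 0"
  shows "smooth_ext (cyclic_maps N) UNIV F f \<longleftrightarrow> smooth F \<and> F = (\<lambda>z. f (orbit (cyclic_maps N) z))"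
proof -
  have "orbit (cyclic_maps N) (g z) = orbit (cyclic_maps N) z" if "g \<in> cyclic_maps N" for g z
    using orbit_eq_iff[OF cyclic_maps_group[OF assms]] that by blast
  then show ?thesis unfolding smooth_ext_def by auto
qed

lemma Cinf_cyclic_iff:
  assumes "N > 0"
  shows "f \<in> Cinf (cyclic_quotient N) \<longleftrightarrow>
    f \<in> extensional (pts (cyclic_quotient N)) \<and> smooth (\<lambda>z. f (orbit (cyclic_maps N) z))"
  unfolding pts_cyclic_quotient
  unfolding cyclic_quotient_def Cinf_orbit_quotient smooth_ext_cyclic_iff[OF assms] by auto

lemma Cinf_cyclicI:
  assumes "N > 0" "f \<in> extensional (pts (cyclic_quotient N))" "smooth F"
    "\<And>z. f (orbit (cyclic_maps N) z) = F z"
  shows "f \<in> Cinf (cyclic_quotient N)"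
  using assms(2,3) unfolding Cinf_cyclic_iff[OF assms(1)] assms(4) by simp

lemma brk_cyclic:
  assumes N: "N > 0" and f: "f \<in> Cinf (cyclic_quotient N)" and g: "g \<in> Cinf (cyclic_quotient N)"
  shows "brk (cyclic_quotient N) f g \<in> extensional (pts (cyclic_quotient N))"
    and "brk (cyclic_quotient N) f g (orbit (cyclic_maps N) z) =
      std_brk (\<lambda>z. f (orbit (cyclic_maps N) z)) (\<lambda>z. g (orbit (cyclic_maps N) z)) z"
proof -
  let ?o = "orbit (cyclic_maps N)"
  have ext: "smooth_ext (cyclic_maps N) UNIV (\<lambda>z. f (?o z)) f" "smooth_ext (cyclic_maps N) UNIV (\<lambda>z. g (?o z)) g"
    using f g by (simp_all add: smooth_ext_cyclic_iff[OF N] Cinf_cyclic_iff[OF N])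
  have wd: "std_brk F G z = std_brk F' G' z'"
    if FG: "smooth_ext (cyclic_maps N) UNIV F f" "smooth_ext (cyclic_maps N) UNIV G g"
      "smooth_ext (cyclic_maps N) UNIV F' f" "smooth_ext (cyclic_maps N) UNIV G' g"
      and "z \<in> UNIV" "z' \<in> UNIV" and z: "?o z = ?o z'" for F G F' G' z z'
  proof -
    have eq: "F = F'" "G = G'" using FG by (simp_all add: smooth_ext_cyclic_iff[OF N])
    obtain k where k: "k \<in> cyclic_maps N" "z' = k z"
      using z unfolding orbit_eq_iff[OF cyclic_maps_group[OF N]] by blast
    then obtain u where u: "u ^ N = 1" "z' = u *s z" unfolding cyclic_maps_def by blast
    have dz: "u *s z = diag (\<chi> j. u) z" for z by (simp add: diag_def vec_eq_iff)
    have inv: "(\<lambda>z. u *s z) \<in> cyclic_maps N" using u(1) unfolding cyclic_maps_def by blast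
    have "std_brk F G (diag (\<chi> j. u) z) = std_brk F G z"
    proof (rule std_brk_diag)
      show "cmod ((\<chi> j. u) $ j) = 1" for j :: 1 using norm_root_unity[OF u(1) N] by simp
      show "F (diag (\<chi> j. u) z) = F z" "G (diag (\<chi> j. u) z) = G z" for z
        using FG(1,2) inv unfolding smooth_ext_def dz[symmetric] by blast+
    qed (use FG in \<open>simp_all add: smooth_ext_def\<close>)
    then show ?thesis by (simp add: eq u(2) dz)
  qed
  show "brk (cyclic_quotient N) f g \<in> extensional (pts (cyclic_quotient N))"
    unfolding pts_cyclic_quotient unfolding cyclic_quotient_def
    by (rule brk_orbit_quotient(1)[OF ext]) (rule wd)
  show "brk (cyclic_quotient N) f g (?o z) = std_brk (\<lambda>z. f (?o z)) (\<lambda>z. g (?o z)) z"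
    unfolding cyclic_quotient_def 
    by (rule brk_orbit_quotient(2)[OF ext _ ext UNIV_I]) (rule wd)
qed

lemma smooth_vec1: "smooth (\<lambda>z::complex^1. F (z $ 1))" if "smooth F" for F :: "complex \<Rightarrow> real"
  by (rule smooth_linear[OF that]) (simp add: linear_iff)

lemma open_power_image_vec1:
  assumes "N > 0" "open (W :: (complex ^ 1) set)"
  shows "open ((\<lambda>z. (z $ 1) ^ N) ` W)"
proof -
  have "open ((\<lambda>x::complex. (\<chi> j. x) :: complex ^ 1) -` W)"
    by (rule open_vimage[OF assms(2)]) (intro continuous_intros continuous_on_vec_lambda)
  moreover have "(\<lambda>z. (z $ 1) ^ N) ` W = (\<lambda>z. z ^ N) ` ((\<lambda>x. (\<chi> j. x)) -` W)"
  proof -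
    have "(\<chi> j. z $ 1) = z" for z :: "complex ^ 1" by (simp add: vec_eq_iff)
    then show ?thesis by (force simp: image_iff)
  qed
  ultimately show ?thesis using open_power_image[OF assms(1)] by simp
qed

lemma openin_cyclic_quotient:
  "openin (space_top (cyclic_quotient N)) V \<longleftrightarrow>
     V \<subseteq> pts (cyclic_quotient N) \<and> open {z. orbit (cyclic_maps N) z \<in> V}"
  unfolding pts_cyclic_quotient unfolding cyclic_quotient_def openin_orbit_quotient by simp

text \<open>
  The invariant functions \<open>|z ^ N - z0 ^ N|^2\<close> generate the quotient topology, because \<open>z \<mapsto> z ^ N\<close>
  is open; smoothness is local and stable under composition with smooth functions already on the
  complex plane.
\<close>

lemma differential_space_cyclic:
  assumes N: "N > 0"
  shows "differential_space (cyclic_quotient N)"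
proof -
  let ?X = "cyclic_quotient N" and ?o = "orbit (cyclic_maps N)"
  note C = Cinf_cyclic_iff[OF N]
  have o: "?o z \<in> pts ?X" for z by (simp add: pts_cyclic_quotient)
  have cont: "openin (space_top ?X) (f -` U \<inter> pts ?X)" if "f \<in> Cinf ?X" "open U" for f U
  proof -
    have "open ((\<lambda>z. f (?o z)) -` U)"
      using that by (intro open_vimage smooth_continuous) (auto simp: C)
    then show ?thesis unfolding openin_cyclic_quotient by (simp add: o vimage_def)
  qed
  define B where "B = {f -` U \<inter> pts ?X | f U. f \<in> Cinf ?X \<and> open (U::real set)}"
  have "space_top ?X = topology_generated_by B"
    unfolding topology_eq
  proof (intro allI iffI)
    fix S assume S: "openin (space_top ?X) S"
    define W where "W = {z. ?o z \<in> S}"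
    have W: "open W" "S \<subseteq> pts ?X" using S by (simp_all add: openin_cyclic_quotient W_def)
    have basis: "\<exists>T\<in>B. \<xi> \<in> T \<and> T \<subseteq> S" if \<xi>: "\<xi> \<in> S" for \<xi>
    proof -
      obtain z0 where z0: "\<xi> = ?o z0" using \<xi> W(2) by (auto simp: pts_cyclic_quotient)
      have "(z0 $ 1) ^ N \<in> (\<lambda>z. (z $ 1) ^ N) ` W" using \<xi> z0 by (simp add: W_def)
      then obtain r where r: "r > 0" "ball ((z0 $ 1) ^ N) r \<subseteq> (\<lambda>z. (z $ 1) ^ N) ` W"
        using open_power_image_vec1[OF N W(1)] open_contains_ball by blast
      \<comment> \<open>An invariant function that is small at \<open>z\<close> only if \<open>z ^ N\<close> is close to \<open>z0 ^ N\<close>.\<close>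
      define F where "F z = (cmod ((z $ 1) ^ N - (z0 $ 1) ^ N))\<^sup>2" for z :: "complex ^ 1"
      define f where "f = (\<lambda>\<eta>\<in>pts ?X. F (SOME z. ?o z = \<eta>))"
      have fF: "f (?o z) = F z" for z
      proof -
        define w where "w = (SOME w. ?o w = ?o z)"
        have "?o w = ?o z" unfolding w_def by (rule someI[of _ z]) simp
        then have "(w $ 1) ^ N = (z $ 1) ^ N" by (simp add: cyclic_orbit_eq_iff[OF N])
        then have "F w = F z" by (simp add: F_def)
        then show ?thesis by (simp add: f_def o w_def)
      qed
      have "smooth F"
      proof -
        have "smooth (\<lambda>z. (Re (1 * z ^ N * cnj z ^ 0) - Re ((z0 $ 1) ^ N))\<^sup>2 + (Im (1 * z ^ N * cnj z ^ 0) - Im ((z0 $ 1) ^ N))\<^sup>2)"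
          by (intro smooth_add smooth_power smooth_diff smooth_complex_monomial smooth_const)
        from smooth_vec1[OF this] show ?thesis by (simp add: F_def[abs_def] cmod_power2)
      qed
      then have "f \<in> Cinf ?X" 
        by (intro Cinf_cyclicI[where f = f and F = F] N fF) (simp_all add: f_def)
      then have "f -` {..<r\<^sup>2} \<inter> pts ?X \<in> B"
        unfolding B_def by (intro CollectI exI[of _ f] exI[of _ "{..<r\<^sup>2}"]) simp
      moreover have "\<xi> \<in> f -` {..<r\<^sup>2} \<inter> pts ?X" using r(1) by (simp add: z0 fF o F_def)
      moreover have "f -` {..<r\<^sup>2} \<inter> pts ?X \<subseteq> S"
      proof
        fix \<eta> assume "\<eta> \<in> f -` {..<r\<^sup>2} \<inter> pts ?X"
        then obtain z where z: "\<eta> = ?o z" "F z < r\<^sup>2" by (auto simp: pts_cyclic_quotient fF)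
        then have "cmod ((z $ 1) ^ N - (z0 $ 1) ^ N) < r" using r(1) unfolding F_def
          by (simp add: power_less_imp_less_base)
        then have "(z $ 1) ^ N \<in> (\<lambda>z. (z $ 1) ^ N) ` W" using r(2) by (auto simp: dist_norm norm_minus_commute)
        then obtain w where "w \<in> W" "(z $ 1) ^ N = (w $ 1) ^ N" by blast
        then have "?o z = ?o w" by (simp add: cyclic_orbit_eq_iff[OF N])
        then show "\<eta> \<in> S" using \<open>w \<in> W\<close> z(1) by (simp add: W_def)
      qed
      ultimately show ?thesis by (intro bexI[of _ "f -` {..<r\<^sup>2} \<inter> pts ?X"] conjI)
    qed
    have "S = \<Union>{T \<in> B. T \<subseteq> S}"
    proof
      show "S \<subseteq> \<Union>{T \<in> B. T \<subseteq> S}"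
      proof
        fix \<xi> assume "\<xi> \<in> S"
        then obtain T where "T \<in> B" "\<xi> \<in> T" "T \<subseteq> S" using basis by metis
        then show "\<xi> \<in> \<Union>{T \<in> B. T \<subseteq> S}" by (intro UnionI[of T]) simp_all
      qed
    qed (rule Union_least, simp)
    moreover have "generate_topology_on B (\<Union>{T \<in> B. T \<subseteq> S})"
      by (rule generate_topology_on.UN) (auto intro: generate_topology_on.Basis)
    ultimately show "openin (topology_generated_by B) S" by (simp add: openin_topology_generated_by_iff)
  next
    fix S assume "openin (topology_generated_by B) S"
    then have "generate_topology_on B S" by (simp add: openin_topology_generated_by_iff)
    then show "openin (space_top ?X) S"
    proof induction
      case (Basis s)
      then show ?case using cont unfolding B_def by blast
    qed auto
  qed
  then have top: "space_top ?X = topology_generated_by {f -` U \<inter> pts ?X | f U. f \<in> Cinf ?X \<and> open U}"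
    unfolding B_def .
  show ?thesis
    unfolding differential_space_def
  proof (intro conjI top)
    show "Cinf ?X \<subseteq> extensional (pts ?X)" by (auto simp: C)
    show "\<forall>f\<in>Cinf ?X. continuous_map (space_top ?X) euclideanreal f"
    proof
      fix f assume f: "f \<in> Cinf ?X"
      have "{x \<in> topspace (space_top ?X). f x \<in> U} = f -` U \<inter> pts ?X" for U by (auto simp: pts_def)
      then show "continuous_map (space_top ?X) euclideanreal f"
        using cont[OF f] by (simp add: continuous_map)
    qed
    show "\<forall>c. fconst ?X c \<in> Cinf ?X"
      by (auto intro!: Cinf_cyclicI[OF N _ smooth_const] simp: fconst_def o)
    show "\<forall>f\<in>Cinf ?X. \<forall>g\<in>Cinf ?X. fadd ?X f g \<in> Cinf ?X \<and> fmult ?X f g \<in> Cinf ?X"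
    proof (intro ballI conjI)
      fix f g assume "f \<in> Cinf ?X" "g \<in> Cinf ?X"
      then have s: "smooth (\<lambda>z. f (?o z))" "smooth (\<lambda>z. g (?o z))" by (simp_all add: C)
      show "fadd ?X f g \<in> Cinf ?X" by (rule Cinf_cyclicI[OF N _ smooth_add[OF s]]) (simp_all add: fadd_def o)
      show "fmult ?X f g \<in> Cinf ?X" by (rule Cinf_cyclicI[OF N _ smooth_mult[OF s]]) (simp_all add: fmult_def o)
    qed
    show "\<forall>k. \<forall>F\<in>smooth_fun {..<k::nat}. \<forall>f\<in>{..<k} \<rightarrow> Cinf ?X. (\<lambda>\<xi>\<in>pts ?X. F (\<lambda>i. f i \<xi>)) \<in> Cinf ?X"
    proof (intro allI ballI)
      fix k :: nat and F and f :: "nat \<Rightarrow> (complex ^ 1) set \<Rightarrow> real"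
      assume F: "F \<in> smooth_fun {..<k}" and f: "f \<in> {..<k} \<rightarrow> Cinf ?X"
      have "smooth (\<lambda>z. f j (?o z))" if "j \<in> {..<k}" for j
        using f that C by blast
      then have "smooth (\<lambda>z. F (\<lambda>j. f j (?o z)))"
        by (rule smooth_compose_fun[where g = "\<lambda>j z. f j (?o z)", OF finite_lessThan F])
      then show "(\<lambda>\<xi>\<in>pts ?X. F (\<lambda>i. f i \<xi>)) \<in> Cinf ?X"
        by (intro Cinf_cyclicI[where F = "\<lambda>z. F (\<lambda>j. f j (?o z))"] N) (simp_all add: o)
    qed
    show "\<forall>f\<in>extensional (pts ?X).
        (\<forall>\<xi>\<in>pts ?X. \<exists>U g. openin (space_top ?X) U \<and> \<xi> \<in> U \<and> g \<in> Cinf ?X \<and> (\<forall>\<eta>\<in>U. f \<eta> = g \<eta>))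
        \<longrightarrow> f \<in> Cinf ?X"
    proof (intro ballI impI)
      fix f assume f: "f \<in> extensional (pts ?X)"
        and loc: "\<forall>\<xi>\<in>pts ?X. \<exists>U g. openin (space_top ?X) U \<and> \<xi> \<in> U \<and> g \<in> Cinf ?X \<and> (\<forall>\<eta>\<in>U. f \<eta> = g \<eta>)"
      have "smooth (\<lambda>z. f (?o z))"
      proof (rule smooth_local)
        fix z
        obtain U g where U: "openin (space_top ?X) U" "?o z \<in> U" "g \<in> Cinf ?X" "\<forall>\<eta>\<in>U. f \<eta> = g \<eta>"
          using loc o by blast
        show "\<exists>U g. open U \<and> z \<in> U \<and> smooth g \<and> (\<forall>w\<in>U. f (?o w) = g w)"
          using U by (intro exI[of _ "{w. ?o w \<in> U}"] exI[of _ "\<lambda>w. g (?o w)"])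
            (auto simp: openin_cyclic_quotient C)
      qed
      then show "f \<in> Cinf ?X" using f by (simp add: C)
    qed
  qed
qed

lemma std_brk_antisym: "std_brk f g z = - std_brk g f z"
  unfolding std_brk_def sum_negf[symmetric] by (rule sum.cong) (simp_all add: mult.commute)

lemma std_brk_add_left:
  assumes "smooth f" "smooth g"
  shows "std_brk (\<lambda>z. f z + g z) h z = std_brk f h z + std_brk g h z"
  unfolding std_brk_def dir_deriv_add[OF assms] by (simp add: sum.distrib[symmetric] algebra_simps)

lemma std_brk_mult_left:
  assumes "smooth f" "smooth g"
  shows "std_brk (\<lambda>z. f z * g z) h z = std_brk f h z * g z + f z * std_brk g h z"
  unfolding std_brk_def dir_deriv_mult[OF assms] sum_distrib_left sum_distrib_right
  by (simp add: sum.distrib[symmetric] algebra_simps)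

lemma dir_deriv_const [simp]: "dir_deriv v (\<lambda>z. c) = (\<lambda>z. 0)"
  by (intro HOL.ext dir_deriv_unique) simp

lemma std_brk_const_left: "std_brk (\<lambda>z. c) h z = 0"
  unfolding std_brk_def by simp

lemma dir_deriv_diff:
  fixes f g :: "'a::euclidean_space \<Rightarrow> real"
  assumes "smooth f" "smooth g"
  shows "dir_deriv v (\<lambda>z. f z - g z) = (\<lambda>z. dir_deriv v f z - dir_deriv v g z)"
  by (intro ext dir_deriv_unique DERIV_diff smooth_has_dir_deriv assms)

text \<open>
  In one complex dimension, every term of the expansion cancels once second derivatives commute.
\<close>

lemma std_brk_jacobi_1:
  fixes f g h :: "complex ^ 1 \<Rightarrow> real"
  assumes "smooth f" "smooth g" "smooth h"
  shows "std_brk f (std_brk g h) z + (std_brk g (std_brk h f) z + std_brk h (std_brk f g) z) = 0"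
proof -
  let ?x = "axis 1 1 :: complex ^ 1" and ?y = "axis 1 \<i> :: complex ^ 1"
  have expand: "dir_deriv v (std_brk g h) z =
     dir_deriv v (dir_deriv ?x g) z * dir_deriv ?y h z + dir_deriv v (dir_deriv ?y h) z * dir_deriv ?x g z
     - (dir_deriv v (dir_deriv ?y g) z * dir_deriv ?x h z + dir_deriv v (dir_deriv ?x h) z * dir_deriv ?y g z)"
    if "smooth g" "smooth h" for g h v
  proof -
    have s: "smooth (dir_deriv ?x g)" "smooth (dir_deriv ?y g)" "smooth (dir_deriv ?x h)" "smooth (dir_deriv ?y h)"
      using that by (auto intro: smooth_dir_deriv axis_in_Basis)
    have "std_brk g h = (\<lambda>z. dir_deriv ?x g z * dir_deriv ?y h z - dir_deriv ?y g z * dir_deriv ?x h z)"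
      by (rule HOL.ext) (rule std_brk_1)
    then show ?thesis
      by (simp add: dir_deriv_diff dir_deriv_mult smooth_mult s)
  qed
  have comm: "dir_deriv ?y (dir_deriv ?x k) z = dir_deriv ?x (dir_deriv ?y k) z" if "smooth k" for k
    using dir_deriv_commute[OF that axis_in_Basis(2,1)] .
  show ?thesis
    unfolding std_brk_1[of f] std_brk_1[of g "std_brk h f"] std_brk_1[of h "std_brk f g"]
      expand[OF assms(2,3)] expand[OF assms(3,1)] expand[OF assms(1,2)]
      comm[OF assms(1)] comm[OF assms(2)] comm[OF assms(3)]
    by (simp add: algebra_simps)
qed

lemma poisson_bracket_on_cyclic:
  assumes N: "N > 0"
  shows "poisson_bracket_on (cyclic_quotient N)"
proof -
  let ?X = "cyclic_quotient N" and ?o = "orbit (cyclic_maps N)"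
  note C = Cinf_cyclic_iff[OF N]
  have o: "?o z \<in> pts ?X" for z by (simp add: pts_cyclic_quotient)
  have eqI: "f = g" if "f \<in> extensional (pts ?X)" "g \<in> extensional (pts ?X)" "\<And>z. f (?o z) = g (?o z)" for f g
    by (rule extensionalityI[OF that(1,2)]) (use that(3) in \<open>auto simp: pts_cyclic_quotient\<close>)
  have add: "fadd ?X f g (?o z) = f (?o z) + g (?o z)" and mult: "fmult ?X f g (?o z) = f (?o z) * g (?o z)"
    and const: "fconst ?X c (?o z) = c" for f g c z by (simp_all add: fadd_def fmult_def fconst_def o)
  have cl: "fconst ?X c \<in> Cinf ?X" "f \<in> Cinf ?X \<Longrightarrow> g \<in> Cinf ?X \<Longrightarrow> fadd ?X f g \<in> Cinf ?X"
    "f \<in> Cinf ?X \<Longrightarrow> g \<in> Cinf ?X \<Longrightarrow> fmult ?X f g \<in> Cinf ?X" for c f g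
    using differential_spaceD(3,4)[OF differential_space_cyclic[OF N]] by auto
  have sm: "smooth (\<lambda>z. f (?o z))" if "f \<in> Cinf ?X" for f using that by (simp add: C)
  note br = brk_cyclic[OF N]
  have bC: "brk ?X f g \<in> Cinf ?X" if "f \<in> Cinf ?X" "g \<in> Cinf ?X" for f g
    by (rule Cinf_cyclicI[OF N br(1)[OF that] smooth_std_brk[OF sm[OF that(1)] sm[OF that(2)]] br(2)[OF that]])
  show ?thesis
    unfolding poisson_bracket_on_def
  proof (intro conjI ballI allI)
    fix f g assume fg: "f \<in> Cinf ?X" "g \<in> Cinf ?X"
    show "brk ?X f g \<in> Cinf ?X" by (rule bC[OF fg])
    show "brk ?X (fmult ?X (fconst ?X c) f) g = fmult ?X (fconst ?X c) (brk ?X f g)" for c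
    proof (rule eqI)
      fix z
      have "brk ?X (fmult ?X (fconst ?X c) f) g (?o z) = std_brk (\<lambda>z. c * f (?o z)) (\<lambda>z. g (?o z)) z"
        by (simp add: br(2) cl fg mult const)
      also have "\<dots> = c * std_brk (\<lambda>z. f (?o z)) (\<lambda>z. g (?o z)) z"
        using std_brk_mult_left[OF smooth_const sm[OF fg(1)]] by (simp add: std_brk_const_left)
      finally show "brk ?X (fmult ?X (fconst ?X c) f) g (?o z) = fmult ?X (fconst ?X c) (brk ?X f g) (?o z)"
        by (simp add: br(2) fg mult const)
    qed (simp_all add: br(1) cl fg)
    show "brk ?X f g = fmult ?X (fconst ?X (-1)) (brk ?X g f)"
    proof (rule eqI)
      fix z
      show "brk ?X f g (?o z) = fmult ?X (fconst ?X (-1)) (brk ?X g f) (?o z)"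
        unfolding mult const br(2)[OF fg] br(2)[OF fg(2,1)]
        using std_brk_antisym[of "\<lambda>z. f (?o z)" "\<lambda>z. g (?o z)" z] by simp
    qed (simp_all add: br(1) fg)
    fix h assume h: "h \<in> Cinf ?X"
    show "brk ?X (fadd ?X f g) h = fadd ?X (brk ?X f h) (brk ?X g h)"
    proof (rule eqI)
      fix z
      show "brk ?X (fadd ?X f g) h (?o z) = fadd ?X (brk ?X f h) (brk ?X g h) (?o z)"
        unfolding add br(2)[OF cl(2)[OF fg] h] br(2)[OF fg(1) h] br(2)[OF fg(2) h]
        by (rule std_brk_add_left[OF sm[OF fg(1)] sm[OF fg(2)]])
    qed (simp_all add: br(1) fg h cl)
    show "fadd ?X (brk ?X f (brk ?X g h)) (fadd ?X (brk ?X g (brk ?X h f)) (brk ?X h (brk ?X f g))) = fconst ?X 0"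
    proof (rule eqI)
      fix z
      have 2: "brk ?X f (brk ?X g h) (?o z) = std_brk (\<lambda>z. f (?o z)) (std_brk (\<lambda>z. g (?o z)) (\<lambda>z. h (?o z))) z"
        if "f \<in> Cinf ?X" "g \<in> Cinf ?X" "h \<in> Cinf ?X" for f g h
        unfolding br(2)[OF that(1) bC[OF that(2,3)]] br(2)[OF that(2,3)] ..
      show "fadd ?X (brk ?X f (brk ?X g h)) (fadd ?X (brk ?X g (brk ?X h f)) (brk ?X h (brk ?X f g))) (?o z)
          = fconst ?X 0 (?o z)"
        unfolding add const 2[OF fg h] 2[OF fg(2) h fg(1)] 2[OF h fg]
        by (rule std_brk_jacobi_1[OF sm[OF fg(1)] sm[OF fg(2)] sm[OF h]])
    qed simp_all
    show "brk ?X f (fmult ?X g h) = fadd ?X (fmult ?X (brk ?X f g) h) (fmult ?X g (brk ?X f h))"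
    proof (rule eqI)
      fix z
      let ?F = "\<lambda>z. f (?o z)" and ?G = "\<lambda>z. g (?o z)" and ?H = "\<lambda>z. h (?o z)"
      have "brk ?X f (fmult ?X g h) (?o z) = std_brk ?F (\<lambda>z. ?G z * ?H z) z"
        unfolding br(2)[OF fg(1) cl(3)[OF fg(2) h]] mult ..
      also have "\<dots> = std_brk ?F ?G z * ?H z + ?G z * std_brk ?F ?H z"
        using std_brk_antisym[of ?F "\<lambda>z. ?G z * ?H z" z] std_brk_mult_left[OF sm[OF fg(2)] sm[OF h], of ?F z]
          std_brk_antisym[of ?F ?G z] std_brk_antisym[of ?F ?H z] by simp
      finally show "brk ?X f (fmult ?X g h) (?o z) = fadd ?X (fmult ?X (brk ?X f g) h) (fmult ?X g (brk ?X f h)) (?o z)"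
        unfolding add mult br(2)[OF fg] br(2)[OF fg(1) h] .
    qed (simp_all add: br(1) fg h cl)
  qed
qed


lemma cyclic_invariants_invariant:
  assumes "N > 0" "g \<in> cyclic_maps N"
  shows "cyclic_invariants N k (g z) = cyclic_invariants N k z"
proof -
  obtain u where u: "g = (\<lambda>z. u *s z)" "u ^ N = 1" using assms(2) unfolding cyclic_maps_def by blast
  then show ?thesis using norm_root_unity[OF u(2) assms(1)]
    by (simp add: cyclic_invariants_def power_mult_distrib norm_mult)
qed

lemma smooth_cyclic_invariants: "smooth (cyclic_invariants N k)"
proof -
  have "smooth (\<lambda>z. Re (1 * z ^ N * cnj z ^ 0))" "smooth (\<lambda>z. Im (1 * z ^ N * cnj z ^ 0))"
    by (rule smooth_complex_monomial)+
  from this[THEN smooth_vec1] smooth_vec1[OF smooth_norm_square]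
  show ?thesis by (cases "k = 1"; cases "k = 2") (simp_all add: cyclic_invariants_def[abs_def])
qed

lemma cyclic_chart_orbit:
  assumes "N > 0"
  shows "cyclic_chart N p (orbit (cyclic_maps N) z) = poly_eval (\<lambda>i. cyclic_invariants N i z) p"
  unfolding cyclic_chart_def
  by (rule invariant_chart_orbit[OF cyclic_maps_group[OF assms] cyclic_invariants_invariant[OF assms]]) simp_all

lemma cyclic_chart_extensional: "cyclic_chart N p \<in> extensional (pts (cyclic_quotient N))"
  unfolding cyclic_chart_def pts_cyclic_quotient by (rule invariant_chart_extensional)

lemma dir_deriv_holomorphic:
  assumes "(h has_field_derivative h') (at (z $ 1))"
  shows "dir_deriv (axis 1 p) (\<lambda>z. Re (h (z $ 1))) (z :: complex ^ 1) = Re (p * h')"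
    and "dir_deriv (axis 1 p) (\<lambda>z. Im (h (z $ 1))) (z :: complex ^ 1) = Im (p * h')"
proof -
  have "((\<lambda>t. z $ 1 + t *\<^sub>R p) has_vector_derivative p) (at 0)"
    by (auto intro!: derivative_eq_intros)
  from field_vector_diff_chain_at[OF this, of h h'] assms
  have d: "((\<lambda>t. h ((z + t *\<^sub>R axis 1 p) $ 1)) has_vector_derivative p * h') (at 0)"
    by (simp add: o_def)
  show "dir_deriv (axis 1 p) (\<lambda>z. Re (h (z $ 1))) z = Re (p * h')"
    using bounded_linear.has_vector_derivative[OF bounded_linear_Re d]
    by (intro dir_deriv_unique) (simp add: has_real_derivative_iff_has_vector_derivative)
  show "dir_deriv (axis 1 p) (\<lambda>z. Im (h (z $ 1))) z = Im (p * h')"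
    using bounded_linear.has_vector_derivative[OF bounded_linear_Im d]
    by (intro dir_deriv_unique) (simp add: has_real_derivative_iff_has_vector_derivative)
qed

lemma dir_deriv_norm_square_1:
  "dir_deriv (axis 1 p) (\<lambda>z. (cmod (z $ 1))\<^sup>2) (z :: complex ^ 1) = 2 * (Re p * Re (z $ 1) + Im p * Im (z $ 1))"
proof (rule dir_deriv_unique)
  have "(cmod ((z + t *\<^sub>R axis 1 p) $ 1))\<^sup>2 = (Re (z $ 1) + t * Re p)\<^sup>2 + (Im (z $ 1) + t * Im p)\<^sup>2" for t
    by (simp add: cmod_power2)
  then show "((\<lambda>t. (cmod ((z + t *\<^sub>R axis 1 p) $ 1))\<^sup>2) has_real_derivative
      2 * (Re p * Re (z $ 1) + Im p * Im (z $ 1))) (at 0)"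
    by (auto intro!: derivative_eq_intros simp: algebra_simps)
qed

text \<open>
  In terms of the invariants \<open>x1\<close>, \<open>x2\<close>, \<open>x3\<close>, the brackets are \<open>{x1, x2} = N^2 * x3^(N - 1)\<close>,
  \<open>{x1, x3} = 2 * N * x2\<close> and \<open>{x2, x3} = - 2 * N * x1\<close>.
\<close>

lemma cyclic_invariants_bracket:
  assumes N: "N > 0"
  shows "\<exists>r. \<forall>z. std_brk (cyclic_invariants N i) (cyclic_invariants N j) z
    = poly_eval (\<lambda>i. cyclic_invariants N i z) r"
proof -
  let ?\<rho> = "cyclic_invariants N"
  have hol: "((\<lambda>x. x ^ N) has_field_derivative of_nat N * x ^ (N - 1)) (at x)" for x :: complex
    by (auto intro!: derivative_eq_intros)
  have \<rho>: "?\<rho> 1 = (\<lambda>z. Re ((z $ 1) ^ N))" "?\<rho> 2 = (\<lambda>z. Im ((z $ 1) ^ N))" "?\<rho> 3 = (\<lambda>z. (cmod (z $ 1))\<^sup>2)"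
    by (auto simp: cyclic_invariants_def)
  have s: "x ^ N = x * x ^ (N - 1)" for x :: complex using N by (metis Suc_diff_1 power_Suc)
  have 12: "std_brk (?\<rho> 1) (?\<rho> 2) z = (real N)\<^sup>2 * ?\<rho> 3 z ^ (N - 1)" for z
  proof -
    have "(cmod x)\<^sup>2 ^ k = (Re (x ^ k))\<^sup>2 + (Im (x ^ k))\<^sup>2" for x :: complex and k
      by (metis cmod_power2 norm_power power_commutes power_mult mult.commute)
    then show ?thesis
      unfolding \<rho> std_brk_1 dir_deriv_holomorphic[OF hol]
      by (simp add: power2_eq_square algebra_simps)
  qed
  have 13: "std_brk (?\<rho> 1) (?\<rho> 3) z = 2 * real N * ?\<rho> 2 z"
    and 23: "std_brk (?\<rho> 2) (?\<rho> 3) z = - (2 * real N * ?\<rho> 1 z)" for z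
    unfolding \<rho> std_brk_1 dir_deriv_holomorphic[OF hol] dir_deriv_norm_square_1
    unfolding s by (simp_all add: algebra_simps)
  have neg: "\<exists>r. \<forall>z. std_brk f g z = poly_eval (\<lambda>i. ?\<rho> i z) r"
    if gf: "\<exists>r. \<forall>z. std_brk g f z = poly_eval (\<lambda>i. ?\<rho> i z) r" for f g
  proof -
    obtain r where "\<forall>z. std_brk g f z = poly_eval (\<lambda>i. ?\<rho> i z) r" using gf by blast
    then have "\<forall>z. std_brk f g z = poly_eval (\<lambda>i. ?\<rho> i z) (Const (-1) * r)"
      using std_brk_antisym[of f g] by (simp add: poly_hom_mult poly_hom_Const)
    then show ?thesis by blast
  qed
  have pow: "poly_eval x (p ^ k) = poly_eval x p ^ k" for x :: "3 \<Rightarrow> real" and p k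
    using poly_hom_Const[of "\<lambda>r. r" x 1] by (induction k) (simp_all add: poly_hom_mult Const_def)
  have e12: "\<exists>r. \<forall>z. std_brk (?\<rho> 1) (?\<rho> 2) z = poly_eval (\<lambda>i. ?\<rho> i z) r"
    by (intro exI[of _ "Const ((real N)\<^sup>2) * Var 3 ^ (N - 1)"])
       (simp add: 12 poly_hom_mult poly_hom_Const poly_hom_Var pow)
  have e13: "\<exists>r. \<forall>z. std_brk (?\<rho> 1) (?\<rho> 3) z = poly_eval (\<lambda>i. ?\<rho> i z) r"
    by (intro exI[of _ "Const (2 * real N) * Var 2"])
       (simp add: 13 poly_hom_mult poly_hom_Const poly_hom_Var)
  have e23: "\<exists>r. \<forall>z. std_brk (?\<rho> 2) (?\<rho> 3) z = poly_eval (\<lambda>i. ?\<rho> i z) r"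
    by (intro exI[of _ "Const (- (2 * real N)) * Var 1"])
       (simp add: 23 poly_hom_mult poly_hom_Const poly_hom_Var)
  have diag0: "std_brk f f z = 0" for f and z :: "complex ^ 1" by (simp add: std_brk_1)
  have eii: "\<exists>r. \<forall>z. std_brk (?\<rho> i) (?\<rho> i) z = poly_eval (\<lambda>i. ?\<rho> i z) r" for i
    by (intro exI[of _ "Const 0"]) (simp add: diag0 poly_hom_Const)
  show ?thesis
    using exhaust_3[of i] exhaust_3[of j]
    by (elim disjE) (simp_all only: e12 e13 e23 neg[OF e12] neg[OF e13] neg[OF e23] eii)
qed

text \<open>
  By the Leibniz rule in each argument, it is enough to know the brackets of the generators.
\<close>

lemma cyclic_polynomial_bracket:
  assumes N: "N > 0"
  shows "\<exists>r. \<forall>z. std_brk (\<lambda>z. poly_eval (\<lambda>i. cyclic_invariants N i z) p)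
      (\<lambda>z. poly_eval (\<lambda>i. cyclic_invariants N i z) q) z
    = poly_eval (\<lambda>i. cyclic_invariants N i z) r"
proof -
  let ?\<rho> = "cyclic_invariants N" and ?e = "\<lambda>p z. poly_eval (\<lambda>i. cyclic_invariants N i z) p"
  have sm: "smooth (?e p)" for p by (intro smooth_poly_eval smooth_cyclic_invariants)
  have left: "\<exists>r. \<forall>z. std_brk (?e p) g z = ?e r z"
    if g: "smooth g" and gen: "\<And>i. \<exists>r. \<forall>z. std_brk (?\<rho> i) g z = ?e r z" for g p
  proof (induction p rule: rpoly_induct)
    case (Const c)
    show ?case by (intro exI[of _ "Const 0"]) (simp add: poly_hom_Const std_brk_const_left)
  next
    case (Var i)
    show ?case using gen[of i] by (simp add: poly_hom_Var)
  next
    case (add p q)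
    then obtain r s where "\<forall>z. std_brk (?e p) g z = ?e r z" "\<forall>z. std_brk (?e q) g z = ?e s z" by blast
    then have "\<forall>z. std_brk (?e (p + q)) g z = ?e (r + s) z"
      by (simp add: poly_hom_add std_brk_add_left[OF sm sm])
    then show ?case by blast
  next
    case (mult p q)
    then obtain r s where "\<forall>z. std_brk (?e p) g z = ?e r z" "\<forall>z. std_brk (?e q) g z = ?e s z" by blast
    then have "\<forall>z. std_brk (?e (p * q)) g z = ?e (r * q + p * s) z"
      by (simp add: poly_hom_add poly_hom_mult std_brk_mult_left[OF sm sm])
    then show ?case by blast
  qed
  have flip: "\<exists>r. \<forall>z. std_brk f g z = ?e r z" if fg: "\<exists>r. \<forall>z. std_brk g f z = ?e r z" for f g
  proof -
    obtain r where "\<forall>z. std_brk g f z = ?e r z" using fg by blast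
    then have "\<forall>z. std_brk f g z = ?e (Const (-1) * r) z"
      using std_brk_antisym[of f g] by (simp add: poly_hom_mult poly_hom_Const)
    then show ?thesis by blast
  qed
  have "\<exists>r. \<forall>z. std_brk (?\<rho> i) (?e q) z = ?e r z" for i
    by (rule flip, rule left[OF smooth_cyclic_invariants cyclic_invariants_bracket[OF N]])
  then show ?thesis by (rule left[OF sm])
qed

theorem global_chart_cyclic:
  assumes N2: "N \<ge> 2"
  shows "global_chart (cyclic_quotient N) (cyclic_chart N)"
proof -
  have N: "N > 0" using N2 by simp
  let ?X = "cyclic_quotient N" and ?\<phi> = "cyclic_chart N" and ?o = "orbit (cyclic_maps N)"
  let ?\<rho> = "cyclic_invariants N"
  note \<phi> = cyclic_chart_orbit[OF N]
  have o: "?o z \<in> pts ?X" for z by (simp add: pts_cyclic_quotient)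
  have eqI: "f = g" if "f \<in> extensional (pts ?X)" "g \<in> extensional (pts ?X)" "\<And>z. f (?o z) = g (?o z)" for f g
    by (rule extensionalityI[OF that(1,2)]) (use that(3) in \<open>auto simp: pts_cyclic_quotient\<close>)
  have sm: "smooth (\<lambda>z. poly_eval (\<lambda>i. ?\<rho> i z) p)" for p by (intro smooth_poly_eval smooth_cyclic_invariants)
  have C: "?\<phi> p \<in> Cinf ?X" for p
    by (rule Cinf_cyclicI[OF N cyclic_chart_extensional sm \<phi>])
  show ?thesis
    unfolding global_chart_def
  proof (intro conjI allI ballI impI)
    show "poisson_differential_space ?X"
      unfolding poisson_differential_space_def
      using differential_space_cyclic[OF N] poisson_bracket_on_cyclic[OF N] by simp
    show "chart_hom ?X ?\<phi>"
      unfolding chart_hom_def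
    proof (intro conjI allI C)
      show "?\<phi> (Const c) = fconst ?X c" for c
        by (rule eqI) (simp_all add: cyclic_chart_extensional \<phi> poly_hom_Const fconst_def o)
      show "?\<phi> (p + q) = fadd ?X (?\<phi> p) (?\<phi> q)" for p q
        by (rule eqI) (simp_all add: cyclic_chart_extensional \<phi> poly_hom_add fadd_def o)
      show "?\<phi> (p * q) = fmult ?X (?\<phi> p) (?\<phi> q)" for p q
        by (rule eqI) (simp_all add: cyclic_chart_extensional \<phi> poly_hom_mult fmult_def o)
    qed
    show "brk ?X (?\<phi> p) (?\<phi> q) \<in> range ?\<phi>" for p q
    proof -
      obtain r where r: "\<And>z. std_brk (\<lambda>z. poly_eval (\<lambda>i. ?\<rho> i z) p) (\<lambda>z. poly_eval (\<lambda>i. ?\<rho> i z) q) z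
          = poly_eval (\<lambda>i. ?\<rho> i z) r" using cyclic_polynomial_bracket[OF N] by blast
      have "brk ?X (?\<phi> p) (?\<phi> q) = ?\<phi> r"
        by (rule eqI) (simp_all add: brk_cyclic[OF N C C] cyclic_chart_extensional \<phi> r)
      then show ?thesis by blast
    qed
    show "\<exists>F\<in>smooth_fun UNIV. \<forall>\<xi>\<in>pts ?X. f \<xi> = F (chart_map ?\<phi> \<xi>)" if f: "f \<in> Cinf ?X" for f
    proof -
      define G where "G w = f (?o (\<chi> j. w))" for w :: complex
      have "linear (\<lambda>w::complex. (\<chi> j. w) :: complex ^ 1)" by (simp add: linear_iff vec_eq_iff)
      moreover have "smooth (\<lambda>z. f (?o z))" using f by (simp add: Cinf_cyclic_iff[OF N])
      ultimately have "smooth G" unfolding G_def using smooth_linear[of "\<lambda>z. f (?o z)"] by blast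
      moreover have "G (u * w) = G w" if "u ^ N = 1" for u w
      proof -
        have "?o (\<chi> j. u * w) = ?o (\<chi> j. w)"
          using that by (simp add: cyclic_orbit_eq_iff[OF N] power_mult_distrib)
        then show ?thesis by (simp add: G_def)
      qed
      ultimately obtain F where F: "smooth F" "\<And>w. G w = F (cyclic_coords N w)"
        using smooth_cyclic_invariant_factors[OF N2] by metis
      have "(\<lambda>x::3 \<Rightarrow> real. F (\<chi> i. x i)) \<in> smooth_fun UNIV"
      proof (rule smooth_imp_smooth_fun[OF F(1)])
        fix b :: "real ^ 3" assume "b \<in> Basis"
        then obtain i where "b = axis i 1" by (auto simp: Basis_vec_def)
        then show "(\<lambda>x::3 \<Rightarrow> real. (\<chi> i. x i) \<bullet> b) \<in> smooth_fun UNIV"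
          by (simp add: inner_axis smooth_fun_coord)
      qed
      moreover have "f (?o z) = F (\<chi> i. chart_map ?\<phi> (?o z) i)" for z
      proof -
        have "(\<chi> j. z $ 1) = z" by (simp add: vec_eq_iff)
        then have "f (?o z) = F (cyclic_coords N (z $ 1))" using F(2)[of "z $ 1"] by (simp add: G_def)
        also have "cyclic_coords N (z $ 1) = (\<chi> i. chart_map ?\<phi> (?o z) i)"
          by (simp add: vec_eq_iff forall_3 vector_3 chart_map_def \<phi> poly_hom_Var cyclic_invariants_def)
        finally show ?thesis .
      qed
      ultimately show ?thesis
        by (intro bexI[of _ "\<lambda>x. F (\<chi> i. x i)"]) (auto simp: pts_cyclic_quotient)
    qed
    show "\<exists>p. ?\<phi> p \<xi> \<noteq> ?\<phi> p \<eta>" if \<xi>\<eta>: "\<xi> \<in> pts ?X" "\<eta> \<in> pts ?X" "\<xi> \<noteq> \<eta>" for \<xi> \<eta>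
    proof -
      obtain z w where zw: "\<xi> = ?o z" "\<eta> = ?o w" using \<xi>\<eta>(1,2) by (auto simp: pts_cyclic_quotient)
      then have "(z $ 1) ^ N \<noteq> (w $ 1) ^ N" using \<xi>\<eta>(3) cyclic_orbit_eq_iff[OF N, of z w] by auto
      then have "?\<rho> 1 z \<noteq> ?\<rho> 1 w \<or> ?\<rho> 2 z \<noteq> ?\<rho> 2 w"
        by (auto simp: cyclic_invariants_def complex_eq_iff)
      then have "?\<phi> (Var 1) \<xi> \<noteq> ?\<phi> (Var 1) \<eta> \<or> ?\<phi> (Var 2) \<xi> \<noteq> ?\<phi> (Var 2) \<eta>"
        by (simp add: zw \<phi> poly_hom_Var)
      then show ?thesis by blast
    qed
  qed
qed

theorem z_graded_chart_cyclic:
  assumes N2: "N \<ge> 2"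
  shows "z_graded_chart (cyclic_quotient N) (cyclic_chart N) (cyclic_grading N)"
proof -
  have N: "N > 0" using N2 by simp
  define v where "v k = (if k = 1 \<or> k = 2 then N else 2)" for k :: 3
  have G: "cyclic_grading N = weight_grading (\<lambda>k. int (v k))"
  proof -
    have "(\<lambda>k. if k = 1 \<or> k = 2 then int N else 2) = (\<lambda>k. int (v k))" by (auto simp: v_def)
    then show ?thesis by (simp add: cyclic_grading_def)
  qed
  have "homogeneous_ideal (weight_grading (\<lambda>k. int (v k))) (chart_ker (cyclic_quotient N) (cyclic_chart N))"
    unfolding cyclic_chart_def
  proof (rule homogeneous_ideal_invariant_chart[OF cyclic_maps_group[OF N] cyclic_invariants_invariant[OF N]])
    show "cyclic_invariants N i (t *\<^sub>R z) = t ^ v i * cyclic_invariants N i z" for t z i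
      by (simp add: cyclic_invariants_def v_def scaleR_power power_mult_distrib)
  qed (simp_all add: pts_cyclic_quotient)
  then show ?thesis
    unfolding z_graded_chart_def G using global_chart_cyclic[OF N2] z_grading_weight_grading by blast
qed

section \<open>Diagonal torus actions\<close>

lemma sum_UNIV_option:
  fixes f :: "'l::finite option \<Rightarrow> 'b::comm_monoid_add"
  shows "(\<Sum>j\<in>UNIV. f j) = f None + (\<Sum>i\<in>UNIV. f (Some i))"
  by (subst UNIV_option_conv, subst sum.insert) (auto simp: sum.reindex)

definition torus_weights :: "int ^ 'n ^ 'l \<Rightarrow> complex ^ 'l \<Rightarrow> complex ^ 'n" where
  "torus_weights A t = (\<chi> j. \<Prod>i\<in>UNIV. (t $ i) powi (A $ i $ j))"

lemma torus_act_diag: "torus_act A t = diag (torus_weights A t)"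
  by (rule HOL.ext) (simp add: torus_act_def diag_def torus_weights_def)

lemma torus_nonzero: "t \<in> torus \<Longrightarrow> t $ i \<noteq> 0"
  unfolding torus_def by (metis (mono_tags, lifting) mem_Collect_eq norm_zero zero_neq_one)

lemma norm_torus_weights: "t \<in> torus \<Longrightarrow> cmod (torus_weights A t $ j) = 1"
  by (simp add: torus_weights_def torus_def prod_norm[symmetric] norm_power_int)

lemma torus_act_mult:
  "torus_act A s (torus_act A t z) = torus_act A (\<chi> i. s $ i * t $ i) z"
  by (simp add: torus_act_def vec_eq_iff power_int_mult_distrib prod.distrib mult_ac)

lemma torus_maps_group: "transformation_group (torus_maps (A :: int ^ 'n ^ 'l))"
  unfolding transformation_group_def
proof (intro conjI ballI)
  have one: "torus_act A (\<chi> i. 1) z = z" for z by (simp add: torus_act_def vec_eq_iff)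
  then have "torus_act A (\<chi> i. 1) = (\<lambda>z. z)" by (rule HOL.ext)
  moreover have "(\<chi> i. 1) \<in> (torus :: (complex ^ 'l) set)" by (simp add: torus_def)
  ultimately show "(\<lambda>z. z) \<in> torus_maps A" unfolding torus_maps_def by (metis imageI)
  fix g assume "g \<in> torus_maps A"
  then obtain s where s: "s \<in> torus" "g = torus_act A s" unfolding torus_maps_def by blast
  show "\<exists>h\<in>torus_maps A. \<forall>z. h (g z) = z"
  proof (rule bexI[of _ "torus_act A (\<chi> i. inverse (s $ i))"])
    show "torus_act A (\<chi> i. inverse (s $ i)) \<in> torus_maps A"
      unfolding torus_maps_def using s(1) by (intro imageI) (simp add: torus_def norm_inverse)
    show "\<forall>z. torus_act A (\<chi> i. inverse (s $ i)) (g z) = z"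
      using one torus_nonzero[OF s(1)] by (simp add: s(2) torus_act_mult)
  qed
  fix h assume "h \<in> torus_maps A"
  then obtain t where t: "t \<in> torus" "h = torus_act A t" unfolding torus_maps_def by blast
  have "(\<lambda>z. g (h z)) = torus_act A (\<chi> i. s $ i * t $ i)"
    by (rule HOL.ext) (simp add: s(2) t(2) torus_act_mult)
  moreover have "(\<chi> i. s $ i * t $ i) \<in> torus" using s(1) t(1) by (simp add: torus_def norm_mult)
  ultimately show "(\<lambda>z. g (h z)) \<in> torus_maps A" unfolding torus_maps_def by blast
qed

lemma prod_cis: "(\<Prod>i\<in>S. cis (f i)) = cis (\<Sum>i\<in>S. f i)"
  by (induction S rule: infinite_finite_induct) (simp_all add: cis_mult)

lemma bezout_family:
  fixes m :: "'l \<Rightarrow> int"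
  assumes "finite S"
  shows "\<exists>k. (\<Sum>i\<in>S. m i * k i) = Gcd (m ` S)"
  using assms
proof (induction S rule: finite_induct)
  case (insert x S)
  then obtain k where k: "(\<Sum>i\<in>S. m i * k i) = Gcd (m ` S)" by blast
  obtain u v where uv: "u * m x + v * Gcd (m ` S) = gcd (m x) (Gcd (m ` S))"
    using bezout_int by blast
  have "(\<Sum>i\<in>S. m i * (if i = x then u else v * k i)) = (\<Sum>i\<in>S. v * (m i * k i))"
    using insert.hyps by (intro sum.cong) auto
  also have "\<dots> = v * Gcd (m ` S)" by (simp add: k[symmetric] sum_distrib_left)
  finally have "(\<Sum>i\<in>insert x S. m i * (if i = x then u else v * k i)) = Gcd (m ` insert x S)"
    using insert.hyps uv by (simp add: mult.commute)
  then show ?case by (intro exI[of _ "\<lambda>i. if i = x then u else v * k i"])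
qed simp

locale diagonal_quotient =
  fixes a n :: "'l::finite \<Rightarrow> nat" and N :: nat
  assumes a_pos: "\<And>i. a i > 0"
    and effective: "effective_torus_action (weight_matrix a n)"
    and N2: "N \<ge> 2"
    and N_eq: "N = lcm_all a + (\<Sum>i\<in>UNIV. mult_exp a n i)"
begin

abbreviation "W \<equiv> weight_matrix a n"
abbreviation "\<Gamma> \<equiv> torus_maps W"
abbreviation "Z \<equiv> zero_fibre W"
abbreviation "\<A> \<equiv> lcm_all a"
abbreviation "m \<equiv> mult_exp a n"

lemma N_pos: "N > 0" using N2 by simp

lemma lcm_pos: "\<A> > 0"
proof -
  have "Lcm (range a) \<noteq> 0" using a_pos by (simp add: Lcm_0_iff image_iff)
  then show ?thesis unfolding lcm_all_def neq0_conv .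
qed

lemma a_dvd_lcm: "a i dvd \<A>" by (simp add: lcm_all_def)

lemma a_times_m: "a i * m i = n i * \<A>"
  using a_dvd_lcm[of i] by (simp add: mult_exp_def)

lemma torus_act_Some: "torus_act W t z $ Some k = (t $ k) powi (- int (a k)) * z $ Some k"
proof -
  have "(\<Prod>i\<in>UNIV. (t $ i) powi (W $ i $ Some k)) = (\<Prod>i\<in>UNIV. if i = k then (t $ k) powi (- int (a k)) else 1)"
    by (intro prod.cong) (auto simp: weight_matrix_def)
  then show ?thesis by (simp add: torus_act_def)
qed

lemma torus_act_None: "torus_act W t z $ None = (\<Prod>i\<in>UNIV. (t $ i) ^ n i) * z $ None"
  by (simp add: torus_act_def weight_matrix_def)

text \<open>
  A common divisor \<open>g\<close> of \<open>a i\<close> and \<open>n i\<close> makes the \<open>g\<close>-th roots of unity in the \<open>i\<close>-th circle act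
  trivially.
\<close>

lemma coprime_a_n: "coprime (a i) (n i)"
proof -
  define g where "g = gcd (a i) (n i)"
  have g: "g > 0" "g dvd a i" "g dvd n i" using a_pos[of i] by (auto simp: g_def)
  define \<zeta> where "\<zeta> = exp (2 * of_real pi * \<i> * of_nat 1 / of_nat g)"
  have \<zeta>g: "\<zeta> ^ g = 1" unfolding \<zeta>_def by (rule complex_root_unity) (use g in simp)
  have pow: "\<zeta> ^ k = 1" if "g dvd k" for k
    using that \<zeta>g by (auto elim!: dvdE simp: power_mult)
  define t :: "complex ^ 'l" where "t = (\<chi> k. if k = i then \<zeta> else 1)"
  have "t \<in> torus" using norm_root_unity[OF \<zeta>g g(1)] by (simp add: torus_def t_def)
  moreover have "torus_act W t z = z" for z
  proof -
    have "torus_act W t z $ j = z $ j" for j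
    proof (cases j)
      case None
      have "(\<Prod>k\<in>UNIV. (t $ k) ^ n k) = 1"
        by (intro prod.neutral) (auto simp: t_def pow[OF g(3)])
      then show ?thesis unfolding None torus_act_None by simp
    next
      case (Some k)
      then show ?thesis unfolding Some torus_act_Some
        by (auto simp: t_def power_int_minus pow[OF g(2)])
    qed
    then show ?thesis by (simp add: vec_eq_iff)
  qed
  ultimately have "t = (\<chi> i. 1)" using effective unfolding effective_torus_action_def by blast
  then have "\<zeta> = 1" by (simp add: vec_eq_iff t_def) metis
  then have "g dvd 1" unfolding \<zeta>_def using complex_root_unity_eq_1[of g 1] g(1) by simp
  then show ?thesis by (simp add: g_def coprime_iff_gcd_eq_1)
qed

text \<open>
  The numbers \<open>m i\<close> generate the integers modulo \<open>\<A>\<close>. Otherwise there is a prime \<open>p\<close> dividing \<open>\<A>\<close>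
  and all the \<open>m i\<close>. Then each \<open>a i\<close> divides \<open>\<A> / p\<close>: if \<open>p\<close> divides \<open>n i\<close>, it is prime to \<open>a i\<close>;
  if not, it divides \<open>\<A> / a i\<close>, as \<open>m i = n i * (\<A> / a i)\<close>. This contradicts the minimality of the
  least common multiple.
\<close>

lemma lcm_multiples_solvable: "\<exists>k s. (\<Sum>i\<in>UNIV. int (m i) * k i) = int j + int \<A> * s"
proof -
  define G where "G = Gcd ((\<lambda>i. int (m i)) ` UNIV)"
  have "gcd (int \<A>) G = 1"
  proof (rule ccontr)
    assume "gcd (int \<A>) G \<noteq> 1"
    then have "nat (gcd (int \<A>) G) \<noteq> 1" by (metis gcd_ge_0_int int_nat_eq of_nat_1)
    then obtain p where p: "prime p" "p dvd nat (gcd (int \<A>) G)" using prime_factor_nat by blast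
    then have "int p dvd gcd (int \<A>) G" by (metis gcd_ge_0_int int_dvd_int_iff int_nat_eq)
    then have pA: "p dvd \<A>" and "int p dvd G" by auto
    then have "int p dvd int (m i)" for i
      using Gcd_dvd[of "int (m i)" "(\<lambda>i. int (m i)) ` UNIV"] unfolding G_def by (meson dvd_trans rangeI)
    then have pm: "p dvd m i" for i by simp
    obtain b where b: "\<A> = p * b" using pA by (elim dvdE)
    have "a i dvd b" for i
    proof (cases "p dvd n i")
      case True
      have "coprime p (a i)"
        using True coprime_a_n[of i] p(1)
        by (meson coprime_common_divisor not_prime_unit prime_imp_coprime)
      then show ?thesis using a_dvd_lcm[of i] b
        by (metis coprime_commute coprime_dvd_mult_right_iff)
    next
      case False
      obtain c where c: "\<A> = a i * c" using a_dvd_lcm[of i] by (elim dvdE)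
      have "a i * m i = a i * (n i * c)" using a_times_m[of i] c by (simp add: mult_ac)
      then have "m i = n i * c" using a_pos[of i] by simp
      then have "p dvd c" using pm[of i] False p(1) by (simp add: prime_dvd_mult_iff)
      then obtain d where d: "c = p * d" by (elim dvdE)
      have "p * b = a i * (p * d)" unfolding d[symmetric] by (rule trans[OF b[symmetric] c])
      then have "p * b = p * (a i * d)" by (simp only: mult.left_commute)
      then have "b = a i * d" using p(1) by (metis mult_cancel_left not_prime_0)
      then show ?thesis by simp
    qed
    then have "\<A> dvd b" unfolding lcm_all_def by (auto intro: Lcm_least)
    then have "\<A> \<le> b" using b lcm_pos by (intro dvd_imp_le) (auto intro: Nat.gr0I)
    moreover have "b < p * b" using prime_gt_1_nat[OF p(1)] b lcm_pos by (cases "b = 0") auto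
    ultimately show False using b by simp
  qed
  moreover obtain u v where "u * int \<A> + v * G = gcd (int \<A>) G" using bezout_int by blast
  ultimately have uv: "v * G = 1 - u * int \<A>" by simp
  obtain k where k: "(\<Sum>i\<in>UNIV. int (m i) * k i) = G"
    using bezout_family[of UNIV "\<lambda>i. int (m i)"] unfolding G_def by auto
  have "(\<Sum>i\<in>UNIV. int (m i) * (int j * v * k i)) = int j * (v * G)"
    by (simp add: k[symmetric] sum_distrib_left mult_ac)
  also have "\<dots> = int j + int \<A> * (- int j * u)" unfolding uv by (simp add: algebra_simps)
  finally show ?thesis by (intro exI[of _ "\<lambda>i. int j * v * k i"] exI[of _ "- int j * u"])
qed

lemma n_div_a: "real (n i) / real (a i) = real (m i) / real \<A>"
proof -
  have "real (a i) * real (m i) = real (n i) * real \<A>" using a_times_m[of i] by (metis of_nat_mult)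
  then show ?thesis using a_pos[of i] lcm_pos by (simp add: field_simps)
qed

lemma sum_m: "(\<Sum>i\<in>UNIV. real (m i)) = real N - real \<A>"
  using arg_cong[OF N_eq, of real] by simp

text \<open>
  The torus element acts on the line of the slice as multiplication by \<open>u\<close>. Writing \<open>u\<close> with angle
  \<open>j / N\<close>, its angles \<open>\<theta> i\<close> have to satisfy \<open>- a i * \<theta> i = j / N\<close> and \<open>(\<Sum>i. n i * \<theta> i) = j / N\<close>
  modulo the integers. The first equations determine \<open>\<theta> i\<close> up to a choice of integers \<open>k i\<close>; as
  the \<open>m i\<close> sum up to \<open>N - \<A>\<close>, the last one becomes the congruence \<open>(\<Sum>i. m i * k i) = j\<close> modulo
  \<open>\<A>\<close>.
\<close>

lemma root_of_unity_lift:
  assumes "u ^ N = 1"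
  obtains t where "t \<in> torus" "\<And>k. (t $ k) powi (- int (a k)) = u" "(\<Prod>i\<in>UNIV. (t $ i) ^ n i) = u"
proof -
  obtain j where "u = exp (2 * of_real pi * \<i> * of_nat j / of_nat N)"
    using assms complex_roots_unity[of N] N_pos by auto
  then have u: "u = cis (2 * pi * (real j / real N))"
    by (simp add: cis_conv_exp mult_ac)
  obtain k s where ks: "(\<Sum>i\<in>UNIV. int (m i) * k i) = int j + int \<A> * s"
    using lcm_multiples_solvable by blast
  define \<theta> where "\<theta> i = (of_int (k i) - real j / real N) / real (a i)" for i
  define t :: "complex ^ 'l" where "t = (\<chi> i. cis (2 * pi * \<theta> i))"
  have "t \<in> torus" by (simp add: torus_def t_def)
  moreover have "(t $ i) powi (- int (a i)) = u" for i
  proof -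
    have "of_int (- int (a i)) * (2 * pi * \<theta> i) = 2 * pi * (real j / real N) + 2 * pi * of_int (- k i)"
      using a_pos[of i] by (simp add: \<theta>_def field_simps)
    then have "(t $ i) powi (- int (a i)) = cis (2 * pi * (real j / real N)) * cis (2 * pi * of_int (- k i))"
      by (simp only: t_def vec_lambda_beta cis_power_int cis_mult)
    then show ?thesis using cis_multiple_2pi[of "of_int (- k i)"] by (simp add: u)
  qed
  moreover have "(\<Prod>i\<in>UNIV. (t $ i) ^ n i) = u"
  proof -
    have "(\<Prod>i\<in>UNIV. (t $ i) ^ n i) = cis (\<Sum>i\<in>UNIV. real (n i) * (2 * pi * \<theta> i))"
      by (simp only: t_def vec_lambda_beta Complex.DeMoivre prod_cis)
    also have "(\<Sum>i\<in>UNIV. real (n i) * (2 * pi * \<theta> i)) = 2 * pi * (real j / real N) + 2 * pi * of_int s"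
    proof -
      have "real (n i) * \<theta> i = (real (m i) * of_int (k i)) / real \<A> - (real j / real N / real \<A>) * real (m i)" for i
      proof -
        have "real (n i) * \<theta> i = (real (n i) / real (a i)) * (of_int (k i) - real j / real N)"
          by (simp add: \<theta>_def)
        then show ?thesis unfolding n_div_a by (simp add: algebra_simps diff_divide_distrib)
      qed
      then have "(\<Sum>i\<in>UNIV. real (n i) * \<theta> i) =
          (\<Sum>i\<in>UNIV. real (m i) * of_int (k i)) / real \<A> - (real j / real N / real \<A>) * (\<Sum>i\<in>UNIV. real (m i))"
        by (simp add: sum_subtractf sum_divide_distrib sum_distrib_left)
      also have "(\<Sum>i\<in>UNIV. real (m i) * of_int (k i)) = real j + real \<A> * of_int s"
        using arg_cong[OF ks, of real_of_int] by simp
      also have "(real j + real \<A> * of_int s) / real \<A> - (real j / real N / real \<A>) * (\<Sum>i\<in>UNIV. real (m i))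
          = real j / real N + of_int s"
        unfolding sum_m using lcm_pos N_pos by (simp add: field_simps)
      finally have "(\<Sum>i\<in>UNIV. real (n i) * \<theta> i) = real j / real N + of_int s" .
      moreover have "(\<Sum>i\<in>UNIV. real (n i) * (2 * pi * \<theta> i)) = 2 * pi * (\<Sum>i\<in>UNIV. real (n i) * \<theta> i)"
        by (simp add: sum_distrib_left mult_ac)
      ultimately show ?thesis by (simp add: distrib_left)
    qed
    also have "cis (2 * pi * (real j / real N) + 2 * pi * of_int s) = u"
      using cis_multiple_2pi[of "of_int s"] by (simp add: u flip: cis_mult)
    finally show ?thesis .
  qed
  ultimately show ?thesis using that by blast
qed

section \<open>A linear slice\<close>

text \<open>
  Up to a common factor these are the moduli of the coordinates of all points of the zero fibre;
  they are normalised so that their squares sum to one.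
\<close>

definition coef :: "'l option \<Rightarrow> real" where
  "coef j = sqrt (real (case j of None \<Rightarrow> \<A> | Some i \<Rightarrow> m i) / real N)"

definition slice :: "complex ^ 1 \<Rightarrow> complex ^ ('l option)" where
  "slice w = (\<chi> j. coef j *\<^sub>R w $ 1)"

lemma coef_nonneg: "coef j \<ge> 0" by (simp add: coef_def)

lemma coef_None_pos: "coef None > 0" using lcm_pos N_pos by (simp add: coef_def)

lemma coef_sq: "(coef None)\<^sup>2 = real \<A> / real N" "(coef (Some i))\<^sup>2 = real (m i) / real N"
  by (simp_all add: coef_def)

lemma coef_relation: "real (a i) * (coef (Some i))\<^sup>2 = real (n i) * (coef None)\<^sup>2"
proof -
  have "real (a i) * real (m i) = real (n i) * real \<A>" using a_times_m[of i] by (metis of_nat_mult)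
  then show ?thesis by (simp add: coef_sq)
qed

lemma sum_coef_sq: "(\<Sum>j\<in>UNIV. (coef j)\<^sup>2) = 1"
  using N_pos by (simp add: sum_UNIV_option coef_sq sum_m flip: sum_divide_distrib add_divide_distrib)

lemma linear_slice: "linear slice"
  by (simp add: linear_iff slice_def vec_eq_iff scaleR_add_right)

lemma mem_zero_fibre:
  "z \<in> Z \<longleftrightarrow> (\<forall>i. real (a i) * (cmod (z $ Some i))\<^sup>2 = real (n i) * (cmod (z $ None))\<^sup>2)"
proof -
  have "(\<Sum>k\<in>UNIV. real_of_int (W $ i $ Some k) * (cmod (z $ Some k))\<^sup>2)
      = (\<Sum>k\<in>UNIV. if k = i then - real (a i) * (cmod (z $ Some i))\<^sup>2 else 0)" for i
    by (intro sum.cong) (auto simp: weight_matrix_def)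
  then have "moment_map W z $ i = 1 / 2 * (real (n i) * (cmod (z $ None))\<^sup>2 - real (a i) * (cmod (z $ Some i))\<^sup>2)" for i
    by (simp add: moment_map_def sum_UNIV_option) (simp add: weight_matrix_def)
  then show ?thesis by (auto simp: zero_fibre_def vec_eq_iff)
qed

lemma slice_in_zero_fibre: "slice w \<in> Z"
proof -
  have "real (a i) * (\<bar>coef (Some i)\<bar> * cmod (w $ 1))\<^sup>2 = real (n i) * (\<bar>coef None\<bar> * cmod (w $ 1))\<^sup>2" for i
    using coef_relation[of i] by (simp add: power_mult_distrib)
  then show ?thesis by (simp add: mem_zero_fibre slice_def)
qed

text \<open>
  The moduli are right by the equations of the zero fibre. For the arguments, a real linear system
  in the angles \<open>\<tau> i\<close> of the torus element and the argument \<open>\<alpha>\<close> of \<open>w\<close> has to be solved, which is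
  possible over the reals as \<open>1 + (\<Sum>i. n i / a i)\<close> is not zero.
\<close>

lemma zero_fibre_reaches_slice:
  assumes "z \<in> Z"
  obtains t w where "t \<in> torus" "z = torus_act W t (slice w)"
proof -
  define r where "r = cmod (z $ None) / coef None"
  have r0: "r \<ge> 0" using coef_None_pos by (simp add: r_def)
  have mod: "cmod (z $ j) = coef j * r" for j
  proof (cases j)
    case None
    then show ?thesis using coef_None_pos by (simp add: r_def)
  next
    case (Some i)
    have "real (a i) * (cmod (z $ Some i))\<^sup>2 = real (n i) * (coef None * r)\<^sup>2"
      using assms coef_None_pos by (simp add: mem_zero_fibre r_def)
    also have "\<dots> = real (a i) * (coef (Some i) * r)\<^sup>2"
      using coef_relation[of i] by (simp add: power_mult_distrib)
    finally have "(cmod (z $ Some i))\<^sup>2 = (coef (Some i) * r)\<^sup>2" using a_pos[of i] by simp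
    then show ?thesis unfolding Some
      by (rule power2_eq_imp_eq) (simp_all add: coef_nonneg r0)
  qed
  define \<theta> where "\<theta> j = Arg (z $ j)" for j
  have polar: "z $ j = (coef j * r) *\<^sub>R cis (\<theta> j)" for j
  proof -
    have "rcis (coef j * r) (\<theta> j) = z $ j"
      using rcis_cmod_Arg[of "z $ j"] unfolding mod \<theta>_def .
    then show ?thesis unfolding rcis_def scaleR_conv_of_real ..
  qed
  \<comment> \<open>The equations are \<open>- a i * \<tau> i + \<alpha> = \<theta> (Some i)\<close> and \<open>(\<Sum>i. n i * \<tau> i) + \<alpha> = \<theta> None\<close>;
    eliminating the \<open>\<tau> i\<close> leaves \<open>s * \<alpha>\<close> on the left.\<close>
  define s where "s = 1 + (\<Sum>i\<in>UNIV. real (n i) / real (a i))"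
  have s: "s > 0" unfolding s_def by (intro add_pos_nonneg sum_nonneg) auto
  define \<alpha> where "\<alpha> = (\<theta> None + (\<Sum>i\<in>UNIV. real (n i) / real (a i) * \<theta> (Some i))) / s"
  define \<tau> where "\<tau> i = (\<alpha> - \<theta> (Some i)) / real (a i)" for i
  define t :: "complex ^ 'l" where "t = (\<chi> i. cis (\<tau> i))"
  define w :: "complex ^ 1" where "w = (\<chi> _. r *\<^sub>R cis \<alpha>)"
  have "z $ j = torus_act W t (slice w) $ j" for j
  proof (cases j)
    case None
    have "(\<Sum>i\<in>UNIV. real (n i) * \<tau> i) + \<alpha> = \<theta> None"
    proof -
      have "(\<Sum>i\<in>UNIV. real (n i) * \<tau> i) = (\<Sum>i\<in>UNIV. real (n i) / real (a i) * \<alpha> - real (n i) / real (a i) * \<theta> (Some i))"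
        by (intro sum.cong refl) (simp add: \<tau>_def diff_divide_distrib right_diff_distrib)
      also have "\<dots> = (s - 1) * \<alpha> - (\<Sum>i\<in>UNIV. real (n i) / real (a i) * \<theta> (Some i))"
        by (simp add: s_def sum_subtractf sum_distrib_right)
      finally show ?thesis using s by (simp add: \<alpha>_def field_simps)
    qed
    then have "(\<Prod>i\<in>UNIV. (t $ i) ^ n i) * cis \<alpha> = cis (\<theta> None)"
      by (simp only: t_def vec_lambda_beta Complex.DeMoivre prod_cis cis_mult)
    then have "(\<Prod>i\<in>UNIV. (t $ i) ^ n i) * (coef None *\<^sub>R r *\<^sub>R cis \<alpha>) = coef None *\<^sub>R r *\<^sub>R cis (\<theta> None)"
      by simp
    from this[symmetric] show ?thesis unfolding None torus_act_None polar
      by (simp only: slice_def w_def vec_lambda_beta scaleR_scaleR)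
  next
    case (Some k)
    have "of_int (- int (a k)) * \<tau> k + \<alpha> = \<theta> (Some k)"
      using a_pos[of k] by (simp add: \<tau>_def)
    then have "(t $ k) powi (- int (a k)) * cis \<alpha> = cis (\<theta> (Some k))"
      by (simp only: t_def vec_lambda_beta cis_power_int cis_mult)
    then have "(t $ k) powi (- int (a k)) * (coef (Some k) *\<^sub>R r *\<^sub>R cis \<alpha>) = coef (Some k) *\<^sub>R r *\<^sub>R cis (\<theta> (Some k))"
      by simp
    from this[symmetric] show ?thesis unfolding Some torus_act_Some polar
      by (simp only: slice_def w_def vec_lambda_beta scaleR_scaleR)
  qed
  then have "z = torus_act W t (slice w)" by (simp add: vec_eq_iff)
  moreover have "t \<in> torus" by (simp add: torus_def t_def)
  ultimately show ?thesis using that by blast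
qed

text \<open>
  The complex invariant with real part \<open>\<rho> (Inl 1)\<close> and imaginary part \<open>\<rho> (Inl 2)\<close>.
\<close>

definition monomial :: "complex ^ ('l option) \<Rightarrow> complex" where
  "monomial z = (z $ None) ^ \<A> * (\<Prod>i\<in>UNIV. (z $ Some i) ^ m i)"

text \<open>
  The value of \<open>monomial\<close> on the slice at \<open>w = 1\<close>, which is the coefficient of \<open>x1\<close> and \<open>x2\<close> in
  the theorem.
\<close>

definition scale :: real where
  "scale = coef None ^ \<A> * (\<Prod>i\<in>UNIV. coef (Some i) ^ m i)"

lemma monomial_invariant:
  assumes t: "t \<in> torus"
  shows "monomial (torus_act W t z) = monomial z"
proof -
  have "((t $ i) ^ n i) ^ \<A> * ((t $ i) powi (- int (a i))) ^ m i = 1" for i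
  proof -
    have "((t $ i) ^ n i) ^ \<A> = ((t $ i) ^ a i) ^ m i"
      using a_times_m[of i] by (simp flip: power_mult)
    then show ?thesis using torus_nonzero[OF t, of i]
      by (simp add: power_int_minus power_inverse)
  qed
  then have one: "(\<Prod>i\<in>UNIV. ((t $ i) ^ n i) ^ \<A> * ((t $ i) powi (- int (a i))) ^ m i) = 1" by simp
  have "monomial (torus_act W t z) = (\<Prod>i\<in>UNIV. ((t $ i) ^ n i) ^ \<A> * ((t $ i) powi (- int (a i))) ^ m i) * monomial z"
    unfolding monomial_def torus_act_None torus_act_Some
    by (simp add: power_mult_distrib prod.distrib prod_power_distrib mult_ac)
  then show ?thesis by (simp add: one)
qed

lemma monomial_slice: "monomial (slice w) = scale *\<^sub>R (w $ 1) ^ N"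
proof -
  have "monomial (slice w) = of_real scale * ((w $ 1) ^ \<A> * (\<Prod>i\<in>UNIV. (w $ 1) ^ m i))"
    by (simp add: monomial_def slice_def scale_def scaleR_conv_of_real power_mult_distrib prod.distrib mult_ac)
  also have "(w $ 1) ^ \<A> * (\<Prod>i\<in>UNIV. (w $ 1) ^ m i) = (w $ 1) ^ N"
    by (simp add: N_eq power_add power_sum)
  finally show ?thesis by (simp add: scaleR_conv_of_real)
qed

lemma scale_pos: "scale > 0"
proof -
  have "coef (Some i) ^ m i > 0" for i
    using N_pos by (cases "m i = 0") (auto simp: coef_def intro!: zero_less_power)
  then show ?thesis unfolding scale_def using coef_None_pos by (intro mult_pos_pos prod_pos) auto
qed

lemma scale_eq: "scale = sqrt (real (\<A> ^ \<A> * (\<Prod>j\<in>UNIV. m j ^ m j)) / real (N ^ N))"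
proof -
  have "scale\<^sup>2 = ((coef None)\<^sup>2) ^ \<A> * (\<Prod>i\<in>UNIV. ((coef (Some i))\<^sup>2) ^ m i)"
    by (simp add: scale_def power_mult_distrib prod_power_distrib mult.commute flip: power_mult)
  also have "\<dots> = real (\<A> ^ \<A> * (\<Prod>j\<in>UNIV. m j ^ m j)) / (real N ^ \<A> * (\<Prod>i\<in>UNIV. real N ^ m i))"
    by (simp add: coef_sq power_divide prod_dividef)
  also have "real N ^ \<A> * (\<Prod>i\<in>UNIV. real N ^ m i) = real N ^ (\<A> + (\<Sum>i\<in>UNIV. m i))"
    by (simp add: power_add power_sum)
  also have "\<A> + (\<Sum>i\<in>UNIV. m i) = N" by (rule N_eq[symmetric])
  finally have "scale\<^sup>2 = real (\<A> ^ \<A> * (\<Prod>j\<in>UNIV. m j ^ m j)) / real (N ^ N)" by simp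
  then show ?thesis using scale_pos by (metis less_eq_real_def real_sqrt_unique)
qed

text \<open>
  Two points of the slice are separated by \<open>monomial\<close> unless they differ by a root of unity, and
  in this case a torus element carries one to the other.
\<close>

lemma orbit_slice_eq_iff:
  "orbit \<Gamma> (slice w) = orbit \<Gamma> (slice w') \<longleftrightarrow> (w $ 1) ^ N = (w' $ 1) ^ N"
proof
  assume "orbit \<Gamma> (slice w) = orbit \<Gamma> (slice w')"
  then obtain g where "g \<in> \<Gamma>" "slice w' = g (slice w)"
    unfolding orbit_eq_iff[OF torus_maps_group] by blast
  then obtain t where "t \<in> torus" "slice w' = torus_act W t (slice w)"
    unfolding torus_maps_def by blast
  then have "monomial (slice w') = monomial (slice w)" using monomial_invariant by simp
  then show "(w $ 1) ^ N = (w' $ 1) ^ N" using scale_pos by (simp add: monomial_slice)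
next
  assume eq: "(w $ 1) ^ N = (w' $ 1) ^ N"
  have "\<exists>u. u ^ N = 1 \<and> w' $ 1 = u * w $ 1"
  proof (cases "w $ 1 = 0")
    case True
    then have "w' $ 1 = 0" using eq N_pos by (metis power_eq_0_iff zero_power)
    then show ?thesis using True by (intro exI[of _ 1]) simp
  next
    case False
    then show ?thesis by (intro exI[of _ "w' $ 1 / w $ 1"]) (simp add: power_divide eq[symmetric])
  qed
  then obtain u where u: "u ^ N = 1" "w' $ 1 = u * w $ 1" by blast
  obtain t where t: "t \<in> torus" "\<And>k. (t $ k) powi (- int (a k)) = u" "(\<Prod>i\<in>UNIV. (t $ i) ^ n i) = u"
    using root_of_unity_lift[OF u(1)] by blast
  have "slice w' $ j = torus_act W t (slice w) $ j" for j
    by (cases j) (simp_all add: torus_act_None torus_act_Some t(2,3) slice_def u(2))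
  then have "slice w' = torus_act W t (slice w)" by (simp add: vec_eq_iff)
  moreover have "torus_act W t \<in> \<Gamma>" unfolding torus_maps_def using t(1) by blast
  ultimately show "orbit \<Gamma> (slice w) = orbit \<Gamma> (slice w')"
    unfolding orbit_eq_iff[OF torus_maps_group] by blast
qed

section \<open>Brackets along the slice\<close>

lemma has_vector_derivative_cis_minus_1:
  "((\<lambda>s::real. (cis (\<alpha> * s) - 1) * p) has_vector_derivative (of_real \<alpha> * (\<i> * p))) (at 0)"
proof -
  have "((\<lambda>s::real. \<i> * of_real (\<alpha> * s)) has_vector_derivative (\<i> * of_real \<alpha>)) (at 0)"
    by (auto intro!: derivative_eq_intros simp: has_vector_derivative_def scaleR_conv_of_real mult_ac)
  moreover have "((\<lambda>x. (exp x - 1) * p) has_field_derivative p) (at (\<i> * of_real (\<alpha> * 0)))"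
    by (auto intro!: derivative_eq_intros)
  ultimately have "((\<lambda>x. (exp x - 1) * p) \<circ> (\<lambda>s::real. \<i> * of_real (\<alpha> * s)) has_vector_derivative (\<i> * of_real \<alpha>) * p) (at 0)"
    by (rule field_vector_diff_chain_at)
  then show ?thesis by (simp add: o_def cis_conv_exp mult_ac)
qed

lemma bounded_linear_axis: "bounded_linear (axis j :: complex \<Rightarrow> complex ^ 'n)"
  by (intro linear_linear[THEN iffD2] linearI) (auto simp: axis_def vec_eq_iff)

definition torus_invariant :: "(complex ^ ('l option) \<Rightarrow> real) \<Rightarrow> bool" where
  "torus_invariant f \<longleftrightarrow> (\<forall>t\<in>torus. \<forall>z. f (torus_act W t z) = f z)"

text \<open>
  An invariant function is constant along the orbit of the \<open>i\<close>-th circle, which moves the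
  coordinates \<open>Some i\<close> and \<open>None\<close> only.
\<close>

lemma infinitesimal_invariance:
  assumes f: "smooth f" and inv: "torus_invariant f"
  shows "real (a i) * dir_deriv (axis (Some i) (\<i> * z $ Some i)) f z
    = real (n i) * dir_deriv (axis None (\<i> * z $ None)) f z"
proof -
  define c where "c s = z + (axis (Some i) ((cis (- real (a i) * s) - 1) * z $ Some i)
    + axis None ((cis (real (n i) * s) - 1) * z $ None))" for s
  define v where "v = (- real (a i)) *\<^sub>R axis (Some i) (\<i> * z $ Some i) + real (n i) *\<^sub>R axis None (\<i> * z $ None)"
  have "c s = torus_act W (\<chi> k. if k = i then cis s else 1) z" for s
  proof -
    have "c s $ j = torus_act W (\<chi> k. if k = i then cis s else 1) z $ j" for j
    proof (cases j)
      case None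
      have "(\<Prod>k\<in>UNIV. ((\<chi> k. if k = i then cis s else 1) $ k) ^ n k) = (\<Prod>k\<in>UNIV. if k = i then cis s ^ n i else 1)"
        by (intro prod.cong) auto
      then have "(\<Prod>k\<in>UNIV. ((\<chi> k. if k = i then cis s else 1) $ k) ^ n k) = cis (real (n i) * s)"
        by (simp add: Complex.DeMoivre)
      then show ?thesis unfolding None torus_act_None by (simp add: c_def axis_def algebra_simps)
    next
      case (Some k)
      have "cis s powi (- int (a i)) = cis (- real (a i) * s)" by (simp only: cis_power_int) simp
      then show ?thesis unfolding Some torus_act_Some by (auto simp: c_def axis_def algebra_simps)
    qed
    then show ?thesis by (simp add: vec_eq_iff)
  qed
  moreover have "(\<chi> k. if k = i then cis s else 1) \<in> torus" for s by (simp add: torus_def)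
  ultimately have const: "f (c s) = f z" for s using inv by (simp add: torus_invariant_def)
  have ax: "of_real r * p = r *\<^sub>R p" for r and p :: complex by (simp add: scaleR_conv_of_real)
  have "(c has_vector_derivative
     (0 + (axis (Some i) (of_real (- real (a i)) * (\<i> * z $ Some i)) + axis None (of_real (real (n i)) * (\<i> * z $ None))))) (at 0)"
    unfolding c_def
    by (intro has_vector_derivative_add has_vector_derivative_const
        bounded_linear.has_vector_derivative[OF bounded_linear_axis] has_vector_derivative_cis_minus_1)
  moreover have "0 + (axis (Some i) (of_real (- real (a i)) * (\<i> * z $ Some i)) + axis None (of_real (real (n i)) * (\<i> * z $ None))) = v"
    unfolding ax v_def by (auto simp: vec_eq_iff axis_def)
  ultimately have "(c has_vector_derivative v) (at 0)" by simp
  from smooth_chain_dir[OF f this] have "((\<lambda>s. f z) has_real_derivative dir_deriv v f (c 0)) (at 0)"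
    unfolding const .
  then have "dir_deriv v f (c 0) = 0" using DERIV_unique DERIV_const by blast
  moreover have "c 0 = z" by (simp add: c_def axis_def vec_eq_iff)
  ultimately have "dir_deriv v f z = 0" by simp
  then show ?thesis unfolding v_def dir_deriv_lincomb[OF f] by simp
qed

text \<open>
  If \<open>n i = 0\<close>, the equation of infinitesimal invariance is void where the coordinate \<open>Some i\<close>
  vanishes. A finite rotation replaces it: the element with angle \<open>pi / a i\<close> reverses the
  coordinate \<open>Some i\<close> and fixes all others, so an invariant function is even in this coordinate.
\<close>

lemma dir_deriv_vanishes:
  assumes f: "smooth f" and inv: "torus_invariant f"
    and n0: "n i = 0" and z0: "z $ Some i = 0"
  shows "dir_deriv (axis (Some i) p) f z = 0"
proof -
  let ?v = "axis (Some i) p :: complex ^ 'l option"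
  define t :: "complex ^ 'l" where "t = (\<chi> k. if k = i then cis (pi / real (a i)) else 1)"
  have "t \<in> torus" by (simp add: torus_def t_def)
  have "torus_act W t (z + s *\<^sub>R ?v) = z + (- s) *\<^sub>R ?v" for s
  proof -
    have "torus_act W t (z + s *\<^sub>R ?v) $ j = (z + (- s) *\<^sub>R ?v) $ j" for j
    proof (cases j)
      case None
      have "(\<Prod>k\<in>UNIV. (t $ k) ^ n k) = 1"
        by (intro prod.neutral) (auto simp: t_def n0)
      then show ?thesis unfolding None torus_act_None by (simp add: axis_def)
    next
      case (Some k)
      have "cis (pi / real (a i)) powi (- int (a i)) = cis (- pi)"
        using a_pos[of i] by (simp only: cis_power_int) simp
      then have "cis (pi / real (a i)) powi (- int (a i)) = -1" by (simp add: complex_eq_iff)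
      then show ?thesis unfolding Some torus_act_Some by (auto simp: t_def axis_def z0)
    qed
    then show ?thesis by (simp add: vec_eq_iff)
  qed
  then have even: "f (z + (- s) *\<^sub>R ?v) = f (z + s *\<^sub>R ?v)" for s
    using inv \<open>t \<in> torus\<close> unfolding torus_invariant_def by metis
  have d: "((\<lambda>s. f (z + s *\<^sub>R ?v)) has_real_derivative dir_deriv ?v f z) (at 0)"
    by (rule smooth_has_dir_deriv[OF f])
  then have "((\<lambda>s. f (z + (- s) *\<^sub>R ?v)) has_real_derivative - dir_deriv ?v f z) (at 0)"
    using DERIV_mirror[of "\<lambda>s. f (z + s *\<^sub>R ?v)" "dir_deriv ?v f z" 0] by simp
  then have "dir_deriv ?v f z = - dir_deriv ?v f z"
    unfolding even using d by (rule DERIV_unique[symmetric])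
  then show ?thesis by simp
qed

lemma dir_deriv_complex_coords:
  assumes "smooth (f :: complex ^ 'n \<Rightarrow> real)"
  shows "dir_deriv v f z = (\<Sum>j\<in>UNIV. Re (v $ j) * dir_deriv (axis j 1) f z + Im (v $ j) * dir_deriv (axis j \<i>) f z)"
proof -
  have "v = (\<Sum>j\<in>UNIV. axis j (v $ j))" by (simp add: vec_eq_iff axis_def)
  then have "dir_deriv v f z = dir_deriv (\<Sum>j\<in>UNIV. axis j (v $ j)) f z" by simp
  also have "\<dots> = (\<Sum>j\<in>UNIV. dir_deriv (axis j (v $ j)) f z)"
    unfolding smooth_dir_deriv_eq(1)[OF assms, of "\<Sum>j\<in>UNIV. axis j (v $ j)"]
      smooth_dir_deriv_eq(1)[OF assms, of "axis j (v $ j)" for j]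
    by (simp add: inner_sum_left sum_distrib_left sum.swap[of _ Basis])
  finally show ?thesis by (simp add: dir_deriv_axis[OF assms, of _ "v $ _"])
qed

lemma dir_deriv_slice:
  assumes "smooth f"
  shows "dir_deriv (axis 1 p) (\<lambda>w. f (slice w)) w =
    (\<Sum>j\<in>UNIV. coef j * (Re p * dir_deriv (axis j 1) f (slice w) + Im p * dir_deriv (axis j \<i>) f (slice w)))"
proof -
  have "slice (w + t *\<^sub>R axis 1 p) = slice w + t *\<^sub>R slice (axis 1 p)" for t
    using linear_slice by (simp add: linear_add linear_scale)
  then have "dir_deriv (axis 1 p) (\<lambda>w. f (slice w)) w = dir_deriv (slice (axis 1 p)) f (slice w)"
    by (simp add: dir_deriv_def)
  then show ?thesis
    unfolding dir_deriv_complex_coords[OF assms, of "slice (axis 1 p)"]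
    by (simp add: slice_def[of "axis 1 p"] distrib_left mult_ac)
qed

text \<open>
  Infinitesimal invariance relates the angular derivatives in the planes \<open>Some i\<close> and \<open>None\<close>
  through the weights; on the slice, \<open>coef_relation\<close> expresses the weights by the coefficients.
\<close>

lemma angular_derivative_slice:
  assumes f: "smooth f" and inv: "torus_invariant f"
  shows "coef None * (Re (w $ 1) * dir_deriv (axis j \<i>) f (slice w) - Im (w $ 1) * dir_deriv (axis j 1) f (slice w))
    = coef j * (Re (w $ 1) * dir_deriv (axis None \<i>) f (slice w) - Im (w $ 1) * dir_deriv (axis None 1) f (slice w))"
proof (cases j)
  case (Some i)
  define Y where "Y k = Re (w $ 1) * dir_deriv (axis k \<i>) f (slice w) - Im (w $ 1) * dir_deriv (axis k 1) f (slice w)" for k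
  have D: "dir_deriv (axis k (\<i> * slice w $ k)) f (slice w) = coef k * Y k" for k
    by (subst dir_deriv_axis[OF f]) (simp add: slice_def Y_def algebra_simps)
  have rel: "real (a i) * (coef (Some i) * Y (Some i)) = real (n i) * (coef None * Y None)"
    using infinitesimal_invariance[OF f inv, of i "slice w"] unfolding D .
  have "coef None * Y (Some i) = coef (Some i) * Y None"
  proof (cases "coef (Some i) = 0")
    case True
    then have n0: "n i = 0" using coef_relation[of i] coef_None_pos by simp
    have z0: "slice w $ Some i = 0" using True by (simp add: slice_def)
    have "Y (Some i) = 0" unfolding Y_def by (simp add: dir_deriv_vanishes[OF f inv n0 z0])
    then show ?thesis using True by simp
  next
    case False
    have n0: "n i \<noteq> 0"
    proof
      assume "n i = 0"
      then show False using False coef_relation[of i] a_pos[of i] by simp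
    qed
    have "real (n i) * coef None * (coef None * Y (Some i)) = (real (n i) * (coef None)\<^sup>2) * Y (Some i)"
      by (simp add: power2_eq_square)
    also have "\<dots> = coef (Some i) * (real (a i) * (coef (Some i) * Y (Some i)))"
      unfolding coef_relation[symmetric] by (simp add: power2_eq_square)
    also have "\<dots> = real (n i) * coef None * (coef (Some i) * Y None)" unfolding rel by simp
    finally show ?thesis using n0 coef_None_pos by simp
  qed
  then show ?thesis by (simp add: Y_def Some)
qed simp

text \<open>
  In the plane of the \<open>j\<close>-th coordinate, write \<open>R j\<close> and \<open>T j\<close> for the radial and the angular
  derivative, both scaled by the modulus of \<open>w\<close>. Then \<open>|w|^2\<close> times the bracket of \<open>F\<close> and \<open>G\<close> is
  the sum over \<open>j\<close> of \<open>R j F * T j G - T j F * R j G\<close>, with \<open>T j f = coef j * X f\<close> for invariant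
  \<open>f\<close>. On the line, the radial derivative of \<open>f\<close> is the sum \<open>S f\<close> of the \<open>coef j * R j f\<close>, and the
  angular one is the sum of the \<open>coef j * T j f\<close>, which is \<open>X f\<close> because the squares of the
  coefficients sum to one. Both brackets thus equal \<open>S F * X G - X F * S G\<close> up to the factor
  \<open>|w|^2\<close>.
\<close>

lemma std_brk_slice_nonzero:
  assumes F: "smooth F" "torus_invariant F"
    and G: "smooth G" "torus_invariant G"
    and w: "w $ 1 \<noteq> 0"
  shows "std_brk F G (slice w) = std_brk (\<lambda>w. F (slice w)) (\<lambda>w. G (slice w)) w"
proof -
  define u v where "u = Re (w $ 1)" and "v = Im (w $ 1)"
  define P where "P f j = dir_deriv (axis j 1) f (slice w)" for f j
  define Q where "Q f j = dir_deriv (axis j \<i>) f (slice w)" for f j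
  define X where "X f = (u * Q f None - v * P f None) / coef None" for f
  define S where "S f = (\<Sum>j\<in>UNIV. coef j * (u * P f j + v * Q f j))" for f
  have Y: "u * Q f j - v * P f j = coef j * X f"
    if "smooth f" "torus_invariant f" for f j
    using angular_derivative_slice[OF that, of w j] coef_None_pos
    by (simp add: X_def P_def Q_def u_def v_def field_simps)
  \<comment> \<open>Passing from the coordinate derivatives to the radial and angular ones.\<close>
  have split: "(u\<^sup>2 + v\<^sup>2) * (p * q' - q * p') = (u * p + v * q) * (u * q' - v * p') - (u * q - v * p) * (u * p' + v * q')"
    for p q p' q' by (simp add: power2_eq_square algebra_simps)
  have "(u\<^sup>2 + v\<^sup>2) * std_brk F G (slice w) = (\<Sum>j\<in>UNIV. (u\<^sup>2 + v\<^sup>2) * (P F j * Q G j - Q F j * P G j))"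
    by (simp add: std_brk_def P_def Q_def sum_distrib_left)
  also have "\<dots> = (\<Sum>j\<in>UNIV. coef j * (u * P F j + v * Q F j) * X G - X F * (coef j * (u * P G j + v * Q G j)))"
    unfolding split Y[OF F] Y[OF G] by (simp add: mult_ac)
  also have "\<dots> = S F * X G - X F * S G"
    by (simp add: S_def sum_subtractf sum_distrib_left sum_distrib_right)
  finally have 1: "(u\<^sup>2 + v\<^sup>2) * std_brk F G (slice w) = S F * X G - X F * S G" .
  define p where "p f = (\<Sum>j\<in>UNIV. coef j * P f j)" for f
  define q where "q f = (\<Sum>j\<in>UNIV. coef j * Q f j)" for f
  have pq: "dir_deriv (axis 1 1) (\<lambda>w. f (slice w)) w = p f" "dir_deriv (axis 1 \<i>) (\<lambda>w. f (slice w)) w = q f"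
    if "smooth f" for f using dir_deriv_slice[OF that] by (simp_all add: p_def q_def P_def Q_def)
  have S: "u * p f + v * q f = S f" for f
    by (simp add: S_def p_def q_def sum_distrib_left sum.distrib distrib_left mult_ac)
  have Xpq: "u * q f - v * p f = X f"
    if "smooth f" "torus_invariant f" for f
  proof -
    have "u * q f - v * p f = (\<Sum>j\<in>UNIV. coef j * (u * Q f j - v * P f j))"
      by (simp add: p_def q_def sum_distrib_left sum_subtractf right_diff_distrib mult_ac)
    also have "\<dots> = (\<Sum>j\<in>UNIV. (coef j)\<^sup>2) * X f"
      unfolding Y[OF that] by (simp add: sum_distrib_right sum_distrib_left power2_eq_square mult_ac)
    finally show ?thesis by (simp add: sum_coef_sq)
  qed
  have "(u\<^sup>2 + v\<^sup>2) * std_brk (\<lambda>w. F (slice w)) (\<lambda>w. G (slice w)) w = S F * X G - X F * S G"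
    unfolding std_brk_1 pq[OF F(1)] pq[OF G(1)] split S Xpq[OF F] Xpq[OF G] ..
  with 1 have "(u\<^sup>2 + v\<^sup>2) * std_brk F G (slice w) = (u\<^sup>2 + v\<^sup>2) * std_brk (\<lambda>w. F (slice w)) (\<lambda>w. G (slice w)) w"
    by simp
  moreover have "u\<^sup>2 + v\<^sup>2 \<noteq> 0" using w by (simp add: u_def v_def complex_eq_iff sum_power2_eq_zero_iff)
  ultimately show ?thesis by (metis mult_left_cancel)
qed

text \<open>
  At the origin, where radial and angular derivatives degenerate, continuity takes over.
\<close>

lemma std_brk_slice:
  assumes F: "smooth F" "torus_invariant F"
    and G: "smooth G" "torus_invariant G"
  shows "std_brk F G (slice w) = std_brk (\<lambda>w. F (slice w)) (\<lambda>w. G (slice w)) w"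
proof (cases "w $ 1 = 0")
  case False
  then show ?thesis by (rule std_brk_slice_nonzero[OF F G])
next
  case True
  then have w0: "w = 0" by (simp add: vec_eq_iff)
  define h where "h w = std_brk F G (slice w) - std_brk (\<lambda>w. F (slice w)) (\<lambda>w. G (slice w)) w" for w
  have "smooth h" unfolding h_def
    by (intro smooth_diff smooth_linear[OF smooth_std_brk[OF F(1) G(1)] linear_slice] smooth_std_brk
        smooth_linear[OF F(1) linear_slice] smooth_linear[OF G(1) linear_slice])
  then have "isCont h 0" using smooth_continuous continuous_on_eq_continuous_at[OF open_UNIV] by blast
  moreover have "isCont (\<lambda>t::real. t *\<^sub>R (axis 1 1 :: complex ^ 1)) 0" by (intro continuous_intros)
  ultimately have "isCont (\<lambda>t::real. h (t *\<^sub>R axis 1 1)) 0"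
    by (intro isCont_o2[where f = "\<lambda>t::real. t *\<^sub>R (axis 1 1 :: complex ^ 1)" and g = h]) simp_all
  then have "((\<lambda>t::real. h (t *\<^sub>R axis 1 1)) \<longlongrightarrow> h 0) (at 0)" by (simp add: isCont_def)
  moreover have "h (t *\<^sub>R axis 1 1) = 0" if "t \<noteq> 0" for t
    unfolding h_def using std_brk_slice_nonzero[OF F G, of "t *\<^sub>R axis 1 1"] that by simp
  then have "((\<lambda>t::real. h (t *\<^sub>R axis 1 1)) \<longlongrightarrow> 0) (at 0)"
    by (intro tendsto_eventually) (simp add: eventually_at_filter)
  ultimately have "h 0 = 0" by (intro LIM_unique)
  then show ?thesis by (simp add: h_def w0)
qed

section \<open>The slice induces an isomorphism of Poisson differential spaces\<close>

abbreviation "X \<equiv> cyclic_quotient N"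
abbreviation "Y \<equiv> symplectic_quotient W"
abbreviation "orbX \<equiv> orbit (cyclic_maps N)"
abbreviation "orbY \<equiv> orbit \<Gamma>"

text \<open>
  The map induced on orbits by \<open>slice\<close>; any representative \<open>w\<close> gives the same value.
\<close>

definition slice_quotient :: "(complex ^ 1) set \<Rightarrow> (complex ^ ('l option)) set" where
  "slice_quotient \<xi> = orbY (slice (SOME w. orbX w = \<xi>))"

lemma slice_quotient_orbit: "slice_quotient (orbX w) = orbY (slice w)"
proof -
  define w' where "w' = (SOME w'. orbX w' = orbX w)"
  have "orbX w' = orbX w" unfolding w'_def by (rule someI[of _ w]) simp
  then have "(w' $ 1) ^ N = (w $ 1) ^ N" by (simp add: cyclic_orbit_eq_iff[OF N_pos])
  then show ?thesis unfolding slice_quotient_def w'_def[symmetric] orbit_slice_eq_iff .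
qed

lemma orbY_torus_act: "t \<in> torus \<Longrightarrow> orbY (torus_act W t z) = orbY z"
  using orbit_eq_iff[OF torus_maps_group, of W z "torus_act W t z"] unfolding torus_maps_def by blast

lemma pts_Y: "pts Y = orbY ` Z"
  unfolding symplectic_quotient_def by (rule pts_orbit_quotient)

lemma orbit_of_slice:
  assumes "z \<in> Z"
  obtains t w where "t \<in> torus" "z = torus_act W t (slice w)" "orbY z = orbY (slice w)"
proof -
  obtain t w where tw: "t \<in> torus" "z = torus_act W t (slice w)"
    using zero_fibre_reaches_slice[OF assms] .
  from that[OF this] orbY_torus_act[OF tw(1)] tw(2) show ?thesis by simp
qed

lemma slice_quotient_image: "slice_quotient ` pts X = pts Y"
proof
  show "slice_quotient ` pts X \<subseteq> pts Y"
    using slice_in_zero_fibre by (auto simp: pts_cyclic_quotient pts_Y slice_quotient_orbit)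
  show "pts Y \<subseteq> slice_quotient ` pts X"
  proof
    fix \<eta> assume "\<eta> \<in> pts Y"
    then obtain z where z: "z \<in> Z" "\<eta> = orbY z" by (auto simp: pts_Y)
    obtain t w where "orbY z = orbY (slice w)" using orbit_of_slice[OF z(1)] by metis
    then have "\<eta> = slice_quotient (orbX w)" by (simp add: z(2) slice_quotient_orbit)
    then show "\<eta> \<in> slice_quotient ` pts X" by (simp add: pts_cyclic_quotient)
  qed
qed

lemma slice_quotient_inj: "inj_on slice_quotient (pts X)"
proof (rule inj_onI)
  fix \<xi> \<eta> assume "\<xi> \<in> pts X" "\<eta> \<in> pts X" and eq: "slice_quotient \<xi> = slice_quotient \<eta>"
  then obtain w w' where w: "\<xi> = orbX w" "\<eta> = orbX w'" by (auto simp: pts_cyclic_quotient)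
  show "\<xi> = \<eta>"
    using eq unfolding w slice_quotient_orbit orbit_slice_eq_iff cyclic_orbit_eq_iff[OF N_pos] .
qed

lemma continuous_monomial: "continuous_on UNIV monomial"
  unfolding monomial_def by (intro continuous_intros)

text \<open>
  The inverse is continuous because on \<open>Z\<close> the orbit is determined by the value of \<open>monomial\<close>, a
  continuous function on the whole space that restricts to a multiple of \<open>w ^ N\<close>, and \<open>w \<mapsto> w ^ N\<close>
  is open.
\<close>

lemma homeomorphic_slice_quotient: "homeomorphic_map (space_top X) (space_top Y) slice_quotient"
  unfolding homeomorphic_map_def quotient_map_def
proof (intro conjI allI impI)
  show "slice_quotient ` topspace (space_top X) = topspace (space_top Y)"
    using slice_quotient_image by (simp add: pts_def)
  show "inj_on slice_quotient (topspace (space_top X))"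
    using slice_quotient_inj by (simp add: pts_def)
  fix U assume "U \<subseteq> topspace (space_top Y)"
  then have U: "U \<subseteq> orbY ` Z" using pts_Y by (simp add: pts_def)
  define V where "V = {x \<in> topspace (space_top X). slice_quotient x \<in> U}"
  have V: "{w. orbX w \<in> V} = {w. orbY (slice w) \<in> U}"
    using pts_cyclic_quotient[of N] by (auto simp: V_def slice_quotient_orbit pts_def)
  have openX: "openin (space_top X) V \<longleftrightarrow> open {w. orbY (slice w) \<in> U}"
  proof -
    have "V \<subseteq> pts X" by (auto simp: V_def pts_def)
    then show ?thesis unfolding openin_cyclic_quotient V by simp
  qed
  have openY: "openin (space_top Y) U \<longleftrightarrow> openin (top_of_set Z) {z \<in> Z. orbY z \<in> U}"
    unfolding symplectic_quotient_def openin_orbit_quotient using U by simp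
  show "openin (space_top X) V \<longleftrightarrow> openin (space_top Y) U"
    unfolding openX openY
  proof
    assume "openin (top_of_set Z) {z \<in> Z. orbY z \<in> U}"
    then obtain T where T: "open T" "{z \<in> Z. orbY z \<in> U} = Z \<inter> T" unfolding openin_open by blast
    have "{w. orbY (slice w) \<in> U} = slice -` T" using T(2) slice_in_zero_fibre by blast
    moreover have "continuous_on UNIV slice"
      using linear_slice by (simp add: linear_conv_bounded_linear linear_continuous_on)
    ultimately show "open {w. orbY (slice w) \<in> U}" using T(1) by (simp add: open_vimage)
  next
    let ?W = "{w. orbY (slice w) \<in> U}"
    assume "open ?W"
    then have op: "open ((\<lambda>w. (w $ 1) ^ N) ` ?W)" by (rule open_power_image_vec1[OF N_pos])
    have "{z \<in> Z. orbY z \<in> U} = Z \<inter> (\<lambda>z. monomial z /\<^sub>R scale) -` ((\<lambda>w. (w $ 1) ^ N) ` ?W)"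
    proof (rule set_eqI)
      fix z
      show "z \<in> {z \<in> Z. orbY z \<in> U} \<longleftrightarrow> z \<in> Z \<inter> (\<lambda>z. monomial z /\<^sub>R scale) -` ((\<lambda>w. (w $ 1) ^ N) ` ?W)"
      proof (cases "z \<in> Z")
        case True
        obtain t w where tw: "t \<in> torus" "z = torus_act W t (slice w)" "orbY z = orbY (slice w)"
          using orbit_of_slice[OF True] .
        have mon: "monomial z /\<^sub>R scale = (w $ 1) ^ N"
          using monomial_invariant[OF tw(1), of "slice w"] scale_pos by (simp add: tw(2) monomial_slice)
        have "orbY (slice w) \<in> U \<longleftrightarrow> (w $ 1) ^ N \<in> (\<lambda>w. (w $ 1) ^ N) ` ?W"
        proof
          assume "(w $ 1) ^ N \<in> (\<lambda>w. (w $ 1) ^ N) ` ?W"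
          then obtain w' where w': "orbY (slice w') \<in> U" "(w $ 1) ^ N = (w' $ 1) ^ N" by blast
          then show "orbY (slice w) \<in> U" using orbit_slice_eq_iff[of w w'] by simp
        qed blast
        then show ?thesis using True tw(3) mon by simp
      qed simp
    qed
    moreover have "open ((\<lambda>z. monomial z /\<^sub>R scale) -` ((\<lambda>w. (w $ 1) ^ N) ` ?W))"
      by (rule open_vimage[OF op]) (intro continuous_intros continuous_monomial)
    ultimately show "openin (top_of_set Z) {z \<in> Z. orbY z \<in> U}" unfolding openin_open by blast
  qed
qed

subsection \<open>The invariants\<close>

abbreviation "\<rho> \<equiv> quotient_invariants a n"

lemma quotient_invariants_simps:
  "\<rho> (Inl 1) z = Re (monomial z)" "\<rho> (Inl 2) z = Im (monomial z)" "\<rho> (Inl 3) z = (cmod (z $ None))\<^sup>2"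
  "\<rho> (Inr i) z = (cmod (z $ Some i))\<^sup>2"
  by (simp_all add: quotient_invariants_def monomial_def Let_def)

lemma quotient_index_cases [case_names 1 2 3 4]:
  fixes v :: "3 + 'l"
  obtains "v = Inl 1" | "v = Inl 2" | "v = Inl 3" | i where "v = Inr i"
proof (cases v)
  case (Inl k)
  then show ?thesis using that exhaust_3[of k] by blast
qed (use that in blast)

lemma quotient_invariants_torus_act:
  assumes "t \<in> torus"
  shows "\<rho> v (torus_act W t z) = \<rho> v z"
proof -
  have "cmod (torus_act W t z $ j) = cmod (z $ j)" for j
    by (simp add: torus_act_diag diag_def norm_mult norm_torus_weights[OF assms])
  then show ?thesis
    by (cases v rule: quotient_index_cases)
       (simp_all only: quotient_invariants_simps monomial_invariant[OF assms])
qed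

lemma quotient_invariants_invariant: "g \<in> \<Gamma> \<Longrightarrow> \<rho> v (g z) = \<rho> v z"
  unfolding torus_maps_def using quotient_invariants_torus_act by blast

lemma smooth_monomial: "smooth (\<lambda>z. Re (monomial z)) \<and> smooth (\<lambda>z. Im (monomial z))"
proof -
  define C :: "(complex ^ ('l option) \<Rightarrow> complex) \<Rightarrow> bool"
    where "C g \<longleftrightarrow> smooth (\<lambda>z. Re (g z)) \<and> smooth (\<lambda>z. Im (g z))" for g
  have mult: "C (\<lambda>z. g z * h z)" if "C g" "C h" for g h
    using that unfolding C_def times_complex.simps by (auto intro!: smooth_diff smooth_add smooth_mult)
  have one: "C (\<lambda>z. 1)" unfolding C_def by simp
  have coord: "C (\<lambda>z. z $ j)" for j
    unfolding C_def using smooth_linear[OF smooth_Re_Im(1), of "\<lambda>z. z $ j"] smooth_linear[OF smooth_Re_Im(2), of "\<lambda>z. z $ j"]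
    by (auto simp: linear_iff)
  have pow: "C (\<lambda>z. g z ^ k)" if "C g" for g k
    by (induction k) (simp_all add: one mult that)
  have prod: "C (\<lambda>z. \<Prod>i\<in>S. g i z)" if "\<And>i. C (g i)" for g and S :: "'l set"
    by (induction S rule: infinite_finite_induct) (simp_all add: one mult that)
  have "C monomial" unfolding monomial_def[abs_def] by (intro mult prod pow coord)
  then show ?thesis unfolding C_def .
qed

lemma smooth_quotient_invariants: "smooth (\<rho> v)"
proof -
  have norm: "smooth (\<lambda>z::complex ^ ('l option). (cmod (z $ j))\<^sup>2)" for j
    using smooth_linear[OF smooth_norm_square, of "\<lambda>z. z $ j"] by (simp add: linear_iff)
  show ?thesis
  proof (cases v rule: quotient_index_cases)
    case 1
    have "\<rho> v = (\<lambda>z. Re (monomial z))" unfolding 1 quotient_invariants_simps[abs_def] ..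
    then show ?thesis using smooth_monomial by simp
  next
    case 2
    have "\<rho> v = (\<lambda>z. Im (monomial z))" unfolding 2 quotient_invariants_simps[abs_def] ..
    then show ?thesis using smooth_monomial by simp
  next
    case 3
    have "\<rho> v = (\<lambda>z. (cmod (z $ None))\<^sup>2)" unfolding 3 quotient_invariants_simps[abs_def] ..
    then show ?thesis using norm by simp
  next
    case (4 i)
    have "\<rho> v = (\<lambda>z. (cmod (z $ Some i))\<^sup>2)" unfolding 4 quotient_invariants_simps[abs_def] ..
    then show ?thesis using norm by simp
  qed
qed

lemma quotient_invariants_slice:
  "\<rho> (Inl 1) (slice w) = scale * cyclic_invariants N 1 w"
  "\<rho> (Inl 2) (slice w) = scale * cyclic_invariants N 2 w"
  "\<rho> (Inl 3) (slice w) = real \<A> / real N * cyclic_invariants N 3 w"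
  "\<rho> (Inr i) (slice w) = real (m i) / real N * cyclic_invariants N 3 w"
  unfolding quotient_invariants_simps monomial_slice coef_sq[symmetric]
  by (simp_all add: cyclic_invariants_def slice_def power_mult_distrib)

subsection \<open>Smooth functions and brackets\<close>

lemma smooth_ext_torus:
  assumes "smooth_ext \<Gamma> Z F f"
  shows "smooth F" "torus_invariant F" "z \<in> Z \<Longrightarrow> f (orbY z) = F z"
  using assms unfolding smooth_ext_def torus_invariant_def torus_maps_def by auto

text \<open>
  A smooth function on \<open>X\<close> is a smooth function of the three cyclic invariants. These are the
  restrictions of torus invariants, and substituting the latter extends the function from the
  slice to a smooth invariant function on the whole space.
\<close>

lemma Cinf_Y_iff: "f \<in> Cinf Y \<longleftrightarrow> f \<in> extensional (pts Y) \<and> pullback X slice_quotient f \<in> Cinf X"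
proof
  assume "f \<in> Cinf Y"
  then obtain F where f: "f \<in> extensional (pts Y)" and F: "smooth_ext \<Gamma> Z F f"
    unfolding pts_Y unfolding symplectic_quotient_def Cinf_orbit_quotient by blast
  have "pullback X slice_quotient f \<in> Cinf X"
  proof (rule Cinf_cyclicI[OF N_pos _ smooth_linear[OF smooth_ext_torus(1)[OF F] linear_slice]])
    show "pullback X slice_quotient f \<in> extensional (pts X)" by (simp add: pullback_def)
    show "pullback X slice_quotient f (orbX w) = F (slice w)" for w
      using smooth_ext_torus(3)[OF F slice_in_zero_fibre]
      by (simp add: pullback_def pts_cyclic_quotient slice_quotient_orbit)
  qed
  with f show "f \<in> extensional (pts Y) \<and> pullback X slice_quotient f \<in> Cinf X" by blast
next
  assume "f \<in> extensional (pts Y) \<and> pullback X slice_quotient f \<in> Cinf X"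
  then have f: "f \<in> extensional (pts Y)" and pb: "pullback X slice_quotient f \<in> Cinf X" by auto
  obtain F where F: "F \<in> smooth_fun (UNIV :: 3 set)"
    "\<And>\<xi>. \<xi> \<in> pts X \<Longrightarrow> pullback X slice_quotient f \<xi> = F (chart_map (cyclic_chart N) \<xi>)"
    using global_chartD(5)[OF global_chart_cyclic[OF N2] pb] by blast
  \<comment> \<open>Torus invariants that restrict to the cyclic invariants on the slice.\<close>
  define \<sigma> where "\<sigma> k z = (if k = 1 then inverse scale * \<rho> (Inl 1) z else if k = 2 then inverse scale * \<rho> (Inl 2) z
    else real N / real \<A> * \<rho> (Inl 3) z)" for k :: 3 and z
  have \<sigma>_smooth: "smooth (\<sigma> k)" for k
  proof -
    have "smooth (\<lambda>z. c * \<rho> v z)" for c v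
      by (intro smooth_mult smooth_const smooth_quotient_invariants)
    then show ?thesis by (cases "k = 1"; cases "k = 2") (simp_all add: \<sigma>_def[abs_def] del: times_divide_eq_left)
  qed
  have \<sigma>_slice: "\<sigma> k (slice w) = cyclic_invariants N k w" for k w
    using exhaust_3[of k] scale_pos lcm_pos N_pos by (auto simp: \<sigma>_def quotient_invariants_slice)
  have \<sigma>_inv: "\<sigma> k (torus_act W t z) = \<sigma> k z" if "t \<in> torus" for k t z
    by (simp add: \<sigma>_def quotient_invariants_torus_act[OF that])
  define G where "G z = F (\<lambda>k. \<sigma> k z)" for z
  have "smooth G" unfolding G_def by (rule smooth_compose_fun[OF finite F(1) \<sigma>_smooth])
  moreover have G_inv: "G (torus_act W t z) = G z" if "t \<in> torus" for t z
    by (simp add: G_def \<sigma>_inv[OF that])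
  moreover have "f (orbY z) = G z" if z: "z \<in> Z" for z
  proof -
    obtain t w where tw: "t \<in> torus" "z = torus_act W t (slice w)" "orbY z = orbY (slice w)"
      using orbit_of_slice[OF z] .
    have "orbX w \<in> pts X" by (simp add: pts_cyclic_quotient)
    from F(2)[OF this] have "f (orbY (slice w)) = F (chart_map (cyclic_chart N) (orbX w))"
      by (simp add: pullback_def pts_cyclic_quotient slice_quotient_orbit)
    also have "chart_map (cyclic_chart N) (orbX w) = (\<lambda>k. \<sigma> k (slice w))"
      by (rule HOL.ext) (simp add: chart_map_def cyclic_chart_orbit[OF N_pos] poly_hom_Var \<sigma>_slice)
    also have "F (\<lambda>k. \<sigma> k (slice w)) = G z" using G_inv[OF tw(1)] by (simp add: G_def[symmetric] tw(2))
    finally show ?thesis using tw(3) by simp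
  qed
  ultimately have "smooth_ext \<Gamma> Z G f" unfolding smooth_ext_def torus_maps_def by auto
  with f show "f \<in> Cinf Y" unfolding pts_Y unfolding symplectic_quotient_def Cinf_orbit_quotient by blast
qed

text \<open>
  The bracket of two invariant functions at a point of \<open>Z\<close> depends only on their values on the
  slice, hence only on their classes modulo the functions vanishing on \<open>Z\<close>.
\<close>

lemma std_brk_zero_fibre:
  assumes F: "smooth_ext \<Gamma> Z F f" and G: "smooth_ext \<Gamma> Z G g"
    and z: "z \<in> Z" "orbY z = orbY (slice w)"
  shows "std_brk F G z = std_brk (\<lambda>w. f (orbY (slice w))) (\<lambda>w. g (orbY (slice w))) w"
proof -
  have "\<exists>h\<in>\<Gamma>. z = h (slice w)"
    using z(2) orbit_eq_iff[OF torus_maps_group, of W "slice w" z] by simp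
  then obtain t where t: "t \<in> torus" "z = torus_act W t (slice w)" unfolding torus_maps_def by blast
  note F' = smooth_ext_torus[OF F] and G' = smooth_ext_torus[OF G]
  have inv: "F (diag (torus_weights W t) z) = F z" "G (diag (torus_weights W t) z) = G z" for z
    using F'(2) G'(2) t(1) unfolding torus_invariant_def torus_act_diag by blast+
  have "std_brk F G z = std_brk F G (slice w)"
    unfolding t(2) torus_act_diag
    by (rule std_brk_diag) (simp_all add: norm_torus_weights[OF t(1)] F'(1) G'(1) inv)
  also have "\<dots> = std_brk (\<lambda>w. F (slice w)) (\<lambda>w. G (slice w)) w"
    by (rule std_brk_slice[OF F'(1,2) G'(1,2)])
  finally show ?thesis by (simp add: F'(3)[OF slice_in_zero_fibre] G'(3)[OF slice_in_zero_fibre])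
qed

lemma brk_Y:
  assumes f: "f \<in> Cinf Y" and g: "g \<in> Cinf Y"
  shows "brk Y f g \<in> extensional (pts Y)"
    and "brk Y f g (orbY (slice w)) = std_brk (\<lambda>w. f (orbY (slice w))) (\<lambda>w. g (orbY (slice w))) w"
proof -
  obtain F G where F: "smooth_ext \<Gamma> Z F f" and G: "smooth_ext \<Gamma> Z G g"
    using f g unfolding symplectic_quotient_def Cinf_orbit_quotient by blast
  have wd: "std_brk F G z = std_brk F' G' z'"
    if FG: "smooth_ext \<Gamma> Z F f" "smooth_ext \<Gamma> Z G g" "smooth_ext \<Gamma> Z F' f" "smooth_ext \<Gamma> Z G' g"
      and z: "z \<in> Z" "z' \<in> Z" "orbY z = orbY z'" for F G F' G' z z'
  proof -
    obtain t w where "orbY z = orbY (slice w)" using orbit_of_slice[OF z(1)] by metis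
    then show ?thesis
      using std_brk_zero_fibre[OF FG(1,2) z(1)] std_brk_zero_fibre[OF FG(3,4) z(2)] z(3) by simp
  qed
  show "brk Y f g \<in> extensional (pts Y)"
    unfolding pts_Y unfolding symplectic_quotient_def
    by (rule brk_orbit_quotient(1)[OF F G]) (rule wd)
  have "brk Y f g (orbY (slice w)) = std_brk F G (slice w)"
    unfolding symplectic_quotient_def
    by (rule brk_orbit_quotient(2)[OF F G _ F G slice_in_zero_fibre]) (rule wd)
  then show "brk Y f g (orbY (slice w)) = std_brk (\<lambda>w. f (orbY (slice w))) (\<lambda>w. g (orbY (slice w))) w"
    using std_brk_zero_fibre[OF F G slice_in_zero_fibre refl] by simp
qed

theorem poisson_iso_slice_quotient: "poisson_iso X Y slice_quotient"
  unfolding poisson_iso_def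
proof (intro conjI ballI)
  show "homeomorphic_map (space_top X) (space_top Y) slice_quotient"
    by (rule homeomorphic_slice_quotient)
  show "Cinf Y = {f \<in> extensional (pts Y). pullback X slice_quotient f \<in> Cinf X}"
    using Cinf_Y_iff by blast
  fix f g assume fg: "f \<in> Cinf Y" "g \<in> Cinf Y"
  show "brk Y f g \<in> extensional (pts Y)" by (rule brk_Y(1)[OF fg])
  have pb: "pullback X slice_quotient f \<in> Cinf X" "pullback X slice_quotient g \<in> Cinf X"
    using fg by (simp_all add: Cinf_Y_iff)
  have pbo: "pullback X slice_quotient h (orbX w) = h (orbY (slice w))" for h w
    by (simp add: pullback_def pts_cyclic_quotient slice_quotient_orbit)
  show "pullback X slice_quotient (brk Y f g) = brk X (pullback X slice_quotient f) (pullback X slice_quotient g)"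
  proof (rule extensionalityI[OF _ brk_cyclic(1)[OF N_pos pb]])
    show "pullback X slice_quotient (brk Y f g) \<in> extensional (pts X)" by (simp add: pullback_def)
    fix \<xi> assume "\<xi> \<in> pts X"
    then obtain w where w: "\<xi> = orbX w" by (auto simp: pts_cyclic_quotient)
    show "pullback X slice_quotient (brk Y f g) \<xi> = brk X (pullback X slice_quotient f) (pullback X slice_quotient g) \<xi>"
      unfolding w brk_cyclic(2)[OF N_pos pb] pbo by (rule brk_Y(2)[OF fg])
  qed
qed

section \<open>The comparison homomorphism\<close>

definition comparison_images :: "3 + 'l \<Rightarrow> 3 rpoly" where
  "comparison_images v = (case v of
     Inl k \<Rightarrow> if k = 1 \<or> k = 2 then Const scale * Var k else Const (real \<A> / real N) * Var 3
   | Inr i \<Rightarrow> Const (real (m i) / real N) * Var 3)"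

lemma comparison_hom_eq: "comparison_hom a n N = poly_subst comparison_images"
  unfolding comparison_hom_def comparison_images_def[abs_def] scale_eq ..

lemma comparison_images_simps:
  "comparison_images (Inl 1) = Const scale * Var 1"
  "comparison_images (Inl 2) = Const scale * Var 2"
  "comparison_images (Inl 3) = Const (real \<A> / real N) * Var 3"
  "comparison_images (Inr i) = Const (real (m i) / real N) * Var 3"
  by (simp_all add: comparison_images_def)

text \<open>
  The homomorphism of the theorem is the restriction of the torus invariants to the slice.
\<close>

lemma poly_eval_comparison_images:
  "poly_eval (\<lambda>k. cyclic_invariants N k w) (comparison_images v) = \<rho> v (slice w)"
  by (cases v rule: quotient_index_cases)
     (simp_all only: comparison_images_simps quotient_invariants_slice poly_hom_mult poly_hom_Const
        poly_hom_Var semiring_hom_id)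

lemma quotient_chart_orbit:
  "z \<in> Z \<Longrightarrow> quotient_chart a n p (orbY z) = poly_eval (\<lambda>v. \<rho> v z) p"
  unfolding quotient_chart_def
  by (rule invariant_chart_orbit[OF torus_maps_group quotient_invariants_invariant])

lemma quotient_chart_extensional: "quotient_chart a n p \<in> extensional (pts Y)"
  unfolding quotient_chart_def pts_Y by (rule invariant_chart_extensional)

lemma chart_comparison:
  "cyclic_chart N (comparison_hom a n N p) = pullback X slice_quotient (quotient_chart a n p)"
proof (rule extensionalityI[OF cyclic_chart_extensional])
  show "pullback X slice_quotient (quotient_chart a n p) \<in> extensional (pts X)" by (simp add: pullback_def)
  fix \<xi> assume "\<xi> \<in> pts X"
  then obtain w where w: "\<xi> = orbX w" by (auto simp: pts_cyclic_quotient)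
  have "pullback X slice_quotient (quotient_chart a n p) \<xi> = quotient_chart a n p (orbY (slice w))"
    by (simp add: w pullback_def pts_cyclic_quotient slice_quotient_orbit)
  also have "\<dots> = cyclic_chart N (comparison_hom a n N p) \<xi>"
    unfolding w quotient_chart_orbit[OF slice_in_zero_fibre] cyclic_chart_orbit[OF N_pos]
      comparison_hom_eq poly_eval_poly_subst poly_eval_comparison_images ..
  finally show "cyclic_chart N (comparison_hom a n N p) \<xi> = pullback X slice_quotient (quotient_chart a n p) \<xi>" ..
qed

lemma surj_comparison_hom: "surj (comparison_hom a n N)"
proof -
  let ?L = "poly_subst comparison_images"
  have c: "?L (Const r) = Const r" "?L (p + q) = ?L p + ?L q" "?L (p * q) = ?L p * ?L q" for r p q
    by (simp_all add: poly_hom_Const poly_hom_add poly_hom_mult)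
  have undo: "Const (inverse r) * (Const r * Var k) = Var k" if "r \<noteq> 0" for r and k :: 3
    using that by (simp add: Const_def Var_def mult_single)
  have "\<exists>p. ?L p = q" for q
  proof (induction q rule: rpoly_induct)
    case (Const r)
    show ?case using c(1) by blast
  next
    case (Var k)
    consider "k = 1" | "k = 2" | "k = 3" using exhaust_3[of k] by blast
    then show ?case
    proof cases
      case 1
      have "?L (Const (inverse scale) * Var (Inl 1)) = Var k"
        using undo[of scale] scale_pos by (simp add: c poly_hom_Var comparison_images_simps 1)
      then show ?thesis by blast
    next
      case 2
      have "?L (Const (inverse scale) * Var (Inl 2)) = Var k"
        using undo[of scale] scale_pos by (simp add: c poly_hom_Var comparison_images_simps 2)
      then show ?thesis by blast
    next
      case 3
      have "?L (Const (inverse (real \<A> / real N)) * Var (Inl 3)) = Var k"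
        using undo[of "real \<A> / real N"] lcm_pos N_pos
        by (simp add: c poly_hom_Var comparison_images_simps 3 del: inverse_divide)
      then show ?thesis by blast
    qed
  next
    case (add p q)
    then obtain p' q' where "?L p' = p" "?L q' = q" by blast
    then have "?L (p' + q') = p + q" by (simp add: c)
    then show ?case by blast
  next
    case (mult p q)
    then obtain p' q' where "?L p' = p" "?L q' = q" by blast
    then have "?L (p' * q') = p * q" by (simp add: c)
    then show ?case by blast
  qed
  then show ?thesis unfolding comparison_hom_eq surj_def by metis
qed

lemma poly_alg_hom_comparison: "poly_alg_hom (comparison_hom a n N)"
  unfolding comparison_hom_eq by (rule poly_alg_hom_poly_subst)

definition weightsY :: "3 + 'l \<Rightarrow> nat" where
  "weightsY v = (if v = Inl 1 \<or> v = Inl 2 then N else 2)"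

lemma quotient_grading_eq: "quotient_grading a n = weight_grading (\<lambda>v. int (weightsY v))"
proof -
  have "(\<lambda>v. if v = Inl 1 \<or> v = Inl 2 then int (\<A> + (\<Sum>i\<in>UNIV. m i)) else 2) = (\<lambda>v. int (weightsY v))"
    unfolding N_eq[symmetric] by (auto simp: weightsY_def)
  then show ?thesis unfolding quotient_grading_def by simp
qed

lemma monomial_scaleR: "monomial (t *\<^sub>R z) = t ^ N *\<^sub>R monomial z"
proof -
  have c: "(t *\<^sub>R z) $ j = complex_of_real t * z $ j" for j
    by (subst vector_scaleR_component) (rule scaleR_conv_of_real)
  show ?thesis unfolding monomial_def c N_eq
    by (simp add: power_add power_sum scaleR_conv_of_real[where 'a = complex] power_mult_distrib
        prod.distrib mult_ac)
qed

lemma homogeneous_ideal_quotient: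
  "homogeneous_ideal (quotient_grading a n) (chart_ker Y (quotient_chart a n))"
  unfolding quotient_grading_eq quotient_chart_def
proof (rule homogeneous_ideal_invariant_chart[OF torus_maps_group quotient_invariants_invariant pts_Y])
  show "t *\<^sub>R z \<in> Z" if "z \<in> Z" for t z
    using that by (simp add: mem_zero_fibre power_mult_distrib mult.left_commute)
  show "\<rho> v (t *\<^sub>R z) = t ^ weightsY v * \<rho> v z" for t z v
    by (cases v rule: quotient_index_cases)
       (simp_all add: quotient_invariants_simps monomial_scaleR weightsY_def power_mult_distrib)
qed

lemma comparison_hom_graded: "comparison_hom a n N ` quotient_grading a n d \<subseteq> cyclic_grading N d"
proof -
  have img: "comparison_images v \<in> weight_grading (\<lambda>k. if k = 1 \<or> k = 2 then int N else 2) (int (weightsY v))" for v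
  proof -
    let ?w = "\<lambda>k::3. if k = 1 \<or> k = 2 then int N else 2"
    have cv: "Const r * Var k \<in> weight_grading ?w (?w k)" for r k
      by (rule weight_grading_Const_mult[OF weight_grading_Var])
    show ?thesis
      using cv[of _ 1] cv[of _ 2] cv[of _ 3]
      by (cases v rule: quotient_index_cases) (simp_all add: comparison_images_simps weightsY_def)
  qed
  show ?thesis
    unfolding comparison_hom_eq quotient_grading_eq cyclic_grading_def
    by (rule image_subsetI) (rule poly_subst_weight_grading[OF img])
qed

theorem z_graded_regular_symplectomorphism_slice:
  "z_graded_regular_symplectomorphism X (cyclic_chart N) (cyclic_grading N)
     Y (quotient_chart a n) (quotient_grading a n) (comparison_hom a n N) (restrict slice_quotient (pts X))"
proof -
  note X = global_chart_cyclic[OF N2]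
  note facts = X poisson_iso_slice_quotient poly_alg_hom_comparison surj_comparison_hom
    quotient_chart_extensional chart_comparison
  have reg: "regular_symplectomorphism X (cyclic_chart N) Y (quotient_chart a n) (comparison_hom a n N)
      (restrict slice_quotient (pts X))"
    by (rule regular_symplectomorphism_transport[OF facts])
  have "z_graded_chart Y (quotient_chart a n) (quotient_grading a n)"
    unfolding z_graded_chart_def
    using global_chart_transport[OF facts] homogeneous_ideal_quotient
    by (simp add: quotient_grading_eq z_grading_weight_grading)
  then show ?thesis
    using reg z_graded_chart_cyclic[OF N2] comparison_hom_graded
    unfolding z_graded_regular_symplectomorphism_def z_graded_arrow_def regular_symplectomorphism_def by blast
qed

end

theorem theorem7:
  fixes a n :: "'l::finite \<Rightarrow> nat" and N :: nat
  assumes "\<forall>i. a i > 0"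
    and "effective_torus_action (weight_matrix a n)"
    and "N \<ge> 2"
    and "N = lcm_all a + (\<Sum>i\<in>UNIV. mult_exp a n i)"
  shows "z_graded_arrow
           (cyclic_quotient N) (cyclic_chart N) (cyclic_grading N)
           (symplectic_quotient (weight_matrix a n)) (quotient_chart a n) (quotient_grading a n)
           (comparison_hom a n N) \<and>
         (\<exists>\<kappa>. lifts_to
           (cyclic_quotient N) (cyclic_chart N)
           (symplectic_quotient (weight_matrix a n)) (quotient_chart a n)
           (comparison_hom a n N) \<kappa> \<and>
         z_graded_regular_symplectomorphism
           (cyclic_quotient N) (cyclic_chart N) (cyclic_grading N)
           (symplectic_quotient (weight_matrix a n)) (quotient_chart a n) (quotient_grading a n)
           (comparison_hom a n N) \<kappa>)"
proof -
  interpret diagonal_quotient a n N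
    using assms by unfold_locales auto
  show ?thesis
    using z_graded_regular_symplectomorphism_slice
    unfolding z_graded_regular_symplectomorphism_def regular_symplectomorphism_def by blast
qed

end
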